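(* Let $\mathbf G$ be one of the groups $\mathbf{SL_2}$, $\mathbf{PGL_2}$, $\mathbf{GL_2}$ and let $k$ be a field of characteristic $p$. Then $H\subseteq\mathbf X$ is a direct factor as a (right) $H$-module. In particular, hypothesis (sur) holds true, i.e. the map $\rho:\mathbf X^*\to H^*=H$ dual to the inclusion $H\subseteq\mathbf X$ is surjective, and for every $m\ge1$ the module $Z_m$ sits in the following exact sequence of $H$-modules $$0\longrightarrow Z_m\longrightarrow((\mathbf X^{K_m})^* )_I\longrightarrow H\longrightarrow0.$$
   Context: Setting. $\mathfrak F$ is a locally compact nonarchimedean field of any characteristic, with ring of integers $\mathfrak O$, prime element $\pi$ and residue field $\mathbb F_q$ of characteristic $p$. $\mathbf G$ is $\mathbf{SL_2}$, $\mathbf{PGL_2}$ or $\mathbf{GL_2}$, $G=\mathbf G(\mathfrak F)$, $K=\mathbf G(\mathfrak O)$; $I\subseteq K$ is the pro-$p$-Iwahori subgroup, i.e. the preimage in $K$ of the $\mathbb F_q$-points of the unipotent radical of the upper triangular Borel subgroup of $\mathbf G_{\mathbb F_q}$; $K_m=\ker(K\to\mathbf G(\mathfrak O/\pi^m\mathfrak O))$ for $m\ge1$. $k$ is a field of characteristic $p$. $\mathbf X=\mathrm{ind}_I^G(1)$ is the space of compactly supported $k$-valued functions on $G/I$ with left translation action of $G$; $H=\mathrm{End}_{k[G]}(\mathbf X)^{\mathrm{op}}$, so $\mathbf X$ is a $(G,H)$-bimodule. $H$ is identified with $\mathbf X^I\subseteq\mathbf X$ as a right $H$-module via $h\mapsto(\mathrm{char}_I)h$.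 For a right $H$-module $Y$, $Y^*=\mathrm{Hom}_H(Y,H)$, a left $H$-module; $(\,\cdot\,)_I$ denotes $I$-coinvariants ($I$ acts on $(\mathbf X^{K_m})^*$ through its action on $\mathbf X^{K_m}$). Let $\mathbf Z_m=\mathrm{im}(\mathbf X^*\to(\mathbf X^{K_m})^* )$ and $Z_m=\ker\big((\mathbf Z_m)_I\to((\mathbf X^{K_m})^* )_I\to(\mathbf X^I)^*=H\big)$, the second map being induced by restriction to $\mathbf X^I$; this second map is also the map to $H$ in the exact sequence of the claim. *)

theory Defs
  imports
    "HOL-Analysis.Analysis"
    "HOL-Algebra.Algebra"
begin

section \<open>Modules over a noncommutative ring\<close>

text \<open>
  The locale \<open>module\<close> of HOL-Algebra requires a commutative ring of scalars. The record
  type of the same name is reused here; the fields \<open>mult\<close> and \<open>one\<close> of a module record are never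
  used and are left undefined.
\<close>

locale left_module = R?: ring R + M?: abelian_group M
  for R :: "('r, 'c) ring_scheme" (structure) and M :: "('r, 'm, 'd) module_scheme" (structure) +
  assumes smult_closed: "a \<in> carrier R \<Longrightarrow> x \<in> carrier M \<Longrightarrow> a \<odot>\<^bsub>M\<^esub> x \<in> carrier M"
    and smult_l_distr: "a \<in> carrier R \<Longrightarrow> b \<in> carrier R \<Longrightarrow> x \<in> carrier M \<Longrightarrow>
      (a \<oplus>\<^bsub>R\<^esub> b) \<odot>\<^bsub>M\<^esub> x = a \<odot>\<^bsub>M\<^esub> x \<oplus>\<^bsub>M\<^esub> b \<odot>\<^bsub>M\<^esub> x"
    and smult_r_distr: "a \<in> carrier R \<Longrightarrow> x \<in> carrier M \<Longrightarrow> y \<in> carrier M \<Longrightarrow>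
      a \<odot>\<^bsub>M\<^esub> (x \<oplus>\<^bsub>M\<^esub> y) = a \<odot>\<^bsub>M\<^esub> x \<oplus>\<^bsub>M\<^esub> a \<odot>\<^bsub>M\<^esub> y"
    and smult_assoc: "a \<in> carrier R \<Longrightarrow> b \<in> carrier R \<Longrightarrow> x \<in> carrier M \<Longrightarrow>
      (a \<otimes>\<^bsub>R\<^esub> b) \<odot>\<^bsub>M\<^esub> x = a \<odot>\<^bsub>M\<^esub> (b \<odot>\<^bsub>M\<^esub> x)"
    and smult_one: "x \<in> carrier M \<Longrightarrow> \<one>\<^bsub>R\<^esub> \<odot>\<^bsub>M\<^esub> x = x"

text \<open>In a right module, \<open>a \<odot>\<^bsub>M\<^esub> x\<close> stands for the product \<open>x a\<close>, so that \<open>x (a b) = (x a) b\<close>.\<close>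

locale right_module = R?: ring R + M?: abelian_group M
  for R :: "('r, 'c) ring_scheme" (structure) and M :: "('r, 'm, 'd) module_scheme" (structure) +
  assumes smult_closed: "a \<in> carrier R \<Longrightarrow> x \<in> carrier M \<Longrightarrow> a \<odot>\<^bsub>M\<^esub> x \<in> carrier M"
    and smult_l_distr: "a \<in> carrier R \<Longrightarrow> b \<in> carrier R \<Longrightarrow> x \<in> carrier M \<Longrightarrow>
      (a \<oplus>\<^bsub>R\<^esub> b) \<odot>\<^bsub>M\<^esub> x = a \<odot>\<^bsub>M\<^esub> x \<oplus>\<^bsub>M\<^esub> b \<odot>\<^bsub>M\<^esub> x"
    and smult_r_distr: "a \<in> carrier R \<Longrightarrow> x \<in> carrier M \<Longrightarrow> y \<in> carrier M \<Longrightarrow>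
      a \<odot>\<^bsub>M\<^esub> (x \<oplus>\<^bsub>M\<^esub> y) = a \<odot>\<^bsub>M\<^esub> x \<oplus>\<^bsub>M\<^esub> a \<odot>\<^bsub>M\<^esub> y"
    and smult_assoc: "a \<in> carrier R \<Longrightarrow> b \<in> carrier R \<Longrightarrow> x \<in> carrier M \<Longrightarrow>
      (a \<otimes>\<^bsub>R\<^esub> b) \<odot>\<^bsub>M\<^esub> x = b \<odot>\<^bsub>M\<^esub> (a \<odot>\<^bsub>M\<^esub> x)"
    and smult_one: "x \<in> carrier M \<Longrightarrow> \<one>\<^bsub>R\<^esub> \<odot>\<^bsub>M\<^esub> x = x"

definition right_submodule ::
    "('r, 'c) ring_scheme \<Rightarrow> ('r, 'm, 'd) module_scheme \<Rightarrow> 'm set \<Rightarrow> bool" where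
  "right_submodule R M N \<longleftrightarrow> right_module R M \<and> subgroup N (add_monoid M) \<and>
     (\<forall>a\<in>carrier R. \<forall>x\<in>N. a \<odot>\<^bsub>M\<^esub> x \<in> N)"

definition right_direct_factor ::
    "('r, 'c) ring_scheme \<Rightarrow> ('r, 'm, 'd) module_scheme \<Rightarrow> 'm set \<Rightarrow> bool" where
  "right_direct_factor R M N \<longleftrightarrow> right_submodule R M N \<and>
     (\<exists>C. right_submodule R M C \<and> N <+>\<^bsub>M\<^esub> C = carrier M \<and> N \<inter> C = {\<zero>\<^bsub>M\<^esub>})"

definition left_module_hom ::
    "('r, 'c) ring_scheme \<Rightarrow> ('r, 'm, 'd) module_scheme \<Rightarrow> ('r, 'n, 'e) module_scheme
      \<Rightarrow> ('m \<Rightarrow> 'n) set" where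
  "left_module_hom R M N = {f \<in> carrier M \<rightarrow> carrier N.
     (\<forall>x\<in>carrier M. \<forall>y\<in>carrier M. f (x \<oplus>\<^bsub>M\<^esub> y) = f x \<oplus>\<^bsub>N\<^esub> f y) \<and>
     (\<forall>a\<in>carrier R. \<forall>x\<in>carrier M. f (a \<odot>\<^bsub>M\<^esub> x) = a \<odot>\<^bsub>N\<^esub> f x)}"

definition short_exact_left ::
    "('r, 'c) ring_scheme \<Rightarrow> ('r, 'l, 'd) module_scheme \<Rightarrow> ('l \<Rightarrow> 'm) \<Rightarrow> ('r, 'm, 'e) module_scheme
      \<Rightarrow> ('m \<Rightarrow> 'n) \<Rightarrow> ('r, 'n, 'f) module_scheme \<Rightarrow> bool" where
  "short_exact_left R L f M g N \<longleftrightarrow>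
     left_module R L \<and> left_module R M \<and> left_module R N \<and>
     f \<in> left_module_hom R L M \<and> g \<in> left_module_hom R M N \<and>
     inj_on f (carrier L) \<and>
     f ` carrier L = {x \<in> carrier M. g x = \<zero>\<^bsub>N\<^esub>} \<and>
     g ` carrier M = carrier N"

definition regular_left_module :: "('r, 'c) ring_scheme \<Rightarrow> ('r, 'r) module" where
  "regular_left_module R = \<lparr>carrier = carrier R, monoid.mult = undefined, one = undefined,
     ring.zero = \<zero>\<^bsub>R\<^esub>, ring.add = ring.add R, smult = monoid.mult R\<rparr>"

text \<open>
  The dual \<open>Hom\<^sub>R(Y, R)\<close> of a right \<open>R\<close>-module \<open>Y\<close>, a left module via \<open>(a l)(y) = a l(y)\<close>.
  Its elements are \<open>undefined\<close> outside \<open>carrier Y\<close>, so that equal maps are equal as functions.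
\<close>

definition dual ::
    "('r, 'c) ring_scheme \<Rightarrow> ('r, 'm, 'd) module_scheme \<Rightarrow> ('r, 'm \<Rightarrow> 'r) module" where
  "dual R Y = \<lparr>carrier = {l \<in> carrier Y \<rightarrow>\<^sub>E carrier R.
       (\<forall>x\<in>carrier Y. \<forall>y\<in>carrier Y. l (x \<oplus>\<^bsub>Y\<^esub> y) = l x \<oplus>\<^bsub>R\<^esub> l y) \<and>
       (\<forall>a\<in>carrier R. \<forall>x\<in>carrier Y. l (a \<odot>\<^bsub>Y\<^esub> x) = l x \<otimes>\<^bsub>R\<^esub> a)},
     monoid.mult = undefined, one = undefined,
     ring.zero = (\<lambda>y\<in>carrier Y. \<zero>\<^bsub>R\<^esub>),
     ring.add = (\<lambda>l l'. \<lambda>y\<in>carrier Y. l y \<oplus>\<^bsub>R\<^esub> l' y),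
     smult = (\<lambda>a l. \<lambda>y\<in>carrier Y. a \<otimes>\<^bsub>R\<^esub> l y)\<rparr>"

text \<open>
  Coinvariants of a set of operators \<open>act u\<close> (\<open>u \<in> U\<close>) on \<open>A\<close>: the quotient by the subgroup
  generated by all \<open>u a - a\<close>. Elements are cosets. The operators used below are \<open>R\<close>-linear, so
  that this subgroup is a submodule.
\<close>

definition coinv_sub :: "('r, 'm, 'd) module_scheme \<Rightarrow> ('u \<Rightarrow> 'm \<Rightarrow> 'm) \<Rightarrow> 'u set \<Rightarrow> 'm set" where
  "coinv_sub A act U =
     generate (add_monoid A) {act u a \<ominus>\<^bsub>A\<^esub> a | u a. u \<in> U \<and> a \<in> carrier A}"

definition coinvariants ::
    "('r, 'm, 'd) module_scheme \<Rightarrow> ('u \<Rightarrow> 'm \<Rightarrow> 'm) \<Rightarrow> 'u set \<Rightarrow> ('r, 'm set) module" where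
  "coinvariants A act U = \<lparr>carrier = a_rcosets\<^bsub>A\<^esub> (coinv_sub A act U),
     monoid.mult = undefined, one = undefined,
     ring.zero = coinv_sub A act U,
     ring.add = set_add A,
     smult = (\<lambda>a C. \<Union>x\<in>C. coinv_sub A act U +>\<^bsub>A\<^esub> (a \<odot>\<^bsub>A\<^esub> x))\<rparr>"

text \<open>The map on coinvariants induced by an equivariant map \<open>f\<close> with target \<open>B\<close>.\<close>

definition coinv_map ::
    "('r, 'm, 'd) module_scheme \<Rightarrow> ('u \<Rightarrow> 'm \<Rightarrow> 'm) \<Rightarrow> 'u set \<Rightarrow> ('l \<Rightarrow> 'm) \<Rightarrow> 'l set \<Rightarrow> 'm set" where
  "coinv_map B act U f C = (\<Union>x\<in>C. coinv_sub B act U +>\<^bsub>B\<^esub> f x)"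


section \<open>The universal module and its Hecke algebra\<close>

type_synonym ('g, 'k) ind = "'g set \<Rightarrow> 'k"
type_synonym ('g, 'k) hecke_elt = "('g, 'k) ind \<Rightarrow> ('g, 'k) ind"
type_synonym ('g, 'k) functional = "('g, 'k) ind \<Rightarrow> ('g, 'k) hecke_elt"

text \<open>
  \<open>G\<close> is a group and \<open>I\<close> an open subgroup; then \<open>G/I\<close> is discrete, and compact support
  means finite support. Functions on \<open>G/I\<close> are extended by zero to all sets.
\<close>

definition ind_space :: "('g, 'b) monoid_scheme \<Rightarrow> 'g set \<Rightarrow> ('g, 'k::field) ind set" where
  "ind_space G I = {x. finite {c. x c \<noteq> 0} \<and> {c. x c \<noteq> 0} \<subseteq> lcosets\<^bsub>G\<^esub> I}"

definition translate ::
    "('g, 'b) monoid_scheme \<Rightarrow> 'g set \<Rightarrow> 'g \<Rightarrow> ('g, 'k::field) ind \<Rightarrow> 'g set \<Rightarrow> 'k" where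
  "translate G I g x = (\<lambda>c. if c \<in> lcosets\<^bsub>G\<^esub> I then x (inv\<^bsub>G\<^esub> g <#\<^bsub>G\<^esub> c) else 0)"

text \<open>
  \<open>H = End(X)\<^sup>o\<^sup>p\<close>: the product \<open>h h'\<close> is \<open>h\<close> followed by \<open>h'\<close>.
\<close>

definition hecke ::
    "('g, 'b) monoid_scheme \<Rightarrow> 'g set \<Rightarrow> ('g, 'k::field) hecke_elt ring" where
  "hecke G I = \<lparr>carrier = {h \<in> ind_space G I \<rightarrow>\<^sub>E ind_space G I.
       (\<forall>x\<in>ind_space G I. \<forall>y\<in>ind_space G I. h (\<lambda>c. x c + y c) = (\<lambda>c. h x c + h y c)) \<and>
       (\<forall>s. \<forall>x\<in>ind_space G I. h (\<lambda>c. s * x c) = (\<lambda>c. s * h x c)) \<and>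
       (\<forall>g\<in>carrier G. \<forall>x\<in>ind_space G I. h (translate G I g x) = translate G I g (h x))},
     monoid.mult = (\<lambda>h h'. \<lambda>x\<in>ind_space G I. h' (h x)),
     one = (\<lambda>x\<in>ind_space G I. x),
     ring.zero = (\<lambda>x\<in>ind_space G I. (\<lambda>c. 0)),
     ring.add = (\<lambda>h h'. \<lambda>x\<in>ind_space G I. (\<lambda>c. h x c + h' x c))\<rparr>"

text \<open>\<open>X\<close> and its submodule \<open>X\<^sup>U\<close> of \<open>U\<close>-fixed vectors as right \<open>H\<close>-modules.\<close>

definition ind_module ::
    "('g, 'b) monoid_scheme \<Rightarrow> 'g set
      \<Rightarrow> (('g, 'k::field) hecke_elt, ('g, 'k) ind) module" where
  "ind_module G I = \<lparr>carrier = ind_space G I, monoid.mult = undefined, one = undefined,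
     ring.zero = (\<lambda>c. 0), ring.add = (\<lambda>x y c. x c + y c), smult = (\<lambda>h x. h x)\<rparr>"

definition ind_fixed ::
    "('g, 'b) monoid_scheme \<Rightarrow> 'g set \<Rightarrow> 'g set
      \<Rightarrow> (('g, 'k::field) hecke_elt, ('g, 'k) ind) module" where
  "ind_fixed G I U = (ind_module G I)
     \<lparr>carrier := {x \<in> ind_space G I. \<forall>u\<in>U. translate G I u x = x}\<rparr>"

definition char_I :: "'g set \<Rightarrow> 'g set \<Rightarrow> 'k::field" where
  "char_I I = (\<lambda>c. if c = I then 1 else 0)"

text \<open>
  \<open>H\<close> is identified with \<open>X\<^sup>I\<close> by \<open>h \<mapsto> (char_I I) h\<close>. Under this
  identification \<open>(X\<^sup>I)\<^sup>* = H\<^sup>* = H\<close> is evaluation at \<open>char_I I\<close>, the element corresponding to \<open>1\<close>.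
\<close>

definition eval_char_I :: "'g set \<Rightarrow> (('g, 'k::field) ind \<Rightarrow> 'r) \<Rightarrow> 'r" where
  "eval_char_I I l = l (char_I I)"

text \<open>Restriction to \<open>X\<^sup>I\<close>, dual to \<open>H \<subseteq> X\<close>, followed by the identification \<open>(X\<^sup>I)\<^sup>* = H\<close>.\<close>

definition rho ::
    "('g, 'b) monoid_scheme \<Rightarrow> 'g set
      \<Rightarrow> ('g, 'k::field) functional \<Rightarrow> ('g, 'k) hecke_elt" where
  "rho G I l = eval_char_I I (restrict l (carrier (ind_fixed G I I)))"

text \<open>The action of \<open>g\<close> on the dual of \<open>Y \<subseteq> X\<close>, where \<open>g\<close> preserves \<open>Y\<close>.\<close>

definition dual_translate ::
    "('g, 'b) monoid_scheme \<Rightarrow> 'g set \<Rightarrow> ('g, 'k::field) ind set \<Rightarrow> 'g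
      \<Rightarrow> (('g, 'k) ind \<Rightarrow> 'r) \<Rightarrow> ('g, 'k) ind \<Rightarrow> 'r" where
  "dual_translate G I Y g l = (\<lambda>y\<in>Y. l (translate G I (inv\<^bsub>G\<^esub> g) y))"

text \<open>
  In the rest of this section \<open>U\<close> is a normal subgroup of \<open>I\<close>, to be instantiated with \<open>K\<^sub>m\<close>.
  \<open>dual_image\<close> is the image of \<open>X\<^sup>*\<close> in \<open>(X\<^sup>U)\<^sup>*\<close>.
\<close>

abbreviation dual_fixed ::
    "('g, 'b) monoid_scheme \<Rightarrow> 'g set \<Rightarrow> 'g set
      \<Rightarrow> (('g, 'k::field) hecke_elt, ('g, 'k) functional) module" where
  "dual_fixed G I U \<equiv> dual (hecke G I) (ind_fixed G I U)"

definition dual_image ::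
    "('g, 'b) monoid_scheme \<Rightarrow> 'g set \<Rightarrow> 'g set
      \<Rightarrow> (('g, 'k::field) hecke_elt, ('g, 'k) functional) module" where
  "dual_image G I U = (dual_fixed G I U)
     \<lparr>carrier := (\<lambda>l. restrict l (carrier (ind_fixed G I U))) `
        carrier (dual (hecke G I) (ind_module G I))\<rparr>"

definition coinv_dual_fixed ::
    "('g, 'b) monoid_scheme \<Rightarrow> 'g set \<Rightarrow> 'g set
      \<Rightarrow> (('g, 'k::field) hecke_elt, ('g, 'k) functional set) module" where
  "coinv_dual_fixed G I U =
     coinvariants (dual_fixed G I U) (dual_translate G I (carrier (ind_fixed G I U))) I"

definition coinv_dual_image ::
    "('g, 'b) monoid_scheme \<Rightarrow> 'g set \<Rightarrow> 'g set
      \<Rightarrow> (('g, 'k::field) hecke_elt, ('g, 'k) functional set) module" where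
  "coinv_dual_image G I U =
     coinvariants (dual_image G I U) (dual_translate G I (carrier (ind_fixed G I U))) I"

definition coinv_incl ::
    "('g, 'b) monoid_scheme \<Rightarrow> 'g set \<Rightarrow> 'g set
      \<Rightarrow> ('g, 'k::field) functional set \<Rightarrow> ('g, 'k) functional set" where
  "coinv_incl G I U =
     coinv_map (dual_fixed G I U) (dual_translate G I (carrier (ind_fixed G I U))) I (\<lambda>l. l)"

text \<open>
  The map \<open>((X\<^sup>U)\<^sup>*)\<^sub>I \<rightarrow> (X\<^sup>I)\<^sup>* = H\<close> induced by restriction. The value of \<open>rho\<close> is the same for all
  elements of a coset, since \<open>I\<close> acts trivially on \<open>X\<^sup>I\<close>.
\<close>

definition coinv_to_hecke ::
    "('g, 'b) monoid_scheme \<Rightarrow> 'g set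
      \<Rightarrow> ('g, 'k::field) functional set \<Rightarrow> ('g, 'k) hecke_elt" where
  "coinv_to_hecke G I C = the_elem (rho G I ` C)"

definition Z_module ::
    "('g, 'b) monoid_scheme \<Rightarrow> 'g set \<Rightarrow> 'g set
      \<Rightarrow> (('g, 'k::field) hecke_elt, ('g, 'k) functional set) module" where
  "Z_module G I U = (coinv_dual_image G I U)
     \<lparr>carrier := {C \<in> carrier (coinv_dual_image G I U).
        coinv_to_hecke G I (coinv_incl G I U C) = \<zero>\<^bsub>hecke G I\<^esub>}\<rparr>"


section \<open>Nonarchimedean local fields\<close>

text \<open>
  A locally compact nonarchimedean field, given by a nontrivial absolute value. Nontriviality
  excludes discrete fields; completeness follows from local compactness.
\<close>

locale nonarch_local_field =
  fixes v :: "'a::field \<Rightarrow> real"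
  assumes nonneg: "0 \<le> v x"
    and eq_zero_iff: "v x = 0 \<longleftrightarrow> x = 0"
    and mult: "v (x * y) = v x * v y"
    and ultrametric: "v (x + y) \<le> max (v x) (v y)"
    and nontrivial: "\<exists>x. x \<noteq> 0 \<and> v x \<noteq> 1"
    and locally_compact: "locally_compact_space (Metric_space.mtopology UNIV (\<lambda>x y. v (x - y)))"

text \<open>The characteristic of the residue field; compare the definition of \<open>CHAR('a)\<close>.\<close>

definition residue_char :: "('a::field \<Rightarrow> real) \<Rightarrow> nat" where
  "residue_char v = Gcd {n. v (of_nat n) < 1}"

definition prime_element :: "('a::field \<Rightarrow> real) \<Rightarrow> 'a \<Rightarrow> bool" where
  "prime_element v \<pi> \<longleftrightarrow> {x. v x < 1} = {\<pi> * y | y. v y \<le> 1}"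

text \<open>Entrywise congruence of matrices modulo the ideal of the ring of integers generated by \<open>a\<close>.\<close>

definition mat_cong :: "('a::field \<Rightarrow> real) \<Rightarrow> 'a \<Rightarrow> 'a^2^2 \<Rightarrow> 'a^2^2 \<Rightarrow> bool" where
  "mat_cong v a A B \<longleftrightarrow> (\<forall>i j. \<exists>y. v y \<le> 1 \<and> A $ i $ j - B $ i $ j = a * y)"

definition upper_unipotent :: "'a::field \<Rightarrow> 'a^2^2" where
  "upper_unipotent b = vector [vector [1, b], vector [0, 1]]"


section \<open>The groups\<close>

text \<open>
  For each group: \<open>G\<close>, \<open>K\<close>, the pro-\<open>p\<close>-Iwahori subgroup \<open>I\<close>, and \<open>K\<^sub>m\<close>. The unipotent
  radical of the upper triangular Borel subgroup consists of the matrices \<open>upper_unipotent b\<close>.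
\<close>

definition GL2 :: "('a::field^2^2) monoid" where
  "GL2 = \<lparr>carrier = {A. det A \<noteq> 0}, monoid.mult = (**), one = mat 1\<rparr>"

definition GL2_K :: "('a::field \<Rightarrow> real) \<Rightarrow> ('a^2^2) set" where
  "GL2_K v = {A. (\<forall>i j. v (A $ i $ j) \<le> 1) \<and> v (det A) = 1}"

definition GL2_I :: "('a::field \<Rightarrow> real) \<Rightarrow> 'a \<Rightarrow> ('a^2^2) set" where
  "GL2_I v \<pi> = {A \<in> GL2_K v. \<exists>b. v b \<le> 1 \<and> mat_cong v \<pi> A (upper_unipotent b)}"

definition GL2_Km :: "('a::field \<Rightarrow> real) \<Rightarrow> 'a \<Rightarrow> nat \<Rightarrow> ('a^2^2) set" where
  "GL2_Km v \<pi> m = {A \<in> GL2_K v. mat_cong v (\<pi> ^ m) A (mat 1)}"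

definition SL2 :: "('a::field^2^2) monoid" where
  "SL2 = \<lparr>carrier = {A. det A = 1}, monoid.mult = (**), one = mat 1\<rparr>"

definition SL2_K :: "('a::field \<Rightarrow> real) \<Rightarrow> ('a^2^2) set" where
  "SL2_K v = {A. (\<forall>i j. v (A $ i $ j) \<le> 1) \<and> det A = 1}"

definition SL2_I :: "('a::field \<Rightarrow> real) \<Rightarrow> 'a \<Rightarrow> ('a^2^2) set" where
  "SL2_I v \<pi> = {A \<in> SL2_K v. \<exists>b. v b \<le> 1 \<and> mat_cong v \<pi> A (upper_unipotent b)}"

definition SL2_Km :: "('a::field \<Rightarrow> real) \<Rightarrow> 'a \<Rightarrow> nat \<Rightarrow> ('a^2^2) set" where
  "SL2_Km v \<pi> m = {A \<in> SL2_K v. mat_cong v (\<pi> ^ m) A (mat 1)}"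

text \<open>
  For a local ring \<open>R\<close> one has \<open>PGL\<^sub>2(R) = GL\<^sub>2(R)/R\<^sup>\<times>\<close>; this applies to the field, to its ring of
  integers and to the quotients of the latter. Hence \<open>K\<close> is the image of \<open>GL2_K\<close>, and equality
  in \<open>PGL\<^sub>2\<close> of a quotient ring is congruence of matrices up to a unit scalar.
\<close>

definition scalars :: "('a::field^2^2) set" where
  "scalars = {mat c | c. c \<noteq> 0}"

definition PGL2 :: "('a::field^2^2) set monoid" where
  "PGL2 = GL2 Mod scalars"

definition PGL2_class :: "'a::field^2^2 \<Rightarrow> ('a^2^2) set" where
  "PGL2_class A = scalars #>\<^bsub>GL2\<^esub> A"

definition PGL2_I :: "('a::field \<Rightarrow> real) \<Rightarrow> 'a \<Rightarrow> ('a^2^2) set set" where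
  "PGL2_I v \<pi> = PGL2_class ` {A \<in> GL2_K v.
     \<exists>u b. v u = 1 \<and> v b \<le> 1 \<and> mat_cong v \<pi> A (mat u ** upper_unipotent b)}"

definition PGL2_Km :: "('a::field \<Rightarrow> real) \<Rightarrow> 'a \<Rightarrow> nat \<Rightarrow> ('a^2^2) set set" where
  "PGL2_Km v \<pi> m = PGL2_class ` {A \<in> GL2_K v. \<exists>u. v u = 1 \<and> mat_cong v (\<pi> ^ m) A (mat u)}"

end

theory Submission
  imports Defs "HOL-Library.Function_Algebras"
begin

text \<open>
  Up to the torus, the cosets of \<open>I\<close> are the oriented edges of the tree of \<open>G\<close>. The edges around a
  vertex form a finite projective line, on which the module is understood explicitly (rank one).
  The \<open>K\<^sub>m\<close>-fixed edges contain a ball; beyond it every edge has a unique predecessor, and \<open>K\<^sub>m\<close>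
  permutes the successors of an edge at its far vertex transitively. Hence a map that is the identity
  on the ball extends outwards, vertex by vertex, to a Hecke equivariant projection onto the
  \<open>K\<^sub>m\<close>-invariants: at each new vertex the relations on a projective line leave a consistent choice
  because \<open>p\<close> divides the number of successors. Distance is measured by \<open>\<parallel>g\<parallel>\<^sup>2 / |det g|\<close>. The
  projection for \<open>I\<close> gives the direct factor and the surjectivity; those for \<open>K\<^sub>m\<close> give the exact sequence.
\<close>

text \<open>Equivariance is the obstacle: a Hecke operator couples edges that are far apart, so a
  map built edge by edge cannot be checked against all of them directly. The algebra is generated by
  three families whose conditions are local: neighbour sums at either end of an edge, the torus, and
  the elements that normalize the pro-p-Iwahori group. A neighbour sum relates edges at one vertex
  only, and beyond the ball an edge is defined from just one of its ends. Generation is itself a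
  consequence: the argument that expresses invariants through orbit sums, run for the pro-p-Iwahori
  group instead of K_m, shows that the operators commuting with the projection already fill the
  algebra. The three groups share one model, matrices with determinants in \<open>\<Delta>\<close>
  and scalars from \<open>Z\<close> put into \<open>J\<close>, so that PGL2 is treated inside GL2.
  Given the projections, functionals on the K_m-invariants extend to all of X; hence Z_m is a full
  kernel, and only the surjectivity onto H needs the projection for I.\<close>

declare zero_fun_apply [simp del] plus_fun_apply [simp del]

lemmas fun_ext = fun_eq_iff zero_fun_apply plus_fun_apply

section \<open>Finitely supported functions on G/I and Hecke operators\<close>

definition scl :: "'k::field \<Rightarrow> ('b \<Rightarrow> 'k) \<Rightarrow> 'b \<Rightarrow> 'k" where
  "scl s x = (\<lambda>c. s * x c)"

lemma scl_simps [simp]: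
  "scl 0 x = 0" "scl 1 x = x" "scl s 0 = 0" "scl s (scl t x) = scl (s * t) x"
  by (auto simp: scl_def fun_ext)

lemma scl_add: "scl s (x + y) = scl s x + scl s y"
  by (simp add: scl_def fun_ext algebra_simps)

lemma scl_add_left: "scl (s + t) x = scl s x + scl t x"
  by (simp add: scl_def fun_ext algebra_simps)

lemma scl_uminus: "scl (- 1) x = - x"
  by (simp add: scl_def fun_ext)

lemma scl_sum: "scl s (\<Sum>u\<in>R. f u) = (\<Sum>u\<in>R. scl s (f u))"
  by (induction R rule: infinite_finite_induct) (simp_all add: scl_add)

lemma sum_const_scl: "(\<Sum>u\<in>R. x) = scl (of_nat (card R)) x"
  by (induction R rule: infinite_finite_induct) (simp_all add: scl_add_left del: sum_constant)

lemma fun_sum_apply: "(\<Sum>u\<in>R. f u) c = (\<Sum>u\<in>R. f u c)"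
  by (induction R rule: infinite_finite_induct) (simp_all add: fun_ext)

lemma add_nonzero_cases: "(a :: 'k::field) + b \<noteq> 0 \<Longrightarrow> a \<noteq> 0 \<or> b \<noteq> 0"
  by auto

text \<open>The parameter \<open>F\<close> fixes the type of the coefficients, which neither
  \<open>G\<close> nor \<open>I\<close> determines.\<close>

locale hecke_pair = group G + subgroup I G
  for G :: "('g, 'b) monoid_scheme" (structure) and I :: "'g set" +
  fixes F :: "'k::field itself"
begin

abbreviation V :: "('g, 'k) ind set" where "V \<equiv> ind_space G I"
abbreviation H :: "('g, 'k) hecke_elt ring" where "H \<equiv> hecke G I"
abbreviation tr :: "'g \<Rightarrow> ('g, 'k) ind \<Rightarrow> ('g, 'k) ind" where "tr \<equiv> translate G I"
abbreviation fixed :: "'g set \<Rightarrow> ('g, 'k) ind set" where "fixed U \<equiv> carrier (ind_fixed G I U)"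

text \<open>The characteristic function of the coset \<open>gI\<close>. These functions span
  \<open>V\<close>, and linear identities below are checked on them.\<close>

definition dl :: "'g \<Rightarrow> ('g, 'k) ind" where
  "dl g = (\<lambda>c. if c = g <# I then 1 else 0)"

lemma I_subset: "I \<subseteq> carrier G"
  by (rule subset)

lemma lcos_mem: "g \<in> carrier G \<Longrightarrow> g <# I \<in> lcosets I"
  by (auto simp: LCOSETS_def)

lemma lcos_cases: assumes "c \<in> lcosets I" obtains g where "g \<in> carrier G" "c = g <# I"
  using assms by (auto simp: LCOSETS_def)

lemma lcos_act: "g \<in> carrier G \<Longrightarrow> a \<in> carrier G \<Longrightarrow> g <# (a <# I) = (g \<otimes> a) <# I"
  using lcos_m_assoc[OF I_subset] by simp

lemma lcos_act_mem: "g \<in> carrier G \<Longrightarrow> c \<in> lcosets I \<Longrightarrow> g <# c \<in> lcosets I"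
  by (auto elim!: lcos_cases simp: lcos_act lcos_mem)

lemma lcos_eq_iff:
  assumes "g \<in> carrier G" "h \<in> carrier G"
  shows "g <# I = h <# I \<longleftrightarrow> inv g \<otimes> h \<in> I"
proof
  assume "g <# I = h <# I"
  moreover have "h \<in> h <# I" using assms by (auto simp: l_coset_def intro!: bexI[of _ \<one>])
  ultimately obtain i where "i \<in> I" "h = g \<otimes> i" by (auto simp: l_coset_def)
  then show "inv g \<otimes> h \<in> I" using assms I_subset by (auto simp: m_assoc[symmetric])
next
  assume *: "inv g \<otimes> h \<in> I"
  then have "h = g \<otimes> (inv g \<otimes> h)" using assms by (simp add: m_assoc[symmetric])
  then have "h \<in> g <# I" using * by (auto simp: l_coset_def)
  then show "g <# I = h <# I"
    using l_repr_independence[OF _ assms(1) subgroup_axioms] by auto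
qed

lemma V_iff: "x \<in> V \<longleftrightarrow> finite {c. x c \<noteq> 0} \<and> (\<forall>c. x c \<noteq> 0 \<longrightarrow> c \<in> lcosets I)"
  by (auto simp: ind_space_def)

lemma V_zero [simp]: "0 \<in> V"
  by (simp add: V_iff zero_fun_apply)

lemma V_add [simp]: "x \<in> V \<Longrightarrow> y \<in> V \<Longrightarrow> x + y \<in> V"
  unfolding V_iff plus_fun_apply
  by (auto intro: finite_subset[of _ "{c. x c \<noteq> 0} \<union> {c. y c \<noteq> 0}"] dest: add_nonzero_cases)

lemma V_scl [simp]: "x \<in> V \<Longrightarrow> scl s x \<in> V"
  unfolding V_iff scl_def by (auto intro: finite_subset[of _ "{c. x c \<noteq> 0}"])

lemma V_uminus [simp]: "x \<in> V \<Longrightarrow> - x \<in> V"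
  by (metis V_scl scl_uminus)

lemma V_diff [simp]: "x \<in> V \<Longrightarrow> y \<in> V \<Longrightarrow> x - y \<in> V"
  by (metis V_add V_uminus add_uminus_conv_diff)

lemma V_sum: "(\<And>u. u \<in> R \<Longrightarrow> f u \<in> V) \<Longrightarrow> (\<Sum>u\<in>R. f u) \<in> V"
  by (induction R rule: infinite_finite_induct) simp_all

lemma dl_V [simp]: "g \<in> carrier G \<Longrightarrow> dl g \<in> V"
  by (auto simp: V_iff dl_def lcos_mem)

lemma dl_eq_iff:
  "g \<in> carrier G \<Longrightarrow> h \<in> carrier G \<Longrightarrow> dl g = dl h \<longleftrightarrow> inv g \<otimes> h \<in> I"
  unfolding lcos_eq_iff[symmetric] dl_def fun_eq_iff by (metis zero_neq_one)

lemma dl_one: "dl \<one> = char_I I"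
  using lcos_mult_one[OF I_subset] by (simp add: dl_def char_I_def fun_ext)

lemma tr_add: "tr g (x + y) = tr g x + tr g y"
  by (simp add: translate_def fun_ext)

lemma tr_scl: "tr g (scl s x) = scl s (tr g x)"
  by (simp add: translate_def fun_ext scl_def)

lemma tr_zero [simp]: "tr g 0 = 0"
  by (simp add: translate_def fun_ext)

lemma tr_uminus: "tr g (- x) = - tr g x"
  by (simp add: translate_def fun_ext)

lemma tr_diff: "tr g (x - y) = tr g x - tr g y"
  by (simp add: translate_def fun_ext)

lemma tr_sum: "tr g (\<Sum>u\<in>R. f u) = (\<Sum>u\<in>R. tr g (f u))"
  by (induction R rule: infinite_finite_induct) (simp_all add: tr_add)

lemma tr_closed [simp]:
  assumes g: "g \<in> carrier G" and x: "x \<in> V"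
  shows "tr g x \<in> V"
proof -
  have "{c. tr g x c \<noteq> 0} \<subseteq> (\<lambda>c. g <# c) ` {c. x c \<noteq> 0}"
  proof
    fix c assume "c \<in> {c. tr g x c \<noteq> 0}"
    then have c: "c \<in> lcosets I" "x (inv g <# c) \<noteq> 0" by (auto simp: translate_def split: if_splits)
    from c(1) obtain a where a: "a \<in> carrier G" "c = a <# I" by (rule lcos_cases)
    then have "g <# (inv g <# c) = c" using g by (simp add: lcos_act m_assoc[symmetric])
    then show "c \<in> (\<lambda>c. g <# c) ` {c. x c \<noteq> 0}" using c(2) by force
  qed
  then have "finite {c. tr g x c \<noteq> 0}" using x finite_subset by (fastforce simp: V_iff)
  then show ?thesis by (auto simp: V_iff translate_def split: if_splits)
qed

lemma tr_one [simp]: "x \<in> V \<Longrightarrow> tr \<one> x = x"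
  by (auto simp: translate_def fun_ext V_iff LCOSETS_def lcos_act)

lemma tr_tr:
  "g \<in> carrier G \<Longrightarrow> h \<in> carrier G \<Longrightarrow> tr g (tr h x) = tr (g \<otimes> h) x"
  by (auto simp: translate_def fun_ext LCOSETS_def lcos_act inv_mult_group m_assoc)

lemma tr_dl [simp]:
  assumes "g \<in> carrier G" "h \<in> carrier G"
  shows "tr g (dl h) = dl (g \<otimes> h)"
proof
  fix c show "tr g (dl h) c = dl (g \<otimes> h) c"
  proof (cases "c \<in> lcosets I")
    case True
    then obtain a where a: "a \<in> carrier G" "c = a <# I" by (rule lcos_cases)
    have "(inv g \<otimes> a) <# I = h <# I \<longleftrightarrow> a <# I = (g \<otimes> h) <# I"
      using a assms by (simp add: lcos_eq_iff inv_mult_group m_assoc)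
    then show ?thesis using True a assms by (simp add: translate_def dl_def lcos_act)
  next
    case False
    then show ?thesis using assms lcos_mem[of "g \<otimes> h"] by (auto simp: translate_def dl_def)
  qed
qed

text \<open>A function of finite support is stripped of one coset at a time, so the size of the
  support decreases.\<close>

lemma V_induct [consumes 1, case_names zero step]:
  assumes "x \<in> V" and z: "P 0"
    and st: "\<And>x s g. x \<in> V \<Longrightarrow> P x \<Longrightarrow> g \<in> carrier G \<Longrightarrow> P (x + scl s (dl g))"
  shows "P x"
  using assms(1)
proof (induction "card {c. x c \<noteq> 0}" arbitrary: x rule: less_induct)
  case less
  show ?case
  proof (cases "x = 0")
    case False
    then obtain c where c: "x c \<noteq> 0" by (auto simp: fun_ext)
    then obtain g where g: "g \<in> carrier G" "c = g <# I"
      using less.prems by (auto simp: V_iff elim: lcos_cases)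
    define y where "y = x - scl (x c) (dl g)"
    have "{d. y d \<noteq> 0} = {d. x d \<noteq> 0} - {c}"
      by (auto simp: y_def scl_def dl_def g)
    moreover have "finite {d. x d \<noteq> 0}" using less.prems by (simp add: V_iff)
    ultimately have "card {d. y d \<noteq> 0} < card {d. x d \<noteq> 0}"
      using c by (metis card_Diff1_less mem_Collect_eq)
    moreover have y: "y \<in> V" using less.prems g by (simp add: y_def)
    ultimately have "P y" using less.hyps by blast
    then have "P (y + scl (x c) (dl g))" using st y g by blast
    then show ?thesis by (simp add: y_def)
  qed (simp add: z)
qed

definition klin :: "(('g, 'k) ind \<Rightarrow> ('g, 'k) ind) \<Rightarrow> bool" where
  "klin f \<longleftrightarrow> (\<forall>x\<in>V. \<forall>y\<in>V. f (x + y) = f x + f y) \<and> (\<forall>s. \<forall>x\<in>V. f (scl s x) = scl s (f x))"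

lemma klin_add: "klin f \<Longrightarrow> x \<in> V \<Longrightarrow> y \<in> V \<Longrightarrow> f (x + y) = f x + f y"
  and klin_scl: "klin f \<Longrightarrow> x \<in> V \<Longrightarrow> f (scl s x) = scl s (f x)"
  by (auto simp: klin_def)

lemma klin_zero: "klin f \<Longrightarrow> f 0 = 0"
  using klin_scl[of f 0 0] by simp

lemma klin_uminus: "klin f \<Longrightarrow> x \<in> V \<Longrightarrow> f (- x) = - f x"
  using klin_scl[of f x "-1"] by (simp add: scl_uminus)

lemma klin_diff: "klin f \<Longrightarrow> x \<in> V \<Longrightarrow> y \<in> V \<Longrightarrow> f (x - y) = f x - f y"
  using klin_add[of f x "- y"] klin_uminus[of f y] by (metis V_uminus add_uminus_conv_diff)

lemma klin_sum: "klin f \<Longrightarrow> (\<And>u. u \<in> R \<Longrightarrow> a u \<in> V) \<Longrightarrow> f (\<Sum>u\<in>R. a u) = (\<Sum>u\<in>R. f (a u))"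
  by (induction R rule: infinite_finite_induct) (simp_all add: klin_zero klin_add V_sum)

lemma klin_eqI:
  assumes "klin f" "klin g" "\<And>a. a \<in> carrier G \<Longrightarrow> f (dl a) = g (dl a)" "x \<in> V"
  shows "f x = g x"
  using assms(4)
  by (induction rule: V_induct) (use assms(1-3) in \<open>simp_all add: klin_zero klin_add klin_scl\<close>)

lemma klin_comp:
  "klin f \<Longrightarrow> klin g \<Longrightarrow> (\<And>x. x \<in> V \<Longrightarrow> g x \<in> V) \<Longrightarrow> klin (\<lambda>x. f (g x))"
  by (simp add: klin_def)

lemma klin_tr: "klin (tr g)"
  by (simp add: klin_def tr_add tr_scl)

text \<open>The linear map with value \<open>\<phi> c\<close> at the characteristic function of
  \<open>c\<close>; the sum is finite on \<open>V\<close>.\<close>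

definition lin_ext :: "('g set \<Rightarrow> ('g, 'k) ind) \<Rightarrow> ('g, 'k) ind \<Rightarrow> ('g, 'k) ind" where
  "lin_ext \<phi> x = (\<Sum>c | x c \<noteq> 0. scl (x c) (\<phi> c))"

lemma lin_ext_superset:
  "finite C \<Longrightarrow> {c. x c \<noteq> 0} \<subseteq> C \<Longrightarrow> lin_ext \<phi> x = (\<Sum>c\<in>C. scl (x c) (\<phi> c))"
  unfolding lin_ext_def by (rule sum.mono_neutral_left) auto

lemma klin_lin_ext: "klin (lin_ext \<phi>)"
  unfolding klin_def
proof (intro conjI ballI allI)
  fix x y assume "x \<in> V" "y \<in> V"
  then have f: "finite ({c. x c \<noteq> 0} \<union> {c. y c \<noteq> 0})" (is "finite ?C") by (simp add: V_iff)
  have "{c. (x + y) c \<noteq> 0} \<subseteq> ?C" by (auto simp: plus_fun_apply)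
  then show "lin_ext \<phi> (x + y) = lin_ext \<phi> x + lin_ext \<phi> y"
    using f by (simp add: lin_ext_superset[of ?C] plus_fun_apply scl_add_left sum.distrib)
next
  fix s x assume "x \<in> V"
  then have f: "finite {c. x c \<noteq> 0}" (is "finite ?C") by (simp add: V_iff)
  have "{c. scl s x c \<noteq> 0} \<subseteq> ?C" by (auto simp: scl_def)
  then show "lin_ext \<phi> (scl s x) = scl s (lin_ext \<phi> x)"
    using f by (simp add: lin_ext_superset[of ?C] scl_sum) (simp add: scl_def)
qed

lemma lin_ext_dl [simp]: "lin_ext \<phi> (dl g) = \<phi> (g <# I)"
proof -
  have "{c. dl g c \<noteq> 0} = {g <# I}" by (auto simp: dl_def)
  then show ?thesis by (simp add: lin_ext_def) (simp add: dl_def)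
qed

lemma lin_ext_closed: "x \<in> V \<Longrightarrow> (\<And>c. c \<in> lcosets I \<Longrightarrow> \<phi> c \<in> V) \<Longrightarrow> lin_ext \<phi> x \<in> V"
  unfolding lin_ext_def by (rule V_sum) (auto simp: V_iff[of x])

lemma H_iff:
  "h \<in> carrier H \<longleftrightarrow> h \<in> V \<rightarrow>\<^sub>E V \<and> klin h \<and> (\<forall>g\<in>carrier G. \<forall>x\<in>V. h (tr g x) = tr g (h x))"
  by (auto simp: hecke_def klin_def scl_def plus_fun_def)

lemma H_closed: "h \<in> carrier H \<Longrightarrow> x \<in> V \<Longrightarrow> h x \<in> V"
  and H_klin: "h \<in> carrier H \<Longrightarrow> klin h"
  and H_tr: "h \<in> carrier H \<Longrightarrow> g \<in> carrier G \<Longrightarrow> x \<in> V \<Longrightarrow> h (tr g x) = tr g (h x)"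
  and H_ext: "h \<in> carrier H \<Longrightarrow> h \<in> extensional V"
  unfolding H_iff by (blast dest: PiE_mem, blast, blast, auto simp: PiE_def)

lemmas H_add = klin_add[OF H_klin] and H_scl = klin_scl[OF H_klin]
  and H_sum = klin_sum[OF H_klin] and H_diff = klin_diff[OF H_klin] and H_zero = klin_zero[OF H_klin]

lemma fixed_iff: "x \<in> fixed U \<longleftrightarrow> x \<in> V \<and> (\<forall>u\<in>U. tr u x = x)"
  by (simp add: ind_fixed_def)

lemma H_dl: "h \<in> carrier H \<Longrightarrow> g \<in> carrier G \<Longrightarrow> h (dl g) = tr g (h (dl \<one>))"
  by (subst H_tr[symmetric]) simp_all

lemma dl_mult_I: "g \<in> carrier G \<Longrightarrow> i \<in> I \<Longrightarrow> dl (g \<otimes> i) = dl g"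
  using I_subset by (subst dl_eq_iff) (auto simp: inv_mult_group m_assoc)

lemma dl_one_fixed: "dl \<one> \<in> fixed I"
proof -
  have "tr i (dl \<one>) = dl \<one>" if "i \<in> I" for i
  proof -
    have i: "i \<in> carrier G" using that I_subset by blast
    have "tr i (dl \<one>) = dl (\<one> \<otimes> i)" using i by simp
    also have "\<dots> = dl \<one>" by (rule dl_mult_I[OF _ that]) simp
    finally show ?thesis .
  qed
  then show ?thesis by (simp add: fixed_iff del: tr_dl)
qed

lemma H_fixed: "h \<in> carrier H \<Longrightarrow> U \<subseteq> carrier G \<Longrightarrow> x \<in> fixed U \<Longrightarrow> h x \<in> fixed U"
  by (auto simp: fixed_iff H_closed H_tr[symmetric])

text \<open>The characteristic function of \<open>I\<close> generates \<open>V\<close> under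
  \<open>G\<close>, so an equivariant operator is determined by its value there.\<close>

lemma H_eqI:
  assumes "h \<in> carrier H" "h' \<in> carrier H" "h (dl \<one>) = h' (dl \<one>)"
  shows "h = h'"
proof (rule extensionalityI[OF H_ext[OF assms(1)] H_ext[OF assms(2)]])
  fix x assume x: "x \<in> V"
  have "h (dl a) = h' (dl a)" if "a \<in> carrier G" for a
  proof -
    have "h (dl a) = tr a (h (dl \<one>))" by (rule H_dl[OF assms(1) that])
    also have "\<dots> = tr a (h' (dl \<one>))" by (simp only: assms(3))
    also have "\<dots> = h' (dl a)" by (rule H_dl[OF assms(2) that, symmetric])
    finally show ?thesis .
  qed
  then show "h x = h' x"
    using klin_eqI[OF H_klin H_klin] assms(1,2) x by blast
qed

text \<open>The inverse of Frobenius reciprocity \<open>h \<mapsto> h (dl \<one>)\<close>: the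
  operator with prescribed value \<open>y\<close> at the characteristic function of
  \<open>I\<close>. Invariance of \<open>y\<close> under \<open>I\<close> makes the chosen coset
  representative immaterial.\<close>

definition hk :: "('g, 'k) ind \<Rightarrow> ('g, 'k) hecke_elt" where
  "hk y = restrict (lin_ext (\<lambda>c. tr (SOME g. g \<in> carrier G \<and> c = g <# I) y)) V"

lemma hk_dl:
  assumes y: "y \<in> fixed I" and g: "g \<in> carrier G"
  shows "hk y (dl g) = tr g y"
proof -
  define g' where "g' = (SOME g'. g' \<in> carrier G \<and> g <# I = g' <# I)"
  have "g' \<in> carrier G \<and> g <# I = g' <# I" unfolding g'_def by (rule someI[of _ g]) (simp add: g)
  then have g': "g' \<in> carrier G" "inv g \<otimes> g' \<in> I" using g lcos_eq_iff by auto
  have "tr g' y = tr (g \<otimes> (inv g \<otimes> g')) y" using g g' by (simp add: m_assoc[symmetric])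
  also have "\<dots> = tr g (tr (inv g \<otimes> g') y)" using g g' by (simp add: tr_tr)
  also have "\<dots> = tr g y" using g' y by (simp add: fixed_iff)
  finally show ?thesis using g by (simp add: hk_def g'_def)
qed

lemma hk_H:
  assumes y: "y \<in> fixed I"
  shows "hk y \<in> carrier H"
proof -
  let ?f = "lin_ext (\<lambda>c. tr (SOME g. g \<in> carrier G \<and> c = g <# I) y)"
  have cl: "?f x \<in> V" if "x \<in> V" for x
  proof (rule lin_ext_closed[OF that])
    fix c assume "c \<in> lcosets I"
    then have "\<exists>g. g \<in> carrier G \<and> c = g <# I" by (auto simp: LCOSETS_def)
    then have "(SOME g. g \<in> carrier G \<and> c = g <# I) \<in> carrier G" by (rule someI2_ex) simp
    then show "tr (SOME g. g \<in> carrier G \<and> c = g <# I) y \<in> V" using y by (simp add: fixed_iff)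
  qed
  have kl: "klin (hk y)" using klin_lin_ext[of "\<lambda>c. tr (SOME g. g \<in> carrier G \<and> c = g <# I) y"]
    by (simp add: hk_def klin_def)
  have hX: "hk y x \<in> V" if "x \<in> V" for x using cl that by (simp add: hk_def)
  have "hk y (tr g x) = tr g (hk y x)" if g: "g \<in> carrier G" and x: "x \<in> V" for g x
    by (rule klin_eqI[OF klin_comp[OF kl klin_tr] klin_comp[OF klin_tr kl] _ x])
      (use g hX in \<open>simp_all add: hk_dl[OF y] tr_tr\<close>)
  then show ?thesis using kl hX by (auto simp: H_iff hk_def)
qed

lemma hk_one: "y \<in> fixed I \<Longrightarrow> hk y (dl \<one>) = y"
  by (simp add: hk_dl fixed_iff)

lemma H_hk:
  assumes "h \<in> carrier H"
  shows "hk (h (dl \<one>)) = h"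
  using H_fixed[OF assms I_subset dl_one_fixed] by (intro H_eqI assms) (simp_all add: hk_H hk_one)

end

section \<open>Modules over a noncommutative ring, duals and coinvariants\<close>

lemma left_moduleI:
  assumes "ring R" "abelian_group M"
    and "\<And>a x. a \<in> carrier R \<Longrightarrow> x \<in> carrier M \<Longrightarrow> a \<odot>\<^bsub>M\<^esub> x \<in> carrier M"
    and "\<And>a b x. a \<in> carrier R \<Longrightarrow> b \<in> carrier R \<Longrightarrow> x \<in> carrier M \<Longrightarrow>
      (a \<oplus>\<^bsub>R\<^esub> b) \<odot>\<^bsub>M\<^esub> x = a \<odot>\<^bsub>M\<^esub> x \<oplus>\<^bsub>M\<^esub> b \<odot>\<^bsub>M\<^esub> x"
    and "\<And>a x y. a \<in> carrier R \<Longrightarrow> x \<in> carrier M \<Longrightarrow> y \<in> carrier M \<Longrightarrow>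
      a \<odot>\<^bsub>M\<^esub> (x \<oplus>\<^bsub>M\<^esub> y) = a \<odot>\<^bsub>M\<^esub> x \<oplus>\<^bsub>M\<^esub> a \<odot>\<^bsub>M\<^esub> y"
    and "\<And>a b x. a \<in> carrier R \<Longrightarrow> b \<in> carrier R \<Longrightarrow> x \<in> carrier M \<Longrightarrow>
      (a \<otimes>\<^bsub>R\<^esub> b) \<odot>\<^bsub>M\<^esub> x = a \<odot>\<^bsub>M\<^esub> (b \<odot>\<^bsub>M\<^esub> x)"
    and "\<And>x. x \<in> carrier M \<Longrightarrow> \<one>\<^bsub>R\<^esub> \<odot>\<^bsub>M\<^esub> x = x"
  shows "left_module R M"
  using assms by (simp add: left_module_def left_module_axioms_def)

lemma right_moduleI:
  assumes "ring R" "abelian_group M"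
    and "\<And>a x. a \<in> carrier R \<Longrightarrow> x \<in> carrier M \<Longrightarrow> a \<odot>\<^bsub>M\<^esub> x \<in> carrier M"
    and "\<And>a b x. a \<in> carrier R \<Longrightarrow> b \<in> carrier R \<Longrightarrow> x \<in> carrier M \<Longrightarrow>
      (a \<oplus>\<^bsub>R\<^esub> b) \<odot>\<^bsub>M\<^esub> x = a \<odot>\<^bsub>M\<^esub> x \<oplus>\<^bsub>M\<^esub> b \<odot>\<^bsub>M\<^esub> x"
    and "\<And>a x y. a \<in> carrier R \<Longrightarrow> x \<in> carrier M \<Longrightarrow> y \<in> carrier M \<Longrightarrow>
      a \<odot>\<^bsub>M\<^esub> (x \<oplus>\<^bsub>M\<^esub> y) = a \<odot>\<^bsub>M\<^esub> x \<oplus>\<^bsub>M\<^esub> a \<odot>\<^bsub>M\<^esub> y"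
    and "\<And>a b x. a \<in> carrier R \<Longrightarrow> b \<in> carrier R \<Longrightarrow> x \<in> carrier M \<Longrightarrow>
      (a \<otimes>\<^bsub>R\<^esub> b) \<odot>\<^bsub>M\<^esub> x = b \<odot>\<^bsub>M\<^esub> (a \<odot>\<^bsub>M\<^esub> x)"
    and "\<And>x. x \<in> carrier M \<Longrightarrow> \<one>\<^bsub>R\<^esub> \<odot>\<^bsub>M\<^esub> x = x"
  shows "right_module R M"
  using assms by (simp add: right_module_def right_module_axioms_def)

lemma left_module_regular:
  assumes "ring R"
  shows "left_module R (regular_left_module R)"
proof -
  interpret ring R by fact
  have "abelian_group (regular_left_module R)"
    by (rule abelian_groupI) (auto simp: regular_left_module_def a_ac intro: a_inv_closed l_neg)
  then show ?thesis
    by (intro left_moduleI assms)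
      (simp_all add: regular_left_module_def l_distr r_distr m_assoc)
qed

lemma (in right_module) smult_zero:
  assumes "a \<in> carrier R"
  shows "a \<odot>\<^bsub>M\<^esub> \<zero>\<^bsub>M\<^esub> = \<zero>\<^bsub>M\<^esub>"
proof -
  have "a \<odot>\<^bsub>M\<^esub> \<zero>\<^bsub>M\<^esub> \<oplus>\<^bsub>M\<^esub> a \<odot>\<^bsub>M\<^esub> \<zero>\<^bsub>M\<^esub> = a \<odot>\<^bsub>M\<^esub> \<zero>\<^bsub>M\<^esub> \<oplus>\<^bsub>M\<^esub> \<zero>\<^bsub>M\<^esub>"
    using assms smult_r_distr[of a "\<zero>\<^bsub>M\<^esub>" "\<zero>\<^bsub>M\<^esub>"] smult_closed[of a "\<zero>\<^bsub>M\<^esub>"] by simp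
  then show ?thesis using assms smult_closed[of a "\<zero>\<^bsub>M\<^esub>"] by (simp del: M.r_zero)
qed

lemma (in left_module) smult_zero:
  assumes "a \<in> carrier R"
  shows "a \<odot>\<^bsub>M\<^esub> \<zero>\<^bsub>M\<^esub> = \<zero>\<^bsub>M\<^esub>"
proof -
  have "a \<odot>\<^bsub>M\<^esub> \<zero>\<^bsub>M\<^esub> \<oplus>\<^bsub>M\<^esub> a \<odot>\<^bsub>M\<^esub> \<zero>\<^bsub>M\<^esub> = a \<odot>\<^bsub>M\<^esub> \<zero>\<^bsub>M\<^esub> \<oplus>\<^bsub>M\<^esub> \<zero>\<^bsub>M\<^esub>"
    using assms smult_r_distr[of a "\<zero>\<^bsub>M\<^esub>" "\<zero>\<^bsub>M\<^esub>"] smult_closed[of a "\<zero>\<^bsub>M\<^esub>"] by simp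
  then show ?thesis using assms smult_closed[of a "\<zero>\<^bsub>M\<^esub>"] by (simp del: M.r_zero)
qed

lemma (in left_module) smult_minus:
  assumes "a \<in> carrier R" "x \<in> carrier M"
  shows "a \<odot>\<^bsub>M\<^esub> (\<ominus>\<^bsub>M\<^esub> x) = \<ominus>\<^bsub>M\<^esub> (a \<odot>\<^bsub>M\<^esub> x)"
proof (rule M.minus_equality[symmetric])
  show "a \<odot>\<^bsub>M\<^esub> (\<ominus>\<^bsub>M\<^esub> x) \<oplus>\<^bsub>M\<^esub> a \<odot>\<^bsub>M\<^esub> x = \<zero>\<^bsub>M\<^esub>"
    using assms by (simp add: smult_r_distr[symmetric] M.l_neg smult_zero)
qed (use assms smult_closed in auto)

text \<open>Negatives are multiples by minus one, so closure under sums and scalars is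
  enough.\<close>

lemma (in left_module) left_module_sub:
  assumes sub: "N \<subseteq> carrier M" and z: "\<zero>\<^bsub>M\<^esub> \<in> N"
    and a: "\<And>x y. x \<in> N \<Longrightarrow> y \<in> N \<Longrightarrow> x \<oplus>\<^bsub>M\<^esub> y \<in> N"
    and s: "\<And>a x. a \<in> carrier R \<Longrightarrow> x \<in> N \<Longrightarrow> a \<odot>\<^bsub>M\<^esub> x \<in> N"
  shows "left_module R (M\<lparr>carrier := N\<rparr>)"
proof -
  have neg: "\<exists>y\<in>N. y \<oplus>\<^bsub>M\<^esub> x = \<zero>\<^bsub>M\<^esub>" if "x \<in> N" for x
  proof (intro bexI)
    have x: "x \<in> carrier M" using that sub by auto
    have "(\<ominus>\<^bsub>R\<^esub> \<one>\<^bsub>R\<^esub>) \<odot>\<^bsub>M\<^esub> x \<oplus>\<^bsub>M\<^esub> x = (\<ominus>\<^bsub>R\<^esub> \<one>\<^bsub>R\<^esub> \<oplus>\<^bsub>R\<^esub> \<one>\<^bsub>R\<^esub>) \<odot>\<^bsub>M\<^esub> x"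
      using x by (simp add: smult_l_distr smult_one)
    also have "\<dots> = \<zero>\<^bsub>R\<^esub> \<odot>\<^bsub>M\<^esub> x" by (simp add: R.l_neg)
    also have "\<dots> = \<zero>\<^bsub>M\<^esub>"
    proof -
      have c: "\<zero>\<^bsub>R\<^esub> \<odot>\<^bsub>M\<^esub> x \<in> carrier M" using x smult_closed by simp
      have "\<zero>\<^bsub>R\<^esub> \<odot>\<^bsub>M\<^esub> x \<oplus>\<^bsub>M\<^esub> \<zero>\<^bsub>R\<^esub> \<odot>\<^bsub>M\<^esub> x = \<zero>\<^bsub>R\<^esub> \<odot>\<^bsub>M\<^esub> x \<oplus>\<^bsub>M\<^esub> \<zero>\<^bsub>M\<^esub>"
        using x smult_l_distr[of "\<zero>\<^bsub>R\<^esub>" "\<zero>\<^bsub>R\<^esub>" x] c by simp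
      then show ?thesis using c by (simp del: M.r_zero)
    qed
    finally show "(\<ominus>\<^bsub>R\<^esub> \<one>\<^bsub>R\<^esub>) \<odot>\<^bsub>M\<^esub> x \<oplus>\<^bsub>M\<^esub> x = \<zero>\<^bsub>M\<^esub>" .
    show "(\<ominus>\<^bsub>R\<^esub> \<one>\<^bsub>R\<^esub>) \<odot>\<^bsub>M\<^esub> x \<in> N" using s that by simp
  qed
  have "abelian_group (M\<lparr>carrier := N\<rparr>)"
    by (rule abelian_groupI)
      (use sub z a neg in \<open>auto simp: M.a_ac subset_iff\<close>)
  then show ?thesis
    using sub s
    by (intro left_moduleI R.ring_axioms)
      (auto simp: smult_l_distr smult_r_distr smult_assoc smult_one subset_iff)
qed

lemma dual_simps [simp]:
  "\<zero>\<^bsub>dual R Y\<^esub> = (\<lambda>y\<in>carrier Y. \<zero>\<^bsub>R\<^esub>)"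
  "l \<oplus>\<^bsub>dual R Y\<^esub> l' = (\<lambda>y\<in>carrier Y. l y \<oplus>\<^bsub>R\<^esub> l' y)"
  "a \<odot>\<^bsub>dual R Y\<^esub> l = (\<lambda>y\<in>carrier Y. a \<otimes>\<^bsub>R\<^esub> l y)"
  by (simp_all add: dual_def)

lemma dual_iff:
  "l \<in> carrier (dual R Y) \<longleftrightarrow> l \<in> carrier Y \<rightarrow>\<^sub>E carrier R \<and>
     (\<forall>x\<in>carrier Y. \<forall>y\<in>carrier Y. l (x \<oplus>\<^bsub>Y\<^esub> y) = l x \<oplus>\<^bsub>R\<^esub> l y) \<and>
     (\<forall>a\<in>carrier R. \<forall>x\<in>carrier Y. l (a \<odot>\<^bsub>Y\<^esub> x) = l x \<otimes>\<^bsub>R\<^esub> a)"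
  by (simp add: dual_def)

lemma dual_eqI:
  assumes "l \<in> carrier (dual R Y)" "l' \<in> carrier (dual R Y)"
    "\<And>y. y \<in> carrier Y \<Longrightarrow> l y = l' y"
  shows "l = l'"
  using assms by (intro PiE_ext[of l "carrier Y" "\<lambda>_. carrier R" l']) (simp_all add: dual_iff)

lemma (in right_module) left_module_dual: "left_module R (dual R M)"
proof -
  note di = dual_iff[of _ R M]
  have cl: "l y \<in> carrier R" if "l \<in> carrier (dual R M)" "y \<in> carrier M" for l y
    using that by (auto simp: di)
  have zero: "\<zero>\<^bsub>dual R M\<^esub> \<in> carrier (dual R M)"
    by (auto simp: di smult_closed)
  have add: "l \<oplus>\<^bsub>dual R M\<^esub> l' \<in> carrier (dual R M)"
    if l: "l \<in> carrier (dual R M)" "l' \<in> carrier (dual R M)" for l l'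
    using l cl[OF l(1)] cl[OF l(2)]
    by (simp add: di smult_closed R.l_distr R.a_ac)
  have smult: "a \<odot>\<^bsub>dual R M\<^esub> l \<in> carrier (dual R M)"
    if l: "a \<in> carrier R" "l \<in> carrier (dual R M)" for a l
    using l cl[OF l(2)]
    by (simp add: di smult_closed R.r_distr R.m_assoc)
  have "abelian_group (dual R M)"
  proof (rule abelian_groupI)
    fix l assume l: "l \<in> carrier (dual R M)"
    show "\<exists>l'\<in>carrier (dual R M). l' \<oplus>\<^bsub>dual R M\<^esub> l = \<zero>\<^bsub>dual R M\<^esub>"
    proof
      show m: "(\<ominus>\<^bsub>R\<^esub> \<one>\<^bsub>R\<^esub>) \<odot>\<^bsub>dual R M\<^esub> l \<in> carrier (dual R M)" by (rule smult) (use l in auto)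
      show "(\<ominus>\<^bsub>R\<^esub> \<one>\<^bsub>R\<^esub>) \<odot>\<^bsub>dual R M\<^esub> l \<oplus>\<^bsub>dual R M\<^esub> l = \<zero>\<^bsub>dual R M\<^esub>"
        by (rule dual_eqI[OF add[OF m l] zero]) (simp add: cl[OF l] R.l_minus R.l_neg)
    qed
    show "\<zero>\<^bsub>dual R M\<^esub> \<oplus>\<^bsub>dual R M\<^esub> l = l"
      by (rule dual_eqI[OF add[OF zero l] l]) (simp add: cl[OF l])
  next
    fix x y z assume "x \<in> carrier (dual R M)" "y \<in> carrier (dual R M)" "z \<in> carrier (dual R M)"
    then show "x \<oplus>\<^bsub>dual R M\<^esub> y \<oplus>\<^bsub>dual R M\<^esub> z = x \<oplus>\<^bsub>dual R M\<^esub> (y \<oplus>\<^bsub>dual R M\<^esub> z)"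
      by (auto simp: fun_eq_iff R.a_assoc cl)
  next
    fix x y assume "x \<in> carrier (dual R M)" "y \<in> carrier (dual R M)"
    then show "x \<oplus>\<^bsub>dual R M\<^esub> y = y \<oplus>\<^bsub>dual R M\<^esub> x"
      by (auto simp: fun_eq_iff R.a_comm cl)
  qed (use add zero in auto)
  then show ?thesis
  proof (intro left_moduleI R.ring_axioms smult)
    fix l assume l: "l \<in> carrier (dual R M)"
    show "\<one>\<^bsub>R\<^esub> \<odot>\<^bsub>dual R M\<^esub> l = l"
      by (rule dual_eqI[OF smult[OF _ l] l]) (simp_all add: cl[OF l])
  qed (auto simp: fun_eq_iff R.l_distr R.r_distr R.m_assoc cl)
qed

lemma left_module_hom_iff:
  "f \<in> left_module_hom R M N \<longleftrightarrow> f \<in> carrier M \<rightarrow> carrier N \<and>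
     (\<forall>x\<in>carrier M. \<forall>y\<in>carrier M. f (x \<oplus>\<^bsub>M\<^esub> y) = f x \<oplus>\<^bsub>N\<^esub> f y) \<and>
     (\<forall>a\<in>carrier R. \<forall>x\<in>carrier M. f (a \<odot>\<^bsub>M\<^esub> x) = a \<odot>\<^bsub>N\<^esub> f x)"
  by (simp add: left_module_hom_def)

locale coinvariant_module = left_module R A
  for R :: "('r, 'c) ring_scheme" (structure) and A :: "('r, 'm, 'd) module_scheme" (structure) +
  fixes act :: "'u \<Rightarrow> 'm \<Rightarrow> 'm" and U :: "'u set"
  assumes act_hom: "u \<in> U \<Longrightarrow> act u \<in> left_module_hom R A A"
begin

abbreviation "S \<equiv> coinv_sub A act U"

lemma act_closed: "u \<in> U \<Longrightarrow> x \<in> carrier A \<Longrightarrow> act u x \<in> carrier A"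
  using act_hom[of u] by (auto simp: left_module_hom_iff)

lemma gens_closed: "{act u a \<ominus>\<^bsub>A\<^esub> a | u a. u \<in> U \<and> a \<in> carrier A} \<subseteq> carrier A"
  using act_closed by auto

lemma sub_abelian: "abelian_subgroup S A"
  by (rule abelian_subgroupI3[OF additive_subgroup.intro M.abelian_group_axioms])
    (unfold coinv_sub_def, rule M.add.generate_is_subgroup, use gens_closed in simp)

sublocale S: abelian_subgroup "coinv_sub A act U" A
  by (rule sub_abelian)

lemma S_induct [consumes 1, case_names zero gen minus add]:
  assumes "x \<in> S" and "P \<zero>\<^bsub>A\<^esub>"
    and "\<And>u a. u \<in> U \<Longrightarrow> a \<in> carrier A \<Longrightarrow> P (act u a \<ominus>\<^bsub>A\<^esub> a)"
    and "\<And>x. x \<in> carrier A \<Longrightarrow> P x \<Longrightarrow> P (\<ominus>\<^bsub>A\<^esub> x)"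
    and "\<And>x y. x \<in> carrier A \<Longrightarrow> y \<in> carrier A \<Longrightarrow> P x \<Longrightarrow> P y \<Longrightarrow> P (x \<oplus>\<^bsub>A\<^esub> y)"
  shows "P x"
proof -
  have "x \<in> generate (add_monoid A) {act u a \<ominus>\<^bsub>A\<^esub> a | u a. u \<in> U \<and> a \<in> carrier A}"
    using assms(1) by (simp add: coinv_sub_def)
  then have "x \<in> carrier A \<and> P x"
  proof (induction rule: generate.induct)
    case (inv h)
    then obtain u a where h: "h = act u a \<ominus>\<^bsub>A\<^esub> a" "u \<in> U" "a \<in> carrier A" by auto
    then have "h \<in> carrier A" "P h" using gens_closed assms(3) by auto
    then show ?case using assms(4) by (simp flip: a_inv_def)
  next
    case (eng h1 h2)
    then show ?case using assms(5) by auto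
  qed (use assms(2,3) act_closed in auto)
  then show ?thesis ..
qed

text \<open>By linearity of \<open>act u\<close>, a scalar \<open>a\<close> carries the generator
  belonging to \<open>b\<close> to the generator belonging to the multiple of \<open>b\<close> by
  \<open>a\<close>.\<close>

lemma S_smult: "a \<in> carrier R \<Longrightarrow> x \<in> S \<Longrightarrow> a \<odot>\<^bsub>A\<^esub> x \<in> S"
proof -
  assume a: "a \<in> carrier R" and "x \<in> S"
  from \<open>x \<in> S\<close> have "x \<in> carrier A \<and> a \<odot>\<^bsub>A\<^esub> x \<in> S"
  proof (induction rule: S_induct)
    case (gen u b)
    have "a \<odot>\<^bsub>A\<^esub> (act u b \<ominus>\<^bsub>A\<^esub> b) = act u (a \<odot>\<^bsub>A\<^esub> b) \<ominus>\<^bsub>A\<^esub> (a \<odot>\<^bsub>A\<^esub> b)"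
      using a gen act_hom act_closed
      by (auto simp: a_minus_def smult_r_distr smult_minus left_module_hom_iff)
    moreover have "act u (a \<odot>\<^bsub>A\<^esub> b) \<ominus>\<^bsub>A\<^esub> (a \<odot>\<^bsub>A\<^esub> b) \<in> S"
      unfolding coinv_sub_def
      by (rule generate.incl) (use a gen smult_closed in blast)
    ultimately show ?case using gens_closed gen by auto
  qed (use a in \<open>auto simp: smult_zero smult_minus smult_r_distr\<close>)
  then show ?thesis ..
qed

text \<open>A multiple of a coset is defined as a union of cosets over all its elements; these
  cosets coincide because \<open>S\<close> is a submodule.\<close>

lemma coset_smult:
  assumes a: "a \<in> carrier R" and x: "x \<in> carrier A"
  shows "a \<odot>\<^bsub>coinvariants A act U\<^esub> (S +>\<^bsub>A\<^esub> x) = S +>\<^bsub>A\<^esub> (a \<odot>\<^bsub>A\<^esub> x)"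
proof -
  have "S +>\<^bsub>A\<^esub> (a \<odot>\<^bsub>A\<^esub> y) = S +>\<^bsub>A\<^esub> (a \<odot>\<^bsub>A\<^esub> x)" if "y \<in> S +>\<^bsub>A\<^esub> x" for y
  proof -
    have "\<exists>s\<in>S. y = s \<oplus>\<^bsub>A\<^esub> x"
      using that by (simp only: a_r_coset_def' UN_iff singleton_iff)
    then obtain s where s: "s \<in> S" "y = s \<oplus>\<^bsub>A\<^esub> x" ..
    then have "a \<odot>\<^bsub>A\<^esub> y = a \<odot>\<^bsub>A\<^esub> s \<oplus>\<^bsub>A\<^esub> a \<odot>\<^bsub>A\<^esub> x"
      using a x S.a_subset by (auto intro!: smult_r_distr)
    then have "a \<odot>\<^bsub>A\<^esub> y \<in> S +>\<^bsub>A\<^esub> (a \<odot>\<^bsub>A\<^esub> x)"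
      using S_smult[OF a s(1)] by (auto simp: a_r_coset_def')
    then show ?thesis
      using M.a_repr_independence[OF _ _ S.a_subgroup] a x smult_closed by metis
  qed
  moreover have "S +>\<^bsub>A\<^esub> x \<noteq> {}" using S.a_rcos_self[OF x] by auto
  ultimately show ?thesis by (auto simp: coinvariants_def)
qed

lemma coset_cases:
  assumes "C \<in> carrier (coinvariants A act U)"
  obtains x where "x \<in> carrier A" "C = S +>\<^bsub>A\<^esub> x"
  using assms by (auto simp: coinvariants_def A_RCOSETS_def')

lemma coset_closed: "x \<in> carrier A \<Longrightarrow> S +>\<^bsub>A\<^esub> x \<in> carrier (coinvariants A act U)"
  by (auto simp: coinvariants_def A_RCOSETS_def')

lemma coset_add: "x \<in> carrier A \<Longrightarrow> y \<in> carrier A \<Longrightarrow>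
    (S +>\<^bsub>A\<^esub> x) \<oplus>\<^bsub>coinvariants A act U\<^esub> (S +>\<^bsub>A\<^esub> y) = S +>\<^bsub>A\<^esub> (x \<oplus>\<^bsub>A\<^esub> y)"
  by (simp add: coinvariants_def S.a_rcos_sum)

text \<open>The additive axioms are those of the quotient group; only the scalar axioms are checked
  on representatives.\<close>

lemma left_module_coinvariants: "left_module R (coinvariants A act U)"
proof -
  interpret F: comm_group "A A_Mod S" by (rule S.a_factorgroup_is_comm_group)
  let ?Q = "coinvariants A act U"
  have c: "carrier (A A_Mod S) = carrier ?Q" "monoid.mult (A A_Mod S) = ring.add ?Q" "one (A A_Mod S) = \<zero>\<^bsub>?Q\<^esub>"
    by (simp_all add: coinvariants_def A_FactGroup_def')
  have ab: "abelian_group ?Q"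
    by (rule abelian_groupI) (fact F.m_closed[unfolded c] F.one_closed[unfolded c]
      F.m_assoc[unfolded c] F.m_comm[unfolded c] F.l_one[unfolded c] F.l_inv_ex[unfolded c])+
  show ?thesis
  proof (rule left_moduleI[OF R.ring_axioms ab])
    show "a \<odot>\<^bsub>coinvariants A act U\<^esub> C \<in> carrier (coinvariants A act U)"
      if "a \<in> carrier R" "C \<in> carrier (coinvariants A act U)" for a C
      using that smult_closed by (auto elim!: coset_cases simp: coset_smult intro!: coset_closed)
  qed (auto elim!: coset_cases
        simp: coset_smult coset_add smult_closed smult_l_distr smult_r_distr smult_assoc smult_one)
qed

text \<open>With this, the map on coinvariants induced by the identity is the identity.\<close>

lemma coset_union: "C \<in> carrier (coinvariants A act U) \<Longrightarrow> (\<Union>x\<in>C. S +>\<^bsub>A\<^esub> x) = C"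
proof (elim coset_cases)
  fix x assume x: "x \<in> carrier A" and C: "C = S +>\<^bsub>A\<^esub> x"
  have "S +>\<^bsub>A\<^esub> y = C" if "y \<in> C" for y
    using M.a_repr_independence[OF _ x S.a_subgroup] that C by metis
  moreover have "C \<noteq> {}" using S.a_rcos_self[OF x] C by auto
  ultimately show ?thesis by auto
qed

end

lemma dual_mem: "l \<in> carrier (dual R Y) \<Longrightarrow> y \<in> carrier Y \<Longrightarrow> l y \<in> carrier R"
  by (auto simp: dual_iff)

section \<open>What an equivariant projection onto fixed vectors implies\<close>

context hecke_pair
begin

lemma H_ops:
  "\<zero>\<^bsub>H\<^esub> = (\<lambda>x\<in>V. 0)"
  "h \<oplus>\<^bsub>H\<^esub> h' = (\<lambda>x\<in>V. h x + h' x)"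
  "\<one>\<^bsub>H\<^esub> = (\<lambda>x\<in>V. x)"
  "h \<otimes>\<^bsub>H\<^esub> h' = (\<lambda>x\<in>V. h' (h x))"
  by (simp_all add: hecke_def plus_fun_def zero_fun_def)

lemma H_ops_closed:
  "\<zero>\<^bsub>H\<^esub> \<in> carrier H"
  "\<one>\<^bsub>H\<^esub> \<in> carrier H"
  "h \<in> carrier H \<Longrightarrow> h' \<in> carrier H \<Longrightarrow> h \<oplus>\<^bsub>H\<^esub> h' \<in> carrier H"
  "h \<in> carrier H \<Longrightarrow> h' \<in> carrier H \<Longrightarrow> h \<otimes>\<^bsub>H\<^esub> h' \<in> carrier H"
proof -
  show "\<zero>\<^bsub>H\<^esub> \<in> carrier H" "\<one>\<^bsub>H\<^esub> \<in> carrier H"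
    by (simp_all add: H_ops H_iff klin_def)
next
  assume h: "h \<in> carrier H" "h' \<in> carrier H"
  note [simp] = H_closed[OF h(1)] H_closed[OF h(2)] H_add[OF h(1)] H_add[OF h(2)]
    H_scl[OF h(1)] H_scl[OF h(2)] H_tr[OF h(1)] H_tr[OF h(2)]
  show "h \<oplus>\<^bsub>H\<^esub> h' \<in> carrier H" "h \<otimes>\<^bsub>H\<^esub> h' \<in> carrier H"
    by (simp_all add: H_ops H_iff[of "restrict _ _"] klin_def tr_add scl_add add_ac)
qed

lemma H_mult_apply: "x \<in> V \<Longrightarrow> (h \<otimes>\<^bsub>H\<^esub> h') x = h' (h x)"
  and H_add_apply: "x \<in> V \<Longrightarrow> (h \<oplus>\<^bsub>H\<^esub> h') x = h x + h' x"
  and H_one_apply: "x \<in> V \<Longrightarrow> \<one>\<^bsub>H\<^esub> x = x"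
  and H_zero_apply: "x \<in> V \<Longrightarrow> \<zero>\<^bsub>H\<^esub> x = 0"
  by (simp_all add: H_ops)

lemma H_scalar: "(\<lambda>x\<in>V. scl s x) \<in> carrier H"
  by (simp add: H_iff klin_def scl_add tr_scl mult.commute)

lemma H_ring: "ring H"
proof (rule ringI)
  note [simp] = H_ops_closed H_closed H_mult_apply H_add_apply H_one_apply H_zero_apply H_add
  have neg: "\<exists>h'\<in>carrier H. h' \<oplus>\<^bsub>H\<^esub> h = \<zero>\<^bsub>H\<^esub>" if h: "h \<in> carrier H" for h
  proof
    \<comment> \<open>The negative of \<open>h\<close> is \<open>h\<close> followed by the scalar
      operator for minus one, which lies in \<open>H\<close>.\<close>
    let ?m = "h \<otimes>\<^bsub>H\<^esub> (\<lambda>x\<in>V. scl (- 1) x)"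
    show m: "?m \<in> carrier H" by (rule H_ops_closed(4)[OF h H_scalar])
    show "?m \<oplus>\<^bsub>H\<^esub> h = \<zero>\<^bsub>H\<^esub>"
      by (rule H_eqI) (use m h scl_add_left[of "- 1" 1 "h (dl \<one>)"] in simp_all)
  qed
  show "abelian_group H"
    by (rule abelian_groupI) (use neg in \<open>auto intro!: H_eqI simp: add_ac\<close>)
  show "Group.monoid H"
    by (rule monoidI) (auto intro!: H_eqI)
qed (auto intro!: H_eqI simp: H_ops_closed H_closed H_mult_apply H_add_apply H_add)

lemma ind_module_simps [simp]:
  "carrier (ind_module G I) = V"
  "x \<oplus>\<^bsub>ind_module G I\<^esub> y = x + y"
  "\<zero>\<^bsub>ind_module G I\<^esub> = (0 :: ('g, 'k) ind)"
  "h \<odot>\<^bsub>ind_module G I\<^esub> x = h x"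
  "x \<oplus>\<^bsub>ind_fixed G I U\<^esub> y = x + y"
  "\<zero>\<^bsub>ind_fixed G I U\<^esub> = (0 :: ('g, 'k) ind)"
  "h \<odot>\<^bsub>ind_fixed G I U\<^esub> x = h x"
  by (simp_all add: ind_module_def ind_fixed_def plus_fun_def zero_fun_def)

text \<open>\<open>H\<close> contains the scalars of the coefficient field, so a subset closed under
  sums and under \<open>H\<close> is closed under negatives.\<close>

lemma right_module_sub:
  assumes "M = (ind_module G I)\<lparr>carrier := N\<rparr>" "N \<subseteq> V" "0 \<in> N"
    and "\<And>x y. x \<in> N \<Longrightarrow> y \<in> N \<Longrightarrow> x + y \<in> N" "\<And>h x. h \<in> carrier H \<Longrightarrow> x \<in> N \<Longrightarrow> h x \<in> N"
  shows "right_module H M"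
proof -
  have neg: "\<exists>y\<in>N. y + x = 0" if "x \<in> N" for x
  proof
    have "(\<lambda>x\<in>V. scl (- 1) x) x = - x" using that assms(2) by (auto simp: scl_uminus)
    then show "- x \<in> N" using assms(5)[OF H_scalar that, of "- 1"] by simp
  qed simp
  have op: "x \<oplus>\<^bsub>M\<^esub> y = x + y" "\<zero>\<^bsub>M\<^esub> = 0" "h \<odot>\<^bsub>M\<^esub> x = h x" "carrier M = N" for x y h
    by (simp_all add: assms(1) ind_module_def plus_fun_def zero_fun_def)
  have "abelian_group M"
    by (rule abelian_groupI) (use assms(3,4) neg in \<open>auto simp: op add_ac\<close>)
  then show ?thesis
    using assms(2-5)
    by (intro right_moduleI H_ring)
      (auto simp: op H_add_apply H_mult_apply H_one_apply H_add subset_iff)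
qed

lemma right_module_ind: "right_module H (ind_module G I)"
  by (rule right_module_sub[of _ V]) (simp_all add: ind_module_def H_closed)

lemma fixed_closed:
  "0 \<in> fixed U" "x \<in> fixed U \<Longrightarrow> y \<in> fixed U \<Longrightarrow> x + y \<in> fixed U"
  "x \<in> fixed U \<Longrightarrow> scl s x \<in> fixed U" "x \<in> fixed U \<Longrightarrow> y \<in> fixed U \<Longrightarrow> x - y \<in> fixed U"
  by (simp_all add: fixed_iff tr_add tr_scl tr_diff)

lemma fixed_sum: "(\<And>u. u \<in> R \<Longrightarrow> f u \<in> fixed U) \<Longrightarrow> (\<Sum>u\<in>R. f u) \<in> fixed U"
  by (simp add: fixed_iff V_sum tr_sum)

lemma right_module_fixed: "U \<subseteq> carrier G \<Longrightarrow> right_module H (ind_fixed G I U)"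
  by (rule right_module_sub[of _ "fixed U"])
    (auto simp: ind_fixed_def H_fixed[unfolded ind_fixed_def, simplified] tr_add)

text \<open>An \<open>H\<close>-linear projection of X onto its \<open>U\<close>-invariants. All
  three claims reduce to its existence for I and for K_m.\<close>

definition retraction :: "'g set \<Rightarrow> (('g, 'k) ind \<Rightarrow> ('g, 'k) ind) \<Rightarrow> bool" where
  "retraction U \<psi> \<longleftrightarrow> klin \<psi> \<and> (\<forall>x\<in>V. \<psi> x \<in> fixed U) \<and> (\<forall>x\<in>fixed U. \<psi> x = x) \<and>
     (\<forall>h\<in>carrier H. \<forall>x\<in>V. \<psi> (h x) = h (\<psi> x))"

lemma right_submoduleI:
  assumes "N \<subseteq> V" "0 \<in> N"
    "\<And>x y. x \<in> N \<Longrightarrow> y \<in> N \<Longrightarrow> x + y \<in> N" "\<And>h x. h \<in> carrier H \<Longrightarrow> x \<in> N \<Longrightarrow> h x \<in> N"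
  shows "right_submodule H (ind_module G I) N"
proof -
  interpret M: right_module H "ind_module G I" by (rule right_module_ind)
  have "\<ominus>\<^bsub>ind_module G I\<^esub> x \<in> N" if "x \<in> N" for x
  proof -
    have x: "x \<in> V" using that assms(1) by auto
    have "(\<lambda>x\<in>V. scl (- 1) x) x = - x" using x by (simp add: scl_uminus)
    then have "- x \<in> N" using assms(4)[OF H_scalar that, of "- 1"] by simp
    moreover have "\<ominus>\<^bsub>ind_module G I\<^esub> x = - x"
      by (rule M.M.minus_equality) (use x in simp_all)
    ultimately show ?thesis by simp
  qed
  then have "subgroup N (add_monoid (ind_module G I))"
    by (intro M.M.add.subgroupI) (use assms in \<open>auto simp flip: a_inv_def\<close>)
  then show ?thesis
    using assms(4) right_module_ind by (simp add: right_submodule_def)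
qed

text \<open>The complement is the kernel of the projection, a submodule because
  \<open>\<psi>\<close> commutes with \<open>H\<close>.\<close>

lemma retraction_direct_factor:
  assumes U: "U \<subseteq> carrier G" and r: "retraction U \<psi>"
  shows "right_direct_factor H (ind_module G I) (fixed U)"
proof -
  note k = r[unfolded retraction_def]
  define C where "C = {x \<in> V. \<psi> x = 0}"
  have fV: "fixed U \<subseteq> V" by (auto simp: fixed_iff)
  have "right_submodule H (ind_module G I) (fixed U)"
    by (rule right_submoduleI) (use fV fixed_closed H_fixed U in auto)
  moreover have "right_submodule H (ind_module G I) C"
    by (rule right_submoduleI) (use k in \<open>auto simp: C_def klin_zero klin_add H_closed H_zero\<close>)
  moreover have "fixed U \<inter> C = {\<zero>\<^bsub>ind_module G I\<^esub>}"
    using k fixed_closed(1) by (auto simp: C_def klin_zero)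
  moreover have "fixed U <+>\<^bsub>ind_module G I\<^esub> C = V"
  proof
    show "fixed U <+>\<^bsub>ind_module G I\<^esub> C \<subseteq> V"
      using fV by (auto simp: set_add_def' C_def)
    show "V \<subseteq> fixed U <+>\<^bsub>ind_module G I\<^esub> C"
    proof
      fix x assume x: "x \<in> V"
      then have p: "\<psi> x \<in> fixed U" "\<psi> x \<in> V" using k fV by auto
      then have "x - \<psi> x \<in> C" using x k by (simp add: C_def klin_diff)
      moreover have "x = \<psi> x + (x - \<psi> x)" by simp
      ultimately show "x \<in> fixed U <+>\<^bsub>ind_module G I\<^esub> C"
        unfolding set_add_def' using p(1) by (simp, intro bexI[of _ "\<psi> x"] bexI[of _ "x - \<psi> x"]) simp_all
    qed
  qed
  ultimately show ?thesis by (auto simp: right_direct_factor_def)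
qed

lemma rho_eq: "rho G I l = l (dl \<one>)"
  using dl_one_fixed by (simp add: rho_def eval_char_I_def flip: dl_one)

lemma hk_add: "x \<in> fixed I \<Longrightarrow> y \<in> fixed I \<Longrightarrow> hk (x + y) = hk x \<oplus>\<^bsub>H\<^esub> hk y"
  by (rule H_eqI) (simp_all add: H_ops_closed hk_H fixed_closed hk_one H_add_apply)

lemma hk_smult: "x \<in> fixed I \<Longrightarrow> h \<in> carrier H \<Longrightarrow> hk (h x) = hk x \<otimes>\<^bsub>H\<^esub> h"
  by (rule H_eqI) (simp_all add: H_ops_closed hk_H H_fixed[OF _ I_subset] hk_one H_mult_apply)

text \<open>The projection followed by the identification of the \<open>I\<close>-invariants with
  \<open>H\<close> is a functional with value 1 at the characteristic function of \<open>I\<close>;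
  left multiplication by \<open>h\<close> turns it into one with value \<open>h\<close>.\<close>

lemma retraction_rho_surj:
  assumes r: "retraction I \<psi>"
  shows "rho G I ` carrier (dual H (ind_module G I)) = carrier H"
proof
  show "rho G I ` carrier (dual H (ind_module G I)) \<subseteq> carrier H"
  proof (clarify, unfold rho_eq)
    fix l :: "('g, 'k) functional" assume "l \<in> carrier (dual H (ind_module G I))"
    then show "l (dl \<one>) \<in> carrier H" by (rule dual_mem) simp
  qed
  show "carrier H \<subseteq> rho G I ` carrier (dual H (ind_module G I))"
  proof
    fix h assume h: "h \<in> carrier H"
    note k = r[unfolded retraction_def]
    interpret R: ring H by (rule H_ring)
    define l where "l = (\<lambda>x\<in>V. h \<otimes>\<^bsub>H\<^esub> hk (\<psi> x))"
    have "l \<in> carrier (dual H (ind_module G I))"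
      using k h hk_H by (simp add: dual_iff l_def klin_add hk_add hk_smult H_closed R.r_distr R.m_assoc)
    moreover have "rho G I l = h"
      using k h dl_one_fixed H_hk[OF H_ops_closed(2)]
      by (simp add: rho_eq l_def H_one_apply)
    ultimately show "h \<in> rho G I ` carrier (dual H (ind_module G I))" by force
  qed
qed

text \<open>A retraction lets every functional on the fixed vectors extend to the whole module.\<close>

lemma retraction_dual_image:
  assumes U: "U \<subseteq> carrier G" and r: "retraction U \<psi>"
  shows "dual_image G I U = (dual_fixed G I U :: (('g, 'k) hecke_elt, ('g, 'k) functional) module)"
proof -
  note k = r[unfolded retraction_def]
  have fV: "fixed U \<subseteq> V" by (auto simp: fixed_iff)
  let ?D = "dual H (ind_fixed G I U)" and ?r = "\<lambda>l :: ('g, 'k) functional. restrict l (fixed U)"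
  have "?r ` carrier (dual H (ind_module G I)) = carrier ?D"
  proof
    show "?r ` carrier (dual H (ind_module G I)) \<subseteq> carrier ?D"
    proof clarify
      fix l :: "('g, 'k) functional" assume l: "l \<in> carrier (dual H (ind_module G I))"
      then have "l x \<in> carrier H" if "x \<in> fixed U" for x
        by (rule dual_mem) (use that fV in auto)
      then show "restrict l (fixed U) \<in> carrier ?D"
        using fV fixed_closed H_fixed[OF _ U] l by (auto simp: dual_iff subset_iff)
    qed
    show "carrier ?D \<subseteq> ?r ` carrier (dual H (ind_module G I))"
    proof
      fix l assume l: "l \<in> carrier ?D"
      define l' where "l' = (\<lambda>x\<in>V. l (\<psi> x))"
      have "l' \<in> carrier (dual H (ind_module G I))"
        using l k H_closed by (auto simp: dual_iff l'_def klin_add)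
      moreover have "?r l' = l"
        by (rule extensionalityI[of _ "fixed U"]) (use l k fV in \<open>auto simp: dual_iff l'_def PiE_def\<close>)
      ultimately show "l \<in> ?r ` carrier (dual H (ind_module G I))" by force
    qed
  qed
  then show ?thesis by (simp add: dual_image_def)
qed

text \<open>Since \<open>I\<close> normalizes \<open>U\<close>, its translations preserve the
  \<open>U\<close>-invariants; the resulting operators on the dual are \<open>H\<close>-linear
  because Hecke operators commute with translations.\<close>

lemma coinvariant_module_dual_fixed:
  assumes U: "U \<subseteq> carrier G"
    and norm: "\<And>i u. i \<in> I \<Longrightarrow> u \<in> U \<Longrightarrow> inv i \<otimes> u \<otimes> i \<in> U"
  shows "coinvariant_module H (dual_fixed G I U :: (('g, 'k) hecke_elt, ('g, 'k) functional) module)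
    (dual_translate G I (fixed U)) I"
proof -
  interpret M: right_module H "ind_fixed G I U" by (rule right_module_fixed[OF U])
  interpret D: left_module H "dual_fixed G I U" by (rule M.left_module_dual)
  have trU: "tr (inv i) x \<in> fixed U" if i: "i \<in> I" and x: "x \<in> fixed U" for i x
  proof -
    have c: "i \<in> carrier G" "x \<in> V" using i x I_subset by (auto simp: fixed_iff)
    have "tr u (tr (inv i) x) = tr (inv i) x" if u: "u \<in> U" for u
    proof -
      have uc: "u \<in> carrier G" using u U by auto
      have "inv (inv i) \<otimes> u \<otimes> inv i \<in> U" using norm[of "inv i" u] i u by simp
      then have "tr (i \<otimes> u \<otimes> inv i) x = x" using x c by (simp add: fixed_iff)
      then have "tr (inv i) (tr (i \<otimes> u \<otimes> inv i) x) = tr (inv i) x" by simp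
      then show ?thesis using c uc by (simp add: tr_tr m_assoc[symmetric])
    qed
    then show ?thesis using c by (simp add: fixed_iff)
  qed
  show ?thesis
  proof (unfold_locales)
    fix i assume i: "i \<in> I"
    then have ic: "inv i \<in> carrier G" using I_subset by auto
    have fV: "fixed U \<subseteq> V" by (auto simp: fixed_iff)
    show "dual_translate G I (fixed U) i \<in> left_module_hom H (dual_fixed G I U) (dual_fixed G I U)"
      unfolding left_module_hom_iff dual_translate_def
    proof (intro conjI ballI funcsetI)
      fix l :: "('g, 'k) functional" assume l: "l \<in> carrier (dual_fixed G I U)"
      show "(\<lambda>y\<in>fixed U. l (tr (inv i) y)) \<in> carrier (dual_fixed G I U)"
        unfolding dual_iff
      proof (intro conjI ballI)
        fix h x assume h: "h \<in> carrier H" and x: "x \<in> fixed U"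
        then have "tr (inv i) (h x) = h (tr (inv i) x)" using H_tr[OF h ic, of x] fV by auto
        then show "(\<lambda>y\<in>fixed U. l (tr (inv i) y)) (h \<odot>\<^bsub>ind_fixed G I U\<^esub> x) =
            (\<lambda>y\<in>fixed U. l (tr (inv i) y)) x \<otimes>\<^bsub>H\<^esub> h"
          using h x trU[OF i x] l H_fixed[OF h U x] by (simp add: dual_iff)
      qed (use trU[OF i] fixed_closed l in \<open>auto simp: dual_iff tr_add\<close>)
    qed (use trU[OF i] in \<open>auto simp: fun_eq_iff\<close>)
  qed
qed

text \<open>The projection for \<open>U\<close> makes the image of the dual of X the whole dual of
  the \<open>U\<close>-invariants. So the map out of \<open>Z_module\<close> is the inclusion of a
  kernel, and exactness on the left and in the middle holds by construction. Surjectivity uses the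
  projection for \<open>I\<close>: a functional on X with the required value is restricted to the
  \<open>U\<close>-invariants.\<close>

lemma short_exact:
  assumes U: "U \<subseteq> I"
    and norm: "\<And>i u. i \<in> I \<Longrightarrow> u \<in> U \<Longrightarrow> inv i \<otimes> u \<otimes> i \<in> U"
    and r: "retraction U \<psi>" and r0: "retraction I \<psi>0"
  shows "short_exact_left H (Z_module G I U) (coinv_incl G I U) (coinv_dual_fixed G I U)
    (coinv_to_hecke G I) (regular_left_module H)"
proof -
  have Uc: "U \<subseteq> carrier G" using U I_subset by auto
  let ?D = "dual_fixed G I U :: (('g, 'k) hecke_elt, ('g, 'k) functional) module"
  let ?act = "dual_translate G I (fixed U) :: 'g \<Rightarrow> ('g, 'k) functional \<Rightarrow> ('g, 'k) functional"
  let ?Q = "coinvariants ?D ?act I"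
  interpret R: ring H by (rule H_ring)
  interpret Q: coinvariant_module H ?D ?act I
    by (rule coinvariant_module_dual_fixed[OF Uc norm])
  interpret N: left_module H "regular_left_module H" by (rule left_module_regular[OF H_ring])
  \<comment> \<open>This is where \<open>U \<subseteq> I\<close> enters: the characteristic function
    of \<open>I\<close> is \<open>U\<close>-fixed, so functionals can be evaluated there.\<close>
  have one: "dl \<one> \<in> fixed U" using dl_one_fixed U unfolding fixed_iff by blast
  have ev: "l (dl \<one>) \<in> carrier H" if "l \<in> carrier ?D" for l using that one by (auto simp: dual_iff)
  have minus: "(\<ominus>\<^bsub>?D\<^esub> l) y = \<ominus>\<^bsub>H\<^esub> l y" if "l \<in> carrier ?D" "y \<in> fixed U" for l y
  proof (rule R.minus_equality[symmetric])
    have "((\<ominus>\<^bsub>?D\<^esub> l) \<oplus>\<^bsub>?D\<^esub> l) y = \<zero>\<^bsub>?D\<^esub> y" using that by (simp only: Q.M.l_neg)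
    then show "(\<ominus>\<^bsub>?D\<^esub> l) y \<oplus>\<^bsub>H\<^esub> l y = \<zero>\<^bsub>H\<^esub>" using that(2) by simp
    have "\<ominus>\<^bsub>?D\<^esub> l \<in> carrier ?D" using that by simp
    then show "(\<ominus>\<^bsub>?D\<^esub> l) y \<in> carrier H" using that(2) by (auto simp: dual_iff)
  qed (use that in \<open>auto simp: dual_iff\<close>)
  \<comment> \<open>The vector \<open>dl \<one>\<close> is \<open>I\<close>-fixed, so evaluation at
    it kills the difference of a functional and its translate, and therefore factors through the
    coinvariants.\<close>
  have S0: "l \<in> carrier ?D \<and> l (dl \<one>) = \<zero>\<^bsub>H\<^esub>" if "l \<in> Q.S" for l
    using that
  proof (induction rule: Q.S_induct)
    case zero
    show ?case by (rule conjI[OF Q.M.zero_closed]) (use one in simp)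
  next
    case (gen i l)
    have i: "inv i \<in> I" using gen by simp
    have a: "?act i l \<in> carrier ?D" by (rule Q.act_closed) (use gen in auto)
    have "tr (inv i) (dl \<one>) = dl \<one>" using dl_one_fixed i by (simp add: fixed_iff del: tr_dl)
    then have "?act i l (dl \<one>) = l (dl \<one>)" using one by (simp add: dual_translate_def)
    then show ?case
      using a gen one ev[OF gen(2)] by (simp add: a_minus_def minus R.r_neg del: dual_simps) (simp add: minus R.r_neg)
  next
    case (minus l)
    then show ?case using one by (simp add: \<open>\<And>y l. l \<in> carrier ?D \<Longrightarrow> y \<in> fixed U \<Longrightarrow> (\<ominus>\<^bsub>?D\<^esub> l) y = \<ominus>\<^bsub>H\<^esub> l y\<close>)
  next
    case (add l l')
    show ?case by (rule conjI[OF Q.M.a_closed]) (use add one in simp_all)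
  qed
  have to_hecke: "coinv_to_hecke G I (Q.S +>\<^bsub>?D\<^esub> l) = l (dl \<one>)" if l: "l \<in> carrier ?D" for l
  proof -
    have const: "rho G I l' = l (dl \<one>)" if "l' \<in> Q.S +>\<^bsub>?D\<^esub> l" for l'
    proof -
      have "\<exists>s\<in>Q.S. l' = s \<oplus>\<^bsub>?D\<^esub> l" using that by (simp only: a_r_coset_def' UN_iff singleton_iff)
      then obtain s where s: "s \<in> Q.S" "l' = s \<oplus>\<^bsub>?D\<^esub> l" ..
      then show ?thesis using S0[OF s(1)] ev[OF l] one by (simp add: rho_eq)
    qed
    have self: "l \<in> Q.S +>\<^bsub>?D\<^esub> l" by (rule Q.S.a_rcos_self[OF l])
    have "rho G I ` (Q.S +>\<^bsub>?D\<^esub> l) = {l (dl \<one>)}"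
    proof (rule equalityI)
      show "rho G I ` (Q.S +>\<^bsub>?D\<^esub> l) \<subseteq> {l (dl \<one>)}"
        by (rule image_subsetI) (simp only: const singleton_iff)
      show "{l (dl \<one>)} \<subseteq> rho G I ` (Q.S +>\<^bsub>?D\<^esub> l)"
        unfolding const[OF self, symmetric] by (simp only: insert_subset empty_subsetI imageI[OF self] simp_thms)
    qed
    then show ?thesis by (simp add: coinv_to_hecke_def)
  qed
  have QQ: "coinv_dual_fixed G I U = ?Q" by (simp add: coinv_dual_fixed_def)
  have hom: "coinv_to_hecke G I \<in> left_module_hom H ?Q (regular_left_module H)"
    unfolding left_module_hom_iff
    using one
    by (auto elim!: Q.coset_cases simp: to_hecke ev Q.coset_add Q.coset_smult Q.M.a_closed Q.smult_closed
        simp del: dual_simps) (auto simp: regular_left_module_def ev)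
  have incl: "coinv_incl G I U C = C" if "C \<in> carrier ?Q" for C
    unfolding coinv_incl_def coinv_map_def by (rule Q.coset_union[OF that])
  define K where "K = {C \<in> carrier ?Q. coinv_to_hecke G I C = \<zero>\<^bsub>H\<^esub>}"
  have Z: "Z_module G I U = ?Q\<lparr>carrier := K\<rparr>"
    unfolding Z_module_def coinv_dual_image_def retraction_dual_image[OF Uc r] K_def
    using incl by (auto intro!: arg_cong[of _ _ "\<lambda>K. ?Q\<lparr>carrier := K\<rparr>"])
  interpret L: left_module H ?Q by (rule Q.left_module_coinvariants)
  have zero: "\<zero>\<^bsub>regular_left_module H\<^esub> = \<zero>\<^bsub>H\<^esub>" and add: "x \<oplus>\<^bsub>regular_left_module H\<^esub> y = x \<oplus>\<^bsub>H\<^esub> y"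
    and smult: "x \<odot>\<^bsub>regular_left_module H\<^esub> y = x \<otimes>\<^bsub>H\<^esub> y"
    and car: "carrier (regular_left_module H) = carrier H" for x y
    by (simp_all add: regular_left_module_def)
  have LZ: "left_module H (?Q\<lparr>carrier := K\<rparr>)"
  proof (rule L.left_module_sub)
    have "Q.S = Q.S +>\<^bsub>?D\<^esub> \<zero>\<^bsub>?D\<^esub>"
      using Q.M.a_coset_add_zero[OF Q.S.a_subset] by (rule sym)
    then show "\<zero>\<^bsub>?Q\<^esub> \<in> K"
      using to_hecke[OF Q.M.zero_closed] one L.M.zero_closed
      by (simp add: K_def) (simp add: coinvariants_def)
  qed (use hom L.smult_closed in \<open>auto simp: K_def left_module_hom_iff add smult\<close>)
  have surj: "coinv_to_hecke G I ` carrier ?Q = carrier H"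
  proof
    show "coinv_to_hecke G I ` carrier ?Q \<subseteq> carrier H"
      using hom by (auto simp: left_module_hom_iff car)
    show "carrier H \<subseteq> coinv_to_hecke G I ` carrier ?Q"
    proof
      fix h assume "h \<in> carrier H"
      then obtain l where l: "l \<in> carrier (dual H (ind_module G I))" "h = rho G I l"
        using retraction_rho_surj[OF r0] by force
      have "restrict l (fixed U) \<in> carrier (dual_image G I U)"
        using l(1) by (simp add: dual_image_def)
      then have "restrict l (fixed U) \<in> carrier ?D"
        by (simp only: retraction_dual_image[OF Uc r])
      then have "coinv_to_hecke G I (Q.S +>\<^bsub>?D\<^esub> restrict l (fixed U)) = h"
        "Q.S +>\<^bsub>?D\<^esub> restrict l (fixed U) \<in> carrier ?Q"
        using one l(2) by (simp_all add: to_hecke rho_eq Q.coset_closed)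
      then show "h \<in> coinv_to_hecke G I ` carrier ?Q" by blast
    qed
  qed
  have "coinv_incl G I U \<in> left_module_hom H (?Q\<lparr>carrier := K\<rparr>) ?Q"
    using incl L.M.a_closed L.smult_closed by (auto simp: left_module_hom_iff K_def)
  then show ?thesis
    unfolding short_exact_left_def QQ Z
    using LZ L.left_module_axioms N.left_module_axioms hom surj incl
    by (auto simp: K_def zero car inj_on_def image_iff)
qed

end

section \<open>Computing in a covering group\<close>

lemma (in group) inv_cancel [simp]:
  "x \<in> carrier G \<Longrightarrow> y \<in> carrier G \<Longrightarrow> inv x \<otimes> (x \<otimes> y) = y"
  "x \<in> carrier G \<Longrightarrow> y \<in> carrier G \<Longrightarrow> x \<otimes> (inv x \<otimes> y) = y"
  by (simp_all add: m_assoc[symmetric])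

text \<open>Computations take place in a group \<open>M\<close> mapping onto \<open>G\<close>, with
  \<open>J\<close> the full preimage of \<open>I\<close>. For SL2 and GL2 the map is the identity;
  for PGL2 it is the projection from GL2, so that classes are handled through matrices.\<close>

locale hecke_cover = group M + P: hecke_pair G I F
  for M :: "('m, 'c) monoid_scheme" (structure) and G :: "('g, 'b) monoid_scheme"
    and I :: "'g set" and F :: "'k::field itself" +
  fixes cl :: "'m \<Rightarrow> 'g" and J :: "'m set"
  assumes cl_hom: "cl \<in> hom M G"
    and cl_surj: "cl ` carrier M = carrier G"
    and J_subgroup: "subgroup J M"
    and J_iff: "x \<in> carrier M \<Longrightarrow> cl x \<in> I \<longleftrightarrow> x \<in> J"
begin

sublocale J: subgroup J M by (rule J_subgroup)

lemma J_carrier: "x \<in> J \<Longrightarrow> x \<in> carrier M"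
  by (rule J.mem_carrier)

lemmas [simp] = J.m_closed J.m_inv_closed J.one_closed J_carrier
lemmas gs = m_assoc inv_mult_group

lemma cl_closed [simp]: "x \<in> carrier M \<Longrightarrow> cl x \<in> carrier G"
  using cl_surj by auto

lemma cl_mult [simp]: "x \<in> carrier M \<Longrightarrow> y \<in> carrier M \<Longrightarrow> cl (x \<otimes> y) = cl x \<otimes>\<^bsub>G\<^esub> cl y"
  using cl_hom by (auto simp: hom_def)

lemma cl_group_hom: "group_hom M G cl"
  by unfold_locales (rule cl_hom)

lemma cl_one [simp]: "cl \<one> = \<one>\<^bsub>G\<^esub>"
  by (rule group_hom.hom_one[OF cl_group_hom])

lemma cl_inv [simp]: "x \<in> carrier M \<Longrightarrow> cl (inv x) = inv\<^bsub>G\<^esub> cl x"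
  by (rule group_hom.hom_inv[OF cl_group_hom])

lemma I_eq: "I = cl ` J"
proof
  show "I \<subseteq> cl ` J"
  proof
    fix c assume c: "c \<in> I"
    then obtain x where "x \<in> carrier M" "c = cl x" using cl_surj P.I_subset by blast
    then show "c \<in> cl ` J" using c J_iff by blast
  qed
qed (use J_iff in auto)

definition D :: "'m \<Rightarrow> ('g, 'k) ind" where "D g = P.dl (cl g)"

lemma D_V [simp]: "g \<in> carrier M \<Longrightarrow> D g \<in> P.V"
  by (simp add: D_def)

lemma inv_mult_J_iff:
  assumes "g \<in> carrier M" "h \<in> carrier M"
  shows "inv\<^bsub>G\<^esub> cl g \<otimes>\<^bsub>G\<^esub> cl h \<in> I \<longleftrightarrow> inv g \<otimes> h \<in> J"
proof -
  have "inv\<^bsub>G\<^esub> cl g \<otimes>\<^bsub>G\<^esub> cl h = cl (inv g \<otimes> h)" using assms by (simp only: cl_mult cl_inv inv_closed)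
  then show ?thesis using J_iff[of "inv g \<otimes> h"] assms by (simp only: m_closed inv_closed)
qed

lemma D_eq_iff: "g \<in> carrier M \<Longrightarrow> h \<in> carrier M \<Longrightarrow> D g = D h \<longleftrightarrow> inv g \<otimes> h \<in> J"
  by (simp only: D_def P.dl_eq_iff cl_closed inv_mult_J_iff)

lemma D_J: "g \<in> carrier M \<Longrightarrow> j \<in> J \<Longrightarrow> D (g \<otimes> j) = D g"
  by (subst D_eq_iff) (simp_all add: gs)

lemma tr_D [simp]: "a \<in> carrier M \<Longrightarrow> g \<in> carrier M \<Longrightarrow> P.tr (cl a) (D g) = D (a \<otimes> g)"
  by (simp add: D_def)

lemma dl_D: "c \<in> carrier G \<Longrightarrow> \<exists>g\<in>carrier M. P.dl c = D g"
  unfolding D_def using cl_surj by (metis imageE)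

lemma klin_eqI_D:
  assumes "P.klin f" "P.klin g" "\<And>a. a \<in> carrier M \<Longrightarrow> f (D a) = g (D a)" "x \<in> P.V"
  shows "f x = g x"
  by (rule P.klin_eqI[OF assms(1,2) _ assms(4)]) (use dl_D assms(3) in metis)

lemma hk_D: "y \<in> P.fixed I \<Longrightarrow> g \<in> carrier M \<Longrightarrow> P.hk y (D g) = P.tr (cl g) y"
  by (simp add: D_def P.hk_dl)

lemma D_one: "D \<one> = P.dl \<one>\<^bsub>G\<^esub>"
  by (simp add: D_def)

lemma hk_D_one: "y \<in> P.fixed I \<Longrightarrow> P.hk y (D \<one>) = y"
  by (simp add: D_one P.hk_one)

lemma fixed_IffD: "y \<in> P.fixed (cl ` B) \<longleftrightarrow> y \<in> P.V \<and> (\<forall>b\<in>B. P.tr (cl b) y = y)"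
  by (auto simp: P.fixed_iff)

lemma fixed_I_iff: "y \<in> P.fixed I \<longleftrightarrow> y \<in> P.V \<and> (\<forall>j\<in>J. P.tr (cl j) y = y)"
  using fixed_IffD[of y J] by (simp flip: I_eq)

lemma klin_H_H: "h \<in> carrier P.H \<Longrightarrow> h' \<in> carrier P.H \<Longrightarrow> P.klin (\<lambda>x. h (h' x))"
  by (rule P.klin_comp) (simp_all add: P.H_klin P.H_closed)

text \<open>As \<open>lin_ext\<close>, for data indexed by elements of \<open>M\<close>; the chosen
  representative is harmless once \<open>\<phi>\<close> is constant on the cosets of
  \<open>J\<close>.\<close>

definition lin :: "('m \<Rightarrow> ('g, 'k) ind) \<Rightarrow> ('g, 'k) ind \<Rightarrow> ('g, 'k) ind" where
  "lin \<phi> = P.lin_ext (\<lambda>c. \<phi> (SOME g. g \<in> carrier M \<and> c = cl g <#\<^bsub>G\<^esub> I))"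

lemma klin_lin: "P.klin (lin \<phi>)"
  by (simp add: lin_def P.klin_lin_ext)

lemma lin_closed:
  assumes "\<And>g. g \<in> carrier M \<Longrightarrow> \<phi> g \<in> P.V" "x \<in> P.V"
  shows "lin \<phi> x \<in> P.V"
  unfolding lin_def
proof (rule P.lin_ext_closed[OF assms(2)])
  fix c assume "c \<in> lcosets\<^bsub>G\<^esub> I"
  then obtain a where "a \<in> carrier G" "c = a <#\<^bsub>G\<^esub> I" by (rule P.lcos_cases)
  then have "\<exists>g. g \<in> carrier M \<and> c = cl g <#\<^bsub>G\<^esub> I"
    using cl_surj by (metis imageE)
  then have "(SOME g. g \<in> carrier M \<and> c = cl g <#\<^bsub>G\<^esub> I) \<in> carrier M" by (rule someI2_ex) simp
  then show "\<phi> (SOME g. g \<in> carrier M \<and> c = cl g <#\<^bsub>G\<^esub> I) \<in> P.V" by (rule assms(1))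
qed

lemma lin_D:
  assumes inv: "\<And>g j. g \<in> carrier M \<Longrightarrow> j \<in> J \<Longrightarrow> \<phi> (g \<otimes> j) = \<phi> g" and g: "g \<in> carrier M"
  shows "lin \<phi> (D g) = \<phi> g"
proof -
  define g' where "g' = (SOME g'. g' \<in> carrier M \<and> cl g <#\<^bsub>G\<^esub> I = cl g' <#\<^bsub>G\<^esub> I)"
  have "g' \<in> carrier M \<and> cl g <#\<^bsub>G\<^esub> I = cl g' <#\<^bsub>G\<^esub> I"
    unfolding g'_def by (rule someI[of _ g]) (simp add: g)
  then have g': "g' \<in> carrier M" "inv g \<otimes> g' \<in> J"
    using g P.lcos_eq_iff[of "cl g" "cl g'"] inv_mult_J_iff[of g g'] cl_closed by blast+
  have "\<phi> g' = \<phi> (g \<otimes> (inv g \<otimes> g'))" using g g' by simp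
  also have "\<dots> = \<phi> g" by (rule inv) (use g g' in auto)
  finally show ?thesis by (simp add: lin_def D_def g'_def)
qed

text \<open>One inclusion suffices for the double coset of \<open>n\<close> under \<open>J\<close>
  to be the single coset \<open>n J\<close>.\<close>

definition norm :: "'m \<Rightarrow> bool" where
  "norm n \<longleftrightarrow> n \<in> carrier M \<and> (\<forall>j\<in>J. inv n \<otimes> j \<otimes> n \<in> J)"

text \<open>The Hecke operator of the coset \<open>n J\<close>. On cosets it is right
  multiplication, taking \<open>g J\<close> to \<open>g n J\<close>; hence it composes in the order
  of the group, read from the inside out.\<close>

definition act :: "'m \<Rightarrow> ('g, 'k) hecke_elt" where "act n = P.hk (D n)"

lemma norm_carrier: "norm n \<Longrightarrow> n \<in> carrier M"
  by (simp add: norm_def)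

lemma norm_J: "norm n \<Longrightarrow> j \<in> J \<Longrightarrow> inv n \<otimes> (j \<otimes> n) \<in> J"
  unfolding norm_def by (metis J_carrier inv_closed m_assoc)

lemma normI: "n \<in> carrier M \<Longrightarrow> (\<And>j. j \<in> J \<Longrightarrow> inv n \<otimes> (j \<otimes> n) \<in> J) \<Longrightarrow> norm n"
  unfolding norm_def by (simp add: m_assoc)

lemmas [simp] = norm_carrier

lemma norm_D:
  assumes n: "norm n"
  shows "D n \<in> P.fixed I"
  unfolding fixed_I_iff
proof (intro conjI ballI)
  fix j assume j: "j \<in> J"
  have "inv (j \<otimes> n) \<otimes> n = inv n \<otimes> (inv j \<otimes> n)" using n j by (simp add: gs)
  then have "D (j \<otimes> n) = D n" using norm_J[OF n, of "inv j"] n j by (simp add: D_eq_iff)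
  then show "P.tr (cl j) (D n) = D n" using n j by simp
qed (use n in simp)

lemma act_H: "norm n \<Longrightarrow> act n \<in> carrier P.H"
  by (simp add: act_def P.hk_H norm_D)

lemma act_D: "norm n \<Longrightarrow> g \<in> carrier M \<Longrightarrow> act n (D g) = D (g \<otimes> n)"
  by (simp add: act_def hk_D norm_D)

lemma norm_mult:
  assumes n: "norm n" "norm n'"
  shows "norm (n \<otimes> n')"
proof (rule normI)
  fix j assume j: "j \<in> J"
  have "inv (n \<otimes> n') \<otimes> (j \<otimes> (n \<otimes> n')) = inv n' \<otimes> ((inv n \<otimes> (j \<otimes> n)) \<otimes> n')"
    using n j by (simp add: gs)
  then show "inv (n \<otimes> n') \<otimes> (j \<otimes> (n \<otimes> n')) \<in> J"
    using norm_J[OF n(2) norm_J[OF n(1) j]] by simp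
qed (use n in simp)

lemma act_act: "norm n \<Longrightarrow> norm n' \<Longrightarrow> x \<in> P.V \<Longrightarrow> act n' (act n x) = act (n \<otimes> n') x"
  by (rule klin_eqI_D[OF klin_H_H P.H_klin])
    (simp_all add: act_H norm_mult act_D P.H_closed m_assoc)

lemma act_J: "j \<in> J \<Longrightarrow> x \<in> P.V \<Longrightarrow> norm j \<Longrightarrow> act j x = x"
  by (rule klin_eqI_D[of "act j" "\<lambda>x. x"]) (simp_all add: act_H P.H_klin act_D D_J, simp add: P.klin_def)

lemma norm_of_J: "j \<in> J \<Longrightarrow> norm j"
  by (rule normI) simp_all

lemma act_cong: "norm n \<Longrightarrow> norm n' \<Longrightarrow> inv n \<otimes> n' \<in> J \<Longrightarrow> act n = act n'"
  using D_eq_iff[of n n'] by (simp add: act_def)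

end

section \<open>The projective line of edges at one vertex\<close>

text \<open>The structure of a finite group of rank one, read modulo \<open>J\<close>:
  \<open>T\<close> is the torus, \<open>s\<close> the Weyl element, \<open>Q\<close> the group of
  the vertex, and \<open>R\<close> represents the cosets \<open>u s J\<close> in
  \<open>J s J\<close>. \<open>Q_cases\<close> is the Bruhat decomposition relative to the opposite
  group \<open>s J (inv s)\<close>; \<open>\<tau> u\<close> is the torus part of \<open>u s\<close>
  in it. Conjugation by \<open>s\<close> permutes these torus parts modulo \<open>J\<close>, and
  \<open>\<kappa>\<close> is that permutation on indices. \<open>normal\<close> says that the
  intersection of \<open>J\<close> with \<open>s J (inv s)\<close> is normal in \<open>J\<close>.
  \<open>R_card\<close> is the place of the characteristic: \<open>R\<close> has as many elements as
  the residue field.\<close>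

locale rank_one = hecke_cover M G I F cl J
  for M :: "('m, 'c) monoid_scheme" (structure) and G :: "('g, 'b) monoid_scheme"
    and I :: "'g set" and F :: "'k::field itself" and cl :: "'m \<Rightarrow> 'g" and J :: "'m set" +
  fixes T Q :: "'m set" and s :: 'm and R :: "'m set" and \<tau> \<kappa> :: "'m \<Rightarrow> 'm"
  assumes T_subgroup: "subgroup T M"
    and T_norm: "t \<in> T \<Longrightarrow> j \<in> J \<Longrightarrow> t \<otimes> j \<otimes> inv t \<in> J"
    and s_carrier [simp]: "s \<in> carrier M"
    and s_T: "t \<in> T \<Longrightarrow> inv s \<otimes> t \<otimes> s \<in> T"
    and s_TJ: "t \<in> T \<Longrightarrow> inv s \<otimes> t \<otimes> s \<in> J \<Longrightarrow> t \<in> J"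
    and s_square: "s \<otimes> s \<in> T"
    and Q_subgroup: "subgroup Q M" and J_Q: "J \<subseteq> Q" and T_Q: "T \<subseteq> Q" and s_Q: "s \<in> Q"
    and Q_cases: "p \<in> Q \<Longrightarrow> (\<exists>t\<in>T. \<exists>j\<in>J. p = s \<otimes> t \<otimes> j) \<or>
      (\<exists>i\<in>J. \<exists>t\<in>T. \<exists>j\<in>J. p = s \<otimes> i \<otimes> inv s \<otimes> t \<otimes> j)"
    and disjoint: "i \<in> J \<Longrightarrow> j \<in> J \<Longrightarrow> i \<otimes> s \<otimes> j \<notin> T"
    and R_finite: "finite R" and R_J: "u \<in> R \<Longrightarrow> u \<in> J" and R_one: "\<one> \<in> R"
    and R_card: "of_nat (card R) = (0 :: 'k)"
    and R_ex: "i \<in> J \<Longrightarrow> \<exists>u\<in>R. \<exists>j\<in>J. i \<otimes> s = u \<otimes> s \<otimes> j"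
    and R_unique: "u \<in> R \<Longrightarrow> u' \<in> R \<Longrightarrow> t \<in> T \<Longrightarrow> j \<in> J \<Longrightarrow> u \<otimes> s = u' \<otimes> s \<otimes> t \<otimes> j \<Longrightarrow>
      u = u' \<and> t \<in> J"
    and tau: "u \<in> R - {\<one>} \<Longrightarrow> \<tau> u \<in> T"
      "u \<in> R - {\<one>} \<Longrightarrow> \<exists>i\<in>J. \<exists>j\<in>J. u \<otimes> s = s \<otimes> i \<otimes> inv s \<otimes> \<tau> u \<otimes> j"
    and kappa: "bij_betw \<kappa> (R - {\<one>}) (R - {\<one>})"
      "u \<in> R - {\<one>} \<Longrightarrow> inv (inv s \<otimes> \<tau> u \<otimes> s) \<otimes> \<tau> (\<kappa> u) \<in> J"
    and normal: "i \<in> J \<Longrightarrow> x \<in> J \<Longrightarrow> inv s \<otimes> x \<otimes> s \<in> J \<Longrightarrow> inv s \<otimes> (i \<otimes> x \<otimes> inv i) \<otimes> s \<in> J"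
begin

sublocale T: subgroup T M by (rule T_subgroup)

lemma T_carrier: "t \<in> T \<Longrightarrow> t \<in> carrier M"
  by (rule T.mem_carrier)

lemma R_carrier: "u \<in> R \<Longrightarrow> u \<in> carrier M"
  by (simp add: R_J)

lemmas [simp] = T.m_closed T.m_inv_closed T.one_closed T_carrier R_carrier R_J

lemma T_norm': "t \<in> T \<Longrightarrow> j \<in> J \<Longrightarrow> t \<otimes> (j \<otimes> inv t) \<in> J" "t \<in> T \<Longrightarrow> j \<in> J \<Longrightarrow> inv t \<otimes> (j \<otimes> t) \<in> J"
  using T_norm[of t j] T_norm[of "inv t" j] by (simp_all add: gs)

lemma norm_T: "t \<in> T \<Longrightarrow> norm t"
  by (rule normI) (simp_all add: T_norm')

lemma s_T': "t \<in> T \<Longrightarrow> inv s \<otimes> (t \<otimes> s) \<in> T"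
  using s_T[of t] by (simp add: gs)

definition ts :: "'m \<Rightarrow> 'm" where "ts t = inv s \<otimes> t \<otimes> s"

lemma ts_T [simp]: "t \<in> T \<Longrightarrow> ts t \<in> T"
  by (simp add: ts_def s_T)

lemma ts_comm: "t \<in> T \<Longrightarrow> t \<otimes> s = s \<otimes> ts t"
  by (simp add: ts_def gs)

lemma T_J_comm: "t \<in> T \<Longrightarrow> j \<in> J \<Longrightarrow> j \<otimes> t = t \<otimes> (inv t \<otimes> (j \<otimes> t))"
  "t \<in> T \<Longrightarrow> j \<in> J \<Longrightarrow> t \<otimes> j = t \<otimes> (j \<otimes> inv t) \<otimes> t"
  by (simp_all add: gs)

text \<open>A map of \<open>R\<close> that permutes the cosets \<open>u s J\<close> may be inserted
  into any sum over them. The next three lemmas are the cases of left and right multiplication by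
  \<open>J\<close> and of conjugation by \<open>T\<close>.\<close>

lemma R_reindex:
  assumes e: "\<And>u. u \<in> R \<Longrightarrow> e u \<in> carrier M \<and> (\<exists>u'\<in>R. \<exists>j\<in>J. e u \<otimes> s = u' \<otimes> s \<otimes> j)"
    and inj: "\<And>u u' j. u \<in> R \<Longrightarrow> u' \<in> R \<Longrightarrow> j \<in> J \<Longrightarrow> e u \<otimes> s = e u' \<otimes> s \<otimes> j \<Longrightarrow> u = u'"
    and f: "\<And>g j. g \<in> carrier M \<Longrightarrow> j \<in> J \<Longrightarrow> f (g \<otimes> j) = f g"
    and g: "g \<in> carrier M"
  shows "(\<Sum>u\<in>R. f (g \<otimes> (e u \<otimes> s))) = (\<Sum>u\<in>R. f (g \<otimes> (u \<otimes> s)))"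
proof -
  have "\<forall>u\<in>R. \<exists>u'. u' \<in> R \<and> (\<exists>j\<in>J. e u \<otimes> s = u' \<otimes> s \<otimes> j)" using e by blast
  then obtain h where h: "\<And>u. u \<in> R \<Longrightarrow> h u \<in> R \<and> (\<exists>j\<in>J. e u \<otimes> s = h u \<otimes> s \<otimes> j)" by metis
  have "inj_on h R"
  proof (rule inj_onI)
    fix u u' assume u: "u \<in> R" "u' \<in> R" "h u = h u'"
    obtain j where j: "j \<in> J" "e u \<otimes> s = h u \<otimes> s \<otimes> j" using h u by blast
    obtain j' where j': "j' \<in> J" "e u' \<otimes> s = h u' \<otimes> s \<otimes> j'" using h u by blast
    have eq: "e u \<otimes> s = e u' \<otimes> s \<otimes> (inv j' \<otimes> j)"
      using j j' u h[OF u(1)] h[OF u(2)] e[OF u(2)] by (simp add: gs)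
    show "u = u'" by (rule inj[OF u(1,2) _ eq]) (use j j' in simp)
  qed
  then have bij: "bij_betw h R R"
    using h by (intro bij_betw_imageI endo_inj_surj R_finite) auto
  have "(\<Sum>u\<in>R. f (g \<otimes> (e u \<otimes> s))) = (\<Sum>u\<in>R. f (g \<otimes> (h u \<otimes> s)))"
  proof (rule sum.cong[OF refl])
    fix u assume u: "u \<in> R"
    then obtain j where j: "j \<in> J" "e u \<otimes> s = h u \<otimes> s \<otimes> j" using h by blast
    then have "g \<otimes> (e u \<otimes> s) = g \<otimes> (h u \<otimes> s) \<otimes> j" using u h[OF u] g by (simp add: gs)
    then show "f (g \<otimes> (e u \<otimes> s)) = f (g \<otimes> (h u \<otimes> s))" using f j u h g by simp
  qed
  also have "\<dots> = (\<Sum>u\<in>R. f (g \<otimes> (u \<otimes> s)))"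
    by (rule sum.reindex_bij_betw[OF bij])
  finally show ?thesis .
qed

lemma sum_left:
  assumes f: "\<And>g j. g \<in> carrier M \<Longrightarrow> j \<in> J \<Longrightarrow> f (g \<otimes> j) = f g"
    and g: "g \<in> carrier M" and i: "i \<in> J"
  shows "(\<Sum>u\<in>R. f (g \<otimes> i \<otimes> (u \<otimes> s))) = (\<Sum>u\<in>R. f (g \<otimes> (u \<otimes> s)))"
proof -
  have "(\<Sum>u\<in>R. f (g \<otimes> ((i \<otimes> u) \<otimes> s))) = (\<Sum>u\<in>R. f (g \<otimes> (u \<otimes> s)))"
  proof (rule R_reindex[OF _ _ f g])
    fix u assume "u \<in> R"
    then show "i \<otimes> u \<in> carrier M \<and> (\<exists>u'\<in>R. \<exists>j\<in>J. i \<otimes> u \<otimes> s = u' \<otimes> s \<otimes> j)"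
      using R_ex[of "i \<otimes> u"] i by simp
  next
    fix u u' j assume u: "u \<in> R" "u' \<in> R" "j \<in> J" and eq: "i \<otimes> u \<otimes> s = i \<otimes> u' \<otimes> s \<otimes> j"
    then have "u \<otimes> s = u' \<otimes> s \<otimes> \<one> \<otimes> j" using i by (simp add: gs)
    then show "u = u'" using R_unique[of u u' \<one> j] u by simp
  qed
  then show ?thesis using i g by (simp add: gs)
qed

text \<open>If \<open>u i s\<close> and \<open>u' i s\<close> define the same coset, then
  \<open>x\<close> below lies in \<open>J\<close> and in \<open>s J (inv s)\<close>; normality of
  the intersection allows the conjugation by \<open>i\<close> to be undone.\<close>

lemma sum_right:
  assumes f: "\<And>g j. g \<in> carrier M \<Longrightarrow> j \<in> J \<Longrightarrow> f (g \<otimes> j) = f g"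
    and g: "g \<in> carrier M" and i: "i \<in> J"
  shows "(\<Sum>u\<in>R. f (g \<otimes> (u \<otimes> i \<otimes> s))) = (\<Sum>u\<in>R. f (g \<otimes> (u \<otimes> s)))"
proof (rule R_reindex[OF _ _ f g])
  fix u assume "u \<in> R"
  then show "u \<otimes> i \<in> carrier M \<and> (\<exists>u'\<in>R. \<exists>j\<in>J. u \<otimes> i \<otimes> s = u' \<otimes> s \<otimes> j)"
    using R_ex[of "u \<otimes> i"] i by simp
next
  fix u u' j assume u: "u \<in> R" "u' \<in> R" and j: "j \<in> J" and eq: "u \<otimes> i \<otimes> s = u' \<otimes> i \<otimes> s \<otimes> j"
  define x where "x = inv i \<otimes> inv u' \<otimes> u \<otimes> i"
  have c [simp]: "i \<in> carrier M" "j \<in> carrier M" "u \<in> carrier M" "u' \<in> carrier M" using u i j by auto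
  have xJ: "x \<in> J" using u i by (simp add: x_def)
  have "inv s \<otimes> x \<otimes> s = inv s \<otimes> inv i \<otimes> inv u' \<otimes> (u \<otimes> i \<otimes> s)"
    by (simp add: x_def gs)
  also have "\<dots> = j" unfolding eq by (simp add: gs)
  finally have "inv s \<otimes> (i \<otimes> x \<otimes> inv i) \<otimes> s \<in> J" using normal[OF i xJ] j by simp
  then have j2: "inv s \<otimes> (inv u' \<otimes> (u \<otimes> s)) \<in> J" by (simp add: x_def gs)
  have "u \<otimes> s = u' \<otimes> s \<otimes> \<one> \<otimes> (inv s \<otimes> (inv u' \<otimes> (u \<otimes> s)))" by (simp add: gs)
  then show "u = u'" using R_unique[OF u T.one_closed j2] by simp
qed

lemma sum_T:
  assumes f: "\<And>g j. g \<in> carrier M \<Longrightarrow> j \<in> J \<Longrightarrow> f (g \<otimes> j) = f g"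
    and g: "g \<in> carrier M" and t: "t \<in> T"
  shows "(\<Sum>u\<in>R. f (g \<otimes> t \<otimes> (u \<otimes> s))) = (\<Sum>u\<in>R. f (g \<otimes> (u \<otimes> s) \<otimes> ts t))"
proof -
  have f': "f (h \<otimes> j \<otimes> ts t) = f (h \<otimes> ts t)" if h: "h \<in> carrier M" and j: "j \<in> J" for h j
  proof -
    have "h \<otimes> j \<otimes> ts t = (h \<otimes> ts t) \<otimes> (inv (ts t) \<otimes> (j \<otimes> ts t))" using h j t by (simp add: gs)
    then show ?thesis using f[of "h \<otimes> ts t" "inv (ts t) \<otimes> (j \<otimes> ts t)"] T_norm'(2)[of "ts t" j] h j t by simp
  qed
  have "(\<Sum>u\<in>R. f (g \<otimes> ((t \<otimes> u \<otimes> inv t) \<otimes> s) \<otimes> ts t)) = (\<Sum>u\<in>R. f (g \<otimes> (u \<otimes> s) \<otimes> ts t))"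
  proof (rule R_reindex[where f = "\<lambda>x. f (x \<otimes> ts t)", OF _ _ f' g])
    fix u assume "u \<in> R"
    then show "t \<otimes> u \<otimes> inv t \<in> carrier M \<and> (\<exists>u'\<in>R. \<exists>j\<in>J. t \<otimes> u \<otimes> inv t \<otimes> s = u' \<otimes> s \<otimes> j)"
      using R_ex[OF T_norm[OF t, of u]] t by simp
  next
    fix u u' j assume u: "u \<in> R" "u' \<in> R" and j: "j \<in> J"
      and eq: "t \<otimes> u \<otimes> inv t \<otimes> s = t \<otimes> u' \<otimes> inv t \<otimes> s \<otimes> j"
    have c [simp]: "t \<in> carrier M" "ts t \<in> carrier M" "j \<in> carrier M" "u \<in> carrier M" "u' \<in> carrier M"
      using u t j by auto
    have t': "inv t \<otimes> s = s \<otimes> inv (ts t)" by (simp add: ts_def gs)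
    have "t \<otimes> (u \<otimes> (s \<otimes> inv (ts t))) = t \<otimes> (u' \<otimes> (s \<otimes> (inv (ts t) \<otimes> j)))"
      using eq by (simp add: gs t' flip: m_assoc[of "inv t" s])
    then have "u \<otimes> (s \<otimes> inv (ts t)) = u' \<otimes> (s \<otimes> (inv (ts t) \<otimes> j))" by simp
    then have "u \<otimes> (s \<otimes> inv (ts t)) \<otimes> ts t = u' \<otimes> (s \<otimes> (inv (ts t) \<otimes> j)) \<otimes> ts t" by simp
    then have "u \<otimes> s = u' \<otimes> s \<otimes> \<one> \<otimes> (inv (ts t) \<otimes> (j \<otimes> ts t))" by (simp add: gs)
    then show "u = u'" using R_unique[OF u T.one_closed, of "inv (ts t) \<otimes> (j \<otimes> ts t)"] T_norm'(2)[of "ts t" j] t j by simp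
  qed
  moreover have "g \<otimes> ((t \<otimes> u \<otimes> inv t) \<otimes> s) \<otimes> ts t = g \<otimes> t \<otimes> (u \<otimes> s)" if "u \<in> R" for u
    using that g t by (simp add: gs ts_def)
  ultimately show ?thesis by simp
qed

text \<open>The characteristic function of \<open>J s J\<close>, summed over its
  \<open>J\<close>-cosets; \<open>Ts\<close> is the corresponding Hecke operator, the neighbour sum
  at the vertex.\<close>

definition S :: "('g, 'k) ind" where "S = (\<Sum>u\<in>R. D (u \<otimes> s))"

definition Ts :: "('g, 'k) hecke_elt" where "Ts = P.hk S"

lemma D_J': "g \<in> carrier M \<Longrightarrow> j \<in> J \<Longrightarrow> D (g \<otimes> j) = D g"
  by (rule D_J)

lemma S_fixed: "S \<in> P.fixed I"
  unfolding fixed_I_iff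
proof (intro conjI ballI)
  show "S \<in> P.V" unfolding S_def by (rule P.V_sum) simp
  fix i assume i: "i \<in> J"
  have "P.tr (cl i) S = (\<Sum>u\<in>R. D (i \<otimes> (u \<otimes> s)))"
    using i by (simp add: S_def P.tr_sum)
  also have "\<dots> = (\<Sum>u\<in>R. D (\<one> \<otimes> i \<otimes> (u \<otimes> s)))" using i by simp
  also have "\<dots> = (\<Sum>u\<in>R. D (\<one> \<otimes> (u \<otimes> s)))" by (rule sum_left) (simp_all add: D_J i)
  also have "\<dots> = S" by (simp add: S_def)
  finally show "P.tr (cl i) S = S" .
qed

lemma Ts_H: "Ts \<in> carrier P.H"
  by (simp add: Ts_def P.hk_H S_fixed)

lemma Ts_D: "g \<in> carrier M \<Longrightarrow> Ts (D g) = (\<Sum>u\<in>R. D (g \<otimes> (u \<otimes> s)))"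
  by (simp add: Ts_def hk_D S_fixed) (simp add: S_def P.tr_sum)

lemma Ts_act:
  assumes t: "t \<in> T" and x: "x \<in> P.V"
  shows "Ts (act t x) = act (ts t) (Ts x)"
proof (rule klin_eqI_D[of "\<lambda>x. Ts (act t x)" "\<lambda>x. act (ts t) (Ts x)", OF _ _ _ x])
  fix g assume g: "g \<in> carrier M"
  have "Ts (act t (D g)) = (\<Sum>u\<in>R. D (g \<otimes> t \<otimes> (u \<otimes> s)))"
    using t g by (simp add: act_D norm_T Ts_D)
  also have "\<dots> = (\<Sum>u\<in>R. D (g \<otimes> (u \<otimes> s) \<otimes> ts t))"
    by (rule sum_T) (use t g in \<open>simp_all add: D_J\<close>)
  also have "\<dots> = act (ts t) (Ts (D g))"
    using t g by (simp add: Ts_D P.H_sum act_H norm_T act_D)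
  finally show "Ts (act t (D g)) = act (ts t) (Ts (D g))" .
qed (use t in \<open>simp_all add: Ts_H act_H norm_T klin_H_H\<close>)

text \<open>The value at \<open>s\<close> forced by the relation at the base edge: each
  \<open>u s\<close> with \<open>u \<noteq> \<one>\<close> is sent to \<open>D (\<tau> u)\<close>,
  and the values at all \<open>u s\<close> have to add up to \<open>S\<close>.\<close>

definition rs :: "('g, 'k) ind" where "rs = S - (\<Sum>u\<in>R - {\<one>}. D (\<tau> u))"

lemma rs_fixed: "rs \<in> P.fixed I"
  unfolding rs_def by (intro P.fixed_closed(4) P.fixed_sum S_fixed norm_D norm_T tau(1))

lemma rs_V: "rs \<in> P.V"
  using rs_fixed by (simp add: P.fixed_iff)

text \<open>The cells of \<open>Q\<close> under the opposite group \<open>s J (inv s)\<close>: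
  \<open>in_s\<close> is the one of its fixed point, \<open>in_opp\<close> the open cell, which
  contains \<open>\<one>\<close>. The argument \<open>t\<close> records the torus part.\<close>

definition in_s :: "'m \<Rightarrow> 'm \<Rightarrow> bool" where
  "in_s t p \<longleftrightarrow> t \<in> T \<and> (\<exists>j\<in>J. p = s \<otimes> t \<otimes> j)"

definition in_opp :: "'m \<Rightarrow> 'm \<Rightarrow> bool" where
  "in_opp t p \<longleftrightarrow> t \<in> T \<and> (\<exists>i\<in>J. \<exists>j\<in>J. p = s \<otimes> i \<otimes> inv s \<otimes> t \<otimes> j)"

text \<open>A form on the functions around a vertex with values in the \<open>I\<close>-invariants,
  that is, in the Hecke algebra. It is invariant under \<open>s J (inv s)\<close> and takes
  \<open>\<one>\<close> to \<open>D \<one>\<close>. Later it propagates values from a root edge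
  \<open>r\<close> to the other edges \<open>r \<otimes> p\<close> of its star, by applying
  \<open>hk (ret p)\<close>.\<close>

definition ret :: "'m \<Rightarrow> ('g, 'k) ind" where
  "ret p = (if \<exists>t. in_opp t p then D (SOME t. in_opp t p)
     else if \<exists>t. in_s t p then act (SOME t. in_s t p) rs else 0)"

text \<open>Uniqueness for the cosets \<open>u s J\<close> leaves no torus part in
  \<open>s J (inv s)\<close> modulo \<open>J\<close>. This makes the torus part in the open cell
  well defined.\<close>

lemma s_conj_J:
  assumes i: "i \<in> J" and t: "t \<in> T" and j: "j \<in> J" and eq: "s \<otimes> i \<otimes> inv s = t \<otimes> j"
  shows "t \<in> J"
proof -
  note [simp] = i t j
  have c [simp]: "i \<in> carrier M" "t \<in> carrier M" "j \<in> carrier M" by auto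
  define j' where "j' = t \<otimes> (j \<otimes> inv t)"
  have j': "j' \<in> J" unfolding j'_def by (rule T_norm'(1)) simp_all
  then obtain u k where u: "u \<in> R" and k: "k \<in> J" and uk: "j' \<otimes> s = u \<otimes> s \<otimes> k" using R_ex by blast
  have c' [simp]: "u \<in> carrier M" "k \<in> carrier M" "j' \<in> carrier M" using u k j' by auto
  have "s \<otimes> i = s \<otimes> i \<otimes> inv s \<otimes> s" by (simp add: gs)
  also have "\<dots> = t \<otimes> j \<otimes> s" unfolding eq ..
  also have "\<dots> = j' \<otimes> s \<otimes> ts t" by (simp add: j'_def ts_def gs)
  also have "\<dots> = u \<otimes> s \<otimes> ts t \<otimes> (inv (ts t) \<otimes> (k \<otimes> ts t))" unfolding uk by (simp add: gs)
  finally have *: "s \<otimes> i = u \<otimes> s \<otimes> ts t \<otimes> (inv (ts t) \<otimes> (k \<otimes> ts t))" .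
  have k': "inv (ts t) \<otimes> (k \<otimes> ts t) \<in> J" by (rule T_norm'(2)) (simp_all add: k)
  have "\<one> \<otimes> s = s \<otimes> i \<otimes> inv i" by (simp add: gs)
  also have "\<dots> = u \<otimes> s \<otimes> ts t \<otimes> (inv (ts t) \<otimes> (k \<otimes> ts t) \<otimes> inv i)" unfolding * by (simp add: gs)
  finally have "ts t \<in> J" using R_unique[OF R_one u, of "ts t" "inv (ts t) \<otimes> (k \<otimes> ts t) \<otimes> inv i"] k' by simp
  then show ?thesis using s_TJ[OF t] by (simp add: ts_def)
qed

lemma in_opp_unique:
  assumes "in_opp t p" "in_opp t' p"
  shows "D t = D t'"
proof -
  obtain i j where ij [simp]: "i \<in> J" "j \<in> J" and p: "p = s \<otimes> i \<otimes> inv s \<otimes> t \<otimes> j" and t [simp]: "t \<in> T"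
    using assms(1) by (auto simp: in_opp_def)
  obtain i' j' where ij' [simp]: "i' \<in> J" "j' \<in> J" and p': "p = s \<otimes> i' \<otimes> inv s \<otimes> t' \<otimes> j'" and t' [simp]: "t' \<in> T"
    using assms(2) by (auto simp: in_opp_def)
  note [simp] = J_carrier[OF ij(1)] J_carrier[OF ij(2)] J_carrier[OF ij'(1)] J_carrier[OF ij'(2)]
    T_carrier[OF t] T_carrier[OF t']
  have jj: "t \<otimes> (j' \<otimes> inv j \<otimes> inv t) \<in> J" by (rule T_norm'(1)) simp_all
  have "s \<otimes> (inv i' \<otimes> i) \<otimes> inv s = inv (s \<otimes> i' \<otimes> inv s) \<otimes> p \<otimes> inv j \<otimes> inv t"
    unfolding p by (simp add: gs)
  also have "\<dots> = (t' \<otimes> inv t) \<otimes> (t \<otimes> (j' \<otimes> inv j \<otimes> inv t))"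
    unfolding p' by (simp add: gs)
  finally have eq: "s \<otimes> (inv i' \<otimes> i) \<otimes> inv s = (t' \<otimes> inv t) \<otimes> (t \<otimes> (j' \<otimes> inv j \<otimes> inv t))" .
  have "t' \<otimes> inv t \<in> J" by (rule s_conj_J[OF _ _ jj eq]) simp_all
  then have "inv t \<otimes> (t' \<otimes> inv t \<otimes> t) \<in> J" by (intro T_norm'(2)) simp_all
  then show ?thesis by (simp add: D_eq_iff gs)
qed

lemma in_s_unique:
  assumes "in_s t p" "in_s t' p"
  shows "act t = act t'"
proof -
  obtain j where j [simp]: "j \<in> J" and p: "p = s \<otimes> t \<otimes> j" and t [simp]: "t \<in> T"
    using assms(1) by (auto simp: in_s_def)
  obtain j' where j' [simp]: "j' \<in> J" and p': "p = s \<otimes> t' \<otimes> j'" and t' [simp]: "t' \<in> T"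
    using assms(2) by (auto simp: in_s_def)
  note [simp] = J_carrier[OF j] J_carrier[OF j'] T_carrier[OF t] T_carrier[OF t']
  have "inv t \<otimes> t' = inv t \<otimes> inv s \<otimes> (s \<otimes> t' \<otimes> j') \<otimes> inv j'" by (simp add: gs)
  also have "\<dots> = j \<otimes> inv j'" unfolding p'[symmetric] p by (simp add: gs)
  finally have "inv t \<otimes> t' \<in> J" by simp
  then show ?thesis by (intro act_cong norm_T) simp_all
qed

text \<open>An element of both cells would produce an element of \<open>J s J\<close> in the
  torus.\<close>

lemma in_s_opp:
  assumes "in_s t p" "in_opp t' p"
  shows False
proof -
  obtain j where j [simp]: "j \<in> J" and p: "p = s \<otimes> t \<otimes> j" and t [simp]: "t \<in> T"
    using assms(1) by (auto simp: in_s_def)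
  obtain i' j' where ij' [simp]: "i' \<in> J" "j' \<in> J" and p': "p = s \<otimes> i' \<otimes> inv s \<otimes> t' \<otimes> j'" and t' [simp]: "t' \<in> T"
    using assms(2) by (auto simp: in_opp_def)
  note [simp] = J_carrier[OF j] J_carrier[OF ij'(1)] J_carrier[OF ij'(2)] T_carrier[OF t] T_carrier[OF t']
  have "t' \<otimes> (j' \<otimes> inv j \<otimes> inv t') \<in> J" by (rule T_norm'(1)) simp_all
  then have jj: "inv (t' \<otimes> (j' \<otimes> inv j \<otimes> inv t')) \<in> J" by simp
  have "t \<otimes> inv t' = inv s \<otimes> p \<otimes> inv j \<otimes> inv t'" unfolding p by (simp add: gs)
  also have "\<dots> = i' \<otimes> inv s \<otimes> (t' \<otimes> (j' \<otimes> inv j \<otimes> inv t'))" unfolding p' by (simp add: gs)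
  finally have "inv (t \<otimes> inv t') = inv (t' \<otimes> (j' \<otimes> inv j \<otimes> inv t')) \<otimes> s \<otimes> inv i'" by (simp add: gs)
  moreover have "inv (t \<otimes> inv t') \<in> T" by simp
  ultimately show False using disjoint[OF jj, of "inv i'"] by simp
qed

lemma ret_opp: "in_opp t p \<Longrightarrow> ret p = D t"
  unfolding ret_def using in_opp_unique[OF someI[of "\<lambda>t. in_opp t p" t]] by metis

lemma ret_s:
  assumes "in_s t p"
  shows "ret p = act t rs"
proof -
  have "\<nexists>t. in_opp t p" using in_s_opp[OF assms] by blast
  moreover have "act (SOME t. in_s t p) = act t"
    by (rule in_s_unique[OF someI[of "\<lambda>t. in_s t p", OF assms] assms])
  ultimately show ?thesis using assms unfolding ret_def by metis
qed

lemma Q_in: "p \<in> Q \<Longrightarrow> (\<exists>t. in_s t p) \<or> (\<exists>t. in_opp t p)"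
  using Q_cases[of p] unfolding in_s_def in_opp_def by blast

lemma in_s_J:
  assumes "in_s t p" and j [simp]: "j \<in> J"
  shows "in_s t (p \<otimes> j)"
proof -
  obtain j' where j' [simp]: "j' \<in> J" and p: "p = s \<otimes> t \<otimes> j'" and t [simp]: "t \<in> T"
    using assms(1) by (auto simp: in_s_def)
  have "p \<otimes> j = s \<otimes> t \<otimes> (j' \<otimes> j)" by (simp add: p m_assoc)
  then show ?thesis unfolding in_s_def using t J.m_closed[OF j' j] by blast
qed

lemma in_s_T:
  assumes "in_s t p" and t' [simp]: "t' \<in> T"
  shows "in_s (t \<otimes> t') (p \<otimes> t')"
proof -
  obtain j where j [simp]: "j \<in> J" and p: "p = s \<otimes> t \<otimes> j" and t [simp]: "t \<in> T"
    using assms(1) by (auto simp: in_s_def)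
  have "p \<otimes> t' = s \<otimes> (t \<otimes> t') \<otimes> (inv t' \<otimes> (j \<otimes> t'))" by (simp add: p gs)
  then show ?thesis unfolding in_s_def using T.m_closed[OF t t'] T_norm'(2)[OF t' j] by blast
qed

lemma in_s_left:
  assumes "in_s t p" and i [simp]: "i \<in> J"
  shows "in_s t (s \<otimes> i \<otimes> inv s \<otimes> p)"
proof -
  obtain j where j [simp]: "j \<in> J" and p: "p = s \<otimes> t \<otimes> j" and t [simp]: "t \<in> T"
    using assms(1) by (auto simp: in_s_def)
  have "s \<otimes> i \<otimes> inv s \<otimes> p = s \<otimes> t \<otimes> ((inv t \<otimes> (i \<otimes> t)) \<otimes> j)" by (simp add: p gs)
  then show ?thesis unfolding in_s_def using t J.m_closed[OF T_norm'(2)[OF t i] j] by blast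
qed

lemma in_oppE:
  assumes "in_opp t p"
  obtains i j where "i \<in> J" "j \<in> J" "t \<in> T" "p = s \<otimes> i \<otimes> inv s \<otimes> t \<otimes> j"
  using assms unfolding in_opp_def by blast

lemma in_opp_J:
  assumes "in_opp t p" and j [simp]: "j \<in> J"
  shows "in_opp t (p \<otimes> j)"
  using assms(1)
proof (rule in_oppE)
  fix i j' assume h [simp]: "i \<in> J" "j' \<in> J" "t \<in> T" and p: "p = s \<otimes> i \<otimes> inv s \<otimes> t \<otimes> j'"
  have "p \<otimes> j = s \<otimes> i \<otimes> inv s \<otimes> t \<otimes> (j' \<otimes> j)" by (simp add: p m_assoc)
  then show ?thesis unfolding in_opp_def using h J.m_closed[OF h(2) j] by blast
qed

lemma in_opp_T:
  assumes "in_opp t p" and t' [simp]: "t' \<in> T"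
  shows "in_opp (t \<otimes> t') (p \<otimes> t')"
  using assms(1)
proof (rule in_oppE)
  fix i j assume h [simp]: "i \<in> J" "j \<in> J" "t \<in> T" and p: "p = s \<otimes> i \<otimes> inv s \<otimes> t \<otimes> j"
  have "p \<otimes> t' = s \<otimes> i \<otimes> inv s \<otimes> (t \<otimes> t') \<otimes> (inv t' \<otimes> (j \<otimes> t'))" by (simp add: p gs)
  then show ?thesis unfolding in_opp_def using h T.m_closed[OF h(3) t'] T_norm'(2)[OF t' h(2)] by blast
qed

lemma in_opp_left:
  assumes "in_opp t p" and i [simp]: "i \<in> J"
  shows "in_opp t (s \<otimes> i \<otimes> inv s \<otimes> p)"
  using assms(1)
proof (rule in_oppE)
  fix i' j assume h [simp]: "i' \<in> J" "j \<in> J" "t \<in> T" and p: "p = s \<otimes> i' \<otimes> inv s \<otimes> t \<otimes> j"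
  have "s \<otimes> i \<otimes> inv s \<otimes> p = s \<otimes> (i \<otimes> i') \<otimes> inv s \<otimes> t \<otimes> j" by (simp add: p gs)
  then show ?thesis unfolding in_opp_def using h J.m_closed[OF i h(1)] by blast
qed

definition regular :: "'m \<Rightarrow> bool" where
  "regular p \<longleftrightarrow> p \<in> carrier M \<and> ((\<exists>t. in_s t p) \<or> (\<exists>t. in_opp t p))"

lemma regular_cases:
  assumes "regular p"
  obtains t where "in_s t p" "t \<in> T" | t where "in_opp t p" "t \<in> T"
  using assms unfolding regular_def in_s_def in_opp_def by blast

lemma Q_regular: "p \<in> Q \<Longrightarrow> regular p"
  using Q_in subgroup.mem_carrier[OF Q_subgroup] by (simp add: regular_def)

lemma ret_fixed: "ret p \<in> P.fixed I"
proof -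
  consider t where "in_opp t p" | t where "in_s t p" | "\<nexists>t. in_opp t p" "\<nexists>t. in_s t p" by blast
  then show ?thesis
  proof cases
    case 1
    then have "t \<in> T" by (simp add: in_opp_def)
    then have "D t \<in> P.fixed I" by (intro norm_D norm_T)
    then show ?thesis using 1 by (simp only: ret_opp)
  next
    case 2
    then have "t \<in> T" by (simp add: in_s_def)
    then have "act t rs \<in> P.fixed I" by (intro P.H_fixed[OF act_H P.I_subset rs_fixed] norm_T)
    then show ?thesis using 2 by (simp only: ret_s)
  next
    case 3
    then show ?thesis by (simp add: ret_def P.fixed_closed)
  qed
qed

lemma ret_V: "ret p \<in> P.V"
  using ret_fixed[of p] by (simp add: P.fixed_iff)

lemma ret_J:
  assumes p: "p \<in> carrier M" and j: "j \<in> J"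
  shows "ret (p \<otimes> j) = ret p"
proof -
  have pj: "p \<otimes> j \<otimes> inv j = p" using p j by (simp add: m_assoc)
  have 1: "in_opp t (p \<otimes> j) \<longleftrightarrow> in_opp t p" for t
    using in_opp_J[of t p j] in_opp_J[of t "p \<otimes> j" "inv j"] j unfolding pj by auto
  have 2: "in_s t (p \<otimes> j) \<longleftrightarrow> in_s t p" for t
    using in_s_J[of t p j] in_s_J[of t "p \<otimes> j" "inv j"] j unfolding pj by auto
  show ?thesis unfolding ret_def 1 2 ..
qed

lemma regular_T:
  assumes "regular p" and t: "t \<in> T"
  shows "regular (p \<otimes> t)" and "ret (p \<otimes> t) = act t (ret p)"
proof -
  have p: "p \<in> carrier M" using assms(1) by (simp add: regular_def)
  from assms(1) have "regular (p \<otimes> t) \<and> ret (p \<otimes> t) = act t (ret p)"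
  proof (cases rule: regular_cases)
    case (1 t')
    then show ?thesis
      using in_s_T[OF 1(1) t] t p
      by (auto simp: ret_s regular_def act_act norm_T rs_V)
  next
    case (2 t')
    then show ?thesis
      using in_opp_T[OF 2(1) t] t p by (auto simp: ret_opp regular_def act_D norm_T)
  qed
  then show "regular (p \<otimes> t)" "ret (p \<otimes> t) = act t (ret p)" by auto
qed

lemma ret_left:
  assumes "regular p" and i: "i \<in> J"
  shows "ret (s \<otimes> i \<otimes> inv s \<otimes> p) = ret p"
  using assms(1) by (cases rule: regular_cases)
    (simp_all add: ret_s[OF in_s_left[OF _ i]] ret_s ret_opp[OF in_opp_left[OF _ i]] ret_opp)

lemma ret_T:
  assumes t: "t \<in> T"
  shows "ret t = D t"
proof (rule ret_opp)
  have "t = s \<otimes> \<one> \<otimes> inv s \<otimes> t \<otimes> \<one>" using t by simp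
  then show "in_opp t t" unfolding in_opp_def using t J.one_closed by blast
qed

lemma ret_us: "u \<in> R - {\<one>} \<Longrightarrow> regular (u \<otimes> s) \<and> ret (u \<otimes> s) = D (\<tau> u)"
  using tau[of u] ret_opp[of "\<tau> u" "u \<otimes> s"] by (auto simp: in_opp_def regular_def)

lemma ret_s_one: "regular s \<and> ret s = rs"
proof -
  have "s = s \<otimes> \<one> \<otimes> \<one>" by simp
  then have "in_s \<one> s" unfolding in_s_def using T.one_closed J.one_closed by blast
  moreover have "act \<one> rs = rs" by (rule act_J[OF J.one_closed rs_V norm_T[OF T.one_closed]])
  ultimately show ?thesis unfolding regular_def using ret_s s_carrier by metis
qed

lemma regular_us: "u \<in> R \<Longrightarrow> regular (u \<otimes> s)"
  using ret_us[of u] ret_s_one by (cases "u = \<one>") auto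

text \<open>The relation at the base edge, for the sake of which \<open>rs\<close> was
  chosen.\<close>

lemma ret_sum: "(\<Sum>u\<in>R. ret (u \<otimes> s)) = S"
proof -
  have "(\<Sum>u\<in>R. ret (u \<otimes> s)) = ret (\<one> \<otimes> s) + (\<Sum>u\<in>R - {\<one>}. ret (u \<otimes> s))"
    by (rule sum.remove[OF R_finite R_one])
  also have "(\<Sum>u\<in>R - {\<one>}. ret (u \<otimes> s)) = (\<Sum>u\<in>R - {\<one>}. D (\<tau> u))"
    by (rule sum.cong) (use ret_us in auto)
  also have "ret (\<one> \<otimes> s) = rs" using ret_s_one by simp
  finally show ?thesis by (simp only: rs_def diff_add_cancel)
qed

lemma Ts_one: "Ts (D \<one>) = S"
  by (simp add: Ts_def hk_D_one S_fixed)

lemma D_rinv_T: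
  assumes t: "t \<in> T" and g: "g \<in> carrier M" and j: "j \<in> J"
  shows "D (g \<otimes> j \<otimes> t) = D (g \<otimes> t)"
  using act_D[OF norm_T[OF t], of "g \<otimes> j"] act_D[OF norm_T[OF t], of g] D_J[OF g j] g j by simp

text \<open>The quadratic relation for \<open>Ts\<close>, evaluated at the base edge. The terms with
  \<open>u' = \<one>\<close> give card \<open>R\<close> copies of \<open>D (s \<otimes> s)\<close>,
  hence zero in \<open>k\<close>; each remaining \<open>u'\<close> contributes a torus translate of
  \<open>S\<close>.\<close>

lemma Ts_S: "Ts S = (\<Sum>u\<in>R - {\<one>}. act (\<tau> u) S)"
proof -
  have "Ts S = (\<Sum>u\<in>R. \<Sum>u'\<in>R. D (u \<otimes> s \<otimes> (u' \<otimes> s)))"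
    by (simp add: S_def P.H_sum[OF Ts_H] Ts_D)
  also have "\<dots> = (\<Sum>u'\<in>R. \<Sum>u\<in>R. D (u \<otimes> s \<otimes> (u' \<otimes> s)))"
    by (rule sum.swap)
  also have "\<dots> = (\<Sum>u\<in>R. D (u \<otimes> s \<otimes> (\<one> \<otimes> s))) + (\<Sum>u'\<in>R - {\<one>}. \<Sum>u\<in>R. D (u \<otimes> s \<otimes> (u' \<otimes> s)))"
    by (rule sum.remove[OF R_finite R_one])
  also have "(\<Sum>u\<in>R. D (u \<otimes> s \<otimes> (\<one> \<otimes> s))) = (\<Sum>u\<in>R. D (s \<otimes> s))"
  proof (rule sum.cong[OF refl])
    fix u assume u: "u \<in> R"
    have "u \<otimes> s \<otimes> (\<one> \<otimes> s) = (s \<otimes> s) \<otimes> (inv (s \<otimes> s) \<otimes> (u \<otimes> (s \<otimes> s)))" using u by (simp add: gs)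
    then show "D (u \<otimes> s \<otimes> (\<one> \<otimes> s)) = D (s \<otimes> s)"
      using D_J[of "s \<otimes> s" "inv (s \<otimes> s) \<otimes> (u \<otimes> (s \<otimes> s))"] T_norm'(2)[OF s_square R_J[OF u]] by simp
  qed
  also have "\<dots> = 0" by (simp add: sum_const_scl R_card del: sum_constant)
  also have "(\<Sum>u'\<in>R - {\<one>}. \<Sum>u\<in>R. D (u \<otimes> s \<otimes> (u' \<otimes> s))) = (\<Sum>u\<in>R - {\<one>}. act (\<tau> u) S)"
  proof (rule sum.cong[OF refl])
    fix u' assume u': "u' \<in> R - {\<one>}"
    then obtain i j where ij: "i \<in> J" "j \<in> J" and eq: "u' \<otimes> s = s \<otimes> i \<otimes> inv s \<otimes> \<tau> u' \<otimes> j"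
      using tau(2) by blast
    have t: "\<tau> u' \<in> T" using tau(1)[OF u'] .
    \<comment> \<open>Moving \<open>i\<close> to the left of \<open>s\<close> conjugates it by
      \<open>s \<otimes> s\<close>, an element of \<open>T\<close>, so it stays in
      \<open>J\<close>.\<close>
    define i' where "i' = (s \<otimes> s) \<otimes> (i \<otimes> inv (s \<otimes> s))"
    have i': "i' \<in> J" unfolding i'_def by (rule T_norm'(1)[OF s_square ij(1)])
    note [simp] = J_carrier[OF ij(1)] J_carrier[OF ij(2)] T_carrier[OF t] J_carrier[OF i']
    have "D (u \<otimes> s \<otimes> (u' \<otimes> s)) = D (\<one> \<otimes> (u \<otimes> i' \<otimes> s) \<otimes> \<tau> u')" if u: "u \<in> R" for u
    proof -
      have "u \<otimes> s \<otimes> (u' \<otimes> s) = u \<otimes> (i' \<otimes> s \<otimes> \<tau> u') \<otimes> j"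
        unfolding eq i'_def using u by (simp add: gs)
      also have "D \<dots> = D (u \<otimes> (i' \<otimes> s \<otimes> \<tau> u'))" by (rule D_J) (use u ij in simp_all)
      finally show ?thesis using u by (simp add: m_assoc)
    qed
    then have "(\<Sum>u\<in>R. D (u \<otimes> s \<otimes> (u' \<otimes> s))) = (\<Sum>u\<in>R. D (\<one> \<otimes> (u \<otimes> i' \<otimes> s) \<otimes> \<tau> u'))"
      by (rule sum.cong[OF refl])
    also have "\<dots> = (\<Sum>u\<in>R. D (\<one> \<otimes> (u \<otimes> s) \<otimes> \<tau> u'))"
      by (rule sum_right[where f = "\<lambda>x. D (x \<otimes> \<tau> u')"]) (simp_all add: D_rinv_T t i')
    also have "\<dots> = act (\<tau> u') S"
      by (simp add: S_def P.H_sum[OF act_H] norm_T t act_D)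
    finally show "(\<Sum>u\<in>R. D (u \<otimes> s \<otimes> (u' \<otimes> s))) = act (\<tau> u') S" .
  qed
  finally show ?thesis by simp
qed

text \<open>Passing \<open>Ts\<close> through \<open>act (\<tau> u)\<close> conjugates the torus
  part by \<open>s\<close>, which merely permutes the terms by \<open>\<kappa>\<close>; the sum
  cancels against the quadratic relation. This is the condition that \<open>ret\<close> has to
  satisfy at the fixed point of the opposite group.\<close>

lemma Ts_rs: "Ts rs = 0"
proof -
  have V: "S \<in> P.V" using S_fixed by (simp add: P.fixed_iff)
  have V2: "(\<Sum>u\<in>R - {\<one>}. D (\<tau> u)) \<in> P.V" by (rule P.V_sum) (simp add: tau)
  have "Ts (\<Sum>u\<in>R - {\<one>}. D (\<tau> u)) = (\<Sum>u\<in>R - {\<one>}. Ts (D (\<tau> u)))"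
    by (rule P.H_sum[OF Ts_H]) (simp add: tau)
  also have "\<dots> = (\<Sum>u\<in>R - {\<one>}. act (\<tau> (\<kappa> u)) S)"
  proof (rule sum.cong[OF refl])
    fix u assume u: "u \<in> R - {\<one>}"
    then have k: "\<kappa> u \<in> R - {\<one>}" using kappa(1) by (auto simp: bij_betw_def)
    have "Ts (D (\<tau> u)) = Ts (act (\<tau> u) (D \<one>))" using tau(1)[OF u] by (simp add: act_D norm_T)
    also have "\<dots> = act (ts (\<tau> u)) S" using tau(1)[OF u] by (simp add: Ts_act Ts_one)
    also have "act (ts (\<tau> u)) = act (\<tau> (\<kappa> u))"
      by (rule act_cong) (use kappa(2)[OF u] tau(1)[OF u] tau(1)[OF k] in \<open>simp_all add: norm_T ts_def s_T\<close>)
    finally show "Ts (D (\<tau> u)) = act (\<tau> (\<kappa> u)) S" .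
  qed
  also have "\<dots> = (\<Sum>u\<in>R - {\<one>}. act (\<tau> u) S)"
    by (rule sum.reindex_bij_betw[OF kappa(1)])
  finally show ?thesis
    using V V2 by (simp add: rs_def P.H_diff[OF Ts_H] Ts_S)
qed

text \<open>At the fixed point all neighbours lie in the open cell with the same torus part, so the
  sum is a multiple of card \<open>R\<close> and vanishes, as the left side does by
  \<open>Ts_rs\<close>. In the open cell the relation is a translate of the one at the base edge,
  since \<open>ret\<close> does not see \<open>s J (inv s)\<close>.\<close>

lemma ret_neighbours:
  assumes p: "regular p"
  shows "Ts (ret p) = (\<Sum>u\<in>R. ret (p \<otimes> (u \<otimes> s)))"
  using p
proof (cases rule: regular_cases)
  case (1 t)
  then obtain j where j [simp]: "j \<in> J" and pe: "p = s \<otimes> t \<otimes> j" and t [simp]: "t \<in> T"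
    by (auto simp: in_s_def)
  have "(\<Sum>u\<in>R. ret (s \<otimes> t \<otimes> j \<otimes> (u \<otimes> s))) = (\<Sum>u\<in>R. ret (s \<otimes> t \<otimes> (u \<otimes> s)))"
    by (rule sum_left) (simp_all add: ret_J)
  also have "\<dots> = (\<Sum>u\<in>R. ret (s \<otimes> (u \<otimes> s) \<otimes> ts t))"
    by (rule sum_T) (simp_all add: ret_J)
  also have "\<dots> = (\<Sum>u\<in>R. D (s \<otimes> s \<otimes> ts t))"
  proof (rule sum.cong[OF refl])
    fix u assume u: "u \<in> R"
    have "s \<otimes> (u \<otimes> s) \<otimes> ts t = s \<otimes> u \<otimes> inv s \<otimes> (s \<otimes> s \<otimes> ts t) \<otimes> \<one>"
      using u by (simp add: gs)
    moreover have "s \<otimes> s \<otimes> ts t \<in> T" using s_square by simp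
    ultimately have "in_opp (s \<otimes> s \<otimes> ts t) (s \<otimes> (u \<otimes> s) \<otimes> ts t)"
      unfolding in_opp_def using R_J[OF u] J.one_closed by blast
    then show "ret (s \<otimes> (u \<otimes> s) \<otimes> ts t) = D (s \<otimes> s \<otimes> ts t)" by (rule ret_opp)
  qed
  also have "\<dots> = 0" by (simp add: sum_const_scl R_card del: sum_constant)
  also have "0 = Ts (ret p)"
    using 1 by (simp add: ret_s Ts_act rs_V Ts_rs P.H_zero act_H norm_T)
  finally show ?thesis unfolding pe by simp
next
  case (2 t)
  then obtain i j where ij [simp]: "i \<in> J" "j \<in> J" and pe: "p = s \<otimes> i \<otimes> inv s \<otimes> t \<otimes> j" and t [simp]: "t \<in> T"
    by (auto simp: in_opp_def)
  have "(\<Sum>u\<in>R. ret (s \<otimes> i \<otimes> inv s \<otimes> t \<otimes> j \<otimes> (u \<otimes> s))) = (\<Sum>u\<in>R. ret (s \<otimes> i \<otimes> inv s \<otimes> t \<otimes> (u \<otimes> s)))"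
    by (rule sum_left) (simp_all add: ret_J)
  also have "\<dots> = (\<Sum>u\<in>R. ret (s \<otimes> i \<otimes> inv s \<otimes> (u \<otimes> s) \<otimes> ts t))"
    by (rule sum_T) (simp_all add: ret_J)
  also have "\<dots> = (\<Sum>u\<in>R. act (ts t) (ret (u \<otimes> s)))"
  proof (rule sum.cong[OF refl])
    fix u assume u: "u \<in> R"
    have "s \<otimes> i \<otimes> inv s \<otimes> (u \<otimes> s) \<otimes> ts t = s \<otimes> i \<otimes> inv s \<otimes> ((u \<otimes> s) \<otimes> ts t)"
      using u by (simp add: gs)
    then show "ret (s \<otimes> i \<otimes> inv s \<otimes> (u \<otimes> s) \<otimes> ts t) = act (ts t) (ret (u \<otimes> s))"
      using ret_left[OF regular_T(1)[OF regular_us[OF u], of "ts t"] ij(1)]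
        regular_T(2)[OF regular_us[OF u], of "ts t"] by simp
  qed
  also have "\<dots> = act (ts t) S"
    by (simp add: P.H_sum[OF act_H, symmetric] norm_T ret_V ret_sum)
  also have "\<dots> = Ts (act t (D \<one>))" by (simp add: Ts_act Ts_one)
  also have "\<dots> = Ts (ret p)" using 2 by (simp add: ret_opp act_D norm_T)
  finally show ?thesis unfolding pe by simp
qed

text \<open>Small elements keep an edge up to the torus; big ones move it to another edge at the
  same vertex.\<close>

definition small :: "'m \<Rightarrow> bool" where "small p \<longleftrightarrow> (\<exists>t\<in>T. \<exists>j\<in>J. p = t \<otimes> j)"

definition big :: "'m \<Rightarrow> bool" where "big p \<longleftrightarrow> (\<exists>i\<in>J. \<exists>t\<in>T. \<exists>j\<in>J. p = i \<otimes> s \<otimes> t \<otimes> j)"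

lemma big_us: "i \<in> J \<Longrightarrow> big (i \<otimes> s)"
  unfolding big_def by (rule bexI[of _ i], rule bexI[of _ \<one>], rule bexI[of _ \<one>]) simp_all

text \<open>The Bruhat decomposition relative to \<open>J\<close> results from the one relative to
  the opposite group on multiplying by \<open>s\<close>.\<close>

lemma Q_small_big:
  assumes p: "p \<in> Q"
  shows "small p \<or> big p"
proof -
  have pc [simp]: "p \<in> carrier M" using p subgroup.mem_carrier[OF Q_subgroup] by simp
  have "inv s \<otimes> p \<in> Q" using p s_Q Q_subgroup by (simp add: subgroup.m_closed subgroup.m_inv_closed)
  then consider t j where "t \<in> T" "j \<in> J" "inv s \<otimes> p = s \<otimes> t \<otimes> j"
    | i t j where "i \<in> J" "t \<in> T" "j \<in> J" "inv s \<otimes> p = s \<otimes> i \<otimes> inv s \<otimes> t \<otimes> j"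
    using Q_cases by blast
  then show ?thesis
  proof cases
    case (1 t j)
    have "p = s \<otimes> (inv s \<otimes> p)" by simp
    also have "\<dots> = (s \<otimes> s \<otimes> t) \<otimes> j" using 1 by (simp add: gs)
    finally have "p = (s \<otimes> s \<otimes> t) \<otimes> j" .
    moreover have "s \<otimes> s \<otimes> t \<in> T" using s_square 1 by simp
    ultimately show ?thesis using 1(2) by (auto simp: small_def)
  next
    case (2 i t j)
    have "p = s \<otimes> (inv s \<otimes> p)" by simp
    also have "\<dots> = ((s \<otimes> s) \<otimes> (i \<otimes> inv (s \<otimes> s))) \<otimes> s \<otimes> t \<otimes> j" unfolding 2(4) using 2(1-3) by (simp add: gs)
    finally show ?thesis using T_norm'(1)[OF s_square 2(1)] 2(2,3) unfolding big_def by blast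
  qed
qed

lemma small_Q:
  assumes "small p"
  shows "p \<in> Q"
proof -
  obtain t j where "t \<in> T" "j \<in> J" and p: "p = t \<otimes> j"
    using assms by (auto simp: small_def)
  then have "t \<in> Q" "j \<in> Q" using J_Q T_Q by blast+
  then show ?thesis unfolding p by (intro subgroup.m_closed[OF Q_subgroup])
qed

lemma big_Q:
  assumes "big p"
  shows "p \<in> Q"
proof -
  obtain i t j where "i \<in> J" "t \<in> T" "j \<in> J" and p: "p = i \<otimes> s \<otimes> t \<otimes> j"
    using assms by (auto simp: big_def)
  then have "i \<in> Q" "t \<in> Q" "j \<in> Q" using J_Q T_Q by blast+
  then show ?thesis unfolding p using s_Q by (intro subgroup.m_closed[OF Q_subgroup])
qed

lemma big_inv:
  assumes "big p"
  shows "big (inv p)"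
proof -
  obtain i t j where h [simp]: "i \<in> J" "t \<in> T" "j \<in> J" and p: "p = i \<otimes> s \<otimes> t \<otimes> j"
    using assms by (auto simp: big_def)
  note [simp] = J_carrier[OF h(1)] J_carrier[OF h(3)] T_carrier[OF h(2)]
  define t' where "t' = ts (inv t \<otimes> inv (s \<otimes> s))"
  have t': "t' \<in> T" unfolding t'_def using s_square by simp
  have "inv p = inv j \<otimes> s \<otimes> t' \<otimes> inv i" by (simp add: p t'_def ts_def gs)
  moreover have "inv j \<in> J" "inv i \<in> J" by simp_all
  ultimately show ?thesis using t' unfolding big_def by blast
qed

lemma big_small:
  assumes "big p" "small q"
  shows "big (p \<otimes> q)"
proof -
  obtain i t j where h [simp]: "i \<in> J" "t \<in> T" "j \<in> J" and p: "p = i \<otimes> s \<otimes> t \<otimes> j"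
    using assms(1) by (auto simp: big_def)
  obtain t' j' where h' [simp]: "t' \<in> T" "j' \<in> J" and q: "q = t' \<otimes> j'"
    using assms(2) by (auto simp: small_def)
  note [simp] = J_carrier[OF h(1)] J_carrier[OF h(3)] T_carrier[OF h(2)] J_carrier[OF h'(2)] T_carrier[OF h'(1)]
  have "p \<otimes> q = i \<otimes> s \<otimes> (t \<otimes> t') \<otimes> (inv t' \<otimes> (j \<otimes> t') \<otimes> j')" by (simp add: p q gs)
  moreover have "inv t' \<otimes> (j \<otimes> t') \<otimes> j' \<in> J" using T_norm'(2)[OF h'(1) h(3)] by simp
  ultimately show ?thesis using h(1) T.m_closed[OF h(2) h'(1)] unfolding big_def by blast
qed

lemma small_inv:
  assumes "small p"
  shows "small (inv p)"
proof -
  obtain t j where h [simp]: "t \<in> T" "j \<in> J" and p: "p = t \<otimes> j"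
    using assms by (auto simp: small_def)
  note [simp] = J_carrier[OF h(2)] T_carrier[OF h(1)]
  have "inv p = inv t \<otimes> (t \<otimes> (inv j \<otimes> inv t))" by (simp add: p gs)
  moreover have "t \<otimes> (inv j \<otimes> inv t) \<in> J" by (rule T_norm'(1)) simp_all
  ultimately show ?thesis using T.m_inv_closed[OF h(1)] unfolding small_def by blast
qed

text \<open>Moving \<open>q\<close> past \<open>u s\<close> leaves its torus part conjugated by
  \<open>s\<close>; uniqueness for the cosets \<open>u s J\<close> forces that part into
  \<open>J\<close>.\<close>

lemma small_mult_us:
  assumes q: "small q" and u: "u \<in> R" "u' \<in> R" and j: "j \<in> J" and eq: "q \<otimes> (u \<otimes> s) = u' \<otimes> s \<otimes> j"
  shows "q \<in> J"
proof -
  obtain t k where h [simp]: "t \<in> T" "k \<in> J" and q: "q = t \<otimes> k"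
    using q by (auto simp: small_def)
  note [simp] = J_carrier[OF h(2)] T_carrier[OF h(1)] J_carrier[OF j] R_carrier[OF u(1)] R_carrier[OF u(2)]
  have "t \<otimes> (k \<otimes> u \<otimes> inv t) \<in> J" by (rule T_norm'(1)) (use u in simp_all)
  then obtain u2 l where u2: "u2 \<in> R" and l: "l \<in> J" and e2: "t \<otimes> (k \<otimes> u \<otimes> inv t) \<otimes> s = u2 \<otimes> s \<otimes> l"
    using R_ex by blast
  note [simp] = R_carrier[OF u2] J_carrier[OF l]
  have l': "inv (ts t) \<otimes> (l \<otimes> ts t) \<otimes> inv j \<in> J" using T_norm'(2)[of "ts t" l] l j by simp
  have "u' \<otimes> s = q \<otimes> (u \<otimes> s) \<otimes> inv j" unfolding eq by (simp add: gs)
  also have "\<dots> = (t \<otimes> (k \<otimes> u \<otimes> inv t) \<otimes> s) \<otimes> ts t \<otimes> inv j" by (simp add: q ts_def gs)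
  also have "\<dots> = u2 \<otimes> s \<otimes> ts t \<otimes> (inv (ts t) \<otimes> (l \<otimes> ts t) \<otimes> inv j)" unfolding e2 by (simp add: gs)
  finally have "ts t \<in> J" using R_unique[OF u(2) u2 _ l'] by simp
  then show ?thesis using s_TJ[OF h(1)] by (simp add: q ts_def)
qed

end

section \<open>Both types of vertices, and the components of the forest\<close>

text \<open>The two end vertices of an edge are indexed by \<open>bool\<close>; each has a rank one
  structure with the same \<open>J\<close> and \<open>T\<close>. \<open>M0\<close> contains both
  vertex groups, and \<open>M\<close> is the union of the translates \<open>M0 \<otimes> n\<close>
  with \<open>n\<close> in \<open>N\<close>. The elements of \<open>N\<close> normalize
  \<open>J\<close>, permute the two types by conjugation, and meet \<open>M0\<close> only inside the
  torus.\<close>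

locale hecke_forest = hecke_cover M G I F cl J
  for M :: "('m, 'c) monoid_scheme" (structure) and G :: "('g, 'b) monoid_scheme"
    and I :: "'g set" and F :: "'k::field itself" and cl :: "'m \<Rightarrow> 'g" and J :: "'m set" +
  fixes T :: "'m set" and Q :: "bool \<Rightarrow> 'm set" and s :: "bool \<Rightarrow> 'm" and R :: "bool \<Rightarrow> 'm set"
    and \<tau> \<kappa> :: "bool \<Rightarrow> 'm \<Rightarrow> 'm" and M0 N :: "'m set"
  assumes rank: "rank_one TYPE('k) M G I cl J T (Q b) (s b) (R b) (\<tau> b) (\<kappa> b)"
    and M0_subgroup: "subgroup M0 M" and Q_M0: "Q b \<subseteq> M0"
    and N_subgroup: "subgroup N M" and N_norm: "n \<in> N \<Longrightarrow> norm n"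
    and N_T: "n \<in> N \<Longrightarrow> t \<in> T \<Longrightarrow> n \<otimes> t \<otimes> inv n \<in> T"
    and N_M0: "n \<in> N \<Longrightarrow> n \<in> M0 \<Longrightarrow> n \<in> T"
    and N_ex: "g \<in> carrier M \<Longrightarrow> \<exists>n\<in>N. g \<otimes> inv n \<in> M0"
    and N_perm: "n \<in> N \<Longrightarrow> \<exists>b'. n \<otimes> s b \<otimes> inv n = s b' \<and> (\<lambda>u. n \<otimes> u \<otimes> inv n) ` R b = R b'"
begin

sublocale rk: rank_one M G I F cl J T "Q b" "s b" "R b" "\<tau> b" "\<kappa> b" for b
  by (rule rank)

sublocale T: subgroup T M by (rule rk.T_subgroup)
sublocale M0: subgroup M0 M by (rule M0_subgroup)
sublocale N: subgroup N M by (rule N_subgroup)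

lemma N_carrier: "n \<in> N \<Longrightarrow> n \<in> carrier M"
  by (rule N.mem_carrier)

lemma M0_carrier: "n \<in> M0 \<Longrightarrow> n \<in> carrier M"
  by (rule M0.mem_carrier)

lemma Q_carrier: "p \<in> Q b \<Longrightarrow> p \<in> carrier M"
  using Q_M0 M0_carrier by blast

lemmas [simp] = N_carrier N.m_closed N.m_inv_closed N.one_closed M0_carrier M0.m_closed M0.m_inv_closed
  Q_carrier

lemma J_M0: "j \<in> J \<Longrightarrow> j \<in> M0"
  using rk.J_Q Q_M0 by blast

lemma T_M0: "t \<in> T \<Longrightarrow> t \<in> M0"
  using rk.T_Q Q_M0 by blast

lemma us_Q: "u \<in> J \<Longrightarrow> u \<otimes> s b \<in> Q b"
  using rk.J_Q rk.s_Q subgroup.m_closed[OF rk.Q_subgroup] by blast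

lemma us_M0: "u \<in> J \<Longrightarrow> u \<otimes> s b \<in> M0"
  using us_Q Q_M0 by blast

end

section \<open>Orbit sums and the generation of the invariants\<close>

text \<open>
  A grading describes the orbits of \<open>B\<close> on the edges \<open>g J\<close> of a forest: \<open>S\<close> consists of the edges
  fixed by \<open>B\<close>, \<open>lev\<close> measures the distance from these, and \<open>rt b h\<close> says that among the edges at the
  vertex \<open>h Q b\<close> exactly those in \<open>h T J\<close> are closest to \<open>S\<close>, while \<open>B\<close> permutes the
  remaining ones transitively.
\<close>

locale hecke_graded = hecke_forest M G I F cl J T Q s R \<tau> \<kappa> M0 N
  for M :: "('m, 'c) monoid_scheme" (structure) and G :: "('g, 'b) monoid_scheme"
    and I :: "'g set" and F :: "'k::field itself" and cl :: "'m \<Rightarrow> 'g" and J :: "'m set"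
    and T :: "'m set" and Q :: "bool \<Rightarrow> 'm set" and s :: "bool \<Rightarrow> 'm" and R :: "bool \<Rightarrow> 'm set"
    and \<tau> \<kappa> :: "bool \<Rightarrow> 'm \<Rightarrow> 'm" and M0 N :: "'m set" +
  fixes B S :: "'m set" and lev :: "'m \<Rightarrow> nat" and rt :: "bool \<Rightarrow> 'm \<Rightarrow> bool"
  assumes B_subgroup: "subgroup B M"
    and S_subset: "S \<subseteq> carrier M"
    and S_mult: "g \<in> S \<Longrightarrow> x \<in> J \<union> T \<union> N \<Longrightarrow> g \<otimes> x \<in> S"
    and S_fix: "g \<in> S \<Longrightarrow> x \<in> B \<Longrightarrow> inv g \<otimes> x \<otimes> g \<in> J"
    and star: "g \<in> carrier M \<Longrightarrow> (\<forall>p\<in>Q b. g \<otimes> p \<in> S) \<or> (\<exists>p\<in>Q b. rt b (g \<otimes> p))"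
    and root_less: "h \<in> carrier M \<Longrightarrow> rt b h \<Longrightarrow> rk.big b p \<Longrightarrow> lev h < lev (h \<otimes> p) \<and> h \<otimes> p \<notin> S"
    and root_trans: "h \<in> carrier M \<Longrightarrow> rt b h \<Longrightarrow> i \<in> J \<Longrightarrow>
      \<exists>x\<in>B. \<exists>j\<in>J. \<exists>k\<in>J. x \<otimes> h = h \<otimes> k \<and> h \<otimes> (i \<otimes> s b) = x \<otimes> h \<otimes> s b \<otimes> j"
    and root_ex: "g \<in> carrier M \<Longrightarrow> g \<notin> S \<Longrightarrow> \<exists>b. \<exists>h\<in>carrier M. rt b h \<and> rk.big b (inv h \<otimes> g)"
    and root_unique: "h \<in> carrier M \<Longrightarrow> h' \<in> carrier M \<Longrightarrow> rt b h \<Longrightarrow> rt b' h' \<Longrightarrow> g \<in> carrier M \<Longrightarrow>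
      rk.big b (inv h \<otimes> g) \<Longrightarrow> rk.big b' (inv h' \<otimes> g) \<Longrightarrow> b = b'"
    and lev_B: "x \<in> B \<Longrightarrow> g \<in> carrier M \<Longrightarrow> lev (x \<otimes> g) = lev g"
begin

sublocale B: subgroup B M by (rule B_subgroup)

lemma B_carrier: "x \<in> B \<Longrightarrow> x \<in> carrier M"
  by (rule B.mem_carrier)

lemma S_carrier: "x \<in> S \<Longrightarrow> x \<in> carrier M"
  using S_subset by blast

lemmas [simp] = B_carrier B.m_closed B.m_inv_closed B.one_closed S_carrier

text \<open>The orbit is a set of characteristic functions, so that each coset counts once in a sum
  over it.\<close>

definition orb :: "'m \<Rightarrow> ('g, 'k) ind set" where
  "orb g = (\<lambda>x. D (x \<otimes> g)) ` B"

lemma orb_V: "g \<in> carrier M \<Longrightarrow> y \<in> orb g \<Longrightarrow> y \<in> P.V"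
  by (auto simp: orb_def)

lemma orb_S:
  assumes g: "g \<in> S"
  shows "orb g = {D g}"
proof -
  have "D (x \<otimes> g) = D g" if x: "x \<in> B" for x
  proof -
    have "inv (x \<otimes> g) \<otimes> g = inv g \<otimes> inv x \<otimes> g" using x g by (simp add: gs)
    then show ?thesis using S_fix[OF g, of "inv x"] x g by (simp add: D_eq_iff)
  qed
  then have "orb g = (\<lambda>x. D g) ` B" unfolding orb_def by (rule image_cong[OF refl])
  also have "\<dots> = {D g}" using image_constant[OF B.one_closed] .
  finally show ?thesis .
qed

text \<open>Two edges in the orbit of a root with a common successor share the vertex, hence differ
  by an element of \<open>Q b\<close>. A big one would raise \<open>lev\<close>, which is constant
  on the orbit; a small one lies in \<open>J\<close> by comparison of the successors. So distinct
  edges of the orbit have disjoint sets of successors.\<close>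

lemma root_J:
  assumes h: "h \<in> carrier M" "rt b h" and x: "x \<in> B" "x' \<in> B" and u: "u \<in> R b" "u' \<in> R b"
    and eq: "D (x \<otimes> h \<otimes> (u \<otimes> s b)) = D (x' \<otimes> h \<otimes> (u' \<otimes> s b))"
  shows "D (x \<otimes> h) = D (x' \<otimes> h)"
proof -
  define z where "z = inv x \<otimes> x'"
  have z: "z \<in> B" using x by (simp add: z_def)
  note [simp] = h(1) B_carrier[OF z] B_carrier[OF x(1)] B_carrier[OF x(2)]
    rk.R_carrier[OF u(1)] rk.R_carrier[OF u(2)]
  define j where "j = inv (x \<otimes> h \<otimes> (u \<otimes> s b)) \<otimes> (x' \<otimes> h \<otimes> (u' \<otimes> s b))"
  have j: "j \<in> J" using eq by (simp add: D_eq_iff j_def)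
  note [simp] = J_carrier[OF j]
  define p where "p = inv h \<otimes> (z \<otimes> h)"
  have pu: "p \<otimes> (u' \<otimes> s b) = u \<otimes> s b \<otimes> j" by (simp add: p_def z_def j_def gs)
  have pc [simp]: "p \<in> carrier M" by (simp add: p_def)
  have "p = (u \<otimes> s b \<otimes> j) \<otimes> inv (u' \<otimes> s b)" unfolding pu[symmetric] by (simp add: gs)
  moreover have "(u \<otimes> s b) \<otimes> j \<in> Q b"
    using us_Q[OF rk.R_J[OF u(1)]] j rk.J_Q subgroup.m_closed[OF rk.Q_subgroup] by blast
  ultimately have pQ: "p \<in> Q b"
    using us_Q[OF rk.R_J[OF u(2)]] subgroup.m_closed[OF rk.Q_subgroup] subgroup.m_inv_closed[OF rk.Q_subgroup]
    by metis
  have "\<not> rk.big b p"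
  proof
    assume "rk.big b p"
    then have "lev h < lev (h \<otimes> p)" using root_less h by blast
    also have "h \<otimes> p = z \<otimes> h" by (simp add: p_def)
    finally show False using lev_B[OF z, of h] by simp
  qed
  then have "rk.small p" using rk.Q_small_big[OF pQ] by blast
  then have "p \<in> J" by (rule rk.small_mult_us[OF _ u(2,1) j pu])
  moreover have "inv (x \<otimes> h) \<otimes> (x' \<otimes> h) = p" by (simp add: p_def z_def gs)
  ultimately show ?thesis by (simp add: D_eq_iff)
qed

text \<open>A subspace containing the edges of \<open>S\<close> and stable under the neighbour sums
  and the torus. Quantifying over such subspaces replaces the module generated by these edges and
  serves as an induction principle.\<close>

definition hyper :: "('g, 'k) ind set \<Rightarrow> bool" where
  "hyper W \<longleftrightarrow> W \<subseteq> P.V \<and> 0 \<in> W \<and> (\<forall>x\<in>W. \<forall>y\<in>W. x + y \<in> W) \<and> (\<forall>c. \<forall>x\<in>W. scl c x \<in> W) \<and>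
     (\<forall>b. \<forall>x\<in>W. rk.Ts b x \<in> W) \<and> (\<forall>t\<in>T. \<forall>x\<in>W. act t x \<in> W) \<and> (\<forall>g\<in>S. D g \<in> W)"

text \<open>The successors of the edges in the orbit of \<open>h\<close> form, after translation by
  \<open>t\<close>, the orbit of \<open>g\<close>: \<open>B\<close> permutes the successors of one
  edge transitively, and those of different edges are disjoint. Hence the orbit sum of
  \<open>g\<close> comes from that of \<open>h\<close> by \<open>Ts\<close> and
  \<open>act t\<close>.\<close>

lemma orb_step:
  assumes h: "h \<in> carrier M" "rt b h" and ijt: "i \<in> J" "t \<in> T" "j \<in> J"
    and g: "g = h \<otimes> (i \<otimes> s b \<otimes> t \<otimes> j)" and fin: "finite (orb h)"
  shows "finite (orb g) \<and> (\<Sum>y\<in>orb g. y) = act t (rk.Ts b (\<Sum>y\<in>orb h. y))"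
proof -
  note [simp] = h(1) J_carrier[OF ijt(1)] J_carrier[OF ijt(3)] rk.T_carrier[OF ijt(2)]
  have nt: "norm t" by (rule rk.norm_T[OF ijt(2)])
  \<comment> \<open>The successors of \<open>y\<close>, read off from one chosen \<open>x\<close>
    with \<open>y = D (x \<otimes> h)\<close>.\<close>
  define E where "E y = (let x = SOME x. x \<in> B \<and> y = D (x \<otimes> h) in (\<lambda>u. D (x \<otimes> h \<otimes> (u \<otimes> s b))) ` R b)" for y
  have E: "\<exists>x\<in>B. y = D (x \<otimes> h) \<and> E y = (\<lambda>u. D (x \<otimes> h \<otimes> (u \<otimes> s b))) ` R b" if "y \<in> orb h" for y
  proof -
    have "\<exists>x. x \<in> B \<and> y = D (x \<otimes> h)" using that by (auto simp: orb_def)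
    from someI_ex[OF this] show ?thesis unfolding E_def Let_def by blast
  qed
  have E_sum: "rk.Ts b y = \<Sum>(E y) \<and> finite (E y) \<and> E y \<subseteq> P.V" if y: "y \<in> orb h" for y
  proof -
    obtain x where x: "x \<in> B" "y = D (x \<otimes> h)" and Ey: "E y = (\<lambda>u. D (x \<otimes> h \<otimes> (u \<otimes> s b))) ` R b"
      using E[OF y] by blast
    note [simp] = B_carrier[OF x(1)]
    have inj: "inj_on (\<lambda>u. D (x \<otimes> h \<otimes> (u \<otimes> s b))) (R b)"
    proof (rule inj_onI)
      fix u u' assume u: "u \<in> R b" "u' \<in> R b" and eq: "D (x \<otimes> h \<otimes> (u \<otimes> s b)) = D (x \<otimes> h \<otimes> (u' \<otimes> s b))"
      note [simp] = rk.R_carrier[OF u(1)] rk.R_carrier[OF u(2)]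
      define k where "k = inv (u' \<otimes> s b) \<otimes> (u \<otimes> s b)"
      have "inv (x \<otimes> h \<otimes> (u' \<otimes> s b)) \<otimes> (x \<otimes> h \<otimes> (u \<otimes> s b)) = k" by (simp add: k_def gs)
      then have k: "k \<in> J" using eq[symmetric] by (simp add: D_eq_iff)
      have "u \<otimes> s b = u' \<otimes> s b \<otimes> \<one> \<otimes> k" by (simp add: k_def gs)
      then show "u = u'" using rk.R_unique[OF u rk.T.one_closed k] by simp
    qed
    have "rk.Ts b y = (\<Sum>u\<in>R b. D (x \<otimes> h \<otimes> (u \<otimes> s b)))" by (simp add: x(2) rk.Ts_D)
    also have "\<dots> = \<Sum>(E y)" unfolding Ey by (simp add: sum.reindex[OF inj])
    finally show ?thesis using Ey rk.R_finite by auto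
  qed
  have disj: "E y \<inter> E y' = {}" if y: "y \<in> orb h" "y' \<in> orb h" "y \<noteq> y'" for y y'
  proof (rule ccontr)
    assume "E y \<inter> E y' \<noteq> {}"
    then obtain e where e: "e \<in> E y" "e \<in> E y'" by blast
    obtain x where x: "x \<in> B" "y = D (x \<otimes> h)" "E y = (\<lambda>u. D (x \<otimes> h \<otimes> (u \<otimes> s b))) ` R b" using E[OF y(1)] by blast
    obtain x' where x': "x' \<in> B" "y' = D (x' \<otimes> h)" "E y' = (\<lambda>u. D (x' \<otimes> h \<otimes> (u \<otimes> s b))) ` R b" using E[OF y(2)] by blast
    obtain u where u: "u \<in> R b" "e = D (x \<otimes> h \<otimes> (u \<otimes> s b))" using e(1) x(3) by blast
    obtain u' where u': "u' \<in> R b" "e = D (x' \<otimes> h \<otimes> (u' \<otimes> s b))" using e(2) x'(3) by blast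
    have "D (x \<otimes> h) = D (x' \<otimes> h)" using root_J[OF h x(1) x'(1) u(1) u'(1)] u(2) u'(2) by simp
    then show False using y(3) x(2) x'(2) by simp
  qed
  \<comment> \<open>Transitivity at the root, translated by \<open>x\<close> and carried past the
    torus element \<open>t\<close>.\<close>
  have move: "\<exists>x'\<in>B. D (x \<otimes> h \<otimes> (k \<otimes> s b)) = D (x' \<otimes> (h \<otimes> s b)) \<and>
      D (x \<otimes> h \<otimes> (k \<otimes> s b \<otimes> t \<otimes> j')) = D (x' \<otimes> (h \<otimes> s b \<otimes> t))"
    if x: "x \<in> B" and k: "k \<in> J" and j': "j' \<in> J" for x k j'
  proof -
    obtain x1 l where x1: "x1 \<in> B" and l: "l \<in> J" and eq: "h \<otimes> (k \<otimes> s b) = x1 \<otimes> h \<otimes> s b \<otimes> l"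
      using root_trans[OF h k] by blast
    note [simp] = B_carrier[OF x] B_carrier[OF x1] J_carrier[OF k] J_carrier[OF l] J_carrier[OF j']
    have 1: "x \<otimes> h \<otimes> (k \<otimes> s b) = x \<otimes> x1 \<otimes> (h \<otimes> s b) \<otimes> l"
      using arg_cong[OF eq, of "\<lambda>y. x \<otimes> y"] by (simp add: gs)
    have "x \<otimes> h \<otimes> (k \<otimes> s b \<otimes> t \<otimes> j') = x \<otimes> h \<otimes> (k \<otimes> s b) \<otimes> t \<otimes> j'" by (simp add: gs)
    also have "\<dots> = x \<otimes> x1 \<otimes> (h \<otimes> s b \<otimes> t) \<otimes> (inv t \<otimes> (l \<otimes> t) \<otimes> j')"
      unfolding 1 by (simp add: gs)
    finally have 2: "x \<otimes> h \<otimes> (k \<otimes> s b \<otimes> t \<otimes> j') = x \<otimes> x1 \<otimes> (h \<otimes> s b \<otimes> t) \<otimes> (inv t \<otimes> (l \<otimes> t) \<otimes> j')" .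
    have "inv t \<otimes> (l \<otimes> t) \<otimes> j' \<in> J" using rk.T_norm'(2)[OF ijt(2) l] j' by simp
    then show ?thesis unfolding 1 2 using x x1 l by (intro bexI[of _ "x \<otimes> x1"]) (simp_all add: D_J)
  qed
  have U: "(\<Union>y\<in>orb h. E y) = (\<lambda>x. D (x \<otimes> (h \<otimes> s b))) ` B"
  proof
    show "(\<Union>y\<in>orb h. E y) \<subseteq> (\<lambda>x. D (x \<otimes> (h \<otimes> s b))) ` B"
    proof
      fix e assume "e \<in> (\<Union>y\<in>orb h. E y)"
      then obtain x u where "x \<in> B" "u \<in> R b" "e = D (x \<otimes> h \<otimes> (u \<otimes> s b))" using E by blast
      then show "e \<in> (\<lambda>x. D (x \<otimes> (h \<otimes> s b))) ` B" using move[of x u \<one>] rk.R_J[of u b] J.one_closed by blast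
    qed
    show "(\<lambda>x. D (x \<otimes> (h \<otimes> s b))) ` B \<subseteq> (\<Union>y\<in>orb h. E y)"
    proof
      fix e assume "e \<in> (\<lambda>x. D (x \<otimes> (h \<otimes> s b))) ` B"
      then obtain x where x: "x \<in> B" "e = D (x \<otimes> (h \<otimes> s b))" by blast
      note [simp] = B_carrier[OF x(1)]
      have y: "D (x \<otimes> h) \<in> orb h" using x by (auto simp: orb_def)
      obtain x' where x': "x' \<in> B" "D (x \<otimes> h) = D (x' \<otimes> h)" and Ey: "E (D (x \<otimes> h)) = (\<lambda>u. D (x' \<otimes> h \<otimes> (u \<otimes> s b))) ` R b"
        using E[OF y] by blast
      note [simp] = B_carrier[OF x'(1)]
      define k where "k = inv (x' \<otimes> h) \<otimes> (x \<otimes> h)"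
      have k: "k \<in> J" using x'(2)[symmetric] by (simp add: D_eq_iff k_def)
      obtain u l where u: "u \<in> R b" and l: "l \<in> J" and eq: "k \<otimes> s b = u \<otimes> s b \<otimes> l" using rk.R_ex[OF k] by blast
      note [simp] = J_carrier[OF k] J_carrier[OF l] rk.R_carrier[OF u]
      have "x \<otimes> (h \<otimes> s b) = x' \<otimes> h \<otimes> (k \<otimes> s b)" by (simp add: k_def gs)
      also have "\<dots> = x' \<otimes> h \<otimes> (u \<otimes> s b) \<otimes> l" unfolding eq by (simp add: gs)
      finally have "e = D (x' \<otimes> h \<otimes> (u \<otimes> s b))" using x(2) l by (simp add: D_J)
      then have "e \<in> E (D (x \<otimes> h))" unfolding Ey using u by blast
      then show "e \<in> (\<Union>y\<in>orb h. E y)" using y by blast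
    qed
  qed
  have og: "orb g = act t ` (\<Union>y\<in>orb h. E y)"
  proof -
    have "orb g = (\<lambda>x. D (x \<otimes> (h \<otimes> s b \<otimes> t))) ` B"
    proof
      show "orb g \<subseteq> (\<lambda>x. D (x \<otimes> (h \<otimes> s b \<otimes> t))) ` B"
      proof
        fix e assume "e \<in> orb g"
        then obtain x where x: "x \<in> B" "e = D (x \<otimes> h \<otimes> (i \<otimes> s b \<otimes> t \<otimes> j))" by (auto simp: orb_def g gs)
        then show "e \<in> (\<lambda>x. D (x \<otimes> (h \<otimes> s b \<otimes> t))) ` B" using move[OF x(1) ijt(1,3)] by auto
      qed
      show "(\<lambda>x. D (x \<otimes> (h \<otimes> s b \<otimes> t))) ` B \<subseteq> orb g"
      proof
        fix e assume "e \<in> (\<lambda>x. D (x \<otimes> (h \<otimes> s b \<otimes> t))) ` B"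
        then obtain x where x: "x \<in> B" "e = D (x \<otimes> (h \<otimes> s b \<otimes> t))" by blast
        obtain x1 l where x1: "x1 \<in> B" and l: "l \<in> J" and eq: "h \<otimes> (i \<otimes> s b) = x1 \<otimes> h \<otimes> s b \<otimes> l"
          using root_trans[OF h ijt(1)] by blast
        note [simp] = B_carrier[OF x(1)] B_carrier[OF x1] J_carrier[OF l]
        have "x \<otimes> inv x1 \<otimes> g = x \<otimes> inv x1 \<otimes> (h \<otimes> (i \<otimes> s b)) \<otimes> t \<otimes> j" by (simp add: g gs)
        also have "\<dots> = x \<otimes> (h \<otimes> s b \<otimes> t) \<otimes> (inv t \<otimes> (l \<otimes> t) \<otimes> j)" unfolding eq by (simp add: gs)
        also have "D \<dots> = e" using x rk.T_norm'(2)[OF ijt(2) l] ijt(3) by (simp add: D_J)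
        finally show "e \<in> orb g" unfolding orb_def using x x1 by (metis (no_types, lifting) B.m_closed B.m_inv_closed imageI)
      qed
    qed
    also have "\<dots> = (\<lambda>x. act t (D (x \<otimes> (h \<otimes> s b)))) ` B"
      by (rule image_cong[OF refl]) (simp add: act_D nt m_assoc)
    finally show ?thesis unfolding U by (simp add: image_image)
  qed
  have inj: "inj_on (act t) (\<Union>y\<in>orb h. E y)"
  proof (rule inj_onI)
    fix e e' assume "e \<in> (\<Union>y\<in>orb h. E y)" "e' \<in> (\<Union>y\<in>orb h. E y)" and eq: "act t e = act t e'"
    then have V: "e \<in> P.V" "e' \<in> P.V" using E_sum by blast+
    have nt': "norm (inv t)" using ijt(2) by (intro rk.norm_T) simp
    have "act (inv t) (act t y) = y" if "y \<in> P.V" for y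
      using that act_act[OF nt nt' that] act_J[OF J.one_closed that norm_of_J[OF J.one_closed]] by simp
    then show "e = e'" using V eq by metis
  qed
  have EV: "(\<Union>y\<in>orb h. E y) \<subseteq> P.V" using E_sum by blast
  have fU: "finite (\<Union>y\<in>orb h. E y)" using fin E_sum by blast
  have "(\<Sum>y\<in>orb g. y) = (\<Sum>e\<in>(\<Union>y\<in>orb h. E y). act t e)"
    unfolding og by (simp add: sum.reindex[OF inj])
  also have "\<dots> = act t (\<Sum>e\<in>(\<Union>y\<in>orb h. E y). e)"
    by (rule P.H_sum[OF act_H[OF nt], symmetric]) (use EV in blast)
  also have "(\<Sum>e\<in>(\<Union>y\<in>orb h. E y). e) = (\<Sum>y\<in>orb h. \<Sum>e\<in>E y. e)"
    by (rule sum.UNION_disjoint[OF fin]) (use E_sum disj in blast)+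
  also have "\<dots> = (\<Sum>y\<in>orb h. rk.Ts b y)"
    by (rule sum.cong[OF refl]) (use E_sum in simp)
  also have "\<dots> = rk.Ts b (\<Sum>y\<in>orb h. y)"
    by (rule P.H_sum[OF rk.Ts_H, symmetric]) (use orb_V[OF h(1)] in blast)
  finally show ?thesis using fU og by simp
qed

text \<open>Induction on \<open>lev\<close>: an edge outside \<open>S\<close> is a successor of a
  root edge of smaller level.\<close>

lemma orb_hyper:
  assumes W: "hyper W" and g: "g \<in> carrier M"
  shows "finite (orb g) \<and> (\<Sum>y\<in>orb g. y) \<in> W"
  using g
proof (induction "lev g" arbitrary: g rule: less_induct)
  case less
  show ?case
  proof (cases "g \<in> S")
    case True
    then show ?thesis using W by (simp add: orb_S hyper_def)
  next
    case False
    then obtain b h where h: "h \<in> carrier M" "rt b h" and big: "rk.big b (inv h \<otimes> g)"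
      using root_ex less.prems by blast
    then obtain i t j where ijt: "i \<in> J" "t \<in> T" "j \<in> J" and e: "inv h \<otimes> g = i \<otimes> s b \<otimes> t \<otimes> j"
      by (auto simp: rk.big_def)
    have g: "g = h \<otimes> (i \<otimes> s b \<otimes> t \<otimes> j)" using h less.prems by (simp flip: e)
    have "lev h < lev g" using root_less[OF h big] h(1) less.prems by simp
    then have IH: "finite (orb h)" "(\<Sum>y\<in>orb h. y) \<in> W" using less.hyps h(1) by blast+
    show ?thesis using orb_step[OF h ijt g IH(1)] IH(2) W ijt(2) unfolding hyper_def by metis
  qed
qed

lemma tr_orb:
  assumes g: "g \<in> carrier M" and x: "x \<in> B"
  shows "P.tr (cl x) (\<Sum>y\<in>orb g. y) = (\<Sum>y\<in>orb g. y)"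
proof -
  note [simp] = B_carrier[OF x] g
  have bij: "bij_betw (P.tr (cl x)) (orb g) (orb g)"
  proof (rule bij_betw_byWitness[where f' = "P.tr (cl (inv x))"])
    show "\<forall>a\<in>orb g. P.tr (cl (inv x)) (P.tr (cl x) a) = a"
      "\<forall>a\<in>orb g. P.tr (cl x) (P.tr (cl (inv x)) a) = a"
      by (auto simp: orb_def simp del: cl_inv)
    show "P.tr (cl x) ` orb g \<subseteq> orb g" "P.tr (cl (inv x)) ` orb g \<subseteq> orb g"
      using x by (auto simp: orb_def m_assoc[symmetric] simp del: cl_inv)
  qed
  show ?thesis using sum.reindex_bij_betw[OF bij, of "\<lambda>y. y"] by (simp add: P.tr_sum)
qed

text \<open>An invariant function is constant on orbits, so a multiple of the orbit sum through a
  point of its support can be split off, and the support shrinks. Thus neighbour sums and the torus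
  produce all \<open>B\<close>-invariants from the edges of \<open>S\<close>.\<close>

lemma fixed_in_hyper:
  assumes W: "hyper W" and y: "y \<in> P.fixed (cl ` B)"
  shows "y \<in> W"
  using y
proof (induction "card {c. y c \<noteq> 0}" arbitrary: y rule: less_induct)
  case less
  show ?case
  proof (cases "y = 0")
    case True
    then show ?thesis using W by (simp add: hyper_def)
  next
    case False
    have V: "y \<in> P.V" and fx: "\<And>x. x \<in> B \<Longrightarrow> P.tr (cl x) y = y"
      using less.prems by (auto simp: fixed_IffD)
    obtain c where c: "y c \<noteq> 0" using False by (auto simp: fun_eq_iff zero_fun_apply)
    then have "c \<in> lcosets\<^bsub>G\<^esub> I" using V by (simp add: P.V_iff)
    then obtain a where a: "a \<in> carrier G" "c = a <#\<^bsub>G\<^esub> I" by (rule P.lcos_cases)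
    then obtain g where g: "g \<in> carrier M" and cg: "c = cl g <#\<^bsub>G\<^esub> I" using cl_surj by (metis imageE)
    define Os where "Os = (\<Sum>z\<in>orb g. z)"
    have fin: "finite (orb g)" and OW: "Os \<in> W" using orb_hyper[OF W g] by (auto simp: Os_def)
    have OV: "Os \<in> P.V" using OW W by (auto simp: hyper_def)
    have const: "y d = y c" if d: "dl \<in> orb g" "dl d \<noteq> 0" for d dl
    proof -
      obtain x where x: "x \<in> B" "dl = D (x \<otimes> g)" using d(1) by (auto simp: orb_def)
      have dx: "d = cl (x \<otimes> g) <#\<^bsub>G\<^esub> I" using d(2) x(2) by (auto simp: D_def P.dl_def split: if_splits)
      have "y d = P.tr (cl x) y d" using fx[OF x(1)] by simp
      also have "\<dots> = y c" using x(1) g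
        by (simp add: translate_def dx cg P.lcos_mem P.lcos_act P.m_assoc[symmetric])
      finally show ?thesis .
    qed
    have O_supp: "y d \<noteq> 0" if d: "Os d \<noteq> 0" for d
    proof -
      have "\<exists>z\<in>orb g. z d \<noteq> 0"
      proof (rule ccontr)
        assume "\<not> ?thesis"
        then have "(\<Sum>z\<in>orb g. z d) = 0" by (intro sum.neutral) blast
        then show False using d by (simp add: Os_def fun_sum_apply)
      qed
      then show ?thesis using const c by metis
    qed
    have Oc: "Os c = 1"
    proof -
      have "Os c = (\<Sum>z\<in>orb g. if z = D g then 1 else 0)"
        unfolding Os_def fun_sum_apply
      proof (rule sum.cong[OF refl])
        fix z assume "z \<in> orb g"
        then obtain x where x: "x \<in> B" "z = D (x \<otimes> g)" by (auto simp: orb_def)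
        have "z c = (if c = cl (x \<otimes> g) <#\<^bsub>G\<^esub> I then 1 else 0)" by (simp add: x(2) D_def P.dl_def)
        also have "c = cl (x \<otimes> g) <#\<^bsub>G\<^esub> I \<longleftrightarrow> D (x \<otimes> g) = D g"
          unfolding cg using x(1) g
          by (metis B_carrier D_def P.dl_eq_iff P.lcos_eq_iff cl_closed m_closed)
        finally show "z c = (if z = D g then 1 else 0)" by (simp add: x(2))
      qed
      also have "\<dots> = 1"
      proof -
        have "D (\<one> \<otimes> g) \<in> orb g" unfolding orb_def by (rule imageI) simp
        then show ?thesis using g fin by simp
      qed
      finally show ?thesis .
    qed
    define y' where "y' = y - scl (y c) Os"
    have y'F: "y' \<in> P.fixed (cl ` B)"
      unfolding fixed_IffD using V OV fx tr_orb[OF g]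
      by (simp add: y'_def P.tr_diff P.tr_scl Os_def)
    have "{d. y' d \<noteq> 0} \<subset> {d. y d \<noteq> 0}"
    proof
      show "{d. y' d \<noteq> 0} \<subseteq> {d. y d \<noteq> 0}" using O_supp by (auto simp: y'_def scl_def)
      have "y' c = 0" using Oc by (simp add: y'_def scl_def)
      then show "{d. y' d \<noteq> 0} \<noteq> {d. y d \<noteq> 0}" using c by blast
    qed
    then have "card {d. y' d \<noteq> 0} < card {d. y d \<noteq> 0}"
      using V by (intro psubset_card_mono) (simp_all add: P.V_iff)
    then have "y' \<in> W" using less.hyps y'F by blast
    then have "y' + scl (y c) Os \<in> W" using OW W by (simp add: hyper_def)
    then show ?thesis unfolding y'_def by (simp only: diff_add_cancel)
  qed
qed

end

section \<open>Extension of the projection from star to star\<close>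

context hecke_graded
begin

text \<open>A root among the edges at the vertex of type \<open>b\<close> of \<open>g\<close>. The
  choice depends on that vertex alone, which keeps the values of \<open>phi\<close> around it
  consistent.\<close>

definition star_root :: "bool \<Rightarrow> 'm \<Rightarrow> 'm" where
  "star_root b g = (SOME h. h \<in> carrier M \<and> inv g \<otimes> h \<in> Q b \<and> rt b h)"

lemma star_root:
  assumes "h \<in> carrier M" "inv g \<otimes> h \<in> Q b" "rt b h"
  shows "star_root b g \<in> carrier M" "inv g \<otimes> star_root b g \<in> Q b" "rt b (star_root b g)"
  using someI[of "\<lambda>h. h \<in> carrier M \<and> inv g \<otimes> h \<in> Q b \<and> rt b h" h] assms
  unfolding star_root_def by blast+

lemma Q_mult: "p \<in> Q b \<Longrightarrow> q \<in> Q b \<Longrightarrow> p \<otimes> q \<in> Q b"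
  and Q_inv: "p \<in> Q b \<Longrightarrow> inv p \<in> Q b"
  by (simp_all add: subgroup.m_closed[OF rk.Q_subgroup] subgroup.m_inv_closed[OF rk.Q_subgroup])

lemma Q_diff:
  assumes "g \<in> carrier M" "g' \<in> carrier M" "inv g \<otimes> g' \<in> Q b"
  shows "inv g' \<otimes> g \<in> Q b"
  using Q_inv[OF assms(3)] assms(1,2) by (simp add: gs)

lemma Q_trans:
  assumes "g \<in> carrier M" "g' \<in> carrier M" "h \<in> carrier M" "inv g \<otimes> g' \<in> Q b" "inv g' \<otimes> h \<in> Q b"
  shows "inv g \<otimes> h \<in> Q b"
  using Q_mult[OF assms(4,5)] assms(1-3) by (simp add: gs)

lemma star_root_eq:
  assumes "g \<in> carrier M" "g' \<in> carrier M" "inv g \<otimes> g' \<in> Q b"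
  shows "star_root b g' = star_root b g"
proof -
  have "inv g' \<otimes> h \<in> Q b \<longleftrightarrow> inv g \<otimes> h \<in> Q b" if "h \<in> carrier M" for h
    using Q_trans[of g g' h b] Q_trans[of g' g h b] Q_diff[of g g' b] assms that by blast
  then have "(\<lambda>h. h \<in> carrier M \<and> inv g' \<otimes> h \<in> Q b \<and> rt b h) = (\<lambda>h. h \<in> carrier M \<and> inv g \<otimes> h \<in> Q b \<and> rt b h)"
    by (intro ext) blast
  then show ?thesis unfolding star_root_def by simp
qed

text \<open>A big difference is big in both directions, so each root would have smaller level than
  the other.\<close>

lemma roots_small:
  assumes h: "h \<in> carrier M" "rt b h" and h': "h' \<in> carrier M" "rt b h'" and q: "inv h \<otimes> h' \<in> Q b"
  shows "rk.small (inv h \<otimes> h')"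
proof -
  have "\<not> rk.big b (inv h \<otimes> h')"
  proof
    assume big: "rk.big b (inv h \<otimes> h')"
    have "lev h < lev h'" using root_less[OF h big] h(1) h'(1) by simp
    moreover have "rk.big b (inv h' \<otimes> h)" using rk.big_inv[OF big] h(1) h'(1) by (simp add: gs)
    then have "lev h' < lev h" using root_less[OF h', of "inv h' \<otimes> h"] h(1) h'(1) by simp
    ultimately show False by simp
  qed
  then show ?thesis using rk.Q_small_big[OF q] by blast
qed

text \<open>Roots of one star differ by small elements, so \<open>g\<close> is big relative to the
  chosen root as soon as it is big relative to some root.\<close>

lemma star_root_big:
  assumes g: "g \<in> carrier M" and h: "h \<in> carrier M" "rt b h" and big: "rk.big b (inv h \<otimes> g)"
  shows "star_root b g \<in> carrier M \<and> rt b (star_root b g) \<and> rk.big b (inv (star_root b g) \<otimes> g) \<and>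
    lev (star_root b g) < lev g"
proof -
  have hg: "inv h \<otimes> g \<in> Q b" by (rule rk.big_Q[OF big])
  have gh: "inv g \<otimes> h \<in> Q b" by (rule Q_diff[OF h(1) g hg])
  define r where "r = star_root b g"
  note r = star_root[OF h(1) gh h(2), folded r_def]
  have hr: "inv h \<otimes> r \<in> Q b" by (rule Q_trans[OF h(1) g r(1) hg r(2)])
  have sm: "rk.small (inv (inv h \<otimes> r))" by (rule rk.small_inv[OF roots_small[OF h r(1,3) hr]])
  have "rk.big b (inv (inv g \<otimes> h \<otimes> (inv h \<otimes> r)))"
    using rk.big_inv[OF rk.big_small[OF rk.big_inv[OF big] roots_small[OF h r(1,3) hr]]] g h(1) r(1)
    by (simp add: gs)
  then have "rk.big b (inv r \<otimes> g)" using g h(1) r(1) by (simp add: gs)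
  then show ?thesis using r root_less[OF r(1,3), of "inv r \<otimes> g"] g unfolding r_def[symmetric] by simp
qed

text \<open>For an edge outside \<open>S\<close>, the type of the end that lies towards
  \<open>S\<close>.\<close>

definition par :: "'m \<Rightarrow> bool" where
  "par g = (SOME b. \<exists>h\<in>carrier M. rt b h \<and> rk.big b (inv h \<otimes> g))"

lemma par:
  assumes "g \<in> carrier M" "g \<notin> S"
  shows "\<exists>h\<in>carrier M. rt (par g) h \<and> rk.big (par g) (inv h \<otimes> g)"
  unfolding par_def by (rule someI_ex[OF root_ex[OF assms]])

lemma par_eq:
  assumes "g \<in> carrier M" "h \<in> carrier M" "rt b h" "rk.big b (inv h \<otimes> g)"
  shows "par g = b"
proof -
  have "g \<notin> S" using root_less[OF assms(2-4)] assms(1,2) by simp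
  then show ?thesis using par[OF assms(1)] root_unique assms by blast
qed

text \<open>Recursion on \<open>lev\<close>: the chosen root of the star at the inner end has
  smaller level than \<open>g\<close>.\<close>

lemma phi_exists:
  "\<exists>\<phi>. \<forall>g. \<phi> g = (if g \<in> carrier M \<and> g \<notin> S
      then P.hk (rk.ret (par g) (inv (star_root (par g) g) \<otimes> g)) (\<phi> (star_root (par g) g)) else D g)"
proof -
  define P where "P f g r \<longleftrightarrow> r = (if g \<in> carrier M \<and> g \<notin> S
      then P.hk (rk.ret (par g) (inv (star_root (par g) g) \<otimes> g)) (f (star_root (par g) g)) else D g)"
    for f :: "'m \<Rightarrow> ('g, 'k) ind" and g r
  have "\<exists>\<phi>. \<forall>g. P \<phi> g (\<phi> g)"
  proof (rule dependent_wf_choice[of "Wellfounded.measure lev"])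
    fix f f' :: "'m \<Rightarrow> ('g, 'k) ind" and g r assume eq: "\<And>z. (z, g) \<in> Wellfounded.measure lev \<Longrightarrow> f z = f' z"
    show "P f g r = P f' g r"
    proof (cases "g \<in> carrier M \<and> g \<notin> S")
      case True
      then obtain h where h: "h \<in> carrier M" "rt (par g) h" "rk.big (par g) (inv h \<otimes> g)" using par by blast
      have "lev (star_root (par g) g) < lev g" using star_root_big[OF _ h] True by blast
      then show ?thesis using eq[of "star_root (par g) g"] by (simp add: P_def)
    next
      case False
      then show ?thesis unfolding P_def by (simp only: if_False)
    qed
  qed (auto simp: P_def)
  then show ?thesis unfolding P_def .
qed

definition phi :: "'m \<Rightarrow> ('g, 'k) ind" where
  "phi = (SOME \<phi>. \<forall>g. \<phi> g = (if g \<in> carrier M \<and> g \<notin> S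
      then P.hk (rk.ret (par g) (inv (star_root (par g) g) \<otimes> g)) (\<phi> (star_root (par g) g)) else D g))"

lemma phi_eq:
  "phi g = (if g \<in> carrier M \<and> g \<notin> S
      then P.hk (rk.ret (par g) (inv (star_root (par g) g) \<otimes> g)) (phi (star_root (par g) g)) else D g)"
  using someI_ex[OF phi_exists, folded phi_def] by blast

lemma phi_S: "g \<in> S \<Longrightarrow> phi g = D g"
  by (subst phi_eq) simp

lemma phi_big:
  assumes "g \<in> carrier M" "h \<in> carrier M" "rt b h" "rk.big b (inv h \<otimes> g)"
  shows "phi g = P.hk (rk.ret b (inv (star_root b g) \<otimes> g)) (phi (star_root b g))"
proof -
  have "g \<notin> S" using root_less[OF assms(2-4)] assms(1,2) by simp
  then show ?thesis using assms(1) par_eq[OF assms] by (subst phi_eq) simp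
qed

text \<open>The edges of \<open>S\<close> are fixed by \<open>B\<close>, and the recursion applies
  Hecke operators, which preserve invariants.\<close>

lemma phi_fixed: "g \<in> carrier M \<Longrightarrow> phi g \<in> P.fixed (cl ` B)"
proof (induction "lev g" arbitrary: g rule: less_induct)
  case less
  show ?case
  proof (cases "g \<in> S")
    case True
    have "D (x \<otimes> g) = D g" if "x \<in> B" for x
    proof -
      have "D (x \<otimes> g) \<in> orb g" using that by (auto simp: orb_def)
      then show ?thesis by (simp add: orb_S[OF True])
    qed
    then have "P.tr (cl x) (D g) = D g" if "x \<in> B" for x using less.prems that by (subst tr_D) simp_all
    then show ?thesis unfolding fixed_IffD phi_S[OF True] using D_V[OF less.prems] by blast
  next
    case False
    then obtain h where h: "h \<in> carrier M" "rt (par g) h" "rk.big (par g) (inv h \<otimes> g)"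
      using par less.prems by blast
    note r = star_root_big[OF less.prems h]
    have ph: "phi (star_root (par g) g) \<in> P.fixed (cl ` B)" using less.hyps r by blast
    have clB: "cl ` B \<subseteq> carrier G" using cl_closed by auto
    have "P.hk (rk.ret (par g) (inv (star_root (par g) g) \<otimes> g)) (phi (star_root (par g) g)) \<in> P.fixed (cl ` B)"
      by (rule P.H_fixed[OF P.hk_H[OF rk.ret_fixed] clB ph])
    then show ?thesis using phi_big[OF less.prems h] by simp
  qed
qed

lemma phi_V: "g \<in> carrier M \<Longrightarrow> phi g \<in> P.V"
  using phi_fixed[of g] by (simp add: P.fixed_iff)

lemma hk_H: "y \<in> P.fixed I \<Longrightarrow> h \<in> carrier P.H \<Longrightarrow> x \<in> P.V \<Longrightarrow> P.hk (h y) x = h (P.hk y x)"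
  by (simp add: P.hk_smult P.H_mult_apply)

text \<open>A small factor does not change the star root, so it affects only the argument of
  \<open>ret\<close>, which is torus equivariant.\<close>

lemma small_act:
  assumes g: "g \<in> carrier M" and t: "t \<in> T" and j: "j \<in> J"
  shows "phi (g \<otimes> t \<otimes> j) = act t (phi g)"
proof -
  note [simp] = g rk.T_carrier[OF t] J_carrier[OF j]
  have nt: "norm t" by (rule rk.norm_T[OF t])
  have sm: "rk.small (t \<otimes> j)" using t j by (auto simp: rk.small_def)
  show ?thesis
  proof (cases "g \<in> S")
    case True
    then have "g \<otimes> t \<otimes> j \<in> S" using t j by (simp add: S_mult)
    then show ?thesis using True j by (simp add: phi_S act_D nt D_J)
  next
    case False
    then obtain h where h: "h \<in> carrier M" "rt (par g) h" and big: "rk.big (par g) (inv h \<otimes> g)"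
      using par g by blast
    let ?b = "par g" let ?r = "star_root ?b g" and ?g = "g \<otimes> t \<otimes> j"
    note r = star_root_big[OF g h big]
    have "inv h \<otimes> g \<otimes> (t \<otimes> j) = inv h \<otimes> ?g" using h(1) by (simp add: m_assoc)
    then have big': "rk.big ?b (inv h \<otimes> ?g)" using rk.big_small[OF big sm] by simp
    have "inv g \<otimes> ?g = t \<otimes> j" by (simp add: m_assoc)
    then have "star_root ?b ?g = ?r" by (intro star_root_eq) (simp_all add: rk.small_Q[OF sm])
    then have "phi ?g = P.hk (rk.ret ?b (inv ?r \<otimes> ?g)) (phi ?r)"
      using phi_big[OF _ h big'] by simp
    also have "inv ?r \<otimes> ?g = inv ?r \<otimes> g \<otimes> t \<otimes> j" using r by (simp add: m_assoc)
    also have "rk.ret ?b \<dots> = act t (rk.ret ?b (inv ?r \<otimes> g))"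
      using r j t by (simp add: rk.ret_J rk.regular_T(2) rk.Q_regular rk.big_Q)
    also have "P.hk \<dots> (phi ?r) = act t (P.hk (rk.ret ?b (inv ?r \<otimes> g)) (phi ?r))"
      by (rule hk_H) (use r in \<open>simp_all add: rk.ret_fixed act_H nt phi_V\<close>)
    also have "P.hk (rk.ret ?b (inv ?r \<otimes> g)) (phi ?r) = phi g" by (rule phi_big[OF g h big, symmetric])
    finally show ?thesis .
  qed
qed

lemma act_one: "x \<in> P.V \<Longrightarrow> act \<one> x = x"
  by (rule act_J) (simp_all add: norm_of_J)

lemma phi_J: "g \<in> carrier M \<Longrightarrow> j \<in> J \<Longrightarrow> phi (g \<otimes> j) = phi g"
  using small_act[of g \<one> j] by (simp add: act_one phi_V)

text \<open>The recursion formula holds also for the root edges of the star, where it reduces to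
  \<open>ret t = D t\<close>. So a single formula covers all edges at a vertex that has a
  root.\<close>

lemma phi_root:
  assumes g: "g \<in> carrier M" and h: "h \<in> carrier M" "rt b h" and q: "inv g \<otimes> h \<in> Q b"
  shows "phi g = P.hk (rk.ret b (inv (star_root b g) \<otimes> g)) (phi (star_root b g))"
proof -
  define r where "r = star_root b g"
  note r = star_root[OF h(1) q h(2), folded r_def]
  have rg: "inv r \<otimes> g \<in> Q b" by (rule Q_diff[OF g r(1,2)])
  show ?thesis
  proof (cases "rk.big b (inv r \<otimes> g)")
    case True
    then show ?thesis by (rule phi_big[OF g r(1,3)])
  next
    case False
    then obtain t j where t: "t \<in> T" and j: "j \<in> J" and e: "inv r \<otimes> g = t \<otimes> j"
      using rk.Q_small_big[OF rg] by (auto simp: rk.small_def)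
    have "g = r \<otimes> (inv r \<otimes> g)" using g r(1) by simp
    then have "g = r \<otimes> t \<otimes> j" unfolding e using r(1) t j by (simp add: m_assoc)
    then have "phi g = act t (phi r)" using small_act[OF r(1) t j] by simp
    also have "\<dots> = P.hk (rk.ret b (t \<otimes> j)) (phi r)"
      using t j by (simp add: rk.ret_J rk.ret_T act_def)
    finally show ?thesis unfolding r_def[symmetric] e .
  qed
qed

text \<open>At a vertex all of whose edges lie in \<open>S\<close>, the map \<open>phi\<close> is
  the identity. At any other vertex all values come from one root \<open>r\<close> by operators
  \<open>hk (ret p)\<close> applied to \<open>phi r\<close>, and the relation is that of
  \<open>ret_neighbours\<close>.\<close>

lemma phi_neighbours:
  assumes g: "g \<in> carrier M"
  shows "rk.Ts b (phi g) = (\<Sum>u\<in>R b. phi (g \<otimes> (u \<otimes> s b)))"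
  using star[OF g, of b]
proof
  assume S: "\<forall>p\<in>Q b. g \<otimes> p \<in> S"
  have "g \<otimes> \<one> \<in> S" using S subgroup.one_closed[OF rk.Q_subgroup] by blast
  then have "rk.Ts b (phi g) = (\<Sum>u\<in>R b. D (g \<otimes> (u \<otimes> s b)))"
    using g by (simp add: phi_S rk.Ts_D)
  also have "\<dots> = (\<Sum>u\<in>R b. phi (g \<otimes> (u \<otimes> s b)))"
    by (rule sum.cong[OF refl], rule phi_S[symmetric]) (use S us_Q rk.R_J in blast)
  finally show ?thesis .
next
  assume "\<exists>p\<in>Q b. rt b (g \<otimes> p)"
  then obtain p where p: "p \<in> Q b" "rt b (g \<otimes> p)" by blast
  define r where "r = star_root b g"
  have pc: "g \<otimes> p \<in> carrier M" "inv g \<otimes> (g \<otimes> p) \<in> Q b" using g p by simp_all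
  note r = star_root[OF pc p(2), folded r_def]
  have rg: "inv r \<otimes> g \<in> Q b" by (rule Q_diff[OF g r(1,2)])
  have "phi (g \<otimes> (u \<otimes> s b)) = P.hk (rk.ret b (inv r \<otimes> g \<otimes> (u \<otimes> s b))) (phi r)" if u: "u \<in> R b" for u
  proof -
    let ?g = "g \<otimes> (u \<otimes> s b)"
    have uc: "u \<otimes> s b \<in> Q b" using us_Q rk.R_J u by blast
    have gg: "?g \<in> carrier M" "inv g \<otimes> ?g \<in> Q b" using g uc by simp_all
    have sr: "star_root b ?g = r" unfolding r_def by (rule star_root_eq[OF g gg])
    have "inv ?g \<otimes> r \<in> Q b" by (rule Q_trans[OF gg(1) g r(1) Q_diff[OF g gg] r(2)])
    then have "phi ?g = P.hk (rk.ret b (inv r \<otimes> ?g)) (phi r)" using phi_root[OF gg(1) r(1,3)] sr by simp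
    then show ?thesis using g r(1) uc by (simp add: m_assoc)
  qed
  then have "(\<Sum>u\<in>R b. phi (g \<otimes> (u \<otimes> s b))) = (\<Sum>u\<in>R b. P.hk (rk.ret b (inv r \<otimes> g \<otimes> (u \<otimes> s b))) (phi r))"
    by (rule sum.cong[OF refl])
  also have "\<dots> = P.hk (\<Sum>u\<in>R b. rk.ret b (inv r \<otimes> g \<otimes> (u \<otimes> s b))) (phi r)"
  proof -
    \<comment> \<open>Additivity of \<open>hk\<close>; the empty sum is obtained from additivity as
      well, by cancelling.\<close>
    have "(\<Sum>u\<in>A. P.hk (a u) x) = P.hk (\<Sum>u\<in>A. a u) x" if "x \<in> P.V" "finite A" "\<And>u. a u \<in> P.fixed I" for x A and a :: "'m \<Rightarrow> ('g, 'k) ind"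
      using that(2)
    proof (induction A rule: finite_induct)
      case empty
      have eq: "P.hk 0 = P.hk 0 \<oplus>\<^bsub>P.H\<^esub> P.hk 0"
        using P.hk_add[OF P.fixed_closed(1) P.fixed_closed(1)] by simp
      have "P.hk 0 x = P.hk 0 x + P.hk 0 x"
        using fun_cong[OF eq, of x] P.H_add_apply[OF that(1)] by metis
      then have "P.hk 0 x = 0" by (simp only: add_cancel_right_right)
      then show ?case by simp
    next
      case (insert u A)
      have "(\<Sum>u\<in>insert u A. P.hk (a u) x) = P.hk (a u) x + (\<Sum>u\<in>A. P.hk (a u) x)"
        by (rule sum.insert[OF insert(1,2)])
      also have "\<dots> = P.hk (a u) x + P.hk (\<Sum>u\<in>A. a u) x" by (simp only: insert(3))
      also have "\<dots> = P.hk (a u + (\<Sum>u\<in>A. a u)) x"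
        by (simp only: P.hk_add[OF that(3) P.fixed_sum[OF that(3)]] P.H_add_apply[OF that(1)])
      also have "a u + (\<Sum>u\<in>A. a u) = (\<Sum>u\<in>insert u A. a u)"
        by (rule sum.insert[OF insert(1,2), symmetric])
      finally show ?case .
    qed
    from this[OF phi_V[OF r(1)] rk.R_finite rk.ret_fixed] show ?thesis .
  qed
  also have "\<dots> = P.hk (rk.Ts b (rk.ret b (inv r \<otimes> g))) (phi r)"
    by (simp only: rk.ret_neighbours[OF rk.Q_regular[OF rg]])
  also have "\<dots> = rk.Ts b (P.hk (rk.ret b (inv r \<otimes> g)) (phi r))"
    by (rule hk_H) (use r in \<open>simp_all add: rk.ret_fixed rk.Ts_H phi_V\<close>)
  also have "\<dots> = rk.Ts b (phi g)"
    using phi_root[OF g pc(1) p(2) pc(2)] by (simp only: r_def)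
  finally show ?thesis by simp
qed

definition comp :: "'m \<Rightarrow> 'm" where "comp g = (SOME n. n \<in> N \<and> g \<otimes> inv n \<in> M0)"

lemma comp: "g \<in> carrier M \<Longrightarrow> comp g \<in> N \<and> g \<otimes> inv (comp g) \<in> M0"
  unfolding comp_def by (rule someI_ex) (use N_ex in blast)

text \<open>The choices in \<open>star_root\<close> need not be compatible with \<open>N\<close>.
  Only the values of \<open>phi\<close> on \<open>M0\<close> are kept; transporting them to the
  translates of \<open>M0\<close> enforces compatibility.\<close>

definition phi' :: "'m \<Rightarrow> ('g, 'k) ind" where "phi' g = act (comp g) (phi (g \<otimes> inv (comp g)))"

text \<open>Two choices of \<open>n\<close> differ by an element of \<open>N\<close> inside
  \<open>M0\<close>, that is, of \<open>T\<close>, and \<open>phi\<close> is torus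
  equivariant.\<close>

lemma phi'_eq:
  assumes g: "g \<in> carrier M" and n: "n \<in> N" "g \<otimes> inv n \<in> M0"
  shows "phi' g = act n (phi (g \<otimes> inv n))"
proof -
  define m where "m = comp g"
  have m: "m \<in> N" "g \<otimes> inv m \<in> M0" using comp[OF g] by (auto simp: m_def)
  note [simp] = g N_carrier[OF n(1)] N_carrier[OF m(1)]
  have "inv (g \<otimes> inv m) \<otimes> (g \<otimes> inv n) \<in> M0" using m(2) n(2) by simp
  then have "m \<otimes> inv n \<in> M0" by (simp add: gs)
  then have t: "m \<otimes> inv n \<in> T" using N_M0 m(1) n(1) by simp
  have "phi (g \<otimes> inv n) = phi (g \<otimes> inv m \<otimes> (m \<otimes> inv n) \<otimes> \<one>)" by (simp add: m_assoc)
  also have "\<dots> = act (m \<otimes> inv n) (phi (g \<otimes> inv m))" by (rule small_act) (simp_all add: t)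
  finally have "act n (phi (g \<otimes> inv n)) = act (m \<otimes> inv n \<otimes> n) (phi (g \<otimes> inv m))"
    by (simp add: act_act[OF rk.norm_T[OF t] N_norm[OF n(1)]] phi_V)
  then show ?thesis by (simp add: phi'_def m_def[symmetric] m_assoc)
qed

lemma phi'_fixed: "g \<in> carrier M \<Longrightarrow> phi' g \<in> P.fixed (cl ` B)"
proof -
  assume g: "g \<in> carrier M"
  have "cl ` B \<subseteq> carrier G" using cl_closed by auto
  moreover have "g \<otimes> inv (comp g) \<in> carrier M" "norm (comp g)" using comp[OF g] g N_norm by simp_all
  ultimately show ?thesis unfolding phi'_def
    by (intro P.H_fixed[OF act_H _ phi_fixed])
qed

lemma phi'_V: "g \<in> carrier M \<Longrightarrow> phi' g \<in> P.V"
  using phi'_fixed[of g] by (simp add: P.fixed_iff)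

lemma phi'_S:
  assumes g: "g \<in> S"
  shows "phi' g = D g"
proof -
  have c: "comp g \<in> N" using comp g by simp
  then have "g \<otimes> inv (comp g) \<in> S" using g by (simp add: S_mult)
  then have "phi' g = D (g \<otimes> inv (comp g) \<otimes> comp g)" unfolding phi'_def
    using c g by (simp add: phi_S act_D N_norm)
  then show ?thesis using c g by (simp add: m_assoc)
qed

text \<open>Conjugation by \<open>n\<close> preserves \<open>T\<close> and \<open>J\<close>, so the
  behaviour of \<open>phi\<close> on \<open>M0\<close> is transported unchanged.\<close>

lemma phi'_TJ:
  assumes g: "g \<in> carrier M" and t: "t \<in> T" and j: "j \<in> J"
  shows "phi' (g \<otimes> t \<otimes> j) = act t (phi' g)"
proof -
  define n where "n = comp g"
  have n: "n \<in> N" "g \<otimes> inv n \<in> M0" using comp[OF g] by (auto simp: n_def)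
  note [simp] = g N_carrier[OF n(1)] J_carrier[OF j] rk.T_carrier[OF t]
  have t': "n \<otimes> t \<otimes> inv n \<in> T" using N_T n t by blast
  have j': "inv (inv n) \<otimes> (j \<otimes> inv n) \<in> J" by (rule norm_J[OF N_norm j]) (simp add: n)
  have e: "g \<otimes> t \<otimes> j \<otimes> inv n = g \<otimes> inv n \<otimes> (n \<otimes> t \<otimes> inv n) \<otimes> (inv (inv n) \<otimes> (j \<otimes> inv n))"
    by (simp add: gs)
  have "g \<otimes> t \<otimes> j \<otimes> inv n \<in> M0" unfolding e by (rule M0.m_closed[OF M0.m_closed[OF n(2) T_M0[OF t']] J_M0[OF j']])
  then have "phi' (g \<otimes> t \<otimes> j) = act n (phi (g \<otimes> t \<otimes> j \<otimes> inv n))" using n(1) by (intro phi'_eq) simp_all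
  also have "\<dots> = act n (act (n \<otimes> t \<otimes> inv n) (phi (g \<otimes> inv n)))"
    unfolding e by (subst small_act[OF _ t' j']) simp_all
  also have "\<dots> = act (n \<otimes> t \<otimes> inv n \<otimes> n) (phi (g \<otimes> inv n))"
    by (rule act_act) (simp_all add: rk.norm_T[OF t'] N_norm[OF n(1)] phi_V)
  also have "n \<otimes> t \<otimes> inv n \<otimes> n = n \<otimes> t" by (simp add: m_assoc)
  also have "act (n \<otimes> t) (phi (g \<otimes> inv n)) = act t (act n (phi (g \<otimes> inv n)))"
    by (rule act_act[symmetric]) (simp_all add: rk.norm_T[OF t] N_norm[OF n(1)] phi_V)
  also have "act n (phi (g \<otimes> inv n)) = phi' g" by (simp add: phi'_def n_def)
  finally show ?thesis .
qed

lemma phi'_N: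
  assumes g: "g \<in> carrier M" and m: "m \<in> N"
  shows "phi' (g \<otimes> m) = act m (phi' g)"
proof -
  define n where "n = comp g"
  have n: "n \<in> N" "g \<otimes> inv n \<in> M0" using comp[OF g] by (auto simp: n_def)
  note [simp] = g N_carrier[OF n(1)] N_carrier[OF m]
  have e: "g \<otimes> m \<otimes> inv (n \<otimes> m) = g \<otimes> inv n" by (simp add: gs)
  have "phi' (g \<otimes> m) = act (n \<otimes> m) (phi (g \<otimes> m \<otimes> inv (n \<otimes> m)))"
    by (rule phi'_eq) (use n m in \<open>simp_all add: e\<close>)
  also have "\<dots> = act m (act n (phi (g \<otimes> inv n)))"
    unfolding e by (rule act_act[symmetric]) (simp_all add: N_norm n m phi_V)
  finally show ?thesis by (simp add: phi'_def n_def)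
qed

lemma Ts_act_N:
  assumes n: "n \<in> N" and b': "n \<otimes> s b \<otimes> inv n = s b'" "(\<lambda>u. n \<otimes> u \<otimes> inv n) ` R b = R b'"
    and f: "\<And>g j. g \<in> carrier M \<Longrightarrow> j \<in> J \<Longrightarrow> f (g \<otimes> j) = f g" and g: "g \<in> carrier M"
  shows "(\<Sum>u\<in>R b. f (g \<otimes> (u \<otimes> s b) \<otimes> inv n)) = (\<Sum>u\<in>R b'. f (g \<otimes> inv n \<otimes> (u \<otimes> s b')))"
proof -
  note [simp] = g N_carrier[OF n]
  have inj: "inj_on (\<lambda>u. n \<otimes> u \<otimes> inv n) (R b)"
    by (rule inj_onI) (simp add: m_assoc)
  have "(\<Sum>u\<in>R b'. f (g \<otimes> inv n \<otimes> (u \<otimes> s b'))) = (\<Sum>u\<in>R b. f (g \<otimes> inv n \<otimes> (n \<otimes> u \<otimes> inv n \<otimes> s b')))"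
    unfolding b'(2)[symmetric] by (simp add: sum.reindex[OF inj])
  also have "\<dots> = (\<Sum>u\<in>R b. f (g \<otimes> (u \<otimes> s b) \<otimes> inv n))"
    unfolding b'(1)[symmetric] by (rule sum.cong[OF refl]) (simp add: gs)
  finally show ?thesis by simp
qed

text \<open>Conjugation by \<open>n\<close> turns the vertex type \<open>b\<close> into
  \<open>b'\<close> and exchanges the corresponding neighbour sums.\<close>

lemma Ts_act:
  assumes n: "n \<in> N" and b': "n \<otimes> s b \<otimes> inv n = s b'" "(\<lambda>u. n \<otimes> u \<otimes> inv n) ` R b = R b'"
    and x: "x \<in> P.V"
  shows "rk.Ts b (act n x) = act n (rk.Ts b' x)"
proof (rule klin_eqI_D[of "\<lambda>x. rk.Ts b (act n x)" "\<lambda>x. act n (rk.Ts b' x)", OF _ _ _ x])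
  fix g assume g: "g \<in> carrier M"
  note [simp] = g N_carrier[OF n]
  have nn: "norm n" using N_norm n by blast
  have "rk.Ts b (act n (D g)) = (\<Sum>u\<in>R b. D (g \<otimes> n \<otimes> (u \<otimes> s b)))"
    by (simp add: act_D nn rk.Ts_D)
  also have "\<dots> = (\<Sum>u\<in>R b. act n (D (g \<otimes> n \<otimes> (u \<otimes> s b) \<otimes> inv n)))"
    by (rule sum.cong[OF refl]) (simp add: act_D nn m_assoc)
  also have "\<dots> = (\<Sum>u\<in>R b'. act n (D (g \<otimes> n \<otimes> inv n \<otimes> (u \<otimes> s b'))))"
    by (rule Ts_act_N[OF n b', where f = "\<lambda>g. act n (D g)"]) (simp_all add: D_J)
  also have "\<dots> = act n (rk.Ts b' (D g))"
    by (simp add: m_assoc rk.Ts_D P.H_sum[OF act_H[OF nn]])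
  finally show "rk.Ts b (act n (D g)) = act n (rk.Ts b' (D g))" .
qed (simp_all add: klin_H_H rk.Ts_H act_H N_norm[OF n])

text \<open>Multiplied by \<open>inv n\<close> on the right, the neighbours of \<open>g\<close>
  become the neighbours of \<open>g \<otimes> inv n\<close> at a vertex of type \<open>b'\<close>,
  all of them inside \<open>M0\<close>.\<close>

lemma phi'_neighbours:
  assumes g: "g \<in> carrier M"
  shows "rk.Ts b (phi' g) = (\<Sum>u\<in>R b. phi' (g \<otimes> (u \<otimes> s b)))"
proof -
  define n where "n = comp g"
  have n: "n \<in> N" "g \<otimes> inv n \<in> M0" using comp[OF g] by (auto simp: n_def)
  note [simp] = g N_carrier[OF n(1)]
  have nn: "norm n" using N_norm n by blast
  obtain b' where b': "n \<otimes> s b \<otimes> inv n = s b'" "(\<lambda>u. n \<otimes> u \<otimes> inv n) ` R b = R b'" using N_perm[OF n(1)] by blast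
  have "rk.Ts b (phi' g) = act n (rk.Ts b' (phi (g \<otimes> inv n)))"
    unfolding phi'_def n_def[symmetric] by (rule Ts_act[OF n(1) b']) (simp add: phi_V)
  also have "\<dots> = (\<Sum>u\<in>R b'. act n (phi (g \<otimes> inv n \<otimes> (u \<otimes> s b'))))"
    by (simp add: phi_neighbours P.H_sum[OF act_H[OF nn]] phi_V)
  also have "\<dots> = (\<Sum>u\<in>R b. act n (phi (g \<otimes> (u \<otimes> s b) \<otimes> inv n)))"
    by (rule Ts_act_N[OF n(1) b', where f = "\<lambda>g. act n (phi g)", symmetric]) (simp_all add: phi_J)
  also have "\<dots> = (\<Sum>u\<in>R b. phi' (g \<otimes> (u \<otimes> s b)))"
  proof (rule sum.cong[OF refl])
    fix u assume u: "u \<in> R b"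
    note [simp] = rk.R_carrier[OF u]
    have "n \<otimes> u \<otimes> inv n \<in> R b'" using b'(2) u by blast
    then have m: "n \<otimes> u \<otimes> inv n \<otimes> s b' \<in> M0" using us_M0 rk.R_J by blast
    have "g \<otimes> (u \<otimes> s b) \<otimes> inv n = g \<otimes> inv n \<otimes> (n \<otimes> u \<otimes> inv n \<otimes> s b')"
      unfolding b'(1)[symmetric] by (simp add: gs)
    then have "g \<otimes> (u \<otimes> s b) \<otimes> inv n \<in> M0" using M0.m_closed[OF n(2) m] by simp
    then show "act n (phi (g \<otimes> (u \<otimes> s b) \<otimes> inv n)) = phi' (g \<otimes> (u \<otimes> s b))"
      using n(1) by (intro phi'_eq[symmetric]) simp_all
  qed
  finally show ?thesis .
qed

definition psi :: "('g, 'k) ind \<Rightarrow> ('g, 'k) ind" where "psi = lin phi'"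

lemma phi'_J: "g \<in> carrier M \<Longrightarrow> j \<in> J \<Longrightarrow> phi' (g \<otimes> j) = phi' g"
  using phi'_TJ[of g \<one> j] by (simp add: act_one phi'_V)

lemma psi_klin: "P.klin psi"
  by (simp add: psi_def klin_lin)

lemma psi_D: "g \<in> carrier M \<Longrightarrow> psi (D g) = phi' g"
  unfolding psi_def by (rule lin_D) (rule phi'_J)

lemma psi_V: "x \<in> P.V \<Longrightarrow> psi x \<in> P.V"
  unfolding psi_def by (rule lin_closed[OF phi'_V])

lemma psi_fixed: "x \<in> P.V \<Longrightarrow> psi x \<in> P.fixed (cl ` B)"
proof (induction rule: P.V_induct)
  case zero
  show ?case by (simp add: P.klin_zero[OF psi_klin] P.fixed_closed)
next
  case (step x c a)
  obtain g where "g \<in> carrier M" "P.dl a = D g" using dl_D step by blast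
  then show ?case using step
    by (simp add: P.klin_add[OF psi_klin] P.klin_scl[OF psi_klin] psi_D P.fixed_closed phi'_fixed)
qed

definition commutes :: "('g, 'k) hecke_elt \<Rightarrow> bool" where
  "commutes h \<longleftrightarrow> h \<in> carrier P.H \<and> (\<forall>x\<in>P.V. psi (h x) = h (psi x))"

lemma commutesI:
  assumes h: "h \<in> carrier P.H" and D: "\<And>g. g \<in> carrier M \<Longrightarrow> psi (h (D g)) = h (psi (D g))"
  shows "commutes h"
  unfolding commutes_def
proof (intro conjI ballI h)
  fix x assume x: "x \<in> P.V"
  show "psi (h x) = h (psi x)"
    by (rule klin_eqI_D[OF P.klin_comp[OF psi_klin P.H_klin[OF h]]
          P.klin_comp[OF P.H_klin[OF h] psi_klin] D x])
      (simp_all add: P.H_closed h psi_V)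
qed

lemma commutes_Ts: "commutes (rk.Ts b)"
  by (rule commutesI) (simp_all add: rk.Ts_H rk.Ts_D P.klin_sum[OF psi_klin] psi_D phi'_neighbours)

lemma commutes_T: "t \<in> T \<Longrightarrow> commutes (act t)"
  using phi'_TJ[of _ t \<one>] by (intro commutesI) (simp_all add: act_H rk.norm_T act_D psi_D)

lemma commutes_N: "n \<in> N \<Longrightarrow> commutes (act n)"
  by (intro commutesI) (simp_all add: act_H N_norm act_D psi_D phi'_N)

text \<open>The vectors that \<open>psi\<close> fixes form a subspace to which
  \<open>fixed_in_hyper\<close> applies: \<open>psi\<close> is the identity on \<open>S\<close> and
  commutes with neighbour sums and torus.\<close>

lemma psi_id: "x \<in> P.fixed (cl ` B) \<Longrightarrow> psi x = x"
proof -
  assume x: "x \<in> P.fixed (cl ` B)"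
  have "hyper {x \<in> P.V. psi x = x}"
    unfolding hyper_def
    using commutes_Ts commutes_T
    by (auto simp: P.klin_zero[OF psi_klin] P.klin_add[OF psi_klin] P.klin_scl[OF psi_klin] commutes_def
        P.H_closed psi_D phi'_S)
  then show ?thesis using fixed_in_hyper[OF _ x] by blast
qed

text \<open>The grading for \<open>J\<close> itself yields that the Hecke algebra is generated by the operators with
  which \<open>psi\<close> was arranged to commute.\<close>

lemma retraction_psi:
  assumes gr: "hecke_graded TYPE('k) M G I cl J T Q s R \<tau> \<kappa> M0 N J S' lev' rt'"
    and S': "\<And>g. g \<in> S' \<Longrightarrow> \<exists>n\<in>N. \<exists>t\<in>T. \<exists>j\<in>J. g = n \<otimes> t \<otimes> j"
  shows "P.retraction (cl ` B) psi"
proof -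
  interpret A: hecke_graded M G I F cl J T Q s R \<tau> \<kappa> M0 N J S' lev' rt' by (rule gr)
  have comm_mult: "commutes (h \<otimes>\<^bsub>P.H\<^esub> h')" if h: "commutes h" "commutes h'" for h h'
    using that by (auto simp: commutes_def P.H_ops_closed P.H_mult_apply P.H_closed psi_V)
  have comm_add: "commutes (h \<oplus>\<^bsub>P.H\<^esub> h')" if h: "commutes h" "commutes h'" for h h'
    using that by (auto simp: commutes_def P.H_ops_closed P.H_add_apply P.H_closed psi_V P.klin_add[OF psi_klin])
  have comm_scalar: "commutes (\<lambda>x\<in>P.V. scl c x)" for c
    using P.H_scalar by (auto simp: commutes_def psi_V P.klin_scl[OF psi_klin])
  have comm_one: "commutes \<one>\<^bsub>P.H\<^esub>"
    by (auto simp: commutes_def P.H_ops_closed P.H_one_apply psi_V)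
  \<comment> \<open>The operators that commute with \<open>psi\<close>, viewed in X through their
    values at the base edge. Stability of \<open>W\<close> under neighbour sums and torus is closure
    of these operators under products.\<close>
  define W where "W = (\<lambda>h. h (D \<one>)) ` Collect commutes"
  have H: "h \<in> carrier P.H" if "commutes h" for h using that by (simp add: commutes_def)
  have W1: "h' (h (D \<one>)) \<in> W" if "commutes h" "commutes h'" for h h'
    unfolding W_def using comm_mult[OF that]
    by (intro image_eqI[of _ _ "h \<otimes>\<^bsub>P.H\<^esub> h'"]) (simp_all add: P.H_mult_apply)
  have "A.hyper W"
    unfolding A.hyper_def
  proof (intro conjI ballI allI)
    show "W \<subseteq> P.V" using H P.H_closed by (auto simp: W_def)
    have "(\<lambda>x\<in>P.V. scl 0 x) (D \<one>) = 0" by simp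
    then show "0 \<in> W" unfolding W_def using comm_scalar[of 0] by (metis imageI mem_Collect_eq)
  next
    fix x y assume "x \<in> W" "y \<in> W"
    then obtain h h' where h: "commutes h" "x = h (D \<one>)" "commutes h'" "y = h' (D \<one>)"
      by (auto simp: W_def)
    show "x + y \<in> W" unfolding W_def using comm_add[OF h(1,3)] h
      by (intro image_eqI[of _ _ "h \<oplus>\<^bsub>P.H\<^esub> h'"]) (simp_all add: P.H_add_apply)
  next
    fix c x assume "x \<in> W"
    then obtain h where h: "commutes h" "x = h (D \<one>)" by (auto simp: W_def)
    then show "scl c x \<in> W" using W1[OF h(1) comm_scalar[of c]] H P.H_closed by simp
  next
    fix b x assume "x \<in> W"
    then show "rk.Ts b x \<in> W" using W1 commutes_Ts by (auto simp: W_def)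
  next
    fix t x assume "t \<in> T" "x \<in> W"
    then show "act t x \<in> W" using W1 commutes_T by (auto simp: W_def)
  next
    fix g assume "g \<in> S'"
    then obtain n t j where n: "n \<in> N" and t: "t \<in> T" and j: "j \<in> J" and g: "g = n \<otimes> t \<otimes> j" using S' by blast
    have "D g = act t (act n (D \<one>))"
      using n t j by (simp add: g D_J act_D N_norm rk.norm_T)
    then show "D g \<in> W" using W1[OF commutes_N[OF n] commutes_T[OF t]] by simp
  qed
  then have W: "P.fixed (cl ` J) \<subseteq> W" using A.fixed_in_hyper by blast
  \<comment> \<open>The value of \<open>h\<close> at \<open>D \<one>\<close> is an
    \<open>I\<close>-invariant, so it is also the value of a commuting operator; an operator is
    determined by this value.\<close>
  have all: "commutes h" if h: "h \<in> carrier P.H" for h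
  proof -
    have "h (D \<one>) \<in> P.fixed I"
      unfolding D_one by (rule P.H_fixed[OF h P.I_subset P.dl_one_fixed])
    then obtain h' where h': "commutes h'" "h (D \<one>) = h' (D \<one>)" using W by (auto simp: I_eq W_def)
    then have "h = h'" using P.H_eqI[OF h H[OF h'(1)]] by (simp add: D_one)
    then show ?thesis using h'(1) by simp
  qed
  show ?thesis
    unfolding P.retraction_def using psi_klin psi_fixed psi_id all by (auto simp: commutes_def)
qed

end

section \<open>Norms and heights of two by two matrices over a local field\<close>

definition m2 :: "'a \<Rightarrow> 'a \<Rightarrow> 'a \<Rightarrow> 'a \<Rightarrow> 'a^2^2" where
  "m2 a b c d = (\<chi> i j. if i = 1 then (if j = 1 then a else b) else (if j = 1 then c else d))"

lemma m2_nth [simp]: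
  "m2 a b c d $ 1 $ 1 = a" "m2 a b c d $ 1 $ 2 = b" "m2 a b c d $ 2 $ 1 = c" "m2 a b c d $ 2 $ 2 = d"
  by (simp_all add: m2_def)

lemma m2_eta: "m2 (A $ 1 $ 1) (A $ 1 $ 2) (A $ 2 $ 1) (A $ 2 $ 2) = A"
  by (simp add: m2_def vec_eq_iff forall_2)

lemma m2_cases [case_names m2]: obtains a b c d where "A = m2 a b c d"
  using m2_eta[of A] by metis

lemma m2_eq [simp]: "m2 a b c d = m2 a' b' c' d' \<longleftrightarrow> a = a' \<and> b = b' \<and> c = c' \<and> d = d'"
  by (metis m2_nth)

lemma m2_mult [simp]:
  "m2 a b c d ** m2 a' b' c' d' =
    m2 (a * a' + b * c' :: 'a::semiring_1) (a * b' + b * d') (c * a' + d * c') (c * b' + d * d')"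
  by (simp add: m2_def vec_eq_iff forall_2 matrix_matrix_mult_def sum_2)

lemma m2_det [simp]: "det (m2 a b c d :: 'a::comm_ring_1^2^2) = a * d - b * c"
  by (simp add: det_2)

lemma mat_m2: "mat c = m2 c 0 0 c"
  by (simp add: m2_def vec_eq_iff forall_2 mat_def)

lemma upper_unipotent_m2: "upper_unipotent b = m2 1 b 0 1"
  by (simp add: upper_unipotent_def m2_def vec_eq_iff forall_2)

lemma ln_power_int: "x > 0 \<Longrightarrow> ln (x powi k) = of_int k * ln (x :: real)"
  by (simp add: ln_powr flip: powr_real_of_int')

locale local_field = nonarch_local_field v for v :: "'a::field \<Rightarrow> real" +
  fixes \<pi> :: 'a
  assumes prime: "prime_element v \<pi>"
begin

lemma v_0 [simp]: "v 0 = 0"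
  by (simp add: eq_zero_iff)

lemma v_1 [simp]: "v 1 = 1"
  using mult[of 1 1] eq_zero_iff[of 1] by simp

lemma v_pos: "x \<noteq> 0 \<Longrightarrow> v x > 0"
  using nonneg[of x] eq_zero_iff[of x] by linarith

lemma v_m1 [simp]: "v (- 1) = 1"
proof -
  have "(v (- 1))\<^sup>2 = 1" using mult[of "- 1" "- 1"] by (simp add: power2_eq_square)
  then show ?thesis using nonneg[of "- 1"] by (simp add: power2_eq_1_iff)
qed

lemma v_minus [simp]: "v (- x) = v x"
  using mult[of "- 1" x] by simp

lemma v_inverse: "v (inverse x) = inverse (v x)"
proof (cases "x = 0")
  case False
  then have "v x * v (inverse x) = 1" by (simp flip: mult)
  then show ?thesis by (simp add: inverse_unique)
qed simp

lemma v_divide: "v (x / y) = v x / v y"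
  by (simp add: divide_inverse mult v_inverse)

lemma v_power: "v (x ^ n) = v x ^ n"
  by (induction n) (simp_all add: mult)

lemma v_add_le: "v x \<le> r \<Longrightarrow> v y \<le> r \<Longrightarrow> v (x + y) \<le> r"
  using ultrametric[of x y] by linarith

lemma v_diff_le: "v x \<le> r \<Longrightarrow> v y \<le> r \<Longrightarrow> v (x - y) \<le> r"
  using v_add_le[of x r "- y"] by simp

lemma v_add_less: "v x < r \<Longrightarrow> v y < r \<Longrightarrow> v (x + y) < r"
  using ultrametric[of x y] by linarith

lemma v_diff_less: "v x < r \<Longrightarrow> v y < r \<Longrightarrow> v (x - y) < r"
  using v_add_less[of x r "- y"] by simp

lemma v_mult_le: "v x \<le> 1 \<Longrightarrow> v y \<le> 1 \<Longrightarrow> v (x * y) \<le> 1"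
  using nonneg[of x] nonneg[of y] by (simp add: mult mult_le_one)

lemma v_mult_less1: "v x < 1 \<Longrightarrow> v y \<le> 1 \<Longrightarrow> v (x * y) < 1"
  using nonneg[of x] nonneg[of y] mult_left_le[of "v y" "v x"] by (simp add: mult)

lemma v_mult_less2: "v x \<le> 1 \<Longrightarrow> v y < 1 \<Longrightarrow> v (x * y) < 1"
  using v_mult_less1[of y x] by (simp add: mult.commute)

lemmas O_intros = v_add_le v_diff_le v_mult_le
lemmas m_intros = v_add_less v_diff_less v_mult_less1 v_mult_less2

lemma v_add_eq: "v y < v x \<Longrightarrow> v (x + y) = v x" "v y < v x \<Longrightarrow> v (y + x) = v x"
proof -
  assume *: "v y < v x"
  have "v x \<le> max (v (x + y)) (v y)" using ultrametric[of "x + y" "- y"] by simp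
  then show "v (x + y) = v x" using * ultrametric[of x y] by linarith
  then show "v (y + x) = v x" by (simp add: add.commute)
qed

lemma v_near_one: "v (x - 1) < 1 \<Longrightarrow> v x = 1"
  using v_add_eq(1)[of "x - 1" 1] by simp

text \<open>Nontriviality gives a nonzero element of absolute value below 1, so the prime element is
  nonzero; \<open>lt_iff\<close> is the discreteness of the value group.\<close>

lemma pi_less: "v \<pi> < 1" and pi_nz: "\<pi> \<noteq> 0" and lt_iff: "v x < 1 \<longleftrightarrow> v x \<le> v \<pi>"
proof -
  have p: "{x. v x < 1} = {\<pi> * y | y. v y \<le> 1}" using prime by (simp add: prime_element_def)
  have "\<pi> \<in> {x. v x < 1}" unfolding p by (rule CollectI, rule exI[of _ 1]) simp
  then show l: "v \<pi> < 1" by simp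
  obtain x where x: "x \<noteq> 0" "v x \<noteq> 1" using nontrivial by blast
  define y where "y = (if v x < 1 then x else inverse x)"
  have y: "y \<noteq> 0" "v y < 1"
    using x v_pos[OF x(1)] by (auto simp: y_def v_inverse inverse_less_1_iff)
  then show nz: "\<pi> \<noteq> 0" using p by auto
  show "v x < 1 \<longleftrightarrow> v x \<le> v \<pi>" for x
  proof
    assume "v x < 1"
    then obtain y where "x = \<pi> * y" "v y \<le> 1" using p by blast
    then show "v x \<le> v \<pi>" using nonneg[of \<pi>] by (simp add: mult mult_left_le)
  qed (use l in simp)
qed

lemma pi_pos: "v \<pi> > 0"
  using pi_nz by (rule v_pos)

lemma discrete: "v x < v y \<Longrightarrow> v x \<le> v \<pi> * v y"
proof -
  assume *: "v x < v y"
  then have y: "v y > 0" using nonneg[of x] by linarith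
  then have "v (x / y) < 1" using * by (simp add: v_divide)
  then have "v (x / y) \<le> v \<pi>" using lt_iff by blast
  then show ?thesis using y by (simp add: v_divide pos_divide_le_eq)
qed

text \<open>The exponent is a logarithm rounded up. If the power were strictly below
  \<open>v x\<close>, discreteness would leave a gap of a full step, more than rounding can
  cause.\<close>

lemma v_value:
  assumes "x \<noteq> 0"
  shows "\<exists>k::int. v x = v \<pi> powi k"
proof -
  define k where "k = \<lceil>log (v \<pi>) (v x)\<rceil>"
  have l: "ln (v \<pi>) < 0" using pi_pos pi_less by (simp add: ln_less_zero)
  define y where "y = v \<pi> powi k"
  have y: "y > 0" using pi_pos by (simp add: y_def)
  have lny: "ln y = of_int k * ln (v \<pi>)" using pi_pos by (simp add: y_def ln_power_int)
  have lnx: "ln (v x) = log (v \<pi>) (v x) * ln (v \<pi>)" using l by (simp add: log_def)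
  have x: "v x > 0" using assms by (rule v_pos)
  have "y \<le> v x"
    using x y l by (subst ln_le_cancel_iff[symmetric]) (auto simp: lny lnx k_def mult_right_mono_neg)
  moreover have "\<not> y < v x"
  proof
    assume less: "y < v x"
    have yv: "y = v (if k \<ge> 0 then \<pi> ^ nat k else inverse (\<pi> ^ nat (- k)))"
      by (simp add: y_def power_int_def v_power v_inverse power_inverse)
    then have "y \<le> v \<pi> * v x" using discrete less by metis
    then have "ln y \<le> ln (v \<pi>) + ln (v x)" using x y pi_pos by (metis ln_le_cancel_iff ln_mult mult_pos_pos less_irrefl)
    then have "of_int k * ln (v \<pi>) \<le> (1 + log (v \<pi>) (v x)) * ln (v \<pi>)"
      by (simp add: lny lnx algebra_simps)
    then have "1 + log (v \<pi>) (v x) \<le> of_int k" using l by (simp add: mult_le_cancel_right)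
    then show False unfolding k_def by linarith
  qed
  ultimately show ?thesis unfolding y_def by (metis antisym_conv1 not_less_iff_gr_or_eq)
qed

text \<open>The left side has odd valuation, the right side even. This separates multiples of
  \<open>omega\<close> from scalars.\<close>

lemma odd_power: "c \<noteq> 0 \<Longrightarrow> z \<noteq> 0 \<Longrightarrow> v c * v c * v \<pi> \<noteq> v z * v z"
proof
  assume "c \<noteq> 0" "z \<noteq> 0" and eq: "v c * v c * v \<pi> = v z * v z"
  then obtain k l where "v c = v \<pi> powi k" "v z = v \<pi> powi l" using v_value by meson
  then have "ln (v \<pi> powi k * v \<pi> powi k * v \<pi>) = ln (v \<pi> powi l * v \<pi> powi l)" using eq by simp
  moreover have "v \<pi> powi k > 0" "v \<pi> powi l > 0" using pi_pos by simp_all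
  ultimately have "real_of_int (k + k + 1) * ln (v \<pi>) = real_of_int (l + l) * ln (v \<pi>)"
    using pi_pos by (simp add: ln_mult ln_power_int algebra_simps)
  moreover have "ln (v \<pi>) < 0" using pi_pos pi_less by (simp add: ln_less_zero)
  ultimately have "k + k + 1 = l + l" by (metis mult_cancel_right of_int_eq_iff less_irrefl)
  then show False by presburger
qed

definition col1 :: "'a^2^2 \<Rightarrow> real" where "col1 A = max (v (A $ 1 $ 1)) (v (A $ 2 $ 1))"
definition col2 :: "'a^2^2 \<Rightarrow> real" where "col2 A = max (v (A $ 1 $ 2)) (v (A $ 2 $ 2))"
definition nrm :: "'a^2^2 \<Rightarrow> real" where "nrm A = max (col1 A) (col2 A)"
text \<open>It exchanges the ends of the standard edge; its square is the scalar
  \<open>\<pi>\<close>.\<close>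

definition omega :: "'a^2^2" where "omega = m2 0 1 \<pi> 0"
text \<open>By the Cartan decomposition this is the inverse of \<open>v \<pi>\<close> raised to the
  distance in the tree between the vertex of \<open>A\<close> and the standard vertex.\<close>

definition height :: "'a^2^2 \<Rightarrow> real" where "height A = (nrm A)\<^sup>2 / v (det A)"

lemma col_m2 [simp]: "col1 (m2 a b c d) = max (v a) (v c)" "col2 (m2 a b c d) = max (v b) (v d)"
  by (simp_all add: col1_def col2_def)

lemma col1_value: "\<exists>x. col1 A = v x"
  by (cases "v (A $ 1 $ 1) \<le> v (A $ 2 $ 1)") (auto simp: col1_def)

lemma col2_value: "\<exists>x. col2 A = v x"
  by (cases "v (A $ 1 $ 2) \<le> v (A $ 2 $ 2)") (auto simp: col2_def)

lemma nrm_value: "\<exists>x. nrm A = v x"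
  using col1_value[of A] col2_value[of A] by (cases "col1 A \<le> col2 A") (auto simp: nrm_def)

lemma nrm_nonneg: "nrm A \<ge> 0"
  using nonneg by (simp add: nrm_def col1_def col2_def le_max_iff_disj)

lemma nrm_le_iff: "nrm (m2 a b c d) \<le> r \<longleftrightarrow> v a \<le> r \<and> v b \<le> r \<and> v c \<le> r \<and> v d \<le> r"
  by (auto simp: nrm_def)

lemma nrm_mult: "nrm (A ** B) \<le> nrm A * nrm B"
proof (cases A rule: m2_cases)
  case A: (m2 a b c d)
  show ?thesis
  proof (cases B rule: m2_cases)
    case B: (m2 a' b' c' d')
    have m: "v x * v y \<le> nrm A * nrm B" if "v x \<le> nrm A" "v y \<le> nrm B" for x y
      using that by (intro mult_mono) (auto simp: nonneg nrm_nonneg)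
    have "v a \<le> nrm A" "v b \<le> nrm A" "v c \<le> nrm A" "v d \<le> nrm A"
      "v a' \<le> nrm B" "v b' \<le> nrm B" "v c' \<le> nrm B" "v d' \<le> nrm B"
      by (simp_all add: A B nrm_def)
    then show ?thesis unfolding A B m2_mult nrm_le_iff unfolding A[symmetric] B[symmetric]
      by (auto intro!: v_add_le m simp: mult)
  qed
qed

lemma det_le: "v (det A) \<le> (nrm A)\<^sup>2"
proof (cases A rule: m2_cases)
  case A: (m2 a b c d)
  have m: "v x * v y \<le> (nrm A)\<^sup>2" if "v x \<le> nrm A" "v y \<le> nrm A" for x y
    unfolding power2_eq_square using that by (intro mult_mono) (auto simp: nonneg nrm_nonneg)
  have "v a \<le> nrm A" "v b \<le> nrm A" "v c \<le> nrm A" "v d \<le> nrm A"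
    by (simp_all add: A nrm_def)
  then have "v (a * d - b * c) \<le> (nrm A)\<^sup>2"
    by (intro v_diff_le) (simp_all only: mult m)
  then show ?thesis using A by simp
qed

lemma height_ge_1: "det A \<noteq> 0 \<Longrightarrow> height A \<ge> 1"
  using det_le[of A] v_pos[of "det A"] by (simp add: height_def)

lemma nrm_scalar: "nrm (mat c ** A) = v c * nrm A"
  by (cases A rule: m2_cases) (simp add: mat_m2 nrm_def mult max_mult_distrib_left nonneg)

lemma det_scalar: "det (mat c ** A :: 'a^2^2) = c * c * det A"
  by (cases A rule: m2_cases) (simp add: mat_m2 algebra_simps)

lemma height_scalar: "c \<noteq> 0 \<Longrightarrow> height (mat c ** A) = height A"
  using v_pos[of c] by (simp add: height_def nrm_scalar det_scalar mult power_mult_distrib power2_eq_square)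

text \<open>The matrices invertible over the ring of integers, expressed by the norm.\<close>

definition integral :: "'a^2^2 \<Rightarrow> bool" where
  "integral A \<longleftrightarrow> nrm A \<le> 1 \<and> v (det A) = 1"

lemma integral_m2: "integral (m2 a b c d) \<longleftrightarrow> v a \<le> 1 \<and> v b \<le> 1 \<and> v c \<le> 1 \<and> v d \<le> 1 \<and> v (a * d - b * c) = 1"
  by (simp add: integral_def nrm_le_iff)

lemma integral_inv_ex:
  assumes "integral A"
  shows "\<exists>B. integral B \<and> A ** B = mat 1 \<and> B ** A = mat 1"
proof (cases A rule: m2_cases)
  case A: (m2 a b c d)
  obtain D where ad: "a * d = D + b * c" by (metis diff_add_cancel)
  have D: "v D = 1" "D \<noteq> 0" using assms ad by (auto simp: A integral_m2)
  have e: "d / D * (a / D) - (- b / D) * (- c / D) = inverse D"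
    using D ad by (simp add: field_simps)
  show ?thesis
  proof (intro exI[of _ "m2 (d / D) (- b / D) (- c / D) (a / D)"] conjI)
    show "integral (m2 (d / D) (- b / D) (- c / D) (a / D))"
      unfolding integral_m2 e using assms D(1) by (simp add: A integral_m2 v_divide v_inverse)
  qed (use D ad in \<open>simp_all add: A mat_m2 field_simps\<close>)
qed

text \<open>The norm is submultiplicative, and both \<open>B\<close> and its inverse have norm at
  most 1.\<close>

lemma nrm_integral_right:
  assumes "integral B"
  shows "nrm (A ** B) = nrm A"
proof (rule antisym)
  have "nrm (Y ** C) \<le> nrm Y" if "integral C" for Y C :: "'a^2^2"
    using nrm_mult[of Y C] that nrm_nonneg[of Y] mult_left_le[of "nrm C" "nrm Y"] by (simp add: integral_def)
  note le = this
  show "nrm (A ** B) \<le> nrm A" by (rule le[OF assms])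
  obtain C where C: "integral C" "B ** C = mat 1" using integral_inv_ex[OF assms] by blast
  have "nrm A = nrm ((A ** B) ** C)" by (simp add: C matrix_mul_assoc[symmetric])
  then show "nrm A \<le> nrm (A ** B)" using le[OF C(1)] by simp
qed

lemma nrm_integral_left:
  assumes "integral B"
  shows "nrm (B ** A) = nrm A"
proof (rule antisym)
  have "nrm (C ** Y) \<le> nrm Y" if "integral C" for Y C :: "'a^2^2"
    using nrm_mult[of C Y] that nrm_nonneg[of Y] mult_left_le_one_le[of "nrm Y" "nrm C"] nrm_nonneg[of C]
    by (simp add: integral_def)
  note le = this
  show "nrm (B ** A) \<le> nrm A" by (rule le[OF assms])
  obtain C where C: "integral C" "C ** B = mat 1" using integral_inv_ex[OF assms] by blast
  have "nrm A = nrm (C ** (B ** A))" by (simp add: C matrix_mul_assoc)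
  then show "nrm A \<le> nrm (B ** A)" using le[OF C(1)] by simp
qed

lemma height_integral: "integral B \<Longrightarrow> height (A ** B) = height A" "integral B \<Longrightarrow> height (B ** A) = height A"
  by (simp_all add: height_def nrm_integral_right nrm_integral_left det_mul mult) (simp_all add: integral_def)

lemma mult_omega: "m2 a b c d ** omega = m2 (b * \<pi>) a (d * \<pi>) c"
  by (simp add: omega_def)

lemma det_omega: "v (det ((A :: 'a^2^2) ** omega)) = v \<pi> * v (det A)"
  by (simp add: det_mul omega_def mult)

lemma omega_omega: "(A :: 'a^2^2) ** omega ** omega = mat \<pi> ** A"
  by (cases A rule: m2_cases) (simp add: omega_def mat_m2 mult.commute)

lemma nrm_omega: "nrm (A ** omega) = max (v \<pi> * col2 A) (col1 A)"
  by (cases A rule: m2_cases) (simp add: mult_omega nrm_def mult mult.commute max_mult_distrib_left pi_pos less_imp_le)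

text \<open>Multiplication by \<open>omega\<close> crosses an edge to its other end. If the first
  column carries the norm this leads away from the standard vertex, otherwise towards it.\<close>

lemma height_omega_up:
  assumes "col1 A = nrm A"
  shows "height (A ** omega) = height A / v \<pi>"
proof -
  have "v \<pi> * col2 A \<le> nrm A"
    using pi_less pi_pos nrm_nonneg[of A] mult_mono[of "v \<pi>" 1 "col2 A" "nrm A"] by (auto simp: nrm_def col2_def nonneg le_max_iff_disj)
  then have "nrm (A ** omega) = nrm A" using assms by (simp add: nrm_omega)
  then show ?thesis by (simp add: height_def det_omega)
qed

lemma height_omega_down:
  assumes "col1 A < nrm A"
  shows "height (A ** omega) = height A * v \<pi>"
proof -
  have c2: "col2 A = nrm A" using assms by (auto simp: nrm_def)
  obtain x where "col1 A = v x" using col1_value by blast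
  moreover obtain y where "col2 A = v y" using col2_value by blast
  ultimately have "col1 A \<le> v \<pi> * col2 A" using assms c2 discrete[of x y] by simp
  then have "nrm (A ** omega) = v \<pi> * nrm A" using c2 by (simp add: nrm_omega)
  then show ?thesis using pi_pos by (simp add: height_def det_omega power2_eq_square)
qed

lemma height_value: "\<exists>x. height A = v x"
proof -
  obtain x where "nrm A = v x" using nrm_value by blast
  then have "height A = v (x\<^sup>2 / det A)" by (simp add: height_def v_divide v_power)
  then show ?thesis by blast
qed

lemma height_discrete:
  assumes "height A > inverse (v \<pi>) ^ k"
  shows "height A \<ge> inverse (v \<pi>) ^ Suc k"
proof -
  obtain x where x: "height A = v x" using height_value by blast
  have "v (inverse \<pi> ^ k) < v x" using assms x by (simp only: v_power v_inverse)
  then have "v (inverse \<pi> ^ k) \<le> v \<pi> * v x" by (rule discrete)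
  then have "inverse (v \<pi>) ^ k \<le> v \<pi> * v x" by (simp only: v_power v_inverse)
  then have "inverse (v \<pi>) * inverse (v \<pi>) ^ k \<le> inverse (v \<pi>) * (v \<pi> * v x)"
    using pi_pos by (intro mult_left_mono) simp_all
  also have "\<dots> = v x" using pi_pos by simp
  finally show ?thesis by (simp only: x power_Suc)
qed

text \<open>A column operation clears the entry of the first column beside the largest entry of the
  second. What is left there is the determinant divided by that largest entry, so the first column
  becomes as short as the determinant allows.\<close>

lemma root_matrix:
  assumes "det A \<noteq> 0"
  shows "\<exists>B. integral B \<and> det B = 1 \<and> col1 (A ** B) * nrm A = v (det A)"
proof -
  have *: "\<exists>B. integral B \<and> det B = 1 \<and> col1 (A ** B) * nrm A = v (det A)"
    if c: "col2 A = nrm A" and nz: "det A \<noteq> 0" for A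
  proof (cases A rule: m2_cases)
    case A: (m2 a b c d)
    have le: "v a \<le> nrm A" "v c \<le> nrm A" by (simp_all add: A nrm_def)
    show ?thesis
    proof (cases "v d \<le> v b")
      case True
      then have b: "v b = nrm A" using c by (simp add: A)
      have bn: "b \<noteq> 0" using nz True eq_zero_iff[of d] nonneg[of d] by (auto simp: A)
      let ?B = "m2 1 0 (- a / b) 1"
      have "v (a / b) \<le> 1" using le(1) b v_pos[OF bn] by (simp add: v_divide)
      then have "integral ?B" by (simp add: integral_m2)
      moreover have "A ** ?B = m2 0 b (- det A / b) d" using bn by (simp add: A field_simps)
      then have "col1 (A ** ?B) * nrm A = v (det A)"
        using v_pos[OF bn] nonneg[of "det A"] by (simp add: v_divide flip: b)
      ultimately show ?thesis by (intro exI[of _ ?B]) simp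
    next
      case False
      then have d: "v d = nrm A" using c by (simp add: A)
      have dn: "d \<noteq> 0" using False nonneg[of b] by auto
      let ?B = "m2 1 0 (- c / d) 1"
      have "v (c / d) \<le> 1" using le(2) d v_pos[OF dn] by (simp add: v_divide)
      then have "integral ?B" by (simp add: integral_m2)
      moreover have "A ** ?B = m2 (det A / d) b 0 d" using dn by (simp add: A field_simps)
      then have "col1 (A ** ?B) * nrm A = v (det A)"
        using v_pos[OF dn] nonneg[of "det A"] by (simp add: v_divide flip: d)
      ultimately show ?thesis by (intro exI[of _ ?B]) simp
    qed
  qed
  show ?thesis
  proof (cases "col2 A = nrm A")
    case True
    then show ?thesis using * assms by blast
  next
    case False
    then have c1: "col1 A = nrm A" by (auto simp: nrm_def max_def split: if_splits)
    \<comment> \<open>If the first column carries the norm, the columns are exchanged, with a sign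
      to keep the determinant.\<close>
    let ?S = "m2 0 1 (- 1) 0 :: 'a^2^2"
    have S: "integral ?S" by (simp add: integral_m2)
    have "col2 (A ** ?S) = col1 A" by (cases A rule: m2_cases) simp
    then have "col2 (A ** ?S) = nrm (A ** ?S)" using c1 by (simp add: nrm_integral_right[OF S])
    moreover have dS: "det (A ** ?S) = det A" by (simp add: det_mul)
    ultimately obtain B where B: "integral B" "det B = 1" "col1 (A ** ?S ** B) * nrm (A ** ?S) = v (det (A ** ?S))"
      using *[of "A ** ?S"] assms by auto
    have "integral (?S ** B)" using B S nrm_mult[of ?S B] by (simp add: integral_def det_mul nrm_integral_left[OF S])
    then show ?thesis using B dS
      by (intro exI[of _ "?S ** B"]) (simp add: det_mul matrix_mul_assoc nrm_integral_right[OF S])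
  qed
qed

end

section \<open>Transport of a rank one structure by an automorphism\<close>

text \<open>The structure at the second vertex of the standard edge arises from the first by an
  automorphism preserving \<open>J\<close> and \<open>T\<close>, so the axioms are verified at one
  vertex only.\<close>

lemma (in rank_one) conj:
  assumes hom: "\<sigma> \<in> hom M M" and inj: "inj_on \<sigma> (carrier M)"
    and sJ: "\<sigma> ` J = J" and sT: "\<sigma> ` T = T"
  shows "rank_one TYPE('k) M G I cl J T (\<sigma> ` Q) (\<sigma> s) (\<sigma> ` R)
    (\<lambda>u. \<sigma> (\<tau> (inv_into (carrier M) \<sigma> u))) (\<lambda>u. \<sigma> (\<kappa> (inv_into (carrier M) \<sigma> u)))"
proof -
  interpret h: group_hom M M \<sigma> by unfold_locales (rule hom)
  have Qc: "Q \<subseteq> carrier M" using subgroup.subset[OF Q_subgroup] .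
  note [simp] = subsetD[OF Qc]
  have inv_s: "inv_into (carrier M) \<sigma> (\<sigma> x) = x" if "x \<in> carrier M" for x
    using inj that by (rule inv_into_f_f)
  have J_in: "\<sigma> x \<in> J" if "x \<in> J" for x using sJ that by blast
  have T_in: "\<sigma> x \<in> T" if "x \<in> T" for x using sT that by blast
  have J_back: "x \<in> J" if x: "\<sigma> x \<in> J" "x \<in> carrier M" for x
  proof -
    obtain y where y: "y \<in> J" "\<sigma> y = \<sigma> x" using sJ x(1) by (metis imageE)
    then have "y = x" using inj x(2) J_carrier[OF y(1)] by (auto dest: inj_onD)
    then show ?thesis using y by simp
  qed
  have J_pre: "\<exists>y\<in>J. x = \<sigma> y" if "x \<in> J" for x using sJ that by blast
  have T_pre: "\<exists>y\<in>T. x = \<sigma> y" if "x \<in> T" for x using sT that by blast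
  have sc: "\<sigma> x \<in> carrier M" if "x \<in> carrier M" for x using that by simp
  have eqD: "x = y" if "\<sigma> x = \<sigma> y" "x \<in> carrier M" "y \<in> carrier M" for x y
    using inj that by (auto dest: inj_onD)
  have one: "\<one> = \<sigma> \<one>" by simp
  show ?thesis
  proof (intro rank_one.intro rank_one_axioms.intro)
    show "hecke_cover M G I cl J" by (rule hecke_cover_axioms)
    show "subgroup T M" by (rule T_subgroup)
    show "subgroup (\<sigma> ` Q) M" by (rule h.subgroup_img_is_subgroup[OF Q_subgroup])
    show "J \<subseteq> \<sigma> ` Q" "T \<subseteq> \<sigma> ` Q" using sJ sT J_Q T_Q by blast+
    show "\<sigma> s \<in> \<sigma> ` Q" using s_Q by simp
    show "\<sigma> s \<in> carrier M" by simp
    show "finite (\<sigma> ` R)" using R_finite by simp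
    show "\<one> \<in> \<sigma> ` R" using R_one one by blast
    have "card (\<sigma> ` R) = card R"
      by (rule card_image, rule inj_on_subset[OF inj]) auto
    then show "of_nat (card (\<sigma> ` R)) = (0 :: 'k)" using R_card by simp
    show "\<sigma> s \<otimes> \<sigma> s \<in> T" using T_in[OF s_square] by simp
  next
    fix t j assume "t \<in> T" "j \<in> J"
    then show "t \<otimes> j \<otimes> inv t \<in> J" by (rule T_norm)
  next
    fix t assume "t \<in> T"
    then obtain y where y: "y \<in> T" "t = \<sigma> y" using T_pre by blast
    then show "inv \<sigma> s \<otimes> t \<otimes> \<sigma> s \<in> T" using T_in[OF s_T[OF y(1)]] by simp
    assume "inv \<sigma> s \<otimes> t \<otimes> \<sigma> s \<in> J"
    then have "inv s \<otimes> y \<otimes> s \<in> J" using y by - (rule J_back, simp_all)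
    then show "t \<in> J" using s_TJ y J_in by blast
  next
    fix p assume "p \<in> \<sigma> ` Q"
    then obtain q where q: "q \<in> Q" "p = \<sigma> q" by blast
    from Q_cases[OF q(1)]
    show "(\<exists>t\<in>T. \<exists>j\<in>J. p = \<sigma> s \<otimes> t \<otimes> j) \<or> (\<exists>i\<in>J. \<exists>t\<in>T. \<exists>j\<in>J. p = \<sigma> s \<otimes> i \<otimes> inv \<sigma> s \<otimes> t \<otimes> j)"
    proof (elim disjE bexE)
      fix t j assume "t \<in> T" "j \<in> J" "q = s \<otimes> t \<otimes> j"
      then have "p = \<sigma> s \<otimes> \<sigma> t \<otimes> \<sigma> j" "\<sigma> t \<in> T" "\<sigma> j \<in> J" using q(2) T_in J_in by simp_all
      then show ?thesis by blast
    next
      fix i t j assume "i \<in> J" "t \<in> T" "j \<in> J" "q = s \<otimes> i \<otimes> inv s \<otimes> t \<otimes> j"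
      then have "p = \<sigma> s \<otimes> \<sigma> i \<otimes> inv \<sigma> s \<otimes> \<sigma> t \<otimes> \<sigma> j" "\<sigma> i \<in> J" "\<sigma> t \<in> T" "\<sigma> j \<in> J"
        using q(2) T_in J_in by simp_all
      then show ?thesis by blast
    qed
  next
    fix i j assume i: "i \<in> J" and j: "j \<in> J"
    obtain i' where i': "i' \<in> J" "i = \<sigma> i'" using J_pre[OF i] by blast
    obtain j' where j': "j' \<in> J" "j = \<sigma> j'" using J_pre[OF j] by blast
    note ij = i'(1) j'(1) i'(2) j'(2)
    show "i \<otimes> \<sigma> s \<otimes> j \<notin> T"
    proof
      assume "i \<otimes> \<sigma> s \<otimes> j \<in> T"
      then obtain t where t: "t \<in> T" "i \<otimes> \<sigma> s \<otimes> j = \<sigma> t" using T_pre by blast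
      have "\<sigma> (i' \<otimes> s \<otimes> j') = \<sigma> t" unfolding t(2)[symmetric] using ij by simp
      then have "i' \<otimes> s \<otimes> j' = t" by (rule eqD) (use ij t(1) in simp_all)
      then show False using disjoint[OF ij(1,2)] t(1) by simp
    qed
  next
    fix u assume "u \<in> \<sigma> ` R" then show "u \<in> J" using J_in R_J by blast
  next
    fix i assume "i \<in> J"
    then obtain i' where i: "i' \<in> J" "i = \<sigma> i'" using J_pre by blast
    then obtain u j where u: "u \<in> R" "j \<in> J" "i' \<otimes> s = u \<otimes> s \<otimes> j" using R_ex by blast
    have "\<sigma> (i' \<otimes> s) = \<sigma> (u \<otimes> s \<otimes> j)" by (simp only: u(3))
    then have "i \<otimes> \<sigma> s = \<sigma> u \<otimes> \<sigma> s \<otimes> \<sigma> j" using i u(1,2) by simp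
    then show "\<exists>u\<in>\<sigma> ` R. \<exists>j\<in>J. i \<otimes> \<sigma> s = u \<otimes> \<sigma> s \<otimes> j" using u J_in by blast
  next
    fix u u' t j assume u: "u \<in> \<sigma> ` R" "u' \<in> \<sigma> ` R" and tj: "t \<in> T" "j \<in> J" and eq: "u \<otimes> \<sigma> s = u' \<otimes> \<sigma> s \<otimes> t \<otimes> j"
    obtain w where w1: "w \<in> R" "u = \<sigma> w" using u(1) by blast
    obtain w' where w2: "w' \<in> R" "u' = \<sigma> w'" using u(2) by blast
    obtain x where x: "x \<in> T" "t = \<sigma> x" using T_pre[OF tj(1)] by blast
    obtain k where k: "k \<in> J" "j = \<sigma> k" using J_pre[OF tj(2)] by blast
    note w = w1(1) w2(1) x(1) k(1) and e = w1(2) w2(2) x(2) k(2)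
    have "w \<otimes> s = w' \<otimes> s \<otimes> x \<otimes> k" using eq w by - (rule eqD, simp_all add: e)
    then show "u = u' \<and> t \<in> J" using R_unique[OF w] e J_in by blast
  next
    fix u assume u: "u \<in> \<sigma> ` R - {\<one>}"
    then obtain w where w0: "w \<in> R" "u = \<sigma> w" by blast
    then have w: "w \<in> R - {\<one>}" "u = \<sigma> w" using u by auto
    then have iu: "inv_into (carrier M) \<sigma> u = w" by (simp add: inv_s)
    note t = tau(1)[OF w(1)]
    show "\<sigma> (\<tau> (inv_into (carrier M) \<sigma> u)) \<in> T" unfolding iu by (rule T_in[OF t])
    obtain i j where ij: "i \<in> J" "j \<in> J" "w \<otimes> s = s \<otimes> i \<otimes> inv s \<otimes> \<tau> w \<otimes> j" using tau(2)[OF w(1)] by blast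
    have "\<sigma> (w \<otimes> s) = \<sigma> (s \<otimes> i \<otimes> inv s \<otimes> \<tau> w \<otimes> j)" by (simp only: ij(3))
    then have "u \<otimes> \<sigma> s = \<sigma> s \<otimes> \<sigma> i \<otimes> inv \<sigma> s \<otimes> \<sigma> (\<tau> w) \<otimes> \<sigma> j" using w ij(1,2) t by simp
    then show "\<exists>i\<in>J. \<exists>j\<in>J. u \<otimes> \<sigma> s = \<sigma> s \<otimes> i \<otimes> inv \<sigma> s \<otimes> \<sigma> (\<tau> (inv_into (carrier M) \<sigma> u)) \<otimes> j"
      unfolding iu using ij J_in by blast
    have kw: "\<kappa> w \<in> R - {\<one>}" using kappa(1) w(1) by (auto simp: bij_betw_def)
    then have ik: "inv_into (carrier M) \<sigma> (\<sigma> (\<kappa> w)) = \<kappa> w" by (simp add: inv_s)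
    have "\<sigma> (inv (inv s \<otimes> \<tau> w \<otimes> s) \<otimes> \<tau> (\<kappa> w)) \<in> J" by (rule J_in[OF kappa(2)[OF w(1)]])
    then show "inv (inv \<sigma> s \<otimes> \<sigma> (\<tau> (inv_into (carrier M) \<sigma> u)) \<otimes> \<sigma> s) \<otimes>
        \<sigma> (\<tau> (inv_into (carrier M) \<sigma> (\<sigma> (\<kappa> (inv_into (carrier M) \<sigma> u))))) \<in> J"
      unfolding iu ik using t tau(1)[OF kw] by simp
  next
    have R': "\<sigma> ` R - {\<one>} = \<sigma> ` (R - {\<one>})"
    proof -
      have "\<sigma> ` (R - {\<one>}) = \<sigma> ` R - \<sigma> ` {\<one>}"
        by (rule inj_on_image_set_diff[OF inj]) auto
      then show ?thesis by simp
    qed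
    have b1: "bij_betw \<sigma> (R - {\<one>}) (\<sigma> ` R - {\<one>})"
      unfolding R' by (rule inj_on_imp_bij_betw, rule inj_on_subset[OF inj]) auto
    have b2: "bij_betw (inv_into (carrier M) \<sigma>) (\<sigma> ` R - {\<one>}) (R - {\<one>})"
      unfolding R' by (rule bij_betw_byWitness[where f' = \<sigma>]) (auto simp: inv_s image_image)
    show "bij_betw (\<lambda>u. \<sigma> (\<kappa> (inv_into (carrier M) \<sigma> u))) (\<sigma> ` R - {\<one>}) (\<sigma> ` R - {\<one>})"
      using bij_betw_trans[OF b2 bij_betw_trans[OF kappa(1) b1]] by (simp add: o_def)
  next
    fix i x assume i: "i \<in> J" and x: "x \<in> J" and *: "inv \<sigma> s \<otimes> x \<otimes> \<sigma> s \<in> J"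
    obtain i' where i': "i' \<in> J" "i = \<sigma> i'" using J_pre[OF i] by blast
    obtain x' where x': "x' \<in> J" "x = \<sigma> x'" using J_pre[OF x] by blast
    note ix = i'(1) x'(1) i'(2) x'(2)
    have "inv s \<otimes> x' \<otimes> s \<in> J" using * ix by - (rule J_back, simp_all)
    from J_in[OF normal[OF ix(1,2) this]]
    show "inv \<sigma> s \<otimes> (i \<otimes> x \<otimes> inv i) \<otimes> \<sigma> s \<in> J" using ix by simp
  qed
qed

section \<open>The residue field\<close>

context local_field
begin

text \<open>Local compactness gives finitely many residue classes. For the divisibility, adding 1
  permutes the classes; comparing the sum of the shifted representatives with the sum of the
  representatives shows that their number lies in the maximal ideal.\<close>

lemma residue_reps:
  "\<exists>B. finite B \<and> 0 \<in> B \<and> (\<forall>b\<in>B. v b \<le> 1) \<and> (\<forall>x. v x \<le> 1 \<longrightarrow> (\<exists>b\<in>B. v (x - b) < 1)) \<and>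
    (\<forall>b\<in>B. \<forall>b'\<in>B. v (b - b') < 1 \<longrightarrow> b = b') \<and> residue_char v dvd card B"
proof -
  have vsym: "v (x - y) = v (y - x)" for x y using v_minus[of "x - y"] by simp
  have tri: "v (x - z) < 1" if "v (x - y) < 1" "v (y - z) < 1" for x y z
    using v_add_less[OF that] by simp
  interpret Metric_space UNIV "\<lambda>x y. v (x - y)"
  proof
    fix x y z :: 'a
    show "v (x - z) \<le> v (x - y) + v (y - z)"
      using ultrametric[of "x - y" "y - z"] nonneg[of "x - y"] nonneg[of "y - z"] by simp
  qed (use nonneg vsym eq_zero_iff in auto)
  have "locally_compact_space mtopology" by (rule locally_compact)
  then obtain U K where UK: "openin mtopology U" "compactin mtopology K" "0 \<in> U" "U \<subseteq> K"
    unfolding locally_compact_space_def by (metis UNIV_I topspace_mtopology)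
  then obtain r where r: "r > 0" "mball 0 r \<subseteq> U" by (auto simp: openin_mtopology)
  \<comment> \<open>Multiplication by \<open>\<pi> ^ n\<close> carries the ring of integers into the
    compact neighbourhood, and division by it turns the small balls of a finite cover into residue
    classes.\<close>
  obtain n where n: "v \<pi> ^ n < r" using real_arch_pow_inv[OF r(1) pi_less] by blast
  have pn: "v (\<pi> ^ n) > 0" using pi_pos by (simp add: v_power)
  define C where "C = (\<lambda>x. mball x (v (\<pi> ^ n))) ` K"
  have "(\<forall>W\<in>C. openin mtopology W) \<and> K \<subseteq> \<Union>C" using pn by (auto simp: C_def in_mball)
  then obtain E where E: "finite E" "E \<subseteq> C" "K \<subseteq> \<Union>E" using UK(2) unfolding compactin_def by meson
  obtain L where L: "finite L" "E = (\<lambda>x. mball x (v (\<pi> ^ n))) ` L" using finite_subset_image[OF E(1) E(2)[unfolded C_def]] by blast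
  define F where "F = (\<lambda>x. x / \<pi> ^ n) ` L"
  have F: "finite F" "\<And>x. v x \<le> 1 \<Longrightarrow> \<exists>f\<in>F. v (x - f) < 1"
  proof -
    show "finite F" using L by (simp add: F_def)
    fix x assume x: "v x \<le> 1"
    have "v \<pi> ^ n * v x \<le> v \<pi> ^ n * 1" by (rule mult_left_mono[OF x]) (use pn in \<open>simp add: v_power\<close>)
    then have "v (\<pi> ^ n * x) < r" using n by (simp add: mult v_power)
    then have "\<pi> ^ n * x \<in> K" using r UK(4) by (auto simp: in_mball)
    then obtain l where l: "l \<in> L" "v (l - \<pi> ^ n * x) < v (\<pi> ^ n)" using E(3) L(2) by (auto simp: in_mball)
    have "l / \<pi> ^ n - x = (l - \<pi> ^ n * x) / \<pi> ^ n" using pi_nz by (simp add: field_simps)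
    then have "v (l / \<pi> ^ n - x) < 1" using l(2) pn by (simp add: v_divide)
    then show "\<exists>f\<in>F. v (x - f) < 1" using l(1) vsym by (auto simp: F_def)
  qed
  \<comment> \<open>The condition depends on \<open>x\<close> only through its residue class, so
    congruent elements get the same representative; the class of 0 gets 0.\<close>
  define rep where "rep x = (SOME y. v y \<le> 1 \<and> v (x - y) < 1 \<and> (v x < 1 \<longrightarrow> y = 0))" for x
  have rep: "v (rep x) \<le> 1 \<and> v (x - rep x) < 1 \<and> (v x < 1 \<longrightarrow> rep x = 0)" if "v x \<le> 1" for x
    unfolding rep_def by (rule someI[of _ "if v x < 1 then 0 else x"]) (use that in auto)
  have rep_eq: "rep x = rep y" if xy: "v (x - y) < 1" for x y
  proof -
    have "v (x - w) < 1 \<longleftrightarrow> v (y - w) < 1" for w using tri[of x y w] tri[of y x w] xy vsym[of x y] by auto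
    from this this[of 0] show ?thesis unfolding rep_def by simp
  qed
  define B where "B = rep ` {x. v x \<le> 1}"
  have "B \<subseteq> rep ` F"
  proof
    fix b assume "b \<in> B"
    then obtain x where x: "v x \<le> 1" "b = rep x" by (auto simp: B_def)
    then obtain f where "f \<in> F" "v (x - f) < 1" using F(2) by blast
    then show "b \<in> rep ` F" using rep_eq x(2) by blast
  qed
  then have fin: "finite B" using F(1) finite_surj by blast
  have B0: "0 \<in> B" using rep[of 0] by (force simp: B_def)
  have B1: "v b \<le> 1" if "b \<in> B" for b
  proof -
    obtain x where x: "v x \<le> 1" "b = rep x" using \<open>b \<in> B\<close> unfolding B_def by blast
    show ?thesis using rep[OF x(1)] x(2) by simp
  qed
  have B2: "\<exists>b\<in>B. v (x - b) < 1" if "v x \<le> 1" for x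
    using rep[OF that] that unfolding B_def by blast
  have repB: "rep b = b" if b: "b \<in> B" for b
  proof -
    obtain x where x: "v x \<le> 1" "b = rep x" using b unfolding B_def by blast
    have "rep x = rep (rep x)" by (rule rep_eq) (use rep[OF x(1)] in blast)
    then show ?thesis unfolding x(2) by (rule sym)
  qed
  have B3: "b = b'" if "b \<in> B" "b' \<in> B" "v (b - b') < 1" for b b'
    using rep_eq[OF that(3)] unfolding repB[OF that(1)] repB[OF that(2)] .
  have r1: "rep (b + 1) \<in> B \<and> v (b + 1 - rep (b + 1)) < 1" if "b \<in> B" for b
  proof -
    have b1: "v (b + 1) \<le> 1" by (rule v_add_le[OF B1[OF that]]) simp
    show ?thesis using rep[OF b1] b1 unfolding B_def by blast
  qed
  have "inj_on (\<lambda>b. rep (b + 1)) B"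
  proof (rule inj_onI)
    fix b b' assume b: "b \<in> B" "b' \<in> B" and eq: "rep (b + 1) = rep (b' + 1)"
    have 1: "v (b + 1 - rep (b' + 1)) < 1" using r1[OF b(1)] unfolding eq by blast
    have 2: "v (rep (b' + 1) - (b' + 1)) < 1" using r1[OF b(2)] unfolding vsym[of "b' + 1" "rep (b' + 1)"] by blast
    have "v ((b + 1) - (b' + 1)) < 1" by (rule tri[OF 1 2])
    then show "b = b'" using B3[OF b] by simp
  qed
  then have bij: "bij_betw (\<lambda>b. rep (b + 1)) B B"
    by (intro bij_betw_imageI endo_inj_surj fin) (use r1 in blast)+
  have "of_nat (card B) = (\<Sum>b\<in>B. b + 1) - (\<Sum>b\<in>B. b)" by (simp add: sum.distrib)
  also have "(\<Sum>b\<in>B. b) = (\<Sum>b\<in>B. rep (b + 1))" by (rule sum.reindex_bij_betw[OF bij, symmetric])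
  also have "(\<Sum>b\<in>B. b + 1) - (\<Sum>b\<in>B. rep (b + 1)) = (\<Sum>b\<in>B. b + 1 - rep (b + 1))" by (rule sum_subtractf[symmetric])
  finally have "of_nat (card B) = (\<Sum>b\<in>B. b + 1 - rep (b + 1))" .
  moreover have "v (\<Sum>b\<in>A. b + 1 - rep (b + 1)) < 1" if "A \<subseteq> B" for A
    using finite_subset[OF that fin] that
  proof (induction A rule: finite_induct)
    case (insert a A)
    have "v (a + 1 - rep (a + 1)) < 1" using r1 insert.prems by blast
    moreover have "v (\<Sum>b\<in>A. b + 1 - rep (b + 1)) < 1" using insert by blast
    ultimately show ?case unfolding sum.insert[OF insert(1,2)] by (rule v_add_less)
  qed simp
  ultimately have "v (of_nat (card B)) < 1" by simp
  then have "residue_char v dvd card B" unfolding residue_char_def by (intro Gcd_dvd) simp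
  then show ?thesis using fin B0 B1 B2 B3 by (intro exI[of _ B]) blast
qed

end

section \<open>A common matrix model for the three groups\<close>

definition matM :: "'a::field set \<Rightarrow> ('a^2^2) monoid" where
  "matM \<Delta> = \<lparr>carrier = {A. det A \<in> \<Delta>}, monoid.mult = (**), one = mat 1\<rparr>"

text \<open>For \<open>Z = {1}\<close> this is the pro-p-Iwahori subgroup within the determinants in
  \<open>\<Delta>\<close>. Allowing all scalars in \<open>Z\<close> gives the preimage in GL2 of the
  one of PGL2.\<close>

definition matJ :: "('a::field \<Rightarrow> real) \<Rightarrow> 'a set \<Rightarrow> 'a set \<Rightarrow> ('a^2^2) set" where
  "matJ v \<Delta> Z = {A. det A \<in> \<Delta> \<and> (\<exists>z\<in>Z. \<exists>a b c d. v a < 1 \<and> v b \<le> 1 \<and> v c < 1 \<and> v d < 1 \<and>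
     A = m2 (z * (1 + a)) (z * b) (z * c) (z * (1 + d)))}"

definition matT :: "('a::field \<Rightarrow> real) \<Rightarrow> 'a set \<Rightarrow> 'a set \<Rightarrow> ('a^2^2) set" where
  "matT v \<Delta> Z = {A. det A \<in> \<Delta> \<and> (\<exists>z\<in>Z. \<exists>a d. v a = 1 \<and> v d = 1 \<and> A = m2 (z * a) 0 0 (z * d))}"

text \<open>The three alternatives are SL2, GL2, and GL2 as a cover of PGL2.\<close>

locale det_scalars = local_field v \<pi> for v :: "'a::field \<Rightarrow> real" and \<pi> +
  fixes \<Delta> Z :: "'a set"
  assumes \<Delta>_cases: "\<Delta> = {1} \<and> Z = {1} \<or> \<Delta> = - {0} \<and> Z = {1} \<or> \<Delta> = - {0} \<and> Z = - {0}"
begin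

text \<open>The group of the standard vertex, enlarged by the scalars in \<open>Z\<close>.\<close>

definition matQ :: "('a^2^2) set" where
  "matQ = {A. det A \<in> \<Delta> \<and> (\<exists>z\<in>Z. \<exists>B. integral B \<and> A = mat z ** B)}"

lemma \<Delta>_nz: "x \<in> \<Delta> \<Longrightarrow> x \<noteq> 0" and \<Delta>_1 [simp]: "1 \<in> \<Delta>"
  and \<Delta>_mult: "x \<in> \<Delta> \<Longrightarrow> y \<in> \<Delta> \<Longrightarrow> x * y \<in> \<Delta>"
  and \<Delta>_inverse: "x \<in> \<Delta> \<Longrightarrow> inverse x \<in> \<Delta>"
  and Z_nz: "z \<in> Z \<Longrightarrow> z \<noteq> 0" and Z_1 [simp]: "1 \<in> Z"
  and Z_mult: "z \<in> Z \<Longrightarrow> w \<in> Z \<Longrightarrow> z * w \<in> Z" and Z_inverse: "z \<in> Z \<Longrightarrow> inverse z \<in> Z"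
  and Z_\<Delta>: "z \<in> Z \<Longrightarrow> z \<in> \<Delta>"
  using \<Delta>_cases by auto

lemma \<Delta>_0 [simp]: "0 \<notin> \<Delta>"
  using \<Delta>_nz by blast

abbreviation "M \<equiv> matM \<Delta>"
abbreviation "J \<equiv> matJ v \<Delta> Z"
abbreviation "T \<equiv> matT v \<Delta> Z"

lemma M_iff [simp]: "A \<in> carrier M \<longleftrightarrow> det A \<in> \<Delta>"
  by (simp add: matM_def)

lemma M_mult [simp]: "A \<otimes>\<^bsub>M\<^esub> B = A ** B"
  by (simp add: matM_def)

lemma M_one [simp]: "\<one>\<^bsub>M\<^esub> = m2 1 0 0 1"
  by (simp add: matM_def mat_m2)

lemma det_M: "det A \<in> \<Delta> \<Longrightarrow> det B \<in> \<Delta> \<Longrightarrow> det (A ** B) \<in> \<Delta>"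
  by (simp add: det_mul \<Delta>_mult)

lemma m2_inverse:
  assumes "a * d - b * c \<noteq> (0 :: 'a)"
  shows "m2 (d / (a * d - b * c)) (- b / (a * d - b * c)) (- c / (a * d - b * c)) (a / (a * d - b * c)) ** m2 a b c d = m2 1 0 0 1"
  using assms by (simp add: diff_divide_distrib[symmetric] mult.commute)

lemma group_M: "Group.group M"
proof (rule groupI)
  fix A assume "A \<in> carrier M"
  then show "\<exists>B\<in>carrier M. B \<otimes>\<^bsub>M\<^esub> A = \<one>\<^bsub>M\<^esub>"
  proof (cases A rule: m2_cases)
    case A: (m2 a b c d)
    define D where "D = a * d - b * c"
    have D: "D \<in> \<Delta>" "D \<noteq> 0" using \<open>A \<in> carrier M\<close> by (auto simp: A D_def)
    let ?B = "m2 (d / D) (- b / D) (- c / D) (a / D)"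
    have e: "?B ** A = m2 1 0 0 1" unfolding D_def A by (rule m2_inverse) (use D in \<open>simp add: D_def\<close>)
    have "det ?B * det A = det (m2 1 0 0 1 :: 'a^2^2)" by (simp only: det_mul[symmetric] e)
    then have "det ?B * det A = 1" by (simp only: m2_det mult_1_right mult_zero_right diff_zero)
    then have "det ?B = inverse (det A)" by (metis inverse_unique mult.commute)
    then have "det ?B \<in> \<Delta>" using \<Delta>_inverse[of "det A"] D(1) by (simp only: A m2_det D_def)
    then show ?thesis using e by (intro bexI[of _ ?B]) simp_all
  qed
qed (simp_all add: det_M matrix_mul_assoc, simp_all add: mat_m2[symmetric])

sublocale M: Group.group M by (rule group_M)

lemma inv_eqI: "det A \<in> \<Delta> \<Longrightarrow> det B \<in> \<Delta> \<Longrightarrow> A ** B = m2 1 0 0 1 \<Longrightarrow> inv\<^bsub>M\<^esub> B = A"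
  by (rule M.inv_equality) simp_all

lemma inv_m2:
  assumes "a * d - b * c \<in> \<Delta>"
  shows "inv\<^bsub>M\<^esub> (m2 a b c d) = m2 (d / (a * d - b * c)) (- b / (a * d - b * c)) (- c / (a * d - b * c)) (a / (a * d - b * c))"
proof -
  have e: "m2 (d / (a * d - b * c)) (- b / (a * d - b * c)) (- c / (a * d - b * c)) (a / (a * d - b * c)) ** m2 a b c d = m2 1 0 0 1"
    (is "?B ** _ = _") by (rule m2_inverse) (use assms in auto)
  have "det ?B * (a * d - b * c) = 1" using arg_cong[OF e, of det] by (simp only: det_mul m2_det) simp
  then have "det ?B = inverse (a * d - b * c)" by (metis inverse_unique mult.commute)
  then show ?thesis using assms \<Delta>_inverse e by (intro inv_eqI) simp_all
qed

lemma inv_diag: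
  assumes "z * a * (z * d) \<in> \<Delta>"
  shows "inv\<^bsub>M\<^esub> (m2 (z * a) 0 0 (z * d)) = m2 (inverse z * inverse a) 0 0 (inverse z * inverse d)"
proof -
  have nz: "z \<noteq> 0" "a \<noteq> 0" "d \<noteq> 0" using assms by auto
  show ?thesis using inv_m2[of "z * a" "z * d" 0 0] assms nz by (simp add: field_simps)
qed

lemma JE:
  assumes "A \<in> J"
  obtains z a b c d where "z \<in> Z" "z \<noteq> 0" "v a < 1" "v b \<le> 1" "v c < 1" "v d < 1"
    "A = m2 (z * (1 + a)) (z * b) (z * c) (z * (1 + d))" "det A \<in> \<Delta>" "1 + a \<noteq> 0" "1 + d \<noteq> 0"
    "v (1 + a) = 1" "v (1 + d) = 1"
proof -
  have one: "v (1 + x) = 1 \<and> 1 + x \<noteq> 0" if "v x < 1" for x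
    using v_add_eq(1)[of x 1] that by auto
  obtain z a b c d where h: "z \<in> Z" "v a < 1" "v b \<le> 1" "v c < 1" "v d < 1"
    "A = m2 (z * (1 + a)) (z * b) (z * c) (z * (1 + d))" "det A \<in> \<Delta>"
    using assms unfolding matJ_def mem_Collect_eq by (elim conjE bexE exE)
  show ?thesis
    by (rule that[of z a b c d]) (use h Z_nz one[OF h(2)] one[OF h(5)] in simp_all)
qed

lemma JI:
  assumes "z \<in> Z" "v a < 1" "v b \<le> 1" "v c < 1" "v d < 1" "det A \<in> \<Delta>"
    "A = m2 (z * (1 + a)) (z * b) (z * c) (z * (1 + d))"
  shows "A \<in> J"
  using assms unfolding matJ_def by blast

lemma TE:
  assumes "A \<in> T"
  obtains z a d where "z \<in> Z" "z \<noteq> 0" "v a = 1" "v d = 1" "a \<noteq> 0" "d \<noteq> 0" "A = m2 (z * a) 0 0 (z * d)" "det A \<in> \<Delta>"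
proof -
  have nz: "x \<noteq> 0" if "v x = 1" for x using that by auto
  obtain z a d where h: "z \<in> Z" "v a = 1" "v d = 1" "A = m2 (z * a) 0 0 (z * d)" "det A \<in> \<Delta>"
    using assms unfolding matT_def mem_Collect_eq by (elim conjE bexE exE)
  show ?thesis by (rule that[of z a d]) (use h Z_nz nz in simp_all)
qed

lemma TI: "z \<in> Z \<Longrightarrow> v a = 1 \<Longrightarrow> v d = 1 \<Longrightarrow> det A \<in> \<Delta> \<Longrightarrow> A = m2 (z * a) 0 0 (z * d) \<Longrightarrow> A \<in> T"
  unfolding matT_def by blast

lemma QE:
  assumes "A \<in> matQ"
  obtains z a b c d where "z \<in> Z" "z \<noteq> 0" "integral (m2 a b c d)"
    "A = m2 (z * a) (z * b) (z * c) (z * d)" "det A \<in> \<Delta>"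
proof -
  obtain z B where z: "z \<in> Z" "integral B" "A = mat z ** B" "det A \<in> \<Delta>" using assms unfolding matQ_def by blast
  obtain a b c d where B: "B = m2 a b c d" by (rule m2_cases)
  show ?thesis by (rule that[of z a b c d]) (use z B Z_nz in \<open>auto simp: mat_m2\<close>)
qed

lemma QI: "z \<in> Z \<Longrightarrow> integral B \<Longrightarrow> det A \<in> \<Delta> \<Longrightarrow> A = mat z ** B \<Longrightarrow> A \<in> matQ"
  unfolding matQ_def by blast

lemma mat_mat: "mat z ** (A :: 'a^2^2) ** (mat w ** B) = mat (z * w) ** (A ** B :: 'a^2^2)"
  by (cases A rule: m2_cases; cases B rule: m2_cases) (simp add: mat_m2 algebra_simps)

lemma integral_mult: "integral A \<Longrightarrow> integral B \<Longrightarrow> integral (A ** B)"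
  unfolding integral_def by (simp add: det_mul mult nrm_integral_left integral_def)

lemma inv_M: "det A \<in> \<Delta> \<Longrightarrow> det (inv\<^bsub>M\<^esub> A) \<in> \<Delta>"
  using M.inv_closed[of A] by simp

lemma subgroup_Q: "subgroup matQ M"
proof (rule M.subgroupI)
  show "matQ \<subseteq> carrier M" by (auto simp: matQ_def)
  have "m2 1 0 0 1 \<in> matQ" by (rule QI[of 1 "m2 1 0 0 1"]) (simp_all add: integral_m2 mat_m2)
  then show "matQ \<noteq> {}" by blast
  fix A assume A: "A \<in> matQ"
  then obtain z B where z: "z \<in> Z" "integral B" "A = mat z ** B" "det A \<in> \<Delta>" unfolding matQ_def by blast
  obtain C where C: "integral C" "C ** B = mat 1" using integral_inv_ex[OF z(2)] by blast
  have e: "mat (inverse z) ** C ** A = m2 1 0 0 1" unfolding z(3) mat_mat C(2) using Z_nz[OF z(1)] by (simp add: mat_m2)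
  have "det (mat (inverse z) ** C) * det A = 1" using arg_cong[OF e, of det] by (simp only: det_mul m2_det) simp
  then have "det (mat (inverse z) ** C) \<in> \<Delta>" using \<Delta>_inverse[OF z(4)] by (metis inverse_unique mult.commute)
  moreover from this have "inv\<^bsub>M\<^esub> A = mat (inverse z) ** C" using z(4) e by (intro inv_eqI)
  ultimately show "inv\<^bsub>M\<^esub> A \<in> matQ" using Z_inverse z(1) C(1) by (intro QI[of "inverse z" C]) simp_all
  fix A' assume "A' \<in> matQ"
  then obtain z' B' where z': "z' \<in> Z" "integral B'" "A' = mat z' ** B'" "det A' \<in> \<Delta>" unfolding matQ_def by blast
  show "A \<otimes>\<^bsub>M\<^esub> A' \<in> matQ"
    by (rule QI[of "z * z'" "B ** B'"]) (use z z' in \<open>simp_all add: Z_mult integral_mult det_M mat_mat[symmetric]\<close>)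
qed

lemma v_inverse_one: "v (1 + a) = 1 \<Longrightarrow> v a < 1 \<Longrightarrow> v (inverse (1 + a) - 1) < 1"
proof -
  assume a: "v (1 + a) = 1" "v a < 1"
  then have "1 + a \<noteq> 0" by auto
  then have "inverse (1 + a) - 1 = - a / (1 + a)" by (simp add: field_simps)
  then show ?thesis using a by (simp add: v_divide)
qed

lemma JI':
  assumes "z \<in> Z" "A = m2 (z * a) (z * b) (z * c) (z * d)" "det A \<in> \<Delta>"
    "v (a - 1) < 1" "v b \<le> 1" "v c < 1" "v (d - 1) < 1"
  shows "A \<in> J"
  by (rule JI[of z "a - 1" b c "d - 1"]) (use assms in simp_all)

lemma subgroup_J: "subgroup J M"
proof (rule M.subgroupI)
  show "J \<subseteq> carrier M" by (auto simp: matJ_def)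
  have "m2 1 0 0 1 \<in> J" by (rule JI[of 1 0 0 0 0]) simp_all
  then show "J \<noteq> {}" by blast
  fix A assume "A \<in> J"
  then show "inv\<^bsub>M\<^esub> A \<in> J"
  proof (cases rule: JE)
    case A: (1 z a b c d)
    define D where "D = (1 + a) * (1 + d) - b * c"
    have bc: "v (b * c) < 1" using A by (intro v_mult_less2) simp_all
    have D: "v D = 1" unfolding D_def using v_add_eq(1)[of "- (b * c)" "(1 + a) * (1 + d)"] bc A by (simp add: mult)
    then have Dn: "D \<noteq> 0" by auto
    have dA: "z * (1 + a) * (z * (1 + d)) - z * b * (z * c) = z * z * D" by (simp add: D_def algebra_simps)
    have "z * (1 + a) * (z * (1 + d)) - z * b * (z * c) \<in> \<Delta>" using A by simp
    note i = inv_m2[OF this, folded A(7), unfolded dA]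
    have one: "v ((1 + x) / D - 1) < 1" if "v x < 1" for x
    proof -
      have "(1 + x) / D - 1 = (x - (a + d + a * d - b * c)) / D" using Dn by (simp add: D_def field_simps)
      moreover have "v (x - (a + d + a * d - b * c)) < 1"
        using A that bc by (intro v_diff_less v_add_less v_mult_less2) simp_all
      ultimately show ?thesis using D by (simp add: v_divide)
    qed
    have e: "inv\<^bsub>M\<^esub> A = m2 (inverse z * ((1 + d) / D)) (inverse z * (- b / D)) (inverse z * (- c / D)) (inverse z * ((1 + a) / D))"
      unfolding i m2_eq using A(2) Dn by (simp add: field_simps)
    show ?thesis
      by (rule JI'[OF _ e]) (use one[OF A(3)] one[OF A(6)] A(4,5) D inv_M[OF A(8)] Z_inverse[OF A(1)] in \<open>simp_all add: v_divide\<close>)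
  qed
  fix A' assume A': "A' \<in> J"
  have "A ** A' \<in> J" using \<open>A \<in> J\<close>
  proof (cases rule: JE)
    case A: (1 z a b c d)
    show ?thesis using A'
    proof (cases rule: JE)
      case B: (1 z' a' b' c' d')
      show ?thesis
      proof (rule JI[of "z * z'" "a + a' + a * a' + b * c'" "(1 + a) * b' + b * (1 + d')" "c * (1 + a') + (1 + d) * c'" "c * b' + d + d' + d * d'", OF _ _ _ _ _ det_M[OF A(8) B(8)]])
        show "v (a + a' + a * a' + b * c') < 1" using A B by (intro v_add_less v_mult_less2) simp_all
        show "v ((1 + a) * b' + b * (1 + d')) \<le> 1" using A B by (intro v_add_le[of "(1 + a) * b'"]) (simp_all add: mult)
        show "v (c * (1 + a') + (1 + d) * c') < 1" using A B by (intro v_add_less[of "c * (1 + a')"]) (simp_all add: mult)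
        have "v (c * b') < 1" using A B by (intro v_mult_less1) simp_all
        then show "v (c * b' + d + d' + d * d') < 1" using A B by (intro v_add_less v_mult_less2[of d d']) simp_all
      qed (use A(1,7) B(1,7) Z_mult in \<open>simp_all add: algebra_simps\<close>)
    qed
  qed
  then show "A \<otimes>\<^bsub>M\<^esub> A' \<in> J" by simp
qed

lemma subgroup_T: "subgroup T M"
proof (rule M.subgroupI)
  show "T \<subseteq> carrier M" by (auto simp: matT_def)
  have "m2 1 0 0 1 \<in> T" by (rule TI[of 1 1 1]) simp_all
  then show "T \<noteq> {}" by blast
  fix A assume "A \<in> T"
  then show "inv\<^bsub>M\<^esub> A \<in> T"
  proof (cases rule: TE)
    case A: (1 z a d)
    have i: "inv\<^bsub>M\<^esub> A = m2 (inverse z * inverse a) 0 0 (inverse z * inverse d)"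
      using inv_diag[of z a d] A by simp
    show ?thesis by (rule TI[of "inverse z" "inverse a" "inverse d"]) (use A i inv_M[OF A(8)] Z_inverse in \<open>simp_all add: v_inverse\<close>)
  qed
  fix A' assume A': "A' \<in> T"
  have "A ** A' \<in> T" using \<open>A \<in> T\<close>
  proof (cases rule: TE)
    case A: (1 z a d)
    show ?thesis using A'
    proof (cases rule: TE)
      case B: (1 z' a' d')
      have det: "det (A ** A') \<in> \<Delta>" by (rule det_M[OF A(8) B(8)])
      show ?thesis by (rule TI[of "z * z'" "a * a'" "d * d'", OF _ _ _ det]) (use A(1-7) B(1-7) Z_mult in \<open>simp_all add: mult\<close>)
    qed
  qed
  then show "A \<otimes>\<^bsub>M\<^esub> A' \<in> T" by simp
qed

definition s0 :: "'a^2^2" where "s0 = m2 0 1 (- 1) 0"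

lemma s0_M [simp]: "det s0 \<in> \<Delta>"
  by (simp add: s0_def)

lemma inv_s0: "inv\<^bsub>M\<^esub> s0 = m2 0 (- 1) 1 0"
  by (rule inv_eqI) (simp_all add: s0_def)

lemma J_M: "A \<in> J \<Longrightarrow> det A \<in> \<Delta>" and T_M: "A \<in> T \<Longrightarrow> det A \<in> \<Delta>" and Q_M: "A \<in> matQ \<Longrightarrow> det A \<in> \<Delta>"
  by (simp_all add: matJ_def matT_def matQ_def)

lemma J_Q: "A \<in> J \<Longrightarrow> A \<in> matQ"
proof (elim JE)
  fix z a b c d assume A: "z \<in> Z" "v a < 1" "v b \<le> 1" "v c < 1" "v d < 1"
    "A = m2 (z * (1 + a)) (z * b) (z * c) (z * (1 + d))" "det A \<in> \<Delta>" "v (1 + a) = 1" "v (1 + d) = 1"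
  have "v (b * c) < 1" using A by (intro v_mult_less2) simp_all
  then have "v ((1 + a) * (1 + d) - b * c) = 1" using v_add_eq(1)[of "- (b * c)" "(1 + a) * (1 + d)"] A by (simp add: mult)
  then show ?thesis by (intro QI[of z "m2 (1 + a) b c (1 + d)"]) (use A in \<open>simp_all add: integral_m2 mat_m2\<close>)
qed

lemma T_Q: "A \<in> T \<Longrightarrow> A \<in> matQ"
proof (elim TE)
  fix z a d assume A: "z \<in> Z" "v a = 1" "v d = 1" "A = m2 (z * a) 0 0 (z * d)" "det A \<in> \<Delta>"
  show ?thesis by (rule QI[of z "m2 a 0 0 d"]) (use A in \<open>simp_all add: integral_m2 mat_m2 mult\<close>)
qed

lemma T_norm: "t \<in> T \<Longrightarrow> j \<in> J \<Longrightarrow> t ** j ** inv\<^bsub>M\<^esub> t \<in> J"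
proof -
  assume t: "t \<in> T" and j: "j \<in> J"
  have det: "det (t ** j ** inv\<^bsub>M\<^esub> t) \<in> \<Delta>" using t j by (intro det_M inv_M T_M J_M)
  show ?thesis using t
  proof (cases rule: TE)
    case t: (1 z \<alpha> \<delta>)
    have i: "inv\<^bsub>M\<^esub> t = m2 (inverse z * inverse \<alpha>) 0 0 (inverse z * inverse \<delta>)"
      using inv_diag[of z \<alpha> \<delta>] t by simp
    show ?thesis using j
    proof (cases rule: JE)
      case j: (1 w a b c d)
      have e: "t ** j ** inv\<^bsub>M\<^esub> t = m2 (w * (1 + a)) (w * (b * \<alpha> / \<delta>)) (w * (c * \<delta> / \<alpha>)) (w * (1 + d))"
        unfolding i unfolding t(7) j(7) m2_mult m2_eq using t(2,5,6) by (simp add: field_simps)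
      show ?thesis
        by (rule JI[OF j(1) j(3) _ _ j(6) det e]) (use t(3,4) j(4,5) in \<open>simp_all add: v_divide mult\<close>)
    qed
  qed
qed

end

section \<open>The rank one structure at the standard vertex\<close>

locale matrix_cover = det_scalars v \<pi> \<Delta> Z + hecke_cover "matM \<Delta>" G I F cl "matJ v \<Delta> Z"
  for v :: "'a::field \<Rightarrow> real" and \<pi> and \<Delta> Z :: "'a set" and G :: "('g, 'b) monoid_scheme"
    and I :: "'g set" and F :: "'k::field itself" and cl :: "'a^2^2 \<Rightarrow> 'g" +
  fixes reps :: "'a set"
  assumes reps_finite: "finite reps" and reps_0: "0 \<in> reps" and reps_le: "b \<in> reps \<Longrightarrow> v b \<le> 1"
    and reps_ex: "v x \<le> 1 \<Longrightarrow> \<exists>b\<in>reps. v (x - b) < 1"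
    and reps_eq: "b \<in> reps \<Longrightarrow> b' \<in> reps \<Longrightarrow> v (b - b') < 1 \<Longrightarrow> b = b'"
    and reps_card: "of_nat (card reps) = (0 :: 'k)"
begin

definition un :: "'a \<Rightarrow> 'a^2^2" where "un b = m2 1 b 0 1"

definition R0 :: "('a^2^2) set" where "R0 = un ` reps"

text \<open>With \<open>b\<close> the off-diagonal entry of \<open>u\<close>, the diagonal part of
  \<open>u ** s0\<close> written as lower unipotent times diagonal times upper unipotent.\<close>

definition tau0 :: "'a^2^2 \<Rightarrow> 'a^2^2" where
  "tau0 u = m2 (- (u $ 1 $ 2)) 0 0 (- inverse (u $ 1 $ 2))"

definition recip :: "'a \<Rightarrow> 'a" where "recip b = (SOME k. k \<in> reps \<and> v (inverse b - k) < 1)"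

text \<open>Conjugation by \<open>s0\<close> interchanges the diagonal entries \<open>- b\<close>
  and \<open>- inverse b\<close> of \<open>tau0\<close>; modulo \<open>J\<close> this replaces
  \<open>b\<close> by the representative of its inverse.\<close>

definition kappa0 :: "'a^2^2 \<Rightarrow> 'a^2^2" where "kappa0 u = un (recip (u $ 1 $ 2))"

lemma un_12 [simp]: "un b $ 1 $ 2 = b"
  by (simp add: un_def)

lemma un_eq [simp]: "un b = un b' \<longleftrightarrow> b = b'"
  by (simp add: un_def)

lemma un_J: "v b \<le> 1 \<Longrightarrow> un b \<in> J"
  by (rule JI[of 1 0 b 0 0]) (simp_all add: un_def)

lemma reps_unit: "b \<in> reps \<Longrightarrow> b \<noteq> 0 \<Longrightarrow> v b = 1"
  using reps_eq[of b 0] reps_0 reps_le[of b] by fastforce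

lemma recip:
  assumes "b \<in> reps" "b \<noteq> 0"
  shows "recip b \<in> reps" "v (inverse b - recip b) < 1" "recip b \<noteq> 0" "recip (recip b) = b"
proof -
  have ex: "\<exists>k. k \<in> reps \<and> v (inverse c - k) < 1" if "v c = 1" for c
    using reps_ex[of "inverse c"] that by (auto simp: v_inverse)
  have b: "v b = 1" by (rule reps_unit[OF assms])
  show k: "recip b \<in> reps" and l: "v (inverse b - recip b) < 1"
    using someI_ex[OF ex[OF b], folded recip_def] by blast+
  show nz: "recip b \<noteq> 0" using l b by (auto simp: v_inverse)
  have kv: "v (recip b) = 1" by (rule reps_unit[OF k nz])
  have "inverse (recip b) - b = b * (inverse b - recip b) / recip b" using nz assms(2) by (simp add: field_simps)
  then have l2: "v (inverse (recip b) - b) < 1" using l b kv by (simp add: v_divide mult)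
  have k2: "recip (recip b) \<in> reps \<and> v (inverse (recip b) - recip (recip b)) < 1"
    using someI_ex[OF ex[OF kv], folded recip_def] .
  have "v ((inverse (recip b) - b) - (inverse (recip b) - recip (recip b))) < 1"
    by (rule v_diff_less[OF l2]) (use k2 in blast)
  then have "v (recip (recip b) - b) < 1" by simp
  then show "recip (recip b) = b" using reps_eq k2 assms(1) by blast
qed

lemma s0_conj: "inv\<^bsub>M\<^esub> s0 ** m2 a b c d ** s0 = m2 d (- c) (- b) a"
  unfolding inv_s0 by (simp add: s0_def)

lemma s0_conj': "s0 ** m2 a b c d ** inv\<^bsub>M\<^esub> s0 = m2 d (- c) (- b) a"
  unfolding inv_s0 by (simp add: s0_def)

lemma det_conj: "det A \<in> \<Delta> \<Longrightarrow> det (inv\<^bsub>M\<^esub> s0 ** A ** s0) \<in> \<Delta>"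
  by (intro det_M inv_M s0_M)

lemma s0_Q: "s0 \<in> matQ"
  by (rule QI[of 1 s0]) (simp_all add: s0_def integral_m2 mat_m2)

text \<open>If the upper left entry is a unit, up to the scalar, elimination gives lower unipotent
  times diagonal times upper unipotent. Otherwise both antidiagonal entries are units and
  \<open>s0\<close> can be split off on the left.\<close>

lemma Q_cases0:
  assumes p: "p \<in> matQ"
  shows "(\<exists>t\<in>T. \<exists>j\<in>J. p = s0 ** t ** j) \<or> (\<exists>i\<in>J. \<exists>t\<in>T. \<exists>j\<in>J. p = s0 ** i ** inv\<^bsub>M\<^esub> s0 ** t ** j)"
  using p
proof (cases rule: QE)
  case h: (1 z a b c d)
  have I: "v a \<le> 1" "v b \<le> 1" "v c \<le> 1" "v d \<le> 1" "v (a * d - b * c) = 1" using h(3) by (auto simp: integral_m2)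
  have dp: "z * z * (a * d - b * c) \<in> \<Delta>" using h(5) by (simp add: h(4) algebra_simps)
  show ?thesis
  proof (cases "v a = 1")
    case True
    then have an: "a \<noteq> 0" by auto
    let ?D = "a * d - b * c"
    let ?t = "m2 (z * a) 0 0 (z * (?D / a))" and ?j = "un (b / a)" and ?i = "un (- c / a)"
    have aux: "z * a * (z * (x / a)) = z * z * x" for x using an by (simp add: field_simps)
    have dt: "det ?t \<in> \<Delta>" using dp by (simp only: m2_det aux mult_zero_left diff_zero)
    have t: "?t \<in> T" by (rule TI[of z a "?D / a", OF _ _ _ dt]) (use h(1) True I(5) in \<open>simp_all add: v_divide\<close>)
    have j: "?j \<in> J" "?i \<in> J" by (rule un_J, simp add: v_divide True I)+
    have "p = s0 ** ?i ** inv\<^bsub>M\<^esub> s0 ** ?t ** ?j"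
      unfolding un_def s0_conj' h(4) using an by (simp add: field_simps)
    then show ?thesis using t j by blast
  next
    case False
    then have a: "v a < 1" using I(1) by simp
    have ad: "v (a * d) < 1" using a I(4) by (rule v_mult_less1)
    have bce: "a * d + - (a * d - b * c) = b * c" by simp
    have "v (a * d + - (a * d - b * c)) = v (- (a * d - b * c))"
      by (rule v_add_eq(2)) (use ad I(5) in \<open>simp only: v_minus\<close>)
    then have "v (b * c) = 1" by (simp only: bce v_minus I(5))
    then have "v b * v c = 1" by (simp add: mult)
    then have bc: "v b = 1" "v c = 1" using I(2,3) nonneg[of b] nonneg[of c]
      by (metis mult_left_le mult_right_le_one_le antisym mult.commute)+
    then have nz: "b \<noteq> 0" "c \<noteq> 0" by auto
    let ?t = "m2 (z * - c) 0 0 (z * b)" and ?j = "m2 (1 * (1 + 0)) (1 * (d / c)) (1 * (a / b)) (1 * (1 + 0))"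
    let ?D = "a * d - b * c"
    let ?t = "m2 (z * - c) 0 0 (z * (- ?D / c))"
    let ?i = "m2 1 (d / c) (- a * c / ?D) (- b * c / ?D)"
    have Dn: "?D \<noteq> 0" using I(5) by auto
    have aux: "z * - c * (z * (- x / c)) = z * z * x" for x using nz by (simp add: field_simps)
    have dt: "det ?t \<in> \<Delta>" using dp by (simp only: m2_det aux mult_zero_left diff_zero)
    have vD: "v (- ?D / c) = 1" by (simp only: v_divide v_minus I(5) bc div_by_1)
    have t: "?t \<in> T" by (rule TI[of z "- c" "- ?D / c", OF h(1) _ vD dt]) (use bc in simp_all)
    have e: "- b * c / ?D = 1 + (- (a * d) / ?D)" using Dn by (simp add: field_simps)
    have "det (m2 1 (d / c) (- a * c / x) (- b * c / x)) = (a * d - b * c) / x" if "x \<noteq> 0" for x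
      using that nz by (simp add: diff_divide_distrib)
    from this[OF Dn] have di: "det ?i = 1" unfolding divide_self[OF Dn] .
    have i: "?i \<in> J"
    proof (rule JI[of 1 0 "d / c" "- a * c / ?D" "- (a * d) / ?D"])
      show "v (d / c) \<le> 1" using I(4) bc by (simp add: v_divide)
      show "v (- a * c / ?D) < 1" using a bc by (simp only: v_divide I(5) div_by_1 mult v_minus mult_1_right)
      show "v (- (a * d) / ?D) < 1" using ad by (simp only: v_divide I(5) div_by_1 v_minus)
      show "det ?i \<in> \<Delta>" unfolding di by (rule \<Delta>_1)
      show "?i = m2 (1 * (1 + 0)) (1 * (d / c)) (1 * (- a * c / ?D)) (1 * (1 + - (a * d) / ?D))"
        by (simp only: e mult_1_left add_0_right)
    qed simp_all
    have "m2 (z * a) (z * b) (z * c) (z * d) =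
        s0 ** m2 (z * - c) 0 0 (z * (- x / c)) ** m2 1 (d / c) (- a * c / x) (- b * c / x)" if "x \<noteq> 0" for x
      unfolding s0_def using nz that by simp
    from this[OF Dn] have "p = s0 ** ?t ** ?i" by (simp only: h(4))
    then show ?thesis using t i by blast
  qed
qed

text \<open>The lower left entry of the product is a scalar times a unit, whereas elements of
  \<open>T\<close> are diagonal.\<close>

lemma disjoint0:
  assumes "i \<in> J" "j \<in> J"
  shows "i ** s0 ** j \<notin> T"
  using assms(1)
proof (cases rule: JE)
  case i: (1 z a b c d)
  show ?thesis using assms(2)
  proof (cases rule: JE)
    case j: (1 z' a' b' c' d')
    have "v (- ((1 + d) * (1 + a')) + c * c') = 1"
    proof -
      have "v (c * c') < 1" using i j by (intro v_mult_less2) simp_all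
      then show ?thesis using v_add_eq(1)[of "c * c'" "- ((1 + d) * (1 + a'))"] i j by (simp only: v_minus mult)
    qed
    then have nz: "- ((1 + d) * (1 + a')) + c * c' \<noteq> 0" by auto
    have "(i ** s0 ** j) $ 2 $ 1 = z * z' * (- ((1 + d) * (1 + a')) + c * c')"
      by (simp add: i(7) j(7) s0_def algebra_simps)
    then have "(i ** s0 ** j) $ 2 $ 1 \<noteq> 0" using nz i(2) j(2) by simp
    then show ?thesis by (auto elim!: TE)
  qed
qed

text \<open>Subtracting from \<open>b / (1 + d)\<close> the representative of its class leaves a
  lower left entry of \<open>?j\<close> in the maximal ideal.\<close>

lemma R_ex0:
  assumes "i \<in> J"
  shows "\<exists>u\<in>R0. \<exists>j\<in>J. i ** s0 = u ** s0 ** j"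
  using assms
proof (cases rule: JE)
  case i: (1 z a b c d)
  obtain k where k: "k \<in> reps" "v (b / (1 + d) - k) < 1" using reps_ex[of "b / (1 + d)"] i by (auto simp: v_divide)
  have "k * (1 + d) - b = - (b / (1 + d) - k) * (1 + d)" using i by (simp add: field_simps)
  then have kb: "v (k * (1 + d) - b) < 1" using k i by (simp only: mult v_minus)
  let ?j = "m2 (z * (1 + d)) (z * - c) (z * (k * (1 + d) - b)) (z * (1 + (a - k * c)))"
  have "v (k * c) < 1" using reps_le[OF k(1)] i by (intro v_mult_less2)
  then have ak: "v (a - k * c) < 1" using i by (intro v_diff_less)
  have "det ?j = det i" by (simp add: i(7) algebra_simps)
  then have j: "?j \<in> J" by (intro JI[of z d "- c" "k * (1 + d) - b" "a - k * c", OF i(1) i(6) _ kb ak]) (use i(5,8) in simp_all)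
  have "i ** s0 = un k ** s0 ** ?j" by (simp add: i(7) un_def s0_def algebra_simps)
  then show ?thesis using k j by (auto simp: R0_def)
qed

text \<open>The quotient of \<open>u ** s0\<close> by \<open>u' ** s0\<close> is lower unipotent.
  Comparing its entries with those of \<open>t ** j\<close> shows that \<open>b\<close> and
  \<open>b'\<close> are congruent and that \<open>t\<close> is a scalar from \<open>Z\<close> times
  a diagonal congruent to 1.\<close>

lemma R_unique0:
  assumes u: "u \<in> R0" "u' \<in> R0" and t: "t \<in> T" and j: "j \<in> J" and eq: "u ** s0 = u' ** s0 ** t ** j"
  shows "u = u' \<and> t \<in> J"
proof -
  obtain b b' where b: "b \<in> reps" "u = un b" and b': "b' \<in> reps" "u' = un b'" using u by (auto simp: R0_def)
  show ?thesis using t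
  proof (cases rule: TE)
    case t: (1 z \<alpha> \<delta>)
    show ?thesis using j
    proof (cases rule: JE)
      case j: (1 w a k c d)
      have "m2 1 0 (b' - b) 1 = t ** j"
      proof -
        have "m2 1 0 (b' - b) 1 = m2 0 (- 1) 1 0 ** m2 1 (- b') 0 1 ** (u ** s0)" by (simp add: b b' un_def s0_def)
        also have "\<dots> = t ** j" unfolding eq by (simp add: b b' un_def s0_def t(7) j(7))
        finally show ?thesis .
      qed
      then have e: "z * \<alpha> * (w * (1 + a)) = 1" "z * \<delta> * (w * (1 + d)) = 1" "z * \<delta> * (w * c) = b' - b"
        by (simp_all add: t(7) j(7))
      have "v z * v w = 1" using arg_cong[OF e(2), of v] t j by (simp add: mult)
      then have "v (b' - b) < 1" using arg_cong[OF e(3), of v] t j by (simp add: mult mult.assoc[symmetric])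
      then have "b' = b" using reps_eq b b' by blast
      have r: "z * \<alpha> = inverse w * (1 + (inverse (1 + a) - 1))" "z * \<delta> = inverse w * (1 + (inverse (1 + d) - 1))"
      proof -
        have "z * \<alpha> = inverse (w * (1 + a))" "z * \<delta> = inverse (w * (1 + d))"
          using e(1,2) by (metis inverse_unique mult.commute)+
        then show "z * \<alpha> = inverse w * (1 + (inverse (1 + a) - 1))" "z * \<delta> = inverse w * (1 + (inverse (1 + d) - 1))"
          by simp_all
      qed
      have "t \<in> J"
        by (rule JI[OF Z_inverse[OF j(1)] v_inverse_one[OF j(11,3)] _ _ v_inverse_one[OF j(12,6)] t(8), of 0 0])
          (simp_all only: t(7) r mult_zero_right v_0 zero_le_one zero_less_one)
      then show ?thesis using \<open>b' = b\<close> b b' by simp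
    qed
  qed
qed

lemma s_T0: "t \<in> T \<Longrightarrow> inv\<^bsub>M\<^esub> s0 ** t ** s0 \<in> T"
proof -
  assume t: "t \<in> T"
  have d: "det (inv\<^bsub>M\<^esub> s0 ** t ** s0) \<in> \<Delta>" by (rule det_conj[OF T_M[OF t]])
  show ?thesis using t
  proof (cases rule: TE)
    case h: (1 z a d)
    show ?thesis by (rule TI[of z d a]) (use h d in \<open>simp_all add: s0_conj\<close>)
  qed
qed

lemma s_TJ0:
  assumes t: "t \<in> T" and j: "inv\<^bsub>M\<^esub> s0 ** t ** s0 \<in> J"
  shows "t \<in> J"
  using t
proof (cases rule: TE)
  case t: (1 z \<alpha> \<delta>)
  show ?thesis using j
  proof (cases rule: JE)
    case j: (1 w a b c d)
    have "m2 (z * \<delta>) 0 0 (z * \<alpha>) = m2 (w * (1 + a)) (w * b) (w * c) (w * (1 + d))"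
      using j(7) by (simp add: t(7) s0_conj del: m2_eq)
    then show ?thesis by (intro JI[OF j(1) j(6) _ _ j(3), of 0 0]) (use t(7,8) in simp_all)
  qed
qed

text \<open>An element of \<open>J\<close> whose conjugate by \<open>s0\<close> is again in
  \<open>J\<close> has its upper right entry in the maximal ideal too; up to scalars it reduces to
  the identity, and this property survives conjugation. The proof writes out the entries of the
  conjugate.\<close>

lemma normal0:
  assumes i: "i \<in> J" and x: "x \<in> J" and c: "inv\<^bsub>M\<^esub> s0 ** x ** s0 \<in> J"
  shows "inv\<^bsub>M\<^esub> s0 ** (i ** x ** inv\<^bsub>M\<^esub> i) ** s0 \<in> J"
  using i
proof (cases rule: JE)
  case i: (1 w a b c' d)
  show ?thesis using x
  proof (cases rule: JE)
    case x: (1 z p q r t)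
    have q: "v q < 1" using c
    proof (cases rule: JE)
      case h: (1 y a1 b1 c1 d1)
      have "z * (1 + t) = y * (1 + a1)" "- (z * q) = y * c1" using h(7) by (simp_all add: x(7) s0_conj)
      note zq = this
      have a: "v z = v y" using arg_cong[OF zq(1), of v] x(12) h(11) by (simp only: mult mult_1_right)
      have "v z * v q = v y * v c1" using arg_cong[OF zq(2), of v] by (simp only: v_minus mult)
      then have "v z * v q = v z * v c1" unfolding a[symmetric] .
      then have "v q = v c1" using v_pos[OF x(2)] by (metis less_irrefl mult_cancel_left)
      then show ?thesis using h(5) by argo
    qed
    define D where "D = (1 + a) * (1 + d) - b * c'"
    have "v (b * c') < 1" using i by (intro v_mult_less2)
    then have D: "v D = 1" unfolding D_def using v_add_eq(1)[of "- (b * c')" "(1 + a) * (1 + d)"] i by (simp add: mult)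
    then have Dn: "D \<noteq> 0" by auto
    have dA: "w * (1 + a) * (w * (1 + d)) - w * b * (w * c') = w * w * D" by (simp add: D_def algebra_simps)
    have "w * (1 + a) * (w * (1 + d)) - w * b * (w * c') \<in> \<Delta>" using i by simp
    note ii = inv_m2[OF this, folded i(7), unfolded dA]
    define y11 where "y11 = ((1 + a) * (1 + d) * p - b * c' * t + b * (1 + d) * r - (1 + a) * c' * q) / D"
    define y12 where "y12 = ((1 + a) * b * (t - p) - b * b * r + (1 + a) * (1 + a) * q) / D"
    define y21 where "y21 = (c' * (1 + d) * (p - t) + (1 + d) * (1 + d) * r - c' * c' * q) / D"
    define y22 where "y22 = ((1 + a) * (1 + d) * t - b * c' * p - b * (1 + d) * r + (1 + a) * c' * q) / D"
    note le = less_imp_le[OF i(3)] less_imp_le[OF i(5)] less_imp_le[OF i(6)] i(4)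
    have u: "v (1 + a) \<le> 1" "v (1 + d) \<le> 1" "v c' \<le> 1" using i by simp_all
    have small': "v y11 < 1 \<and> v y12 < 1 \<and> v y21 < 1 \<and> v y22 < 1"
      unfolding y11_def y12_def y21_def y22_def v_divide D div_by_1
      using u i(4) x(3,5,6) q
      by (intro conjI v_diff_less v_add_less v_mult_less2 v_mult_le) assumption+
    then have small: "v y11 < 1" "v y12 < 1" "v y21 < 1" "v y22 < 1" by blast+
    have y: "i ** x ** inv\<^bsub>M\<^esub> i = m2 (z * (1 + y11)) (z * y12) (z * y21) (z * (1 + y22))"
    proof -
      have "D * inverse D = 1" using Dn by simp
      have "z * (1 + y11) * D = z * (D + y11 * D)" "z * (1 + y22) * D = z * (D + y22 * D)" by (simp_all add: algebra_simps)
      moreover have "y11 * D = (1 + a) * (1 + d) * p - b * c' * t + b * (1 + d) * r - (1 + a) * c' * q"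
        "y12 * D = (1 + a) * b * (t - p) - b * b * r + (1 + a) * (1 + a) * q"
        "y21 * D = c' * (1 + d) * (p - t) + (1 + d) * (1 + d) * r - c' * c' * q"
        "y22 * D = (1 + a) * (1 + d) * t - b * c' * p - b * (1 + d) * r + (1 + a) * c' * q"
        using Dn by (simp_all add: y11_def y12_def y21_def y22_def)
      moreover have ixi: "i ** x ** inv\<^bsub>M\<^esub> i = m2
          (z * (((1 + a) * (1 + p) + b * r) * (1 + d) - ((1 + a) * q + b * (1 + t)) * c') / D)
          (z * (((1 + a) * q + b * (1 + t)) * (1 + a) - ((1 + a) * (1 + p) + b * r) * b) / D)
          (z * ((c' * (1 + p) + (1 + d) * r) * (1 + d) - (c' * q + (1 + d) * (1 + t)) * c') / D)
          (z * ((c' * q + (1 + d) * (1 + t)) * (1 + a) - (c' * (1 + p) + (1 + d) * r) * b) / D)"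
        unfolding ii unfolding i(7) x(7) m2_mult m2_eq using i(2) Dn by (simp add: field_simps)
      ultimately show ?thesis
        using Dn by (simp add: divide_eq_eq D_def[symmetric]) (simp add: D_def algebra_simps)
    qed
    have "det (i ** x ** inv\<^bsub>M\<^esub> i) \<in> \<Delta>" using \<open>i \<in> J\<close> \<open>x \<in> J\<close> by (intro det_M inv_M J_M)
    then have "det (inv\<^bsub>M\<^esub> s0 ** (i ** x ** inv\<^bsub>M\<^esub> i) ** s0) \<in> \<Delta>" by (rule det_conj)
    then show ?thesis
      by (intro JI[OF x(1) small(4) _ _ small(1), of "- y21" "- y12"]) (use small in \<open>simp_all add: y s0_conj\<close>)
  qed
qed

lemma rank_one_0: "rank_one TYPE('k) M G I cl J T matQ s0 R0 tau0 kappa0"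
proof (intro rank_one.intro rank_one_axioms.intro)
  show "hecke_cover M G I cl J" by (rule hecke_cover_axioms)
  show "subgroup T M" "subgroup matQ M" by (rule subgroup_T subgroup_Q)+
  show "J \<subseteq> matQ" "T \<subseteq> matQ" using J_Q T_Q by blast+
  show "s0 \<in> matQ" by (rule s0_Q)
  show "s0 \<in> carrier M" by simp
  show "finite R0" by (simp add: R0_def reps_finite)
  show "\<one>\<^bsub>M\<^esub> \<in> R0" unfolding R0_def using reps_0 by (intro image_eqI[of _ _ 0]) (simp_all add: un_def)
  have "card R0 = card reps" unfolding R0_def by (rule card_image) (simp add: inj_on_def)
  then show "of_nat (card R0) = (0 :: 'k)" using reps_card by simp
  show "s0 \<otimes>\<^bsub>M\<^esub> s0 \<in> T" by (rule TI[of 1 "- 1" "- 1"]) (simp_all add: s0_def)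
next
  fix t j assume "t \<in> T" "j \<in> J"
  then show "t \<otimes>\<^bsub>M\<^esub> j \<otimes>\<^bsub>M\<^esub> inv\<^bsub>M\<^esub> t \<in> J" using T_norm by simp
next
  fix t assume t: "t \<in> T"
  show "inv\<^bsub>M\<^esub> s0 \<otimes>\<^bsub>M\<^esub> t \<otimes>\<^bsub>M\<^esub> s0 \<in> T" using s_T0[OF t] by simp
  assume "inv\<^bsub>M\<^esub> s0 \<otimes>\<^bsub>M\<^esub> t \<otimes>\<^bsub>M\<^esub> s0 \<in> J"
  then show "t \<in> J" using s_TJ0[OF t] by simp
next
  fix p assume "p \<in> matQ"
  from Q_cases0[OF this]
  show "(\<exists>t\<in>T. \<exists>j\<in>J. p = s0 \<otimes>\<^bsub>M\<^esub> t \<otimes>\<^bsub>M\<^esub> j) \<or>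
      (\<exists>i\<in>J. \<exists>t\<in>T. \<exists>j\<in>J. p = s0 \<otimes>\<^bsub>M\<^esub> i \<otimes>\<^bsub>M\<^esub> inv\<^bsub>M\<^esub> s0 \<otimes>\<^bsub>M\<^esub> t \<otimes>\<^bsub>M\<^esub> j)"
    by (simp only: M_mult)
next
  fix i j assume "i \<in> J" "j \<in> J"
  then show "i \<otimes>\<^bsub>M\<^esub> s0 \<otimes>\<^bsub>M\<^esub> j \<notin> T" using disjoint0 by simp
next
  fix u assume "u \<in> R0" then show "u \<in> J" using un_J reps_le by (auto simp: R0_def)
next
  fix i assume "i \<in> J"
  from R_ex0[OF this] show "\<exists>u\<in>R0. \<exists>j\<in>J. i \<otimes>\<^bsub>M\<^esub> s0 = u \<otimes>\<^bsub>M\<^esub> s0 \<otimes>\<^bsub>M\<^esub> j" by (simp only: M_mult)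
next
  fix u u' t j assume h: "u \<in> R0" "u' \<in> R0" "t \<in> T" "j \<in> J"
    and eq: "u \<otimes>\<^bsub>M\<^esub> s0 = u' \<otimes>\<^bsub>M\<^esub> s0 \<otimes>\<^bsub>M\<^esub> t \<otimes>\<^bsub>M\<^esub> j"
  show "u = u' \<and> t \<in> J" by (rule R_unique0[OF h eq[unfolded M_mult]])
next
  fix u assume "u \<in> R0 - {\<one>\<^bsub>M\<^esub>}"
  then obtain b where b: "b \<in> reps" "u = un b" "b \<noteq> 0" by (auto simp: R0_def un_def)
  have vb: "v b = 1" by (rule reps_unit[OF b(1,3)])
  show "tau0 u \<in> T" by (rule TI[of 1 "- b" "- inverse b"]) (use b vb in \<open>simp_all add: tau0_def v_inverse\<close>)
  have "un (- inverse b) \<in> J" by (rule un_J) (simp add: v_inverse vb)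
  moreover have "u ** s0 = s0 ** un (- inverse b) ** inv\<^bsub>M\<^esub> s0 ** tau0 u ** un (- inverse b)"
    using b(3) unfolding b(2) un_def s0_conj' by (simp add: tau0_def s0_def)
  ultimately show "\<exists>i\<in>J. \<exists>j\<in>J. u \<otimes>\<^bsub>M\<^esub> s0 = s0 \<otimes>\<^bsub>M\<^esub> i \<otimes>\<^bsub>M\<^esub> inv\<^bsub>M\<^esub> s0 \<otimes>\<^bsub>M\<^esub> tau0 u \<otimes>\<^bsub>M\<^esub> j"
    unfolding M_mult by blast
  note r = recip[OF b(1,3)]
  define k where "k = recip b"
  have kn: "k \<noteq> 0" "v k = 1" using r reps_unit by (auto simp: k_def)
  have "b * k - 1 = - b * (inverse b - k)" using b(3) by (simp add: field_simps)
  then have bk: "v (b * k - 1) < 1" using r(2) vb by (simp only: k_def mult v_minus)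
  have "inverse (b * k) - 1 = - (b * k - 1) / (b * k)" using b(3) kn by (simp add: field_simps)
  then have bk': "v (inverse (b * k) - 1) < 1" using bk vb kn by (simp only: v_divide mult v_minus)
  have c: "inv\<^bsub>M\<^esub> s0 ** tau0 u ** s0 = m2 (1 * - inverse b) 0 0 (1 * - b)" unfolding tau0_def s0_conj by (simp add: b(2))
  have e: "inv\<^bsub>M\<^esub> (inv\<^bsub>M\<^esub> s0 ** tau0 u ** s0) ** tau0 (kappa0 u) = m2 (1 * (b * k)) (1 * 0) (1 * 0) (1 * inverse (b * k))"
    unfolding c by (subst inv_diag) (use b kn in \<open>simp_all add: tau0_def kappa0_def k_def inverse_minus_eq\<close>)
  have "det (inv\<^bsub>M\<^esub> (inv\<^bsub>M\<^esub> s0 ** tau0 u ** s0) ** tau0 (kappa0 u)) \<in> \<Delta>"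
    unfolding e using b(3) kn by (simp add: field_simps)
  then have "inv\<^bsub>M\<^esub> (inv\<^bsub>M\<^esub> s0 ** tau0 u ** s0) ** tau0 (kappa0 u) \<in> J"
    by (rule JI'[OF Z_1 e _ bk _ _ bk']) simp_all
  then show "inv\<^bsub>M\<^esub> (inv\<^bsub>M\<^esub> s0 \<otimes>\<^bsub>M\<^esub> tau0 u \<otimes>\<^bsub>M\<^esub> s0) \<otimes>\<^bsub>M\<^esub> tau0 (kappa0 u) \<in> J" by (simp only: M_mult)
next
  have R: "R0 - {\<one>\<^bsub>M\<^esub>} = un ` (reps - {0})" by (auto simp: R0_def un_def)
  show "bij_betw kappa0 (R0 - {\<one>\<^bsub>M\<^esub>}) (R0 - {\<one>\<^bsub>M\<^esub>})"
    unfolding R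
  proof (rule bij_betw_byWitness[where f' = kappa0])
    show "\<forall>u\<in>un ` (reps - {0}). kappa0 (kappa0 u) = u" "\<forall>u\<in>un ` (reps - {0}). kappa0 (kappa0 u) = u"
      using recip(4) by (simp_all add: kappa0_def)
    show "kappa0 ` un ` (reps - {0}) \<subseteq> un ` (reps - {0})" "kappa0 ` un ` (reps - {0}) \<subseteq> un ` (reps - {0})"
      unfolding kappa0_def image_image un_12 using recip(1,3) by blast+
  qed
next
  fix i x assume h: "i \<in> J" "x \<in> J" "inv\<^bsub>M\<^esub> s0 \<otimes>\<^bsub>M\<^esub> x \<otimes>\<^bsub>M\<^esub> s0 \<in> J"
  show "inv\<^bsub>M\<^esub> s0 \<otimes>\<^bsub>M\<^esub> (i \<otimes>\<^bsub>M\<^esub> x \<otimes>\<^bsub>M\<^esub> inv\<^bsub>M\<^esub> i) \<otimes>\<^bsub>M\<^esub> s0 \<in> J" using normal0[OF h(1,2) h(3)[unfolded M_mult]] unfolding M_mult .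
qed

end

lemma (in rank_one) big_not_small:
  assumes "big p"
  shows "\<not> small p"
proof
  assume "small p"
  then obtain t' j' where h' [simp]: "t' \<in> T" "j' \<in> J" and p': "p = t' \<otimes> j'" by (auto simp: small_def)
  obtain i t j where h [simp]: "i \<in> J" "t \<in> T" "j \<in> J" and p: "p = i \<otimes> s \<otimes> t \<otimes> j"
    using assms by (auto simp: big_def)
  note [simp] = J_carrier[OF h(1)] J_carrier[OF h(3)] T_carrier[OF h(2)] J_carrier[OF h'(2)] T_carrier[OF h'(1)]
  have J: "t \<otimes> (j \<otimes> inv j' \<otimes> inv t) \<in> J" by (rule T_norm'(1)) simp_all
  have "i \<otimes> s \<otimes> (t \<otimes> (j \<otimes> inv j' \<otimes> inv t)) = p \<otimes> inv j' \<otimes> inv t" by (simp add: p gs)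
  also have "\<dots> = t' \<otimes> inv t" by (simp add: p' gs)
  finally show False using disjoint[OF h(1) J] by simp
qed

section \<open>The two ends of an edge and their heights\<close>

context det_scalars
begin

lemma omega_inv: "omega ** m2 0 (inverse \<pi>) 1 0 = m2 1 0 0 1" "m2 0 (inverse \<pi>) 1 0 ** omega = m2 1 0 0 1"
  using pi_nz by (simp_all add: omega_def)

text \<open>Conjugation by \<open>omega\<close>; it is an involution because the square of
  \<open>omega\<close> is scalar.\<close>

definition sig :: "'a^2^2 \<Rightarrow> 'a^2^2" where "sig A = omega ** A ** m2 0 (inverse \<pi>) 1 0"

lemma sig_m2: "sig (m2 a b c d) = m2 d (c / \<pi>) (b * \<pi>) a"
  using pi_nz by (simp add: sig_def omega_def field_simps)

lemma sig_sig [simp]: "sig (sig A) = A"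
  using pi_nz by (cases A rule: m2_cases) (simp add: sig_m2)

lemma det_sig [simp]: "det (sig A) = det A"
  using pi_nz by (cases A rule: m2_cases) (simp add: sig_m2 mult.commute)

lemma sig_mult: "sig (A ** B) = sig A ** sig B"
  using pi_nz by (cases A rule: m2_cases; cases B rule: m2_cases) (simp add: sig_m2 field_simps)

lemma omega_right: "(A :: 'a^2^2) ** p ** omega = A ** omega ** sig p"
  by (cases A rule: m2_cases; cases p rule: m2_cases) (use pi_nz in \<open>simp add: sig_m2 omega_def field_simps\<close>)

lemma sig_J: "A \<in> J \<Longrightarrow> sig A \<in> J"
proof (elim JE)
  fix z a b c d assume A: "z \<in> Z" "v a < 1" "v b \<le> 1" "v c < 1" "v d < 1"
    "A = m2 (z * (1 + a)) (z * b) (z * c) (z * (1 + d))" "det A \<in> \<Delta>"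
  have "v (c / \<pi>) \<le> 1" using A(4) lt_iff[of c] pi_pos by (simp add: v_divide)
  moreover have "v (b * \<pi>) < 1" by (rule v_mult_less2[OF A(3) pi_less])
  ultimately show "sig A \<in> J"
  proof (rule JI[OF A(1,5) _ _ A(2)])
    show "det (sig A) \<in> \<Delta>" using A(7) by (simp only: det_sig)
    show "sig A = m2 (z * (1 + d)) (z * (c / \<pi>)) (z * (b * \<pi>)) (z * (1 + a))" using A(6) by (simp add: sig_m2)
  qed
qed

lemma sig_T: "A \<in> T \<Longrightarrow> sig A \<in> T"
proof (elim TE)
  fix z a d assume A: "z \<in> Z" "v a = 1" "v d = 1" "A = m2 (z * a) 0 0 (z * d)" "det A \<in> \<Delta>"
  show "sig A \<in> T"
  proof (rule TI[OF A(1,3,2)])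
    show "det (sig A) \<in> \<Delta>" using A(5) by (simp only: det_sig)
    show "sig A = m2 (z * d) 0 0 (z * a)" using A(4) by (simp add: sig_m2)
  qed
qed

lemma sig_image: "(\<And>A. A \<in> Y \<Longrightarrow> sig A \<in> Y) \<Longrightarrow> sig ` Y = Y"
  by (metis image_eqI image_subsetI sig_sig subsetI subset_antisym)

lemma sig_hom: "sig \<in> hom M M"
  by (simp add: hom_def sig_mult)

lemma sig_inj: "inj_on sig Y"
  by (metis inj_onI sig_sig)

text \<open>The columns of \<open>Xb b g\<close> span the lattice of the end of type
  \<open>b\<close> of the edge \<open>g\<close>. By \<open>X_mult\<close>, moving \<open>g\<close>
  around that vertex is right multiplication of \<open>Xb b g\<close> by the twisted element, so
  both types reduce to the standard vertex.\<close>

definition Xb :: "bool \<Rightarrow> 'a^2^2 \<Rightarrow> 'a^2^2" where "Xb b g = (if b then g ** omega else g)"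

definition tw :: "bool \<Rightarrow> 'a^2^2 \<Rightarrow> 'a^2^2" where "tw b p = (if b then sig p else p)"

lemma X_mult: "Xb b (g ** p) = Xb b g ** tw b p"
  by (simp add: Xb_def tw_def omega_right)

lemma tw_tw [simp]: "tw b (tw b p) = p" and det_tw [simp]: "det (tw b p) = det p"
  and tw_mult: "tw b (p ** q) = tw b p ** tw b q"
  by (simp_all add: tw_def sig_mult)

lemma tw_J: "p \<in> J \<Longrightarrow> tw b p \<in> J" and tw_T: "p \<in> T \<Longrightarrow> tw b p \<in> T"
  by (simp_all add: tw_def sig_J sig_T)

lemma det_X: "det (Xb b g) \<noteq> 0 \<longleftrightarrow> det g \<noteq> 0"
  using pi_nz by (simp add: Xb_def det_mul omega_def)

lemma mat_right: "(A :: 'a^2^2) ** (mat z ** B) = mat z ** (A ** B :: 'a^2^2)"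
  by (cases A rule: m2_cases; cases B rule: m2_cases) (simp add: mat_m2 algebra_simps)

lemma height_Q: "p \<in> matQ \<Longrightarrow> height (A ** p) = height A"
proof -
  assume "p \<in> matQ"
  then obtain z B where z: "z \<in> Z" "integral B" "p = mat z ** B" unfolding matQ_def by blast
  then show ?thesis using height_scalar[OF Z_nz[OF z(1)]] by (simp add: mat_right height_integral)
qed

lemma height_Q_left: "p \<in> matQ \<Longrightarrow> height (p ** A) = height A"
proof -
  assume "p \<in> matQ"
  then obtain z B where z: "z \<in> Z" "integral B" "p = mat z ** B" unfolding matQ_def by blast
  then show ?thesis using height_scalar[OF Z_nz[OF z(1)]] by (simp add: matrix_mul_assoc[symmetric] height_integral)
qed

text \<open>The height of the farther end of the edge.\<close>

definition ht :: "'a^2^2 \<Rightarrow> real" where "ht g = max (height g) (height (g ** omega))"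

lemma ht_X: "ht g = max (height (Xb b g)) (height (Xb b g ** omega))"
  using pi_nz by (simp add: ht_def Xb_def omega_omega height_scalar max.commute)

abbreviation qq :: real where "qq \<equiv> inverse (v \<pi>)"

lemma qq_gt: "qq > 1"
  using pi_pos pi_less by (simp add: one_less_inverse)

text \<open>The first column is as short as the determinant allows. This is a condition on the
  matrix, finer than one on its edge; the right representative is what makes
  \<open>root_conj\<close> work.\<close>

definition root :: "'a^2^2 \<Rightarrow> bool" where "root Y \<longleftrightarrow> col1 Y * nrm Y = v (det Y)"

lemma nrm_pos: "det Y \<noteq> 0 \<Longrightarrow> nrm Y > 0"
  using det_le[of Y] v_pos[of "det Y"] nrm_nonneg[of Y] by (cases "nrm Y = 0") auto

lemma root_col:
  assumes "root Y" "det Y \<noteq> 0" "height Y > 1"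
  shows "col1 Y < nrm Y"
proof -
  have "col1 Y \<noteq> nrm Y"
  proof
    assume "col1 Y = nrm Y"
    then have "height Y = 1" using assms(1) v_pos[OF assms(2)] by (simp add: root_def height_def power2_eq_square)
    then show False using assms(3) by simp
  qed
  then show ?thesis by (auto simp: nrm_def)
qed

lemma ht_down: "col1 (Xb b g) < nrm (Xb b g) \<Longrightarrow> ht g = height (Xb b g)"
proof -
  assume c: "col1 (Xb b g) < nrm (Xb b g)"
  have "height (Xb b g) \<ge> 0" using nonneg by (simp add: height_def)
  then have "height (Xb b g) * v \<pi> \<le> height (Xb b g)" using pi_less by (simp add: mult_left_le)
  then show ?thesis using height_omega_down[OF c] by (simp add: ht_X[of g b])
qed

lemma ht_up: "col1 (Xb b g) = nrm (Xb b g) \<Longrightarrow> ht g = height (Xb b g) * qq"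
proof -
  assume c: "col1 (Xb b g) = nrm (Xb b g)"
  have "height (Xb b g) \<ge> 0" using nonneg by (simp add: height_def)
  then have "height (Xb b g) \<le> height (Xb b g) * qq" using qq_gt mult_left_mono[of 1 qq "height (Xb b g)"] by simp
  then show ?thesis using height_omega_up[OF c] by (simp add: ht_X[of g b] divide_inverse)
qed

lemma ht_ge: "det g \<noteq> 0 \<Longrightarrow> ht g \<ge> 1"
  using height_ge_1[of g] by (simp add: ht_def)

text \<open>One end of an edge is the nearer one. If the second column dominates,
  \<open>omega\<close> puts it first with a factor \<open>\<pi>\<close>, and by discreteness it
  still dominates.\<close>

lemma up_ex: "\<exists>b. col1 (Xb b g) = nrm (Xb b g)"
proof (cases "col1 g = nrm g")
  case True
  then show ?thesis by (intro exI[of _ False]) (simp add: Xb_def)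
next
  case False
  then have c: "col1 g < col2 g" by (auto simp: nrm_def)
  obtain x y where xy: "col1 g = v x" "col2 g = v y" using col1_value col2_value by metis
  have le: "col1 g \<le> v \<pi> * col2 g" using discrete c unfolding xy by blast
  have "col1 (g ** omega) = v \<pi> * col2 g"
    by (cases g rule: m2_cases) (simp add: mult_omega mult mult.commute max_mult_distrib_left pi_pos less_imp_le)
  then have "col1 (g ** omega) = nrm (g ** omega)" using le by (simp only: nrm_omega max_absorb1)
  then show ?thesis by (intro exI[of _ True]) (simp add: Xb_def)
qed

text \<open>Otherwise crossing the edge and returning would raise the height twice, although it
  leads back to the same vertex.\<close>

lemma up_unique:
  assumes "det g \<noteq> 0" "col1 (Xb b g) = nrm (Xb b g)" "col1 (Xb b' g) = nrm (Xb b' g)"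
  shows "b = b'"
proof (rule ccontr)
  assume "b \<noteq> b'"
  then have u: "col1 g = nrm g" "col1 (g ** omega) = nrm (g ** omega)"
    using assms by (auto simp: Xb_def split: if_splits)
  have "height (g ** omega ** omega) = height g" using pi_nz by (simp add: omega_omega height_scalar)
  then have e: "height g = height g / v \<pi> / v \<pi>"
    by (simp only: height_omega_up[OF u(2)] height_omega_up[OF u(1)])
  have h: "height g > 0" using height_ge_1[OF assms(1)] by linarith
  have "v \<pi> * v \<pi> < 1 * 1" by (rule mult_strict_mono) (use pi_less pi_pos in simp_all)
  then have "height g * (v \<pi> * v \<pi>) < height g * 1" using h by (simp only: mult_less_cancel_left_pos mult_1_left)
  moreover have "height g * (v \<pi> * v \<pi>) = height g" using e pi_pos by (simp add: field_simps)
  ultimately show False by simp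
qed

end

lemma log_step:
  fixes q H :: real
  assumes "q > 1" "H \<ge> 1"
  shows "nat \<lfloor>log q (H * q)\<rfloor> = Suc (nat \<lfloor>log q H\<rfloor>)"
proof -
  have "log q (H * q) = log q H + 1" using assms by (simp add: log_def ln_mult add_divide_distrib)
  moreover have "log q H \<ge> 0" using assms by simp
  ultimately show ?thesis by (simp add: nat_add_distrib)
qed

lemma (in Group.group) inv_mult_cancel:
  assumes "g \<in> carrier G" "p \<in> carrier G"
  shows "inv (g \<otimes> p) \<otimes> g = inv p" "g \<otimes> p \<otimes> inv p = g" "g \<otimes> (inv g \<otimes> p) = p"
  using assms by (simp_all add: inv_mult_group m_assoc)

section \<open>Edges pointing towards the base edge\<close>

context det_scalars
begin

lemmas monoid_M = group.is_monoid[OF group_M]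

lemma one_right [simp]: "(A :: 'a^2^2) ** m2 1 0 0 1 = A" and one_left [simp]: "m2 1 0 0 1 ** (A :: 'a^2^2) = A"
  by (cases A rule: m2_cases, simp)+

lemma JT_form:
  assumes p: "p \<in> J \<or> p \<in> T"
  obtains z a b c d where "z \<noteq> 0" "p = m2 (z * a) (z * b) (z * c) (z * d)" "v a = 1" "v c < 1" "integral (m2 a b c d)"
  using p
proof
  assume "p \<in> J"
  then show ?thesis
  proof (cases rule: JE)
    case h: (1 z a b c d)
    have "v (b * c) < 1" by (rule v_mult_less2[OF h(4,5)])
    then have "v (- (b * c) + (1 + a) * (1 + d)) = 1"
      using v_add_eq(2)[of "- (b * c)" "(1 + a) * (1 + d)"] by (simp only: v_minus mult h(11,12) mult_1)
    then have "v ((1 + a) * (1 + d) - b * c) = 1" by (simp only: uminus_add_conv_diff)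
    then show ?thesis using h by (intro that[of z "1 + a" b c "1 + d"]) (simp_all add: integral_m2)
  qed
next
  assume "p \<in> T"
  then show ?thesis
  proof (cases rule: TE)
    case h: (1 z a d)
    show ?thesis by (rule that[of z a 0 0 d]) (use h in \<open>simp_all add: integral_m2 mult\<close>)
  qed
qed

lemma nrm_form: "integral (m2 a b c d) \<Longrightarrow> nrm (Y ** m2 (z * a) (z * b) (z * c) (z * d)) = v z * nrm Y"
proof -
  assume i: "integral (m2 a b c d)"
  have "m2 (z * a) (z * b) (z * c) (z * d) = mat z ** m2 a b c d" by (simp add: mat_m2)
  then show ?thesis by (simp only: mat_right nrm_scalar nrm_integral_right[OF i])
qed

lemma small_entry:
  assumes "z \<noteq> 0" "v a = 1" "v c < 1" "v x < r" "v y \<le> r"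
  shows "v (x * (z * a) + y * (z * c)) < v z * r"
proof -
  have r: "r > 0" using assms(4) nonneg[of x] by linarith
  have "v y * v c \<le> r * v c" by (rule mult_right_mono[OF assms(5) nonneg])
  also have "\<dots> < r * 1" by (rule mult_strict_left_mono[OF assms(3) r])
  finally have A: "v (x * a + y * c) < r" by (intro v_add_less) (simp_all add: mult assms(2,4))
  have e: "x * (z * a) + y * (z * c) = z * (x * a + y * c)" by (simp add: algebra_simps)
  show ?thesis unfolding e mult by (rule mult_strict_left_mono[OF A v_pos[OF assms(1)]])
qed

lemma entry_le: "v (Y $ 1 $ 1) \<le> col1 Y" "v (Y $ 2 $ 1) \<le> col1 Y" "v (Y $ 1 $ 2) \<le> nrm Y" "v (Y $ 2 $ 2) \<le> nrm Y"
  "col1 Y \<le> nrm Y"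
  by (simp_all add: nrm_def col1_def col2_def)

lemma JT_small:
  assumes "p \<in> J \<or> p \<in> T"
  shows "col1 Y < nrm Y \<Longrightarrow> col1 (Y ** p) < nrm (Y ** p)"
    "v (Y $ 2 $ 1) < nrm Y \<Longrightarrow> v ((Y ** p) $ 2 $ 1) < nrm (Y ** p)"
proof -
  obtain z a b c d where z: "z \<noteq> 0" and p: "p = m2 (z * a) (z * b) (z * c) (z * d)" and a: "v a = 1" "v c < 1"
    and i: "integral (m2 a b c d)" by (rule JT_form[OF assms])
  have n: "nrm (Y ** p) = v z * nrm Y" unfolding p by (rule nrm_form[OF i])
  obtain x y x' y' where Y: "Y = m2 x y x' y'" by (rule m2_cases)
  have le: "v y \<le> nrm Y" "v y' \<le> nrm Y" using entry_le(3,4)[of Y] by (simp_all add: Y)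
  show "col1 (Y ** p) < nrm (Y ** p)" if c: "col1 Y < nrm Y"
  proof -
    have l: "v x < nrm Y" "v x' < nrm Y" using c by (simp_all add: Y)
    show ?thesis unfolding n
      using small_entry[OF z a l(1) le(1)] small_entry[OF z a l(2) le(2)] by (simp add: Y p)
  qed
  show "v ((Y ** p) $ 2 $ 1) < nrm (Y ** p)" if c: "v (Y $ 2 $ 1) < nrm Y"
  proof -
    have l: "v x' < nrm Y" using c by (simp add: Y)
    show ?thesis unfolding n using small_entry[OF z a l le(2)] by (simp add: Y p)
  qed
qed

text \<open>Away from the standard vertex, the edge that points towards it. At the standard vertex
  no edge does so; there the base edge is singled out, characterized by a small lower left
  entry.\<close>

definition low :: "'a^2^2 \<Rightarrow> bool" where
  "low Y \<longleftrightarrow> (if height Y = 1 then v (Y $ 2 $ 1) < nrm Y else col1 Y < nrm Y)"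

lemma JT_Q: "p \<in> J \<or> p \<in> T \<Longrightarrow> p \<in> matQ"
  using J_Q T_Q by blast

lemma JT_inv:
  assumes p: "p \<in> J \<or> p \<in> T"
  shows "\<exists>p'. (p' \<in> J \<or> p' \<in> T) \<and> p ** p' = m2 1 0 0 1"
proof -
  have c: "p \<in> carrier M" using p J_M T_M by auto
  have "p ** inv\<^bsub>M\<^esub> p = m2 1 0 0 1" using group.r_inv[OF group_M c] by (simp only: M_mult M_one)
  then show ?thesis using p subgroup.m_inv_closed[OF subgroup_J] subgroup.m_inv_closed[OF subgroup_T] by blast
qed

lemma JT_low: "p \<in> J \<or> p \<in> T \<Longrightarrow> low (Y ** p) \<longleftrightarrow> low Y"
proof -
  have *: "low (Y ** p)" if "p \<in> J \<or> p \<in> T" "low Y" for p Y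
    using that JT_small[OF that(1), of Y] height_Q[OF JT_Q[OF that(1)], of Y] by (simp add: low_def split: if_splits)
  assume p: "p \<in> J \<or> p \<in> T"
  then obtain p' where p': "p' \<in> J \<or> p' \<in> T" "p ** p' = m2 1 0 0 1" using JT_inv by blast
  have "low Y" if "low (Y ** p)"
    using *[OF p'(1) that] by (simp only: matrix_mul_assoc[symmetric] p'(2) one_right)
  then show ?thesis using *[OF p] by blast
qed

lemma integral_s0: "integral s0"
  by (simp add: s0_def integral_m2)

text \<open>At the standard vertex a matrix with a small lower row would have too small a
  determinant. Elsewhere \<open>s0\<close> moves the longer second column into the first
  place.\<close>

lemma low_s0:
  assumes Y: "low Y" and det: "det Y \<noteq> 0"
  shows "\<not> low (Y ** s0)"
proof -
  note h = height_integral(1)[OF integral_s0, of Y] nrm_integral_right[OF integral_s0, of Y]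
  obtain x y x' y' where Ye: "Y = m2 x y x' y'" by (rule m2_cases)
  show ?thesis
  proof (cases "height Y = 1")
    case True
    let ?n = "nrm Y"
    have n: "?n > 0" by (rule nrm_pos[OF det])
    have x': "v x' < ?n" using Y True by (simp add: low_def Ye)
    have le: "v x \<le> ?n" "v y \<le> ?n" using entry_le(1,3,5)[of Y] by (simp_all add: Ye)
    have D: "v (x * y' - y * x') = ?n * ?n"
      using True v_pos[OF det] by (simp add: height_def power2_eq_square Ye)
    have "\<not> v y' < ?n"
    proof
      assume y': "v y' < ?n"
      have "v x * v y' < ?n * ?n" by (rule le_less_trans[OF mult_right_mono[OF le(1) nonneg] mult_strict_left_mono[OF y' n]])
      moreover have "v y * v x' < ?n * ?n" by (rule le_less_trans[OF mult_right_mono[OF le(2) nonneg] mult_strict_left_mono[OF x' n]])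
      ultimately have "v (x * y' - y * x') < ?n * ?n" by (intro v_diff_less) (simp_all add: mult)
      then show False using D by simp
    qed
    moreover have "(Y ** s0) $ 2 $ 1 = - y'" by (simp add: Ye s0_def)
    ultimately show ?thesis using True by (simp add: low_def h)
  next
    case False
    then have "col1 Y < nrm Y" using Y by (simp add: low_def)
    moreover have "col1 (Y ** s0) = col2 Y" by (simp add: Ye s0_def)
    ultimately show ?thesis using False by (simp add: low_def h) (simp add: nrm_def)
  qed
qed

lemma not_low_up: "\<not> low Y \<Longrightarrow> col1 Y = nrm Y"
  using entry_le(2,5)[of Y] by (auto simp: low_def split: if_splits)

text \<open>At the standard vertex a column operation clears the lower left entry. Elsewhere
  \<open>root_matrix\<close> applies, and the short first column makes the edge point
  inwards.\<close>

lemma Root_ex: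
  assumes det: "det Y \<noteq> 0"
  shows "\<exists>B. integral B \<and> det B = 1 \<and> low (Y ** B) \<and> (height Y = 1 \<or> root (Y ** B))"
proof (cases "height Y = 1")
  case True
  obtain x y x' y' where Ye: "Y = m2 x y x' y'" by (rule m2_cases)
  have "\<exists>B. integral B \<and> det B = 1 \<and> (Y ** B) $ 2 $ 1 = 0"
  proof (cases "v x' \<le> v y'")
    case True
    have "v (- x' / y') \<le> 1" using True nonneg[of y'] by (cases "y' = 0") (simp_all add: v_divide v_pos)
    moreover have "x' + y' * (- x' / y') = 0" using True eq_zero_iff[of x'] nonneg[of x'] by (cases "y' = 0") simp_all
    ultimately show ?thesis by (intro exI[of _ "m2 1 0 (- x' / y') 1"]) (simp add: integral_m2 Ye)
  next
    case False
    then have x': "x' \<noteq> 0" using nonneg[of y'] by auto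
    have "v (- y' / x') \<le> 1" using False v_pos[OF x'] by (simp add: v_divide)
    then show ?thesis using x' by (intro exI[of _ "m2 (- y' / x') (- 1) 1 0"]) (simp add: integral_m2 Ye)
  qed
  then obtain B where B: "integral B" "det B = 1" "(Y ** B) $ 2 $ 1 = 0" by blast
  have "low (Y ** B)"
    using True nrm_pos[OF det] B(3) by (simp add: low_def height_integral(1)[OF B(1)] nrm_integral_right[OF B(1)])
  then show ?thesis using B True by blast
next
  case False
  then have h: "height Y > 1" using height_ge_1[OF det] by simp
  obtain B where B: "integral B" "det B = 1" "col1 (Y ** B) * nrm Y = v (det Y)" using root_matrix[OF det] by blast
  have d: "det (Y ** B) = det Y" using B(2) by (simp add: det_mul)
  have r: "root (Y ** B)" unfolding root_def d nrm_integral_right[OF B(1)] by (rule B(3))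
  have "col1 (Y ** B) < nrm (Y ** B)"
    by (rule root_col[OF r]) (use h det in \<open>simp_all only: d height_integral(1)[OF B(1)] not_False_eq_True\<close>)
  then have "low (Y ** B)" using False by (simp add: low_def height_integral(1)[OF B(1)])
  then show ?thesis using B r by blast
qed

lemma low_scalar: "c \<noteq> 0 \<Longrightarrow> low (mat c ** Y) \<longleftrightarrow> low Y"
proof -
  assume c: "c \<noteq> 0"
  obtain x y x' y' where Y: "Y = m2 x y x' y'" by (rule m2_cases)
  have e: "(mat c ** Y) $ 2 $ 1 = c * x'" "col1 (mat c ** Y) = v c * col1 Y" "Y $ 2 $ 1 = x'"
    by (simp_all add: Y mat_m2 mult max_mult_distrib_left nonneg)
  show ?thesis unfolding low_def height_scalar[OF c] nrm_scalar e mult using v_pos[OF c] by simp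
qed

text \<open>\<open>J\<close> fixes the base edge and hence preserves the direction towards
  it.\<close>

lemma J_low_left: "x \<in> J \<Longrightarrow> low (x ** Y) \<longleftrightarrow> low Y"
proof -
  have *: "low (x ** Y)" if x: "x \<in> J" and Y: "low Y" for x Y
    using x
  proof (cases rule: JE)
    case h: (1 z a b c d)
    obtain x1 y1 x2 y2 where Ye: "Y = m2 x1 y1 x2 y2" by (rule m2_cases)
    have "v (b * c) < 1" by (rule v_mult_less2[OF h(4,5)])
    then have "v (- (b * c) + (1 + a) * (1 + d)) = 1"
      using v_add_eq(2)[of "- (b * c)" "(1 + a) * (1 + d)"] by (simp only: v_minus mult h(11,12) mult_1)
    then have i: "integral (m2 (1 + a) b c (1 + d))" using h by (simp add: integral_m2)
    have xe: "x = mat z ** m2 (1 + a) b c (1 + d)" by (simp add: h(7) mat_m2)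
    have n: "nrm (x ** Y) = v z * nrm Y"
      unfolding xe by (simp only: matrix_mul_assoc[symmetric] nrm_scalar nrm_integral_left[OF i])
    have z: "v z > 0" by (rule v_pos[OF h(2)])
    have xY: "x ** Y = mat z ** m2 ((1 + a) * x1 + b * x2) ((1 + a) * y1 + b * y2) (c * x1 + (1 + d) * x2) (c * y1 + (1 + d) * y2)"
      by (simp only: xe matrix_mul_assoc[symmetric] Ye m2_mult)
    have e11: "(x ** Y) $ 1 $ 1 = z * ((1 + a) * x1 + b * x2)" and e21: "(x ** Y) $ 2 $ 1 = z * (c * x1 + (1 + d) * x2)"
      unfolding xY mat_m2 m2_mult m2_nth by simp_all
    have lt: "v (c * x1 + (1 + d) * x2) < nrm Y" if l: "v x2 < nrm Y"
    proof -
      have "v x1 \<le> nrm Y" using entry_le(1,5)[of Y] by (simp add: Ye)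
      then show ?thesis using small_entry[of 1 "1 + d" c x2 "nrm Y" x1] l h by (simp add: mult.commute add.commute)
    qed
    have hx: "height (x ** Y) = height Y" by (rule height_Q_left[OF J_Q[OF x]])
    show ?thesis
    proof (cases "height Y = 1")
      case True
      then have "v x2 < nrm Y" using Y by (simp add: low_def Ye)
      from lt[OF this] have "v z * v (c * x1 + (1 + d) * x2) < v z * nrm Y" using z by simp
      then have "v ((x ** Y) $ 2 $ 1) < nrm (x ** Y)" unfolding n e21 mult .
      then show ?thesis using True hx by (simp add: low_def)
    next
      case False
      then have "col1 Y < nrm Y" using Y by (simp add: low_def)
      then have l: "v x1 < nrm Y" "v x2 < nrm Y" by (simp_all add: Ye)
      have "v b * v x2 \<le> 1 * v x2" by (rule mult_right_mono[OF h(4) nonneg])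
      then have "v ((1 + a) * x1 + b * x2) < nrm Y" using l by (intro v_add_less) (simp_all add: mult h(11))
      with lt[OF l(2)] have "v z * v ((1 + a) * x1 + b * x2) < v z * nrm Y" "v z * v (c * x1 + (1 + d) * x2) < v z * nrm Y"
        using z by simp_all
      then have "col1 (x ** Y) < nrm (x ** Y)" unfolding n col1_def e11 e21 mult by simp
      then show ?thesis using False hx by (simp add: low_def)
    qed
  qed
  assume x: "x \<in> J"
  have xi: "inv\<^bsub>M\<^esub> x \<in> J" by (rule subgroup.m_inv_closed[OF subgroup_J x])
  have "inv\<^bsub>M\<^esub> x ** x = m2 1 0 0 1" using group.l_inv[OF group_M, of x] J_M[OF x] by simp
  then have "low Y" if "low (x ** Y)" using *[OF xi that] by (simp add: matrix_mul_assoc)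
  then show ?thesis using *[OF x] by blast
qed

lemma X_left: "Xb b (x ** g) = x ** Xb b g"
  by (simp add: Xb_def matrix_mul_assoc)

lemma X_inj: "Xb b A = Xb b B \<Longrightarrow> A = B"
  by (cases A rule: m2_cases; cases B rule: m2_cases) (use pi_nz in \<open>simp add: Xb_def mult_omega split: if_splits\<close>)

lemma height_X: "tw b p \<in> matQ \<Longrightarrow> height (Xb b (g ** p)) = height (Xb b g)"
  by (simp add: X_mult height_Q)

lemma ht_alt: "ht g = max (height (Xb False g)) (height (Xb True g))"
  by (simp add: ht_def Xb_def)

lemma height_not: "height (Xb (\<not> b) g) = height (Xb b g ** omega)"
  using pi_nz by (simp add: Xb_def omega_omega height_scalar)

lemma height_other: "col1 (Xb b g) = nrm (Xb b g) \<Longrightarrow> height (Xb (\<not> b) g) = height (Xb b g) * qq"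
  by (simp add: height_not height_omega_up divide_inverse)

lemma det_X': "det g \<in> \<Delta> \<Longrightarrow> det (Xb b g) \<noteq> 0"
  using \<Delta>_nz by (simp add: det_X)

lemma height_X_ge: "det g \<in> \<Delta> \<Longrightarrow> height (Xb b g) \<ge> 1"
  by (rule height_ge_1[OF det_X'])

lemma ht_le: "det g \<in> \<Delta> \<Longrightarrow> ht g \<le> height (Xb b g) * qq"
proof (cases "col1 (Xb b g) = nrm (Xb b g)")
  case True then show ?thesis by (simp add: ht_up)
next
  case False
  assume d: "det g \<in> \<Delta>"
  have "col1 (Xb b g) < nrm (Xb b g)" using False entry_le(5)[of "Xb b g"] by linarith
  then have "ht g = height (Xb b g)" by (rule ht_down)
  moreover have "height (Xb b g) * 1 \<le> height (Xb b g) * qq"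
    by (rule mult_left_mono) (use qq_gt height_X_ge[OF d, of b] in linarith)+
  ultimately show ?thesis by simp
qed

lemma ht_ge_qq: "det g \<in> \<Delta> \<Longrightarrow> ht g \<ge> qq"
proof -
  assume d: "det g \<in> \<Delta>"
  obtain b where "col1 (Xb b g) = nrm (Xb b g)" using up_ex by blast
  then have "ht g = height (Xb b g) * qq" by (rule ht_up)
  moreover have "1 * qq \<le> height (Xb b g) * qq" by (rule mult_right_mono) (use qq_gt height_X_ge[OF d, of b] in linarith)+
  ultimately show ?thesis by simp
qed

section \<open>Levels and components\<close>

text \<open>The base edge up to the torus and the elements of \<open>Nn\<close>; see
  \<open>E_form\<close>.\<close>

definition E :: "'a^2^2 \<Rightarrow> bool" where "E g \<longleftrightarrow> (\<exists>b. height (Xb b g) = 1 \<and> low (Xb b g))"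

text \<open>The base edge has \<open>ht\<close> equal to \<open>qq\<close>, like the other edges at
  the standard vertex. Setting it apart with level 0 puts it strictly below them.\<close>

definition lev :: "'a^2^2 \<Rightarrow> nat" where "lev g = (if E g then 0 else nat \<lfloor>log qq (ht g)\<rfloor>)"

text \<open>Scalars, and scalar multiples of \<open>omega\<close>, which exchange the two ends of an
  edge.\<close>

definition Nn :: "('a^2^2) set" where
  "Nn = {A. det A \<in> \<Delta> \<and> (\<exists>c. c \<noteq> 0 \<and> (A = m2 c 0 0 c \<or> A = m2 0 c (c * \<pi>) 0))}"

text \<open>All of SL2; the matrices with unit determinant in GL2; and those whose determinant has
  even valuation in the model of PGL2.\<close>

definition MM :: "('a^2^2) set" where
  "MM = {A. det A \<in> \<Delta> \<and> (\<exists>z\<in>Z. v (det A) = v z * v z)}"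

lemma JT_tw: "p \<in> J \<or> p \<in> T \<Longrightarrow> tw b p \<in> J \<or> tw b p \<in> T"
  using tw_J tw_T by blast

lemma JT_E: "p \<in> J \<or> p \<in> T \<Longrightarrow> ht (g ** p) = ht g \<and> (E g \<longrightarrow> E (g ** p))"
proof -
  assume p: "p \<in> J \<or> p \<in> T"
  have "height (Xb b (g ** p)) = height (Xb b g)" for b by (rule height_X[OF JT_Q[OF JT_tw[OF p]]])
  moreover have "low (Xb b (g ** p)) \<longleftrightarrow> low (Xb b g)" for b by (simp add: X_mult JT_low[OF JT_tw[OF p]])
  ultimately show ?thesis by (simp add: ht_alt E_def)
qed

lemma N_E: "n \<in> Nn \<Longrightarrow> ht (g ** n) = ht g \<and> (E g \<longrightarrow> E (g ** n))"
proof -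
  assume "n \<in> Nn"
  then obtain c where c: "c \<noteq> 0" "n = m2 c 0 0 c \<or> n = m2 0 c (c * \<pi>) 0" unfolding Nn_def by blast
  \<comment> \<open>The flag \<open>e\<close> tells whether \<open>n\<close> exchanges the two ends
    of the edge.\<close>
  have "\<exists>e. \<forall>b. \<exists>c. c \<noteq> 0 \<and> Xb (b \<noteq> e) (g ** n) = mat c ** Xb b g"
    using c(2)
  proof
    assume n: "n = m2 c 0 0 c"
    have "Xb (b \<noteq> False) (g ** n) = mat c ** Xb b g" for b
      by (cases g rule: m2_cases) (simp add: Xb_def n mat_m2 omega_def algebra_simps)
    then show ?thesis using c(1) by blast
  next
    assume n: "n = m2 0 c (c * \<pi>) 0"
    have "Xb (b \<noteq> True) (g ** n) = mat (if b then c else c * \<pi>) ** Xb b g" for b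
      by (cases g rule: m2_cases) (simp add: Xb_def n mat_m2 omega_def algebra_simps)
    moreover have "(if b then c else c * \<pi>) \<noteq> 0" for b using c(1) pi_nz by simp
    ultimately show ?thesis by blast
  qed
  then obtain e where e: "\<And>b. \<exists>c. c \<noteq> 0 \<and> Xb (b \<noteq> e) (g ** n) = mat c ** Xb b g" by blast
  have h: "height (Xb (b \<noteq> e) (g ** n)) = height (Xb b g) \<and> (low (Xb (b \<noteq> e) (g ** n)) \<longleftrightarrow> low (Xb b g))" for b
    using e[of b] height_scalar low_scalar by metis
  have "ht (g ** n) = ht g" using h[of False] h[of True] by (cases e) (simp_all add: ht_alt max.commute)
  moreover have "E (g ** n)" if Eg: "E g"
  proof -
    obtain b where "height (Xb b g) = 1" "low (Xb b g)" using Eg unfolding E_def by blast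
    then show ?thesis unfolding E_def using h[of b] by (intro exI[of _ "b \<noteq> e"]) simp
  qed
  ultimately show ?thesis by blast
qed

lemma J_E_left: "x \<in> J \<Longrightarrow> ht (x ** g) = ht g \<and> (E (x ** g) \<longleftrightarrow> E g)"
  by (simp add: ht_alt E_def X_left J_low_left height_Q_left J_Q)

section \<open>Congruence subgroups and the edges that they fix\<close>

text \<open>No scalars from \<open>Z\<close> are inserted: for PGL2 the image of this group is
  already the congruence subgroup.\<close>

definition Kg :: "nat \<Rightarrow> ('a^2^2) set" where
  "Kg m = {A. det A \<in> \<Delta> \<and> (\<exists>a b c d. v a \<le> v \<pi> ^ m \<and> v b \<le> v \<pi> ^ m \<and> v c \<le> v \<pi> ^ m \<and> v d \<le> v \<pi> ^ m \<and>
    A = m2 (1 + a) b c (1 + d))}"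

lemma pi_power: "m \<ge> 1 \<Longrightarrow> v \<pi> ^ m < 1" "v \<pi> ^ m > 0"
  using pi_less pi_pos by (simp_all add: power_less_one_iff)

lemma Kg_J: "m \<ge> 1 \<Longrightarrow> A \<in> Kg m \<Longrightarrow> A \<in> J"
proof -
  assume m: "m \<ge> 1" and "A \<in> Kg m"
  then obtain a b c d where h: "det A \<in> \<Delta>" "v a \<le> v \<pi> ^ m" "v b \<le> v \<pi> ^ m" "v c \<le> v \<pi> ^ m" "v d \<le> v \<pi> ^ m"
    "A = m2 (1 + a) b c (1 + d)" unfolding Kg_def by blast
  show ?thesis by (rule JI[of 1 a b c d]) (use h pi_power(1)[OF m] in \<open>simp_all del: m2_det\<close>)
qed

lemma v_lin:
  assumes "v \<alpha> \<le> e" "v \<beta> \<le> e" "v x \<le> C" "v y \<le> C"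
  shows "v (\<alpha> * x + \<beta> * y) \<le> e * C"
proof -
  have "0 \<le> e" "0 \<le> C" using assms(1,3) nonneg[of \<alpha>] nonneg[of x] by linarith+
  then show ?thesis using assms by (intro v_add_le) (simp_all add: mult mult_mono nonneg)
qed

lemma Kg_subgroup: "m \<ge> 1 \<Longrightarrow> subgroup (Kg m) M"
proof -
  assume m: "m \<ge> 1"
  let ?r = "v \<pi> ^ m"
  note r = pi_power(1)[OF m] pi_power(2)[of m]
  have le: "v (x * y) \<le> ?r" if "v x \<le> ?r" "v y \<le> ?r" for x y
  proof -
    have "v x * v y \<le> ?r * 1" by (rule mult_mono) (use that r nonneg in simp_all)
    then show ?thesis by (simp add: mult)
  qed
  show ?thesis
  proof (rule group.subgroupI[OF group_M])
    show "Kg m \<subseteq> carrier M" by (auto simp: Kg_def)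
    have "m2 1 0 0 1 \<in> Kg m" unfolding Kg_def mem_Collect_eq
      by (rule conjI, simp, rule exI[of _ 0], rule exI[of _ 0], rule exI[of _ 0], rule exI[of _ 0]) (use r in simp)
    then show "Kg m \<noteq> {}" by blast
  next
    fix A assume "A \<in> Kg m"
    then obtain a b c d where h: "det A \<in> \<Delta>" "v a \<le> ?r" "v b \<le> ?r" "v c \<le> ?r" "v d \<le> ?r"
      "A = m2 (1 + a) b c (1 + d)" unfolding Kg_def by blast
    let ?D = "(1 + a) * (1 + d) - b * c" and ?e = "a + d + a * d - b * c"
    have e: "v ?e \<le> ?r" by (intro v_add_le v_diff_le le h)
    have D1: "?D = 1 + ?e" by (simp add: algebra_simps)
    have D: "v ?D = 1" unfolding D1 by (rule v_add_eq(1)[of ?e 1, simplified]) (use e r in linarith)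
    then have Dn: "?D \<noteq> 0" by auto
    have inv: "inv\<^bsub>M\<^esub> A = m2 ((1 + d) / ?D) (- b / ?D) (- c / ?D) ((1 + a) / ?D)"
      unfolding h(6) by (rule inv_m2) (use h(1) in \<open>simp only: h(6) m2_det\<close>)
    have q: "(1 + x) / ?D = 1 + (x - ?e) / ?D" for x
    proof -
      have "1 + y / z = (z + y) / z" if "z \<noteq> 0" for y z :: 'a using that by (simp add: add_divide_distrib)
      from this[OF Dn] have "1 + (x - ?e) / ?D = (?D + (x - ?e)) / ?D" .
      also have "?D + (x - ?e) = 1 + x" by (simp add: algebra_simps)
      finally show ?thesis ..
    qed
    have "v ((x - ?e) / ?D) \<le> ?r" if "v x \<le> ?r" for x
      unfolding v_divide D div_by_1 by (rule v_diff_le[OF that e])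
    then have "inv\<^bsub>M\<^esub> A = m2 (1 + (d - ?e) / ?D) (- b / ?D) (- c / ?D) (1 + (a - ?e) / ?D) \<and>
        v ((d - ?e) / ?D) \<le> ?r \<and> v ((a - ?e) / ?D) \<le> ?r \<and> v (- b / ?D) \<le> ?r \<and> v (- c / ?D) \<le> ?r"
      using h inv by (simp only: q v_divide D div_by_1 v_minus)
    then show "inv\<^bsub>M\<^esub> A \<in> Kg m" using inv_M[OF h(1)] unfolding Kg_def by blast
  next
    fix A B assume "A \<in> Kg m" "B \<in> Kg m"
    then obtain a b c d a' b' c' d' where h: "det A \<in> \<Delta>" "v a \<le> ?r" "v b \<le> ?r" "v c \<le> ?r" "v d \<le> ?r"
      "A = m2 (1 + a) b c (1 + d)" "det B \<in> \<Delta>" "v a' \<le> ?r" "v b' \<le> ?r" "v c' \<le> ?r" "v d' \<le> ?r"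
      "B = m2 (1 + a') b' c' (1 + d')" unfolding Kg_def by blast
    have "A ** B = m2 (1 + (a + a' + a * a' + b * c')) (b' + a * b' + b + b * d') (c + c * a' + c' + d * c')
        (1 + (d + d' + c * b' + d * d'))"
      by (simp add: h algebra_simps)
    moreover have "v (a + a' + a * a' + b * c') \<le> ?r" "v (b' + a * b' + b + b * d') \<le> ?r"
      "v (c + c * a' + c' + d * c') \<le> ?r" "v (d + d' + c * b' + d * d') \<le> ?r"
      by (intro v_add_le le h)+
    ultimately show "A \<otimes>\<^bsub>M\<^esub> B \<in> Kg m" using det_M[OF h(1,7)] unfolding Kg_def M_mult by blast
  qed
qed

text \<open>The deviation of the conjugate from the identity has entries bilinear in the columns of
  \<open>g\<close>, divided by the determinant; each is bounded by two column norms times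
  \<open>v \<pi> ^ m\<close>.\<close>

lemma conj_form:
  assumes g: "det g \<in> \<Delta>" and x: "x \<in> Kg m"
  obtains p q r s where "inv\<^bsub>M\<^esub> g ** x ** g = m2 (1 + p) q r (1 + s)" "det (m2 (1 + p) q r (1 + s)) \<in> \<Delta>"
    "v p * v (det g) \<le> col2 g * (v \<pi> ^ m * col1 g)" "v q * v (det g) \<le> col2 g * (v \<pi> ^ m * col2 g)"
    "v r * v (det g) \<le> col1 g * (v \<pi> ^ m * col1 g)" "v s * v (det g) \<le> col1 g * (v \<pi> ^ m * col2 g)"
proof -
  let ?e = "v \<pi> ^ m"
  obtain a b c d where ge: "g = m2 a b c d" by (rule m2_cases)
  obtain \<alpha> \<beta> \<gamma> \<delta> where h: "det x \<in> \<Delta>" "v \<alpha> \<le> ?e" "v \<beta> \<le> ?e" "v \<gamma> \<le> ?e" "v \<delta> \<le> ?e"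
    "x = m2 (1 + \<alpha>) \<beta> \<gamma> (1 + \<delta>)" using x unfolding Kg_def by blast
  define \<iota> where "\<iota> = inverse (a * d - b * c)"
  have Dn: "a * d - b * c \<noteq> 0" using \<Delta>_nz[OF g] by (simp add: ge)
  have io: "\<iota> * (a * d - b * c) = 1" using Dn by (simp add: \<iota>_def)
  let ?D = "v (det g)"
  have Dp: "?D > 0" by (rule v_pos[OF \<Delta>_nz[OF g]])
  have vi: "v \<iota> = inverse ?D" by (simp add: \<iota>_def v_inverse ge)
  \<comment> \<open>The entries of the adjugate of \<open>g\<close>, times \<open>x\<close> minus
    the identity, times \<open>g\<close>. The resulting \<open>?y\<close> is justified by
    \<open>g ** ?y = x ** g\<close>.\<close>
  define P where "P = d * (\<alpha> * a + \<beta> * c) + - b * (\<gamma> * a + \<delta> * c)"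
  define Q where "Q = d * (\<alpha> * b + \<beta> * d) + - b * (\<gamma> * b + \<delta> * d)"
  define R where "R = - c * (\<alpha> * a + \<beta> * c) + a * (\<gamma> * a + \<delta> * c)"
  define S where "S = - c * (\<alpha> * b + \<beta> * d) + a * (\<gamma> * b + \<delta> * d)"
  let ?y = "m2 (1 + \<iota> * P) (\<iota> * Q) (\<iota> * R) (1 + \<iota> * S)"
  have k: "a * (\<iota> * (d * u + - b * w)) + b * (\<iota> * (- c * u + a * w)) = u"
    "c * (\<iota> * (d * u + - b * w)) + d * (\<iota> * (- c * u + a * w)) = w" for u w
  proof -
    have "a * (\<iota> * (d * u + - b * w)) + b * (\<iota> * (- c * u + a * w)) = \<iota> * (a * d - b * c) * u"
      "c * (\<iota> * (d * u + - b * w)) + d * (\<iota> * (- c * u + a * w)) = \<iota> * (a * d - b * c) * w"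
      by (simp_all add: algebra_simps)
    then show "a * (\<iota> * (d * u + - b * w)) + b * (\<iota> * (- c * u + a * w)) = u"
      "c * (\<iota> * (d * u + - b * w)) + d * (\<iota> * (- c * u + a * w)) = w" by (simp_all only: io mult_1_left)
  qed
  note kk = k[of "\<alpha> * a + \<beta> * c" "\<gamma> * a + \<delta> * c", folded P_def R_def]
    k[of "\<alpha> * b + \<beta> * d" "\<gamma> * b + \<delta> * d", folded Q_def S_def]
  have sh: "x1 * (1 + p) + x2 * q = x1 + (x1 * p + x2 * q)" "x1 * p + x2 * (1 + q) = x2 + (x1 * p + x2 * q)"
    for x1 x2 p q :: 'a by (simp_all add: algebra_simps)
  have gy: "g ** ?y = x ** g"
    unfolding ge h(6) m2_mult m2_eq sh kk by (simp add: distrib_right)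
  have dy: "det ?y = det x"
  proof -
    have "det g * det ?y = det x * det g" using arg_cong[OF gy, of det] by (simp only: det_mul)
    then show ?thesis using \<Delta>_nz[OF g] by (simp add: mult.commute del: m2_det)
  qed
  have "inv\<^bsub>M\<^esub> g ** x ** g = inv\<^bsub>M\<^esub> g ** g ** ?y" by (simp only: matrix_mul_assoc[symmetric] gy)
  also have "inv\<^bsub>M\<^esub> g ** g = m2 1 0 0 1" using group.l_inv[OF group_M, of g] g by simp
  finally have iy: "inv\<^bsub>M\<^esub> g ** x ** g = ?y" by (simp only: one_left)
  have C: "v a \<le> col1 g" "v c \<le> col1 g" "v b \<le> col2 g" "v d \<le> col2 g" "v (- c) \<le> col1 g" "v (- b) \<le> col2 g"
    by (simp_all add: ge)
  have L: "v (\<alpha> * a + \<beta> * c) \<le> ?e * col1 g" "v (\<gamma> * a + \<delta> * c) \<le> ?e * col1 g"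
    "v (\<alpha> * b + \<beta> * d) \<le> ?e * col2 g" "v (\<gamma> * b + \<delta> * d) \<le> ?e * col2 g"
    by (rule v_lin; rule h C)+
  have B: "v P \<le> col2 g * (?e * col1 g)" "v Q \<le> col2 g * (?e * col2 g)"
    "v R \<le> col1 g * (?e * col1 g)" "v S \<le> col1 g * (?e * col2 g)"
    unfolding P_def Q_def R_def S_def by (rule v_lin; rule L C)+
  have s: "v (\<iota> * w) * ?D = v w" for w using Dp by (simp add: mult vi)
  show ?thesis by (rule that[OF iy]) (unfold dy s, rule h(1), (rule B)+)
qed

text \<open>The congruence subgroup fixes the edges of the ball of radius \<open>m\<close>. If the
  second column is longer, the shorter first column supplies the strict inequalities. If the first
  column carries the norm, \<open>ht g\<close> is \<open>height g * qq\<close>, and the spare factor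
  supplies them.\<close>

lemma conj_Kg:
  assumes m: "m \<ge> 1" and g: "det g \<in> \<Delta>" and ht: "ht g \<le> qq ^ m" and x: "x \<in> Kg m"
  shows "inv\<^bsub>M\<^esub> g ** x ** g \<in> J"
proof -
  let ?e = "v \<pi> ^ m"
  note e = pi_power(2)[of m]
  let ?D = "v (det g)"
  have Dp: "?D > 0" by (rule v_pos[OF \<Delta>_nz[OF g]])
  obtain p q r s where y: "inv\<^bsub>M\<^esub> g ** x ** g = m2 (1 + p) q r (1 + s)" "det (m2 (1 + p) q r (1 + s)) \<in> \<Delta>"
    and le: "v p * ?D \<le> col2 g * (?e * col1 g)" "v q * ?D \<le> col2 g * (?e * col2 g)"
    "v r * ?D \<le> col1 g * (?e * col1 g)" "v s * ?D \<le> col1 g * (?e * col2 g)" by (rule conj_form[OF g x])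
  define C1 C2 where "C1 = col1 g" and "C2 = col2 g"
  have C: "C1 \<ge> 0" "C2 \<ge> 0" using nonneg by (simp_all add: C1_def C2_def col1_def col2_def le_max_iff_disj)
  have n: "nrm g = max C1 C2" by (simp add: nrm_def C1_def C2_def)
  have qe: "qq ^ m * ?e = 1" using pi_pos by (simp add: power_inverse)
  have B: "C2 * (?e * C1) < ?D \<and> C2 * (?e * C2) \<le> ?D \<and> C1 * (?e * C1) < ?D"
  proof (cases "col1 g < nrm g")
    case True
    then have c: "C1 < C2" using n by (simp add: C1_def C2_def)
    have "height g \<le> qq ^ m" using ht_down[of False g] True ht by (simp add: Xb_def)
    then have "height g * ?e \<le> qq ^ m * ?e" by (rule mult_right_mono) (use e in simp)
    then have "height g * ?e \<le> 1" unfolding qe .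
    moreover have "nrm g = C2" using n c by simp
    ultimately have 2: "C2 * (?e * C2) \<le> ?D" using Dp by (simp add: height_def power2_eq_square field_simps)
    have C2: "C2 > 0" using c C by linarith
    have 1: "C2 * (?e * C1) < C2 * (?e * C2)" using C2 e c by simp
    have "C1 * (?e * C1) \<le> C2 * (?e * C1)" by (rule mult_right_mono) (use c e C in simp_all)
    then show ?thesis using 1 2 by linarith
  next
    case False
    then have u: "col1 g = nrm g" using entry_le(5)[of g] by linarith
    then have c: "C2 \<le> C1" using n by (simp add: C1_def C2_def)
    have "height g * qq \<le> qq ^ m" using ht_up[of False g] u ht by (simp add: Xb_def)
    then have "height g * qq * ?e \<le> qq ^ m * ?e" by (rule mult_right_mono) (use e in simp)
    then have "height g * qq * ?e \<le> 1" unfolding qe .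
    then have "height g * ?e \<le> v \<pi>" using pi_pos by (simp add: field_simps)
    then have "height g * ?e < 1" using pi_less by linarith
    moreover have "nrm g = C1" using n c by simp
    ultimately have 2: "C1 * (?e * C1) < ?D" using Dp by (simp add: height_def power2_eq_square field_simps)
    have "C2 * (?e * C2) \<le> C1 * (?e * C1)" "C2 * (?e * C1) \<le> C1 * (?e * C1)"
      by (intro mult_mono order_refl; use c e C in simp)+
    then show ?thesis using 2 by linarith
  qed
  note le' = le[folded C1_def C2_def]
  have lt: "v w < 1" if "v w * ?D \<le> y" "y < ?D" for w y
  proof -
    have "v w * ?D < 1 * ?D" using that by linarith
    then show ?thesis using Dp by (simp only: mult_less_cancel_right_pos)
  qed
  have "v q * ?D \<le> 1 * ?D" using le'(2) B by linarith
  then have q: "v q \<le> 1" using Dp by (simp only: mult_le_cancel_right_pos)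
  have S': "v s * ?D \<le> C2 * (?e * C1)" using le'(4) by (simp only: mult.commute mult.left_commute)
  show ?thesis unfolding y(1)
    by (rule JI[OF Z_1 lt[OF le'(1)] q lt[OF le'(3)] lt[OF S']]) (use B y(2) in \<open>simp_all del: m2_det\<close>)
qed

text \<open>Elements of \<open>J\<close> have height 1, so the bounds of \<open>conj_form\<close>
  lose nothing.\<close>

lemma conj_Kg_J:
  assumes g: "g \<in> J" and x: "x \<in> Kg m"
  shows "inv\<^bsub>M\<^esub> g ** x ** g \<in> Kg m"
proof -
  let ?e = "v \<pi> ^ m"
  let ?D = "v (det g)"
  have gM: "det g \<in> \<Delta>" by (rule J_M[OF g])
  have Dp: "?D > 0" by (rule v_pos[OF \<Delta>_nz[OF gM]])
  obtain p q r s where y: "inv\<^bsub>M\<^esub> g ** x ** g = m2 (1 + p) q r (1 + s)" "det (m2 (1 + p) q r (1 + s)) \<in> \<Delta>"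
    and le: "v p * ?D \<le> col2 g * (?e * col1 g)" "v q * ?D \<le> col2 g * (?e * col2 g)"
    "v r * ?D \<le> col1 g * (?e * col1 g)" "v s * ?D \<le> col1 g * (?e * col2 g)" by (rule conj_form[OF gM x])
  have "height g = height (m2 1 0 0 1)" using height_Q[OF J_Q[OF g], of "m2 1 0 0 1"] by simp
  moreover have "height (m2 1 0 0 1) = 1" by (simp add: height_def nrm_def)
  ultimately have "height g = 1" by (rule trans)
  then have D: "?D = nrm g * nrm g" using Dp by (simp add: height_def power2_eq_square)
  have c: "0 \<le> col1 g" "0 \<le> col2 g" "col1 g \<le> nrm g" "col2 g \<le> nrm g" "?e \<ge> 0"
    using nonneg pi_pos by (simp_all add: nrm_def col1_def col2_def le_max_iff_disj)
  have b: "w \<le> ?e" if "w * ?D \<le> x * (?e * y)" "0 \<le> x" "0 \<le> y" "x \<le> nrm g" "y \<le> nrm g" for w x y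
  proof -
    have "x * (?e * y) \<le> nrm g * (?e * nrm g)" by (intro mult_mono order_refl) (use that c in simp_all)
    then have "w * ?D \<le> ?e * ?D" using that(1) by (simp add: D mult.commute mult.left_commute)
    then show ?thesis using Dp by (simp only: mult_le_cancel_right_pos)
  qed
  have "v p \<le> ?e" "v q \<le> ?e" "v r \<le> ?e" "v s \<le> ?e"
    using b[OF le(1)] b[OF le(2)] b[OF le(3)] b[OF le(4)] c by simp_all
  then show ?thesis unfolding y(1) using y(2) unfolding Kg_def by blast
qed

text \<open>The deviation of \<open>x\<close> from the identity consists of products of two entries
  of the first column of \<open>Y\<close>, times \<open>b\<close>, divided by the determinant. For a
  root other than at height 1 these are bounded by the inverse of \<open>height Y\<close>, which
  puts \<open>x\<close> into the congruence subgroup. This is how that group moves the successors of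
  a root edge.\<close>

lemma root_conj:
  assumes Y: "det Y \<noteq> 0" and b: "v b \<le> 1" and lo: "low Y" and rt: "height Y = 1 \<or> root Y"
  obtains x where "det x = 1" "x ** Y = Y ** m2 1 b 0 1" "x \<in> J"
    "\<And>m. m \<ge> 1 \<Longrightarrow> height Y \<ge> qq ^ m \<Longrightarrow> x \<in> Kg m"
proof -
  obtain y11 y12 y21 y22 where Ye: "Y = m2 y11 y12 y21 y22" by (rule m2_cases)
  define \<rho> where "\<rho> = b * inverse (y11 * y22 - y12 * y21)"
  have Dn: "y11 * y22 - y12 * y21 \<noteq> 0" using Y by (simp add: Ye)
  have rho: "\<rho> * (y11 * y22 - y12 * y21) = b" using Dn by (simp add: \<rho>_def)
  let ?D = "v (det Y)"
  have Dp: "?D > 0" by (rule v_pos[OF Y])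
  have vr: "v \<rho> \<le> inverse ?D"
    using mult_right_mono[OF b, of "inverse ?D"] Dp by (simp add: \<rho>_def mult v_inverse Ye)
  let ?x = "m2 (1 + - \<rho> * (y11 * y21)) (\<rho> * (y11 * y11)) (- \<rho> * (y21 * y21)) (1 + \<rho> * (y11 * y21))"
  have d: "det ?x = 1" by (simp add: algebra_simps)
  have x: "?x ** Y = Y ** m2 1 b 0 1"
    unfolding Ye m2_mult m2_eq by (simp add: rho[symmetric] algebra_simps)
  have lt: "v (\<rho> * w) < 1" if "v w < ?D" for w
  proof -
    have "v \<rho> * v w \<le> inverse ?D * v w" by (rule mult_right_mono[OF vr nonneg])
    also have "\<dots> < inverse ?D * ?D" by (rule mult_strict_left_mono[OF that]) (use Dp in simp)
    also have "\<dots> = 1" using Dp by simp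
    finally show ?thesis by (simp only: mult)
  qed
  have leq: "v (\<rho> * w) \<le> r" if "v w \<le> r * ?D" for w r
  proof -
    have "v \<rho> * v w \<le> inverse ?D * (r * ?D)" by (rule mult_mono) (use vr that nonneg Dp in simp_all)
    then show ?thesis using Dp by (simp add: mult field_simps)
  qed
  have "v (y11 * y21) < ?D \<and> v (y11 * y11) \<le> ?D \<and> v (y21 * y21) < ?D \<and>
      (height Y \<noteq> 1 \<longrightarrow> (\<forall>y\<in>{y11 * y21, y11 * y11, y21 * y21}. v y \<le> col1 Y * col1 Y))"
  proof -
    have c: "v y11 \<le> col1 Y" "v y21 \<le> col1 Y" "col1 Y \<ge> 0" using nonneg by (simp_all add: Ye le_max_iff_disj)
    have m: "v (y11 * y21) \<le> col1 Y * col1 Y" "v (y11 * y11) \<le> col1 Y * col1 Y" "v (y21 * y21) \<le> col1 Y * col1 Y"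
      unfolding mult by (intro mult_mono c nonneg)+
    have n: "nrm Y > 0" by (rule nrm_pos[OF Y])
    show ?thesis
    proof (cases "height Y = 1")
      case True
      have l: "v y21 < nrm Y" using lo True by (simp add: low_def Ye)
      have D: "?D = nrm Y * nrm Y" using True Dp by (simp add: height_def power2_eq_square)
      have y: "v y11 \<le> nrm Y" using c entry_le(5)[of Y] by linarith
      have "v y11 * v y21 < ?D" unfolding D by (rule le_less_trans[OF mult_right_mono[OF y nonneg] mult_strict_left_mono[OF l n]])
      moreover have "v y11 * v y11 \<le> ?D" unfolding D by (intro mult_mono y nonneg) (use n in simp)
      moreover have "v y21 * v y21 < ?D"
        unfolding D by (rule le_less_trans[OF mult_right_mono[OF less_imp_le[OF l] nonneg] mult_strict_left_mono[OF l n]])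
      ultimately show ?thesis using True by (simp add: mult)
    next
      case False
      then have l: "col1 Y < nrm Y" and r: "col1 Y * nrm Y = ?D" using lo rt by (simp_all add: low_def root_def)
      have "col1 Y \<noteq> 0" using r Dp by auto
      then have cp: "col1 Y > 0" using c(3) by simp
      have "col1 Y * col1 Y < ?D" unfolding r[symmetric] by (rule mult_strict_left_mono[OF l cp])
      then show ?thesis using m by auto
    qed
  qed
  then have B: "v (y11 * y21) < ?D" "v (y11 * y11) \<le> 1 * ?D" "v (y21 * y21) < ?D"
    and B': "height Y \<noteq> 1 \<Longrightarrow> y \<in> {y11 * y21, y11 * y11, y21 * y21} \<Longrightarrow> v y \<le> col1 Y * col1 Y" for y
    by auto
  have m: "v (- \<rho> * w) = v (\<rho> * w)" for w by (simp only: mult v_minus)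
  have xJ: "?x \<in> J"
    by (rule JI[OF Z_1, of "- \<rho> * (y11 * y21)" "\<rho> * (y11 * y11)" "- \<rho> * (y21 * y21)" "\<rho> * (y11 * y21)"])
      (unfold m d, (rule lt leq B \<Delta>_1 | simp)+)
  have xK: "?x \<in> Kg k" if k: "k \<ge> 1" "height Y \<ge> qq ^ k" for k
  proof -
    have "qq ^ k > 1" using qq_gt k(1) by (simp add: one_less_power)
    then have h1: "height Y \<noteq> 1" using k(2) by linarith
    then have r: "col1 Y * nrm Y = ?D" using rt by (simp add: root_def)
    have n: "nrm Y > 0" by (rule nrm_pos[OF Y])
    have qe: "qq ^ k * v \<pi> ^ k = 1" using pi_pos by (simp add: power_inverse)
    have "1 \<le> height Y * v \<pi> ^ k" using mult_right_mono[OF k(2), of "v \<pi> ^ k"] qe pi_pos by simp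
    then have "?D \<le> nrm Y * nrm Y * v \<pi> ^ k" using Dp by (simp add: height_def power2_eq_square field_simps)
    then have "nrm Y * col1 Y \<le> nrm Y * (v \<pi> ^ k * nrm Y)" using r by (simp add: mult.commute mult.left_commute)
    then have "col1 Y \<le> v \<pi> ^ k * nrm Y" using n by simp
    then have "col1 Y * col1 Y \<le> v \<pi> ^ k * nrm Y * col1 Y"
      by (rule mult_right_mono) (use nonneg in \<open>simp add: col1_def le_max_iff_disj\<close>)
    then have "col1 Y * col1 Y \<le> v \<pi> ^ k * ?D" unfolding r[symmetric] by (simp add: mult.commute mult.left_commute)
    then have w: "v (\<rho> * w) \<le> v \<pi> ^ k" if "w \<in> {y11 * y21, y11 * y11, y21 * y21}" for w
      by (intro leq order_trans[OF B'[OF h1 that]])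
    show ?thesis unfolding Kg_def mem_Collect_eq
    proof (intro conjI exI)
      show "det ?x \<in> \<Delta>" unfolding d by simp
      show "?x = m2 (1 + - \<rho> * (y11 * y21)) (\<rho> * (y11 * y11)) (- \<rho> * (y21 * y21)) (1 + \<rho> * (y11 * y21))" ..
    qed (unfold m, (rule w, simp)+)
  qed
  show ?thesis by (rule that[OF d x xJ xK])
qed

text \<open>A matrix of height 1 with small lower left entry is Iwahori up to a scalar; the scalar
  \<open>w\<close> accounts for its norm, and the rest splits into a diagonal part and an element of
  \<open>J\<close>.\<close>

lemma E_form:
  assumes g: "det g \<in> \<Delta>" and E: "E g"
  shows "\<exists>n\<in>Nn. \<exists>t\<in>T. \<exists>j\<in>J. g = n ** t ** j"
proof -
  obtain b where h: "height (Xb b g) = 1" "low (Xb b g)" using E unfolding E_def by blast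
  let ?Y = "Xb b g"
  obtain y11 y12 y21 y22 where Ye: "?Y = m2 y11 y12 y21 y22" by (rule m2_cases)
  have Y0: "det ?Y \<noteq> 0" by (rule det_X'[OF g])
  have n: "nrm ?Y > 0" by (rule nrm_pos[OF Y0])
  define D where "D = y11 * y22 - y12 * y21"
  have D0: "D \<noteq> 0" using Y0 by (simp add: Ye D_def)
  have vD: "v D = nrm ?Y * nrm ?Y"
    using h(1) v_pos[OF D0] by (simp add: height_def power2_eq_square D_def Ye)
  have l: "v y21 < nrm ?Y" using h by (simp add: low_def Ye)
  have le: "v y11 \<le> nrm ?Y" "v y12 \<le> nrm ?Y" "v y22 \<le> nrm ?Y"
    using entry_le(1,3,4,5)[of ?Y] by (simp_all add: Ye)
  have s: "v (y12 * y21) < v D"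
    unfolding mult vD by (rule le_less_trans[OF mult_right_mono[OF le(2) nonneg] mult_strict_left_mono[OF l n]])
  have "v (y12 * y21 + D) = v D" by (rule v_add_eq(2)[OF s])
  then have "v y11 * v y22 = nrm ?Y * nrm ?Y" by (simp add: D_def mult[symmetric] vD[unfolded D_def])
  \<comment> \<open>The product of the diagonal entries has the largest absolute value possible, so
    the upper left one attains the norm.\<close>
  then have v11: "v y11 = nrm ?Y"
    using le n mult_mono[of "v y11" "nrm ?Y" "v y22" "nrm ?Y"] nonneg[of y22] nonneg[of y11]
    by (smt (verit) mult_le_cancel_left mult_le_cancel_right)
  have y0: "y11 \<noteq> 0" using v11 n by auto
  \<comment> \<open>For SL2 no scalar is available. Determinant 1 makes the norm 1, and
    \<open>b\<close> must be false, since \<open>omega\<close> would give a determinant of odd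
    valuation.\<close>
  have w: "\<exists>w. v w = nrm ?Y \<and> (\<Delta> = {1} \<longrightarrow> w = 1 \<and> \<not> b)"
  proof (cases "\<Delta> = {1}")
    case True
    have b: "\<not> b"
    proof
      assume b: b
      obtain w where w: "nrm ?Y = v w" using nrm_value by blast
      have dY: "det ?Y = D" unfolding Ye D_def by simp
      have "v (det ?Y) = v \<pi> * v (det g)" using b by (simp add: Xb_def det_omega)
      moreover have "det g = 1" using g True by simp
      ultimately have "v D = v \<pi>" unfolding dY by simp
      then have "v w * v w = v 1 * v 1 * v \<pi>" using vD unfolding w by simp
      moreover have "w \<noteq> 0" using n w by auto
      ultimately show False using odd_power[of 1 w] by simp
    qed
    then have "D = 1" using g True Ye by (simp add: Xb_def D_def)
    then have "nrm ?Y * nrm ?Y = 1" using vD by simp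
    then have "nrm ?Y = 1" using n by (simp add: square_eq_1_iff)
    then show ?thesis using b by (intro exI[of _ 1]) simp
  next
    case False
    then show ?thesis using nrm_value[of ?Y] by metis
  qed
  then obtain w where w: "v w = nrm ?Y" "\<Delta> = {1} \<Longrightarrow> w = 1 \<and> \<not> b" by blast
  have w0: "w \<noteq> 0" using w(1) n by auto
  \<comment> \<open>The second diagonal entry is chosen to give \<open>?t\<close> the determinant
    \<open>D / (w * w)\<close>, which leaves determinant 1 for \<open>?j\<close>.\<close>
  let ?t = "m2 (y11 / w) 0 0 (D / (y11 * w))" and ?j = "m2 1 (y12 / y11) (y21 * y11 / D) (y22 * y11 / D)"
  have dt: "det ?t \<in> \<Delta>"
  proof (cases "\<Delta> = {1}")
    case True
    then have "D = 1" using g Ye w(2) by (simp add: Xb_def D_def)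
    then show ?thesis using w(2)[OF True] y0 by simp
  next
    case False
    then show ?thesis using \<Delta>_cases w0 y0 D0 by auto
  qed
  have "v (D / (y11 * w)) = 1" using n by (simp add: v_divide mult vD v11 w(1))
  moreover have "v (y11 / w) = 1" using n by (simp add: v_divide v11 w(1))
  ultimately have t: "?t \<in> T" by (intro TI[OF Z_1 _ _ dt]) simp_all
  have "y22 * y11 - y12 * y21 = D" by (simp add: D_def mult.commute)
  then have dj: "det ?j = 1" using D0 y0 by (simp add: diff_divide_distrib[symmetric])
  have e: "y22 * y11 / D = 1 + y12 * y21 / D"
  proof -
    have "1 + y12 * y21 / D = (D + y12 * y21) / D" using D0 by (simp add: add_divide_distrib)
    then show ?thesis by (simp add: D_def mult.commute)
  qed
  have j: "?j \<in> J"
  proof (rule JI[OF Z_1, of 0 "y12 / y11" "y21 * y11 / D" "y12 * y21 / D"])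
    show "v (y12 / y11) \<le> 1" using le n by (simp add: v_divide v11)
    show "v (y21 * y11 / D) < 1" using l n by (simp add: v_divide mult v11 vD)
    show "v (y12 * y21 / D) < 1" using s v_pos[OF D0] by (simp add: v_divide)
  qed (use dj e in \<open>simp_all del: m2_det\<close>)
  have Y: "?Y = mat w ** ?t ** ?j" unfolding Ye using w0 D0 y0 by (simp add: mat_m2)
  show ?thesis
  proof (cases b)
    case False
    have "det (m2 w 0 0 w) \<in> \<Delta>"
      using w(2) \<Delta>_cases w0 by (cases "\<Delta> = {1}") auto
    then have wN: "m2 w 0 0 w \<in> Nn" unfolding Nn_def using w0 by blast
    have "Xb b g = g" using False by (simp add: Xb_def)
    then have "g = m2 w 0 0 w ** ?t ** ?j" using Y unfolding mat_m2 by (simp only:)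
    then show ?thesis using wN t j by blast
  next
    case True
    \<comment> \<open>With this constant \<open>m2 0 ?c (?c * \<pi>) 0 ** omega\<close> is the
      scalar \<open>w\<close>, which undoes the twist in \<open>Xb True g\<close>.\<close>
    let ?c = "w / \<pi>"
    have c: "?c \<noteq> 0" using w0 pi_nz by simp
    have "\<Delta> = - {0}" using w(2) True \<Delta>_cases by blast
    then have nN: "m2 0 ?c (?c * \<pi>) 0 \<in> Nn" unfolding Nn_def using c w0 pi_nz by auto
    have "g = m2 0 ?c (?c * \<pi>) 0 ** sig ?t ** sig ?j"
    proof (rule X_inj[of True])
      have "Xb True g = mat w ** ?t ** ?j" using Y True by simp
      also have "\<dots> = Xb True (m2 0 ?c (?c * \<pi>) 0 ** sig ?t ** sig ?j)"
        using pi_nz by (simp add: Xb_def omega_right) (simp add: omega_def mat_m2)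
      finally show "Xb True g = \<dots>" .
    qed
    then show ?thesis using nN sig_T[OF t] sig_J[OF j] by blast
  qed
qed

end

text \<open>The edges \<open>n t J\<close> are fixed by \<open>J\<close> because \<open>n\<close>
  and \<open>t\<close> normalize it.\<close>

lemma (in hecke_cover) conj_norm_J:
  assumes n: "norm n" "norm t" and j: "j \<in> J" and x: "x \<in> J"
  shows "inv (n \<otimes> t \<otimes> j) \<otimes> x \<otimes> (n \<otimes> t \<otimes> j) \<in> J"
proof -
  note [simp] = norm_carrier[OF n(1)] norm_carrier[OF n(2)] J_carrier[OF j] J_carrier[OF x]
  have "inv t \<otimes> ((inv n \<otimes> (x \<otimes> n)) \<otimes> t) \<in> J" by (rule norm_J[OF n(2) norm_J[OF n(1) x]])
  then have "inv j \<otimes> (inv t \<otimes> ((inv n \<otimes> (x \<otimes> n)) \<otimes> t)) \<otimes> j \<in> J" by (intro J.m_closed[OF J.m_closed[OF J.m_inv_closed[OF j]] j])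
  then show ?thesis by (simp add: gs)
qed

section \<open>Scalars and multiples of \<open>omega\<close> against the determinant\<close>

context det_scalars
begin

lemma Nn_cases:
  assumes "n \<in> Nn"
  obtains c where "c \<noteq> 0" "n = m2 c 0 0 c" "inv\<^bsub>M\<^esub> n = m2 (inverse c) 0 0 (inverse c)" "det n \<in> \<Delta>"
  | c where "c \<noteq> 0" "n = m2 0 c (c * \<pi>) 0" "inv\<^bsub>M\<^esub> n = m2 0 (inverse (c * \<pi>)) (inverse (c * \<pi>) * \<pi>) 0" "det n \<in> \<Delta>"
proof -
  obtain c where c: "c \<noteq> 0" and d: "det n \<in> \<Delta>" and cs: "n = m2 c 0 0 c \<or> n = m2 0 c (c * \<pi>) 0"
    using assms unfolding Nn_def by blast
  show ?thesis using cs
  proof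
    assume e: "n = m2 c 0 0 c"
    let ?i = "m2 (inverse c) 0 0 (inverse c)"
    have "det ?i = inverse (det n)" by (simp add: e)
    then have di: "det ?i \<in> \<Delta>" using \<Delta>_inverse[OF d] by (simp only:)
    have "?i ** n = m2 1 0 0 1" using c by (simp add: e)
    from inv_eqI[OF di d this] show ?thesis using that(1) c e d by blast
  next
    assume e: "n = m2 0 c (c * \<pi>) 0"
    let ?i = "m2 0 (inverse (c * \<pi>)) (inverse (c * \<pi>) * \<pi>) 0"
    have "det ?i = inverse (det n)" using c pi_nz by (simp add: e field_simps)
    then have di: "det ?i \<in> \<Delta>" using \<Delta>_inverse[OF d] by (simp only:)
    have "?i ** n = m2 1 0 0 1" using c pi_nz by (simp add: e field_simps)
    from inv_eqI[OF di d this] show ?thesis using that(2) c e d by blast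
  qed
qed

text \<open>Scalars conjugate trivially, multiples of \<open>omega\<close> by
  \<open>sig\<close>.\<close>

lemma Nn_conj: "n \<in> Nn \<Longrightarrow> \<exists>e. \<forall>u. n ** u ** inv\<^bsub>M\<^esub> n = tw e u"
proof (erule Nn_cases)
  fix c assume c: "c \<noteq> 0" "n = m2 c 0 0 c" "inv\<^bsub>M\<^esub> n = m2 (inverse c) 0 0 (inverse c)"
  have "n ** u ** inv\<^bsub>M\<^esub> n = tw False u" for u
    unfolding c(3) by (cases u rule: m2_cases) (use c(1) in \<open>simp add: c(2) tw_def\<close>)
  then show ?thesis by blast
next
  fix c assume c: "c \<noteq> 0" "n = m2 0 c (c * \<pi>) 0" "inv\<^bsub>M\<^esub> n = m2 0 (inverse (c * \<pi>)) (inverse (c * \<pi>) * \<pi>) 0"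
  have "n ** u ** inv\<^bsub>M\<^esub> n = tw True u" for u
    unfolding c(3) by (cases u rule: m2_cases) (use c(1) pi_nz in \<open>simp add: c(2) tw_def sig_m2 field_simps\<close>)
  then show ?thesis by blast
qed

lemma Nn_I: "c \<noteq> 0 \<Longrightarrow> det (m2 c 0 0 c) \<in> \<Delta> \<Longrightarrow> m2 c 0 0 c \<in> Nn"
  "c \<noteq> 0 \<Longrightarrow> det (m2 0 c (c * \<pi>) 0) \<in> \<Delta> \<Longrightarrow> m2 0 c (c * \<pi>) 0 \<in> Nn"
  unfolding Nn_def by blast+

lemma Nn_subgroup: "subgroup Nn M"
proof -
  show ?thesis
  proof (rule group.subgroupI[OF group_M])
    show "Nn \<subseteq> carrier M" by (auto simp: Nn_def)
    have "m2 1 0 0 1 \<in> Nn" by (rule Nn_I) simp_all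
    then show "Nn \<noteq> {}" by blast
  next
    fix A assume A: "A \<in> Nn"
    from A show "inv\<^bsub>M\<^esub> A \<in> Nn"
    proof (cases rule: Nn_cases)
      case h: (1 c)
      show ?thesis unfolding h(3) by (rule Nn_I) (use h(1) inv_M[OF h(4)] in \<open>simp_all only: h(3) inverse_nonzero_iff_nonzero not_False_eq_True\<close>)
    next
      case h: (2 c)
      show ?thesis unfolding h(3)
      proof (rule Nn_I)
        show "inverse (c * \<pi>) \<noteq> 0" using h(1) pi_nz by simp
        show "det (m2 0 (inverse (c * \<pi>)) (inverse (c * \<pi>) * \<pi>) 0) \<in> \<Delta>" using inv_M[OF h(4)] by (simp only: h(3))
      qed
    qed
  next
    fix A B assume A: "A \<in> Nn" and B: "B \<in> Nn"
    obtain c where c: "c \<noteq> 0" "det A \<in> \<Delta>" "A = m2 c 0 0 c \<or> A = m2 0 c (c * \<pi>) 0" using A unfolding Nn_def by blast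
    obtain d where d: "d \<noteq> 0" "det B \<in> \<Delta>" "B = m2 d 0 0 d \<or> B = m2 0 d (d * \<pi>) 0" using B unfolding Nn_def by blast
    have "\<exists>e. e \<noteq> 0 \<and> (A ** B = m2 e 0 0 e \<or> A ** B = m2 0 e (e * \<pi>) 0)"
    proof (cases "(A = m2 c 0 0 c) = (B = m2 d 0 0 d)")
      case True
      then consider "A = m2 c 0 0 c" "B = m2 d 0 0 d" | "A = m2 0 c (c * \<pi>) 0" "B = m2 0 d (d * \<pi>) 0" using c(3) d(3) by blast
      then show ?thesis
      proof cases
        case 1 then show ?thesis using c(1) d(1) by (intro exI[of _ "c * d"]) simp
      next
        case 2 then show ?thesis using c(1) d(1) pi_nz by (intro exI[of _ "c * d * \<pi>"]) (simp add: mult.commute mult.left_commute)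
      qed
    next
      case False
      then show ?thesis using c(1,3) d(1,3) by (intro exI[of _ "c * d"]) (auto simp: mult.commute mult.left_commute)
    qed
    then show "A \<otimes>\<^bsub>M\<^esub> B \<in> Nn" using det_M[OF c(2) d(2)] unfolding Nn_def M_mult by blast
  qed
qed

lemma det_inv: "det A \<in> \<Delta> \<Longrightarrow> det (inv\<^bsub>M\<^esub> A) = inverse (det A)"
proof -
  assume A: "det A \<in> \<Delta>"
  have "inv\<^bsub>M\<^esub> A ** A = m2 1 0 0 1" using group.l_inv[OF group_M, of A] A by simp
  then have "det (inv\<^bsub>M\<^esub> A) * det A = det (m2 1 0 0 (1 :: 'a))" by (simp only: det_mul[symmetric])
  then have "det A * det (inv\<^bsub>M\<^esub> A) = 1" by (simp add: mult.commute)
  then show ?thesis by (rule inverse_unique[symmetric])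
qed

lemma MM_subgroup: "subgroup MM M"
proof -
  show ?thesis
  proof (rule group.subgroupI[OF group_M])
    show "MM \<subseteq> carrier M" by (auto simp: MM_def)
    have "m2 1 0 0 1 \<in> MM" unfolding MM_def mem_Collect_eq using Z_1 by (intro conjI bexI[of _ 1]) simp_all
    then show "MM \<noteq> {}" by blast
  next
    fix A assume "A \<in> MM"
    then obtain z where z: "det A \<in> \<Delta>" "z \<in> Z" "v (det A) = v z * v z" unfolding MM_def by blast
    then show "inv\<^bsub>M\<^esub> A \<in> MM" unfolding MM_def mem_Collect_eq
      by (intro conjI inv_M bexI[of _ "inverse z"] Z_inverse) (simp_all add: det_inv v_inverse)
  next
    fix A B assume "A \<in> MM" "B \<in> MM"
    then obtain z w where z: "det A \<in> \<Delta>" "z \<in> Z" "v (det A) = v z * v z" "det B \<in> \<Delta>" "w \<in> Z" "v (det B) = v w * v w"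
      unfolding MM_def by blast
    then show "A \<otimes>\<^bsub>M\<^esub> B \<in> MM" unfolding MM_def mem_Collect_eq M_mult
      by (intro conjI det_M bexI[of _ "z * w"] Z_mult) (simp_all add: det_mul mult)
  qed
qed

text \<open>A scalar in \<open>MM\<close> is a unit times an element of \<open>Z\<close>; a multiple
  of \<open>omega\<close> has determinant of odd valuation and cannot lie there.\<close>

lemma Nn_MM: "n \<in> Nn \<Longrightarrow> n \<in> MM \<Longrightarrow> n \<in> T"
proof (erule Nn_cases)
  fix c assume c: "c \<noteq> 0" "n = m2 c 0 0 c" "det n \<in> \<Delta>" and "n \<in> MM"
  then obtain z where z: "z \<in> Z" "v (c * c) = v z * v z" unfolding MM_def by auto
  have z0: "z \<noteq> 0" by (rule Z_nz[OF z(1)])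
  have "v c * v c = v z * v z" using z(2) by (simp only: mult)
  then have "v c = v z" by (rule power2_eq_imp_eq[OF _ nonneg nonneg, unfolded power2_eq_square])
  then show ?thesis using c z0 v_pos[OF z0] by (intro TI[OF z(1), of "c / z" "c / z"]) (simp_all add: v_divide del: m2_det)
next
  fix c assume c: "c \<noteq> 0" "n = m2 0 c (c * \<pi>) 0" and "n \<in> MM"
  then obtain z where z: "z \<in> Z" "v (- (c * (c * \<pi>))) = v z * v z" unfolding MM_def by auto
  then have "v c * v c * v \<pi> = v z * v z" by (simp add: mult mult.assoc)
  then show ?thesis using odd_power[OF c(1) Z_nz[OF z(1)]] by blast
qed

text \<open>The valuation of the determinant is matched by a scalar power of \<open>\<pi>\<close> if
  it is even, and by such a power times \<open>omega\<close> if it is odd.\<close>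

lemma Nn_ex: "det g \<in> \<Delta> \<Longrightarrow> \<exists>n\<in>Nn. g ** inv\<^bsub>M\<^esub> n \<in> MM"
proof (cases "\<Delta> = {1}")
  case True
  assume g: "det g \<in> \<Delta>"
  have n: "m2 1 0 0 1 \<in> Nn" by (rule Nn_I) simp_all
  have "g ** inv\<^bsub>M\<^esub> (m2 1 0 0 1) = g" using monoid.inv_one[OF group.is_monoid[OF group_M]] by simp
  moreover have "g \<in> MM" unfolding MM_def mem_Collect_eq using g True Z_1 by (intro conjI bexI[of _ 1]) simp_all
  ultimately show ?thesis using n by metis
next
  case False
  assume g: "det g \<in> \<Delta>"
  have \<Delta>: "\<Delta> = - {0}" using False \<Delta>_cases by blast
  obtain k where k: "v (det g) = v \<pi> powi k" using v_value[OF \<Delta>_nz[OF g]] by blast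
  have "\<exists>n\<in>Nn. v (det n) = v (det g)"
  proof -
    define l where "l = k div 2"
    define c where "c = \<pi> powi l"
    have c: "c \<noteq> 0" using pi_nz by (simp add: c_def)
    have vc: "v c = v \<pi> powi l" by (simp add: c_def power_int_def v_power v_inverse)
    have p: "v c * v c = v \<pi> powi (l + l)" unfolding vc by (rule power_int_add[symmetric]) (use pi_pos in simp)
    show ?thesis
    proof (cases "even k")
      case True
      then have "k = l + l" unfolding l_def by presburger
      then have "v (det (m2 c 0 0 c)) = v (det g)" using p k by (simp add: mult)
      moreover have "m2 c 0 0 c \<in> Nn" by (rule Nn_I) (use c \<Delta> in simp_all)
      ultimately show ?thesis by blast
    next
      case False
      then have kl: "k = l + l + 1" unfolding l_def by presburger
      have "v \<pi> powi (l + l + 1) = v c * v c * v \<pi>" using pi_pos p by (simp add: power_int_add)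
      then have "v (det (m2 0 c (c * \<pi>) 0)) = v (det g)" using k kl by (simp add: mult mult.assoc)
      moreover have "m2 0 c (c * \<pi>) 0 \<in> Nn" by (rule Nn_I) (use c pi_nz \<Delta> in simp_all)
      ultimately show ?thesis by blast
    qed
  qed
  then obtain n where n: "n \<in> Nn" "v (det n) = v (det g)" by blast
  have nM: "det n \<in> \<Delta>" using n(1) unfolding Nn_def by blast
  have "v (det (g ** inv\<^bsub>M\<^esub> n)) = 1" using v_pos[OF \<Delta>_nz[OF g]] by (simp add: det_mul det_inv[OF nM] mult v_inverse n(2))
  then have "g ** inv\<^bsub>M\<^esub> n \<in> MM"
    unfolding MM_def mem_Collect_eq using det_M[OF g inv_M[OF nM]] Z_1 by (intro conjI bexI[of _ 1]) simp_all
  then show ?thesis using n(1) by blast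
qed

lemma tw_image: "(\<And>p. p \<in> Y \<Longrightarrow> tw b p \<in> Y) \<Longrightarrow> tw b ` Y = Y"
proof
  assume h: "\<And>p. p \<in> Y \<Longrightarrow> tw b p \<in> Y"
  show "Y \<subseteq> tw b ` Y"
  proof
    fix p assume "p \<in> Y"
    from h[OF this] have "tw b (tw b p) \<in> tw b ` Y" by (rule imageI)
    then show "p \<in> tw b ` Y" by simp
  qed
qed blast

lemma tw_tw': "tw e (tw b p) = tw (e \<noteq> b) p"
  by (simp add: tw_def)

lemma tw_hom: "tw b \<in> hom M M"
  by (simp add: hom_def tw_mult)

lemma tw_inj: "inj_on (tw b) Y"
  by (metis inj_onI tw_tw)

definition Qf :: "bool \<Rightarrow> ('a^2^2) set" where "Qf b = tw b ` matQ"
definition sf :: "bool \<Rightarrow> 'a^2^2" where "sf b = tw b s0"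

lemma Qf_D: "p \<in> Qf b \<Longrightarrow> tw b p \<in> matQ \<and> det p \<in> \<Delta>"
  unfolding Qf_def using Q_M by auto

lemma Qf_I: "integral B \<Longrightarrow> det B = 1 \<Longrightarrow> tw b B \<in> Qf b"
  unfolding Qf_def by (rule imageI, rule QI[OF Z_1]) simp_all

text \<open>Roots are considered only at vertices of height at least \<open>qq ^ m\<close>; closer
  to the centre all edges of the star lie in \<open>Sm m\<close>.\<close>

definition rtm :: "nat \<Rightarrow> bool \<Rightarrow> 'a^2^2 \<Rightarrow> bool" where
  "rtm m b h \<longleftrightarrow> low (Xb b h) \<and> (height (Xb b h) = 1 \<or> root (Xb b h)) \<and> height (Xb b h) \<ge> qq ^ m"

text \<open>Since \<open>ht\<close> is at least \<open>qq\<close>, the case \<open>m = 0\<close>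
  leaves only the base edge. That case belongs to the group \<open>J\<close> itself, for
  \<open>m \<ge> 1\<close> the clause on \<open>E\<close> adds nothing new, by
  \<open>E_ht\<close>.\<close>

definition Sm :: "nat \<Rightarrow> ('a^2^2) set" where
  "Sm m = {g. det g \<in> \<Delta> \<and> (ht g \<le> qq ^ m \<or> E g)}"

definition Bm :: "nat \<Rightarrow> ('a^2^2) set" where "Bm m = (if m = 0 then J else Kg m)"

lemma Bm_J: "x \<in> Bm m \<Longrightarrow> x \<in> J"
  using Kg_J[of m x] by (cases m) (simp_all add: Bm_def)

lemma root_pick:
  assumes g: "det g \<in> \<Delta>" and h: "height (Xb b g) \<ge> qq ^ m"
  shows "\<exists>p\<in>Qf b. rtm m b (g ** p)"
proof -
  obtain B where B: "integral B" "det B = 1" "low (Xb b g ** B)" "height (Xb b g) = 1 \<or> root (Xb b g ** B)"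
    using Root_ex[OF det_X'[OF g, of b]] by blast
  have "Xb b (g ** tw b B) = Xb b g ** B" by (simp add: X_mult)
  then have "rtm m b (g ** tw b B)" using B h by (simp add: rtm_def height_integral(1)[OF B(1)])
  then show ?thesis using Qf_I[OF B(1,2)] by blast
qed

lemma E_ht: "det g \<in> \<Delta> \<Longrightarrow> E g \<Longrightarrow> m \<ge> 1 \<Longrightarrow> ht g \<le> qq ^ m"
proof -
  assume g: "det g \<in> \<Delta>" and "E g" and m: "m \<ge> 1"
  then obtain b where "height (Xb b g) = 1" unfolding E_def by blast
  then have "ht g \<le> qq ^ 1" using ht_le[OF g, of b] by simp
  also have "\<dots> \<le> qq ^ m" by (rule power_increasing[OF m]) (use qq_gt in simp)
  finally show ?thesis .
qed

text \<open>The edges \<open>h\<close> and \<open>g\<close> share a vertex of height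
  \<open>H\<close>. As \<open>g\<close> is not low it leads away from there, so \<open>ht g\<close>
  is \<open>H * qq\<close>; the root \<open>h\<close> either points inwards, with
  \<open>ht h\<close> equal to \<open>H\<close>, or is the base edge, of level 0.\<close>

lemma lev_step:
  assumes h: "det h \<in> \<Delta>" "rtm m b h" and g: "col1 (Xb b g) = nrm (Xb b g)" "height (Xb b g) = height (Xb b h)"
    "\<not> low (Xb b g)"
  shows "lev h < lev g \<and> \<not> ht g \<le> qq ^ m \<and> \<not> E g"
proof -
  let ?H = "height (Xb b h)"
  have H: "?H \<ge> 1" by (rule height_X_ge[OF h(1)])
  have hg: "ht g = ?H * qq" using ht_up[OF g(1)] g(2) by simp
  have "?H * 1 < ?H * qq" by (rule mult_strict_left_mono) (use H qq_gt in linarith)+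
  then have lt: "?H < ?H * qq" by simp
  have E: "\<not> E g"
  proof
    assume "E g"
    then obtain b' where b': "height (Xb b' g) = 1" "low (Xb b' g)" unfolding E_def by blast
    then have "b' = (\<not> b)" using g(3) by (cases "b' = b") auto
    then show False using height_other[OF g(1)] b'(1) g(2) lt H by simp
  qed
  have lg: "lev g = Suc (nat \<lfloor>log qq ?H\<rfloor>)" using E hg log_step[OF qq_gt H] by (simp only: lev_def if_False)
  have "lev h \<le> nat \<lfloor>log qq ?H\<rfloor>"
  proof (cases "?H = 1")
    case True
    then have "E h" using h(2) unfolding E_def rtm_def by blast
    then show ?thesis by (simp add: lev_def)
  next
    case False
    then have "col1 (Xb b h) < nrm (Xb b h)" using h(2) by (simp add: rtm_def low_def)
    then show ?thesis by (simp add: lev_def ht_down)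
  qed
  moreover have "qq ^ m \<le> ?H" using h(2) by (simp add: rtm_def)
  ultimately show ?thesis using lg E hg lt by linarith
qed

end

section \<open>The matrix groups as a graded forest\<close>

context matrix_cover
begin

definition Rf :: "bool \<Rightarrow> ('a^2^2) set" where "Rf b = tw b ` R0"
definition tauf :: "bool \<Rightarrow> 'a^2^2 \<Rightarrow> 'a^2^2" where "tauf b = (\<lambda>u. tw b (tau0 (inv_into (carrier M) (tw b) u)))"
definition kappaf :: "bool \<Rightarrow> 'a^2^2 \<Rightarrow> 'a^2^2" where "kappaf b = (\<lambda>u. tw b (kappa0 (inv_into (carrier M) (tw b) u)))"

lemma rank_f: "rank_one TYPE('k) M G I cl J T (Qf b) (sf b) (Rf b) (tauf b) (kappaf b)"
  unfolding Qf_def sf_def Rf_def tauf_def kappaf_def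
  by (rule rank_one.conj[OF rank_one_0 tw_hom tw_inj tw_image tw_image]) (rule tw_J tw_T, assumption)+

lemma forest: "hecke_forest TYPE('k) M G I cl J T Qf sf Rf tauf kappaf MM Nn"
proof (rule hecke_forest.intro[OF hecke_cover_axioms hecke_forest_axioms.intro])
  fix b
  show "rank_one TYPE('k) M G I cl J T (Qf b) (sf b) (Rf b) (tauf b) (kappaf b)" by (rule rank_f)
  show "Qf b \<subseteq> MM"
  proof
    fix p assume "p \<in> Qf b"
    then obtain q where q: "q \<in> matQ" "p = tw b q" unfolding Qf_def by blast
    then obtain z B where z: "z \<in> Z" "integral B" "q = mat z ** B" unfolding matQ_def by blast
    then have "v (det p) = v z * v z" by (simp add: q(2) det_scalar mult integral_def)
    then show "p \<in> MM" unfolding MM_def using z(1) Q_M[OF q(1)] q(2) by auto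
  qed
next
  fix n assume n: "n \<in> Nn"
  have nM: "n \<in> carrier M" using n by (simp add: Nn_def)
  show "norm n"
  proof (rule normI[OF nM])
    fix j assume j: "j \<in> J"
    have i: "inv\<^bsub>M\<^esub> n \<in> Nn" by (rule subgroup.m_inv_closed[OF Nn_subgroup n])
    obtain e where e: "\<And>u. inv\<^bsub>M\<^esub> n ** u ** inv\<^bsub>M\<^esub> (inv\<^bsub>M\<^esub> n) = tw e u" using Nn_conj[OF i] by blast
    have "inv\<^bsub>M\<^esub> n ** (j ** n) = tw e j" using e[of j] unfolding group.inv_inv[OF group_M nM] by (simp only: matrix_mul_assoc)
    then show "inv\<^bsub>M\<^esub> n \<otimes>\<^bsub>M\<^esub> (j \<otimes>\<^bsub>M\<^esub> n) \<in> J" unfolding M_mult using tw_J[OF j] by simp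
  qed
next
  fix n t assume n: "n \<in> Nn" and t: "t \<in> T"
  show "n \<otimes>\<^bsub>M\<^esub> t \<otimes>\<^bsub>M\<^esub> inv\<^bsub>M\<^esub> n \<in> T" unfolding M_mult using Nn_conj[OF n] tw_T[OF t] by metis
next
  fix n b assume n: "n \<in> Nn"
  obtain e where e: "\<And>u. n ** u ** inv\<^bsub>M\<^esub> n = tw e u" using Nn_conj[OF n] by blast
  show "\<exists>b'. n \<otimes>\<^bsub>M\<^esub> sf b \<otimes>\<^bsub>M\<^esub> inv\<^bsub>M\<^esub> n = sf b' \<and> (\<lambda>u. n \<otimes>\<^bsub>M\<^esub> u \<otimes>\<^bsub>M\<^esub> inv\<^bsub>M\<^esub> n) ` Rf b = Rf b'"
    unfolding M_mult e sf_def Rf_def image_image tw_tw' by blast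
next
  fix g assume "g \<in> carrier M"
  then show "\<exists>n\<in>Nn. g \<otimes>\<^bsub>M\<^esub> inv\<^bsub>M\<^esub> n \<in> MM" unfolding M_mult M_iff by (rule Nn_ex)
qed (rule MM_subgroup Nn_subgroup Nn_MM; assumption?)+

sublocale W: hecke_forest M G I F cl J T Qf sf Rf tauf kappaf MM Nn
  by (rule forest)

text \<open>A big element contains a single factor \<open>s0\<close>, up to the twist, which turns a
  low edge into one that is not; the factors from \<open>J\<close> and \<open>T\<close> affect
  neither height nor lowness.\<close>

lemma bigD:
  assumes "W.rk.big b p"
  shows "det p \<in> \<Delta>" "height (Xb b (h ** p)) = height (Xb b h)"
    "det h \<in> \<Delta> \<Longrightarrow> low (Xb b h) \<Longrightarrow> \<not> low (Xb b (h ** p))"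
proof -
  obtain i t j where h: "i \<in> J" "t \<in> T" "j \<in> J" and p: "p = i ** sf b ** t ** j"
    using assms unfolding W.rk.big_def M_mult by blast
  have ds: "det (sf b) \<in> \<Delta>" by (simp only: sf_def det_tw s0_M)
  show "det p \<in> \<Delta>" unfolding p by (intro det_M ds J_M T_M h)
  let ?i = "tw b i" and ?t = "tw b t" and ?j = "tw b j"
  have i: "?i \<in> J \<or> ?i \<in> T" "?i \<in> J" and t: "?t \<in> J \<or> ?t \<in> T" and j: "?j \<in> J \<or> ?j \<in> T"
    using tw_J tw_T h by blast+
  have e: "Xb b (h ** p) = Xb b h ** ?i ** s0 ** ?t ** ?j"
    by (simp only: p X_mult tw_mult sf_def tw_tw matrix_mul_assoc)
  show "height (Xb b (h ** p)) = height (Xb b h)"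
    unfolding e by (simp only: height_Q[OF JT_Q[OF i(1)]] height_Q[OF JT_Q[OF t]] height_Q[OF JT_Q[OF j]]
      height_integral(1)[OF integral_s0])
  assume g: "det h \<in> \<Delta>" and l: "low (Xb b h)"
  have "det (Xb b h ** ?i) \<noteq> 0" using det_X'[OF g] \<Delta>_nz[OF J_M[OF i(2)]] by (simp only: det_mul mult_eq_0_iff) blast
  from low_s0[OF _ this] show "\<not> low (Xb b (h ** p))"
    unfolding e JT_low[OF j] JT_low[OF t] JT_low[OF i(1)] using l by blast
qed

lemma not_low_big:
  assumes p: "p \<in> Qf b" and l: "low (Xb b h)" "\<not> low (Xb b (h ** p))"
  shows "W.rk.big b p"
proof (rule ccontr)
  assume "\<not> W.rk.big b p"
  then have "W.rk.small p" using W.rk.Q_small_big[OF p] by blast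
  then obtain t j where h: "t \<in> T" "j \<in> J" and pe: "p = t ** j" unfolding W.rk.small_def M_mult by blast
  have t: "tw b t \<in> J \<or> tw b t \<in> T" and j: "tw b j \<in> J \<or> tw b j \<in> T" using tw_J tw_T h by blast+
  have "Xb b (h ** p) = Xb b h ** tw b t ** tw b j" by (simp only: pe X_mult tw_mult matrix_mul_assoc)
  then show False using l JT_low[OF t] JT_low[OF j] by metis
qed

text \<open>Stars at small height lie in \<open>Sm m\<close> entirely, and the others contain a root
  by \<open>root_pick\<close>; levels grow by \<open>lev_step\<close>; transitivity is
  \<open>root_conj\<close>; and an edge outside \<open>Sm m\<close> has a unique inner end by
  \<open>up_unique\<close>.\<close>

lemma graded: "hecke_graded TYPE('k) M G I cl J T Qf sf Rf tauf kappaf MM Nn (Bm m) (Sm m) lev (rtm m)"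
proof (rule hecke_graded.intro[OF forest hecke_graded_axioms.intro])
  show "subgroup (Bm m) M" by (cases "m = 0") (simp_all add: Bm_def subgroup_J Kg_subgroup)
  show "Sm m \<subseteq> carrier M" by (auto simp: Sm_def)
next
  fix g x assume g: "g \<in> Sm m" and x: "x \<in> J \<union> T \<union> Nn"
  have "ht (g ** x) = ht g \<and> (E g \<longrightarrow> E (g ** x))" using x JT_E[of x g] N_E[of x g] by blast
  moreover have "det x \<in> \<Delta>" using x J_M T_M unfolding Nn_def by blast
  ultimately show "g \<otimes>\<^bsub>M\<^esub> x \<in> Sm m" using g unfolding Sm_def M_mult by (auto simp: det_M)
next
  fix g x assume g: "g \<in> Sm m" and x: "x \<in> Bm m"
  have gM: "det g \<in> \<Delta>" using g by (simp add: Sm_def)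
  show "inv\<^bsub>M\<^esub> g \<otimes>\<^bsub>M\<^esub> x \<otimes>\<^bsub>M\<^esub> g \<in> J"
  proof (cases "m = 0")
    case True
    then have "E g" using g ht_ge_qq[OF gM] qq_gt by (simp add: Sm_def)
    then obtain n t j where h: "n \<in> Nn" "t \<in> T" "j \<in> J" and ge: "g = n ** t ** j" using E_form[OF gM] by blast
    show ?thesis
      using conj_norm_J[OF W.N_norm[OF h(1)] W.rk.norm_T[OF h(2)] h(3) Bm_J[OF x]] unfolding M_mult ge .
  next
    case False
    then have m: "m \<ge> 1" by simp
    have "ht g \<le> qq ^ m" using g E_ht[OF gM _ m] unfolding Sm_def by blast
    then show ?thesis unfolding M_mult using conj_Kg[OF m gM] x False by (simp add: Bm_def)
  qed
next
  fix g b assume "g \<in> carrier M"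
  then have g: "det g \<in> \<Delta>" by simp
  show "(\<forall>p\<in>Qf b. g \<otimes>\<^bsub>M\<^esub> p \<in> Sm m) \<or> (\<exists>p\<in>Qf b. rtm m b (g \<otimes>\<^bsub>M\<^esub> p))"
  proof (cases "height (Xb b g) \<ge> qq ^ m")
    case True
    then show ?thesis unfolding M_mult using root_pick[OF g] by blast
  next
    case False
    then obtain k where k: "m = Suc k" using height_X_ge[OF g, of b] by (cases m) auto
    \<comment> \<open>Heights are powers of \<open>qq\<close>, so being below \<open>qq ^ m\<close>
      means being at most \<open>qq ^ k\<close>; the far ends then stay within
      \<open>qq ^ m\<close>.\<close>
    have le: "height (Xb b g) \<le> qq ^ k"
    proof (rule ccontr)
      assume "\<not> height (Xb b g) \<le> qq ^ k"
      then have "qq ^ k < height (Xb b g)" by simp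
      from height_discrete[OF this] show False using False k by simp
    qed
    have "g ** p \<in> Sm m" if p: "p \<in> Qf b" for p
    proof -
      note q = Qf_D[OF p]
      have gp: "det (g ** p) \<in> \<Delta>" using det_M[OF g] q by blast
      have "ht (g ** p) \<le> height (Xb b g) * qq" using ht_le[OF gp, of b] height_X[of b p g] q by simp
      also have "\<dots> \<le> qq ^ k * qq" by (rule mult_right_mono[OF le]) (use qq_gt in linarith)
      finally show ?thesis using gp unfolding Sm_def k by (simp add: mult.commute)
    qed
    then show ?thesis unfolding M_mult by blast
  qed
next
  fix h b p assume "h \<in> carrier M" and r: "rtm m b h" and p: "W.rk.big b p"
  then have h: "det h \<in> \<Delta>" by simp
  have l: "low (Xb b h)" using r by (simp add: rtm_def)
  note nl = bigD(3)[OF p h l]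
  from lev_step[OF h r not_low_up[OF nl] bigD(2)[OF p] nl]
  show "lev h < lev (h \<otimes>\<^bsub>M\<^esub> p) \<and> h \<otimes>\<^bsub>M\<^esub> p \<notin> Sm m" unfolding M_mult Sm_def by blast
next
  fix h b i assume "h \<in> carrier M" and r: "rtm m b h" and i: "i \<in> J"
  then have h: "det h \<in> \<Delta>" by simp
  \<comment> \<open>\<open>R_ex\<close> replaces \<open>i\<close> by a representative
    \<open>u\<close>, whose twist is unipotent with entry \<open>\<beta>\<close>, so that
    \<open>root_conj\<close> applies.\<close>
  obtain u j where u: "u \<in> Rf b" "j \<in> J" "i \<otimes>\<^bsub>M\<^esub> sf b = u \<otimes>\<^bsub>M\<^esub> sf b \<otimes>\<^bsub>M\<^esub> j" using W.rk.R_ex[OF i] by blast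
  obtain \<beta> where b: "\<beta> \<in> reps" "u = tw b (un \<beta>)" using u(1) unfolding Rf_def R0_def by blast
  have rr: "low (Xb b h)" "height (Xb b h) = 1 \<or> root (Xb b h)" "height (Xb b h) \<ge> qq ^ m" using r by (simp_all add: rtm_def)
  obtain x where x: "x ** Xb b h = Xb b h ** m2 1 \<beta> 0 1" "x \<in> J" "m \<ge> 1 \<Longrightarrow> x \<in> Kg m"
    using root_conj[OF det_X'[OF h] reps_le[OF b(1)] rr(1,2)] rr(3) by blast
  have e2: "Xb b (h ** u) = Xb b h ** m2 1 \<beta> 0 1" by (simp only: X_mult b(2) tw_tw un_def)
  have "Xb b (x ** h) = Xb b (h ** u)" using x(1) by (simp only: e2 X_left[of b x h])
  then have xh: "x ** h = h ** u" by (rule X_inj)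
  have "x \<in> Bm m" using x by (simp add: Bm_def)
  moreover have "h ** (i ** sf b) = x ** h ** sf b ** j"
    unfolding u(3)[unfolded M_mult] xh by (simp only: matrix_mul_assoc)
  ultimately show "\<exists>x\<in>Bm m. \<exists>j\<in>J. \<exists>k\<in>J. x \<otimes>\<^bsub>M\<^esub> h = h \<otimes>\<^bsub>M\<^esub> k \<and>
      h \<otimes>\<^bsub>M\<^esub> (i \<otimes>\<^bsub>M\<^esub> sf b) = x \<otimes>\<^bsub>M\<^esub> h \<otimes>\<^bsub>M\<^esub> sf b \<otimes>\<^bsub>M\<^esub> j"
    unfolding M_mult using xh u(2) W.rk.R_J[OF u(1)] by blast
next
  fix g assume gc: "g \<in> carrier M" and gS: "g \<notin> Sm m"
  have g: "det g \<in> \<Delta>" using gc by simp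
  obtain b where b: "col1 (Xb b g) = nrm (Xb b g)" using up_ex by blast
  have nS: "\<not> ht g \<le> qq ^ m" "\<not> E g" using gS g by (simp_all add: Sm_def)
  have hg: "ht g = height (Xb b g) * qq" by (rule ht_up[OF b])
  have H: "height (Xb b g) \<ge> qq ^ m"
  proof (cases m)
    case 0 then show ?thesis using height_X_ge[OF g] by simp
  next
    case (Suc k)
    have "qq * qq ^ k < qq * height (Xb b g)" using nS(1) hg Suc by (simp add: mult.commute not_le)
    then have "qq ^ k < height (Xb b g)" using qq_gt by (simp only: mult_less_cancel_left_pos less_trans[OF zero_less_one])
    then show ?thesis using height_discrete[of k "Xb b g"] Suc by simp
  qed
  have nl: "\<not> low (Xb b g)"
  proof
    assume l: "low (Xb b g)"
    show False
    proof (cases "height (Xb b g) = 1")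
      case True then show False using l nS(2) unfolding E_def by blast
    next
      case False then show False using l b by (simp add: low_def)
    qed
  qed
  obtain p where p: "p \<in> Qf b" "rtm m b (g ** p)" using root_pick[OF g H] by blast
  have pM: "det p \<in> \<Delta>" using Qf_D[OF p(1)] by blast
  have pc: "p \<in> carrier M" using pM by simp
  have pi: "inv\<^bsub>M\<^esub> p \<in> Qf b" by (rule subgroup.m_inv_closed[OF W.rk.Q_subgroup p(1)])
  have e1: "inv\<^bsub>M\<^esub> (g \<otimes>\<^bsub>M\<^esub> p) \<otimes>\<^bsub>M\<^esub> g = inv\<^bsub>M\<^esub> p"
    by (rule group.inv_mult_cancel(1)[OF group_M gc pc])
  have "g \<otimes>\<^bsub>M\<^esub> p \<otimes>\<^bsub>M\<^esub> inv\<^bsub>M\<^esub> p = g" by (rule group.inv_mult_cancel(2)[OF group_M gc pc])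
  then have e2: "g ** p ** inv\<^bsub>M\<^esub> p = g" unfolding M_mult .
  have "W.rk.big b (inv\<^bsub>M\<^esub> p)"
    by (rule not_low_big[OF pi, of "g ** p"]) (use p(2) nl in \<open>simp_all add: rtm_def e2\<close>)
  then show "\<exists>b. \<exists>h\<in>carrier M. rtm m b h \<and> W.rk.big b (inv\<^bsub>M\<^esub> h \<otimes>\<^bsub>M\<^esub> g)"
    using p(2) e1 monoid.m_closed[OF monoid_M gc pc] unfolding M_mult by metis
next
  fix h h' b b' g assume c: "h \<in> carrier M" "h' \<in> carrier M" and r: "rtm m b h" "rtm m b' h'" and gc: "g \<in> carrier M"
    and p: "W.rk.big b (inv\<^bsub>M\<^esub> h \<otimes>\<^bsub>M\<^esub> g)" "W.rk.big b' (inv\<^bsub>M\<^esub> h' \<otimes>\<^bsub>M\<^esub> g)"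
  have up: "col1 (Xb b g) = nrm (Xb b g)" if c: "h \<in> carrier M" "rtm m b h" and p: "W.rk.big b (inv\<^bsub>M\<^esub> h \<otimes>\<^bsub>M\<^esub> g)" for h b
  proof -
    have "h \<otimes>\<^bsub>M\<^esub> (inv\<^bsub>M\<^esub> h \<otimes>\<^bsub>M\<^esub> g) = g" by (rule group.inv_mult_cancel(3)[OF group_M c(1) gc])
    moreover have "\<not> low (Xb b (h ** (inv\<^bsub>M\<^esub> h \<otimes>\<^bsub>M\<^esub> g)))" by (rule bigD(3)[OF p]) (use c in \<open>simp_all add: rtm_def\<close>)
    ultimately show ?thesis by (intro not_low_up) (simp only: M_mult not_False_eq_True)
  qed
  have "det g \<noteq> 0" using gc \<Delta>_nz by simp
  from up_unique[OF this up[OF c(1) r(1) p(1)] up[OF c(2) r(2) p(2)]] show "b = b'" .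
next
  fix x g assume "x \<in> Bm m"
  then show "lev (x \<otimes>\<^bsub>M\<^esub> g) = lev g" using J_E_left[OF Bm_J, of x m g] by (simp add: lev_def)
qed

text \<open>The grading for \<open>m = 0\<close> is used for every \<open>m\<close>: it shows that
  the map built for \<open>Bm m\<close> commutes with the entire Hecke algebra.\<close>

lemma retraction_ex: "\<exists>\<psi>. P.retraction (cl ` Bm m) \<psi>"
proof -
  interpret A: hecke_graded M G I F cl J T Qf sf Rf tauf kappaf MM Nn "Bm m" "Sm m" lev "rtm m" by (rule graded)
  have "hecke_graded TYPE('k) M G I cl J T Qf sf Rf tauf kappaf MM Nn J (Sm 0) lev (rtm 0)"
    using graded[of 0] by (simp only: Bm_def refl if_True)
  then show ?thesis
  proof (intro exI, rule A.retraction_psi)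
    fix g assume g: "g \<in> Sm 0"
    then have gM: "det g \<in> \<Delta>" by (simp add: Sm_def)
    have "E g" using g ht_ge_qq[OF gM] qq_gt by (simp add: Sm_def)
    then show "\<exists>n\<in>Nn. \<exists>t\<in>T. \<exists>j\<in>J. g = n \<otimes>\<^bsub>M\<^esub> t \<otimes>\<^bsub>M\<^esub> j" unfolding M_mult using E_form[OF gM] by blast
  qed
qed

lemma cl_J: "cl ` J = I"
proof
  show "cl ` J \<subseteq> I" using J_iff J_carrier by blast
  show "I \<subseteq> cl ` J"
  proof
    fix i assume i: "i \<in> I"
    then have "i \<in> carrier G" by (rule P.mem_carrier)
    then obtain x where "x \<in> carrier M" "i = cl x" using cl_surj by (metis imageE)
    then show "i \<in> cl ` J" using J_iff i by blast
  qed
qed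

lemma Kg_norm:
  assumes m: "m \<ge> 1" and i: "i \<in> I" and u: "u \<in> cl ` Kg m"
  shows "inv\<^bsub>G\<^esub> i \<otimes>\<^bsub>G\<^esub> u \<otimes>\<^bsub>G\<^esub> i \<in> cl ` Kg m"
proof -
  obtain j where j: "j \<in> J" "i = cl j" using i cl_J by blast
  obtain x where x: "x \<in> Kg m" "u = cl x" using u by blast
  have xc: "x \<in> carrier M" by (rule J_carrier[OF Kg_J[OF m x(1)]])
  have jc: "j \<in> carrier M" by (rule J_carrier[OF j(1)])
  have "cl (inv\<^bsub>M\<^esub> j \<otimes>\<^bsub>M\<^esub> x \<otimes>\<^bsub>M\<^esub> j) = inv\<^bsub>G\<^esub> i \<otimes>\<^bsub>G\<^esub> u \<otimes>\<^bsub>G\<^esub> i"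
    unfolding j(2) x(2) cl_mult[OF monoid.m_closed[OF monoid_M group.inv_closed[OF group_M jc] xc] jc] cl_mult[OF group.inv_closed[OF group_M jc] xc]
      group_hom.hom_inv[OF cl_group_hom jc] ..
  then show ?thesis using conj_Kg_J[OF j(1) x(1)] unfolding M_mult by (metis imageI)
qed

theorem splitting:
  shows "right_direct_factor P.H (ind_module G I) (P.fixed I)"
    and "rho G I ` carrier (dual P.H (ind_module G I)) = carrier P.H"
    and "m \<ge> 1 \<Longrightarrow> short_exact_left P.H (Z_module G I (cl ` Kg m)) (coinv_incl G I (cl ` Kg m))
      (coinv_dual_fixed G I (cl ` Kg m)) (coinv_to_hecke G I) (regular_left_module P.H)"
proof -
  obtain \<psi>0 where r0: "P.retraction I \<psi>0" using retraction_ex[of 0] cl_J by (auto simp: Bm_def)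
  show "right_direct_factor P.H (ind_module G I) (P.fixed I)"
    by (rule P.retraction_direct_factor[OF P.subset r0])
  show "rho G I ` carrier (dual P.H (ind_module G I)) = carrier P.H" by (rule P.retraction_rho_surj[OF r0])
  assume m: "m \<ge> 1"
  then obtain \<psi> where r: "P.retraction (cl ` Kg m) \<psi>" using retraction_ex[of m] by (auto simp: Bm_def)
  have "cl ` Kg m \<subseteq> I" using cl_J Kg_J[OF m] by blast
  from P.short_exact[OF this Kg_norm[OF m] r r0]
  show "short_exact_left P.H (Z_module G I (cl ` Kg m)) (coinv_incl G I (cl ` Kg m))
      (coinv_dual_fixed G I (cl ` Kg m)) (coinv_to_hecke G I) (regular_left_module P.H)" .
qed

end

section \<open>The matrix model compared with the definitions of the groups\<close>

context det_scalars
begin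

lemma cover_id: "hecke_cover M M J id J"
proof (rule hecke_cover.intro[OF group_M hecke_pair.intro[OF group_M subgroup_J] hecke_cover_axioms.intro])
  show "subgroup J M" by (rule subgroup_J)
qed (simp_all add: hom_def)

text \<open>The characteristic of \<open>k\<close> enters through the number of residue
  representatives, which it divides.\<close>

lemma cover_splitting:
  fixes G :: "('g, 'b) monoid_scheme"
  assumes c: "hecke_cover M G I cl J" and p: "CHAR('k::field) = residue_char v"
    and U: "\<And>m. m \<ge> 1 \<Longrightarrow> cl ` Kg m = U m"
  shows "right_direct_factor (hecke G I) (ind_module G I :: (_, ('g, 'k) ind) module) (carrier (ind_fixed G I I))"
    and "rho G I ` carrier (dual (hecke G I) (ind_module G I)) = carrier (hecke G I :: ('g, 'k) hecke_elt ring)"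
    and "\<forall>m\<ge>1. short_exact_left (hecke G I :: ('g, 'k) hecke_elt ring) (Z_module G I (U m))
      (coinv_incl G I (U m)) (coinv_dual_fixed G I (U m)) (coinv_to_hecke G I) (regular_left_module (hecke G I))"
proof -
  obtain B where B: "finite B" "0 \<in> B" "\<forall>b\<in>B. v b \<le> 1" "\<forall>x. v x \<le> 1 \<longrightarrow> (\<exists>b\<in>B. v (x - b) < 1)"
    "\<forall>b\<in>B. \<forall>b'\<in>B. v (b - b') < 1 \<longrightarrow> b = b'" "residue_char v dvd card B" using residue_reps by blast
  have k: "of_nat (card B) = (0 :: 'k)" using B(6) p by (simp add: of_nat_eq_0_iff_char_dvd)
  interpret A: matrix_cover v \<pi> \<Delta> Z G I "TYPE('k)" cl B
    by (rule matrix_cover.intro[OF det_scalars_axioms c matrix_cover_axioms.intro]) (use B k in blast)+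
  show "right_direct_factor (hecke G I) (ind_module G I :: (_, ('g, 'k) ind) module) (carrier (ind_fixed G I I))"
    by (rule A.splitting(1))
  show "rho G I ` carrier (dual (hecke G I) (ind_module G I)) = carrier (hecke G I :: ('g, 'k) hecke_elt ring)"
    by (rule A.splitting(2))
  show "\<forall>m\<ge>1. short_exact_left (hecke G I :: ('g, 'k) hecke_elt ring) (Z_module G I (U m))
      (coinv_incl G I (U m)) (coinv_dual_fixed G I (U m)) (coinv_to_hecke G I) (regular_left_module (hecke G I))"
  proof (intro allI impI)
    fix m :: nat assume m: "m \<ge> 1"
    show "short_exact_left (hecke G I :: ('g, 'k) hecke_elt ring) (Z_module G I (U m))
      (coinv_incl G I (U m)) (coinv_dual_fixed G I (U m)) (coinv_to_hecke G I) (regular_left_module (hecke G I))"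
      using A.splitting(3)[OF m] unfolding U[OF m] .
  qed
qed

lemma pi_multiple: "(\<exists>y. v y \<le> 1 \<and> x = \<pi> ^ m * y) \<longleftrightarrow> v x \<le> v \<pi> ^ m"
proof
  assume "\<exists>y. v y \<le> 1 \<and> x = \<pi> ^ m * y"
  then obtain y where y: "v y \<le> 1" "x = \<pi> ^ m * y" by blast
  have "v \<pi> ^ m * v y \<le> v \<pi> ^ m" by (rule mult_left_le[OF y(1)]) (use pi_pos in simp)
  then show "v x \<le> v \<pi> ^ m" by (simp add: y(2) mult v_power)
next
  assume x: "v x \<le> v \<pi> ^ m"
  have "v (x / \<pi> ^ m) \<le> 1" using x pi_pos by (simp add: v_divide v_power)
  moreover have "x = \<pi> ^ m * (x / \<pi> ^ m)" using pi_nz by simp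
  ultimately show "\<exists>y. v y \<le> 1 \<and> x = \<pi> ^ m * y" by blast
qed

lemma mat_cong_iff: "mat_cong v (\<pi> ^ m) (m2 x y z w) (m2 a b c d) \<longleftrightarrow>
    v (x - a) \<le> v \<pi> ^ m \<and> v (y - b) \<le> v \<pi> ^ m \<and> v (z - c) \<le> v \<pi> ^ m \<and> v (w - d) \<le> v \<pi> ^ m"
  unfolding mat_cong_def pi_multiple forall_2 m2_nth by blast

lemma mat_cong_pi: "mat_cong v \<pi> (m2 x y z w) (m2 a b c d) \<longleftrightarrow>
    v (x - a) < 1 \<and> v (y - b) < 1 \<and> v (z - c) < 1 \<and> v (w - d) < 1"
  using mat_cong_iff[of 1] unfolding lt_iff power_one_right .

lemma unit_form: "v a < 1 \<Longrightarrow> v b \<le> 1 \<Longrightarrow> v c < 1 \<Longrightarrow> v d < 1 \<Longrightarrow> integral (m2 (1 + a) b c (1 + d))"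
proof -
  assume h: "v a < 1" "v b \<le> 1" "v c < 1" "v d < 1"
  have u: "v (1 + a) = 1" "v (1 + d) = 1" using v_add_eq(1)[of a 1] v_add_eq(1)[of d 1] h by simp_all
  have "v (b * c) < 1" by (rule v_mult_less2[OF h(2,3)])
  then have "v (- (b * c) + (1 + a) * (1 + d)) = 1"
    using v_add_eq(2)[of "- (b * c)" "(1 + a) * (1 + d)"] by (simp only: v_minus mult u mult_1)
  then show ?thesis using h u by (simp add: integral_m2)
qed

lemma entries_m2: "(\<forall>i j. v (m2 a b c d $ i $ j) \<le> 1) \<longleftrightarrow> v a \<le> 1 \<and> v b \<le> 1 \<and> v c \<le> 1 \<and> v d \<le> 1"
  unfolding forall_2 m2_nth by blast

lemma GL2_K_m2: "m2 a b c d \<in> GL2_K v \<longleftrightarrow> integral (m2 a b c d)"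
  unfolding GL2_K_def mem_Collect_eq entries_m2 m2_det integral_m2 by blast

lemma J_form:
  "A \<in> J \<longleftrightarrow> det A \<in> \<Delta> \<and> (\<exists>z\<in>Z. \<exists>B\<in>GL2_K v. (\<exists>b. v b \<le> 1 \<and> mat_cong v \<pi> B (upper_unipotent b)) \<and> A = mat z ** B)"
proof
  assume A: "A \<in> J"
  then show "det A \<in> \<Delta> \<and> (\<exists>z\<in>Z. \<exists>B\<in>GL2_K v. (\<exists>b. v b \<le> 1 \<and> mat_cong v \<pi> B (upper_unipotent b)) \<and> A = mat z ** B)"
  proof (cases rule: JE)
    case h: (1 z a b c d)
    let ?B = "m2 (1 + a) b c (1 + d)"
    have "?B \<in> GL2_K v" unfolding GL2_K_m2 by (rule unit_form[OF h(3,4,5,6)])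
    moreover have "mat_cong v \<pi> ?B (upper_unipotent b)" unfolding upper_unipotent_m2 mat_cong_pi using h by simp
    moreover have "A = mat z ** ?B" unfolding h(7) by (simp add: mat_m2)
    ultimately show ?thesis using J_M[OF A] h(1,4) by blast
  qed
next
  assume "det A \<in> \<Delta> \<and> (\<exists>z\<in>Z. \<exists>B\<in>GL2_K v. (\<exists>b. v b \<le> 1 \<and> mat_cong v \<pi> B (upper_unipotent b)) \<and> A = mat z ** B)"
  then obtain z B b where h: "det A \<in> \<Delta>" "z \<in> Z" "B \<in> GL2_K v" "mat_cong v \<pi> B (upper_unipotent b)" "A = mat z ** B" by blast
  obtain x y z' w where B: "B = m2 x y z' w" by (rule m2_cases)
  have i: "v y \<le> 1" using h(3) unfolding B GL2_K_m2 integral_m2 by blast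
  have l: "v (x - 1) < 1" "v (z' - 0) < 1" "v (w - 1) < 1" using h(4) unfolding B upper_unipotent_m2 mat_cong_pi by blast+
  show "A \<in> J" by (rule JI[OF h(2), of "x - 1" y z' "w - 1"]) (use l i h(1) in \<open>simp_all add: h(5) B mat_m2 del: m2_det\<close>)
qed

lemma Kg_form:
  assumes m: "m \<ge> 1"
  shows "A \<in> Kg m \<longleftrightarrow> det A \<in> \<Delta> \<and> A \<in> GL2_K v \<and> mat_cong v (\<pi> ^ m) A (mat 1)"
proof
  assume "A \<in> Kg m"
  then obtain a b c d where h: "det A \<in> \<Delta>" "v a \<le> v \<pi> ^ m" "v b \<le> v \<pi> ^ m" "v c \<le> v \<pi> ^ m" "v d \<le> v \<pi> ^ m"
    and A: "A = m2 (1 + a) b c (1 + d)" unfolding Kg_def by blast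
  have r: "v \<pi> ^ m < 1" by (rule pi_power(1)[OF m])
  have "A \<in> GL2_K v" unfolding A GL2_K_m2 by (rule unit_form) (use h r in linarith)+
  moreover have "mat_cong v (\<pi> ^ m) A (mat 1)" unfolding A mat_m2 mat_cong_iff using h by simp
  ultimately show "det A \<in> \<Delta> \<and> A \<in> GL2_K v \<and> mat_cong v (\<pi> ^ m) A (mat 1)" using h(1) by blast
next
  assume h: "det A \<in> \<Delta> \<and> A \<in> GL2_K v \<and> mat_cong v (\<pi> ^ m) A (mat 1)"
  obtain x y z w where A: "A = m2 x y z w" by (rule m2_cases)
  have "v (x - 1) \<le> v \<pi> ^ m \<and> v (y - 0) \<le> v \<pi> ^ m \<and> v (z - 0) \<le> v \<pi> ^ m \<and> v (w - 1) \<le> v \<pi> ^ m"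
    using h unfolding A mat_m2 mat_cong_iff by blast
  moreover have "A = m2 (1 + (x - 1)) y z (1 + (w - 1))" by (simp add: A)
  ultimately show "A \<in> Kg m" unfolding Kg_def mem_Collect_eq using h by (metis diff_zero)
qed

end

section \<open>The groups SL2, GL2 and PGL2\<close>

context local_field
begin

lemma mat_one: "mat 1 ** (A :: 'a^2^2) = A"
  by (rule matrix_mul_lid)

lemma bex_one: "(\<exists>z\<in>{1}. \<exists>B\<in>S. P B \<and> A = mat z ** B) \<longleftrightarrow> A \<in> S \<and> P (A :: 'a^2^2)"
proof -
  have "(\<exists>z\<in>{1}. \<exists>B\<in>S. P B \<and> A = mat z ** B) \<longleftrightarrow> (\<exists>B\<in>S. P B \<and> A = mat 1 ** B)" by blast
  then show ?thesis unfolding mat_one by blast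
qed

lemma SL2_splitting:
  assumes p: "CHAR('k::field) = residue_char v"
  shows "right_direct_factor (hecke SL2 (SL2_I v \<pi>)) (ind_module SL2 (SL2_I v \<pi>) :: (_, ('a^2^2, 'k) ind) module)
      (carrier (ind_fixed SL2 (SL2_I v \<pi>) (SL2_I v \<pi>)))"
    and "rho SL2 (SL2_I v \<pi>) ` carrier (dual (hecke SL2 (SL2_I v \<pi>)) (ind_module SL2 (SL2_I v \<pi>))) =
      carrier (hecke SL2 (SL2_I v \<pi>) :: ('a^2^2, 'k) hecke_elt ring)"
    and "\<forall>m\<ge>1. short_exact_left (hecke SL2 (SL2_I v \<pi>) :: ('a^2^2, 'k) hecke_elt ring)
      (Z_module SL2 (SL2_I v \<pi>) (SL2_Km v \<pi> m)) (coinv_incl SL2 (SL2_I v \<pi>) (SL2_Km v \<pi> m))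
      (coinv_dual_fixed SL2 (SL2_I v \<pi>) (SL2_Km v \<pi> m)) (coinv_to_hecke SL2 (SL2_I v \<pi>))
      (regular_left_module (hecke SL2 (SL2_I v \<pi>)))"
proof -
  interpret S: det_scalars v \<pi> "{1}" "{1}" by unfold_locales simp
  have M: "matM {1 :: 'a} = SL2" by (simp add: matM_def SL2_def)
  have K: "A \<in> GL2_K v \<longleftrightarrow> A \<in> SL2_K v" if "det A = 1" for A
    using that by (simp add: GL2_K_def SL2_K_def)
  have SD: "det A = 1" if "A \<in> SL2_K v" for A using that by (simp add: SL2_K_def)
  have J: "matJ v {1} {1} = SL2_I v \<pi>"
  proof -
    have "A \<in> matJ v {1} {1} \<longleftrightarrow> A \<in> SL2_I v \<pi>" for A
      unfolding S.J_form bex_one SL2_I_def mem_Collect_eq singleton_iff using K[of A] SD[of A] by blast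
    then show ?thesis by blast
  qed
  have U: "id ` S.Kg m = SL2_Km v \<pi> m" if m: "m \<ge> 1" for m
  proof -
    have "A \<in> id ` S.Kg m \<longleftrightarrow> A \<in> SL2_Km v \<pi> m" for A
      unfolding image_id id_apply S.Kg_form[OF m] SL2_Km_def mem_Collect_eq singleton_iff using K[of A] SD[of A] by blast
    then show ?thesis by blast
  qed
  note r = S.cover_splitting[OF S.cover_id p U, unfolded M J]
  show "right_direct_factor (hecke SL2 (SL2_I v \<pi>)) (ind_module SL2 (SL2_I v \<pi>) :: (_, ('a^2^2, 'k) ind) module)
      (carrier (ind_fixed SL2 (SL2_I v \<pi>) (SL2_I v \<pi>)))" by (rule r(1))
  show "rho SL2 (SL2_I v \<pi>) ` carrier (dual (hecke SL2 (SL2_I v \<pi>)) (ind_module SL2 (SL2_I v \<pi>))) =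
      carrier (hecke SL2 (SL2_I v \<pi>) :: ('a^2^2, 'k) hecke_elt ring)" by (rule r(2))
  show "\<forall>m\<ge>1. short_exact_left (hecke SL2 (SL2_I v \<pi>) :: ('a^2^2, 'k) hecke_elt ring)
      (Z_module SL2 (SL2_I v \<pi>) (SL2_Km v \<pi> m)) (coinv_incl SL2 (SL2_I v \<pi>) (SL2_Km v \<pi> m))
      (coinv_dual_fixed SL2 (SL2_I v \<pi>) (SL2_Km v \<pi> m)) (coinv_to_hecke SL2 (SL2_I v \<pi>))
      (regular_left_module (hecke SL2 (SL2_I v \<pi>)))" by (rule r(3))
qed

lemma matM_GL2: "matM (- {0 :: 'a}) = GL2"
  by (simp add: matM_def GL2_def)

lemma GL2_K_det: "A \<in> GL2_K v \<Longrightarrow> det A \<noteq> 0"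
  by (auto simp: GL2_K_def)

lemma GL2_splitting:
  assumes p: "CHAR('k::field) = residue_char v"
  shows "right_direct_factor (hecke GL2 (GL2_I v \<pi>)) (ind_module GL2 (GL2_I v \<pi>) :: (_, ('a^2^2, 'k) ind) module)
      (carrier (ind_fixed GL2 (GL2_I v \<pi>) (GL2_I v \<pi>)))"
    and "rho GL2 (GL2_I v \<pi>) ` carrier (dual (hecke GL2 (GL2_I v \<pi>)) (ind_module GL2 (GL2_I v \<pi>))) =
      carrier (hecke GL2 (GL2_I v \<pi>) :: ('a^2^2, 'k) hecke_elt ring)"
    and "\<forall>m\<ge>1. short_exact_left (hecke GL2 (GL2_I v \<pi>) :: ('a^2^2, 'k) hecke_elt ring)
      (Z_module GL2 (GL2_I v \<pi>) (GL2_Km v \<pi> m)) (coinv_incl GL2 (GL2_I v \<pi>) (GL2_Km v \<pi> m))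
      (coinv_dual_fixed GL2 (GL2_I v \<pi>) (GL2_Km v \<pi> m)) (coinv_to_hecke GL2 (GL2_I v \<pi>))
      (regular_left_module (hecke GL2 (GL2_I v \<pi>)))"
proof -
  interpret S: det_scalars v \<pi> "- {0}" "{1}" by unfold_locales simp
  have J: "matJ v (- {0}) {1} = GL2_I v \<pi>"
  proof -
    have "A \<in> matJ v (- {0}) {1} \<longleftrightarrow> A \<in> GL2_I v \<pi>" for A
      unfolding S.J_form bex_one GL2_I_def mem_Collect_eq using GL2_K_det[of A] by blast
    then show ?thesis by blast
  qed
  have U: "id ` S.Kg m = GL2_Km v \<pi> m" if m: "m \<ge> 1" for m
  proof -
    have "A \<in> id ` S.Kg m \<longleftrightarrow> A \<in> GL2_Km v \<pi> m" for A
      unfolding image_id id_apply S.Kg_form[OF m] GL2_Km_def mem_Collect_eq using GL2_K_det[of A] by blast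
    then show ?thesis by blast
  qed
  note r = S.cover_splitting[OF S.cover_id p U, unfolded matM_GL2 J]
  show "right_direct_factor (hecke GL2 (GL2_I v \<pi>)) (ind_module GL2 (GL2_I v \<pi>) :: (_, ('a^2^2, 'k) ind) module)
      (carrier (ind_fixed GL2 (GL2_I v \<pi>) (GL2_I v \<pi>)))" by (rule r(1))
  show "rho GL2 (GL2_I v \<pi>) ` carrier (dual (hecke GL2 (GL2_I v \<pi>)) (ind_module GL2 (GL2_I v \<pi>))) =
      carrier (hecke GL2 (GL2_I v \<pi>) :: ('a^2^2, 'k) hecke_elt ring)" by (rule r(2))
  show "\<forall>m\<ge>1. short_exact_left (hecke GL2 (GL2_I v \<pi>) :: ('a^2^2, 'k) hecke_elt ring)
      (Z_module GL2 (GL2_I v \<pi>) (GL2_Km v \<pi> m)) (coinv_incl GL2 (GL2_I v \<pi>) (GL2_Km v \<pi> m))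
      (coinv_dual_fixed GL2 (GL2_I v \<pi>) (GL2_Km v \<pi> m)) (coinv_to_hecke GL2 (GL2_I v \<pi>))
      (regular_left_module (hecke GL2 (GL2_I v \<pi>)))" by (rule r(3))
qed

lemma class_eq: "PGL2_class A = {mat c ** A | c. c \<noteq> (0 :: 'a)}"
  unfolding PGL2_class_def r_coset_def scalars_def by (auto simp: GL2_def)

lemma mat_entry: "(mat c ** (A :: 'a^2^2)) $ i $ j = c * A $ i $ j"
  using exhaust_2[of i] exhaust_2[of j] by (cases A rule: m2_cases) (auto simp: mat_m2)

lemma mat_mat_mult: "mat c ** (mat d ** (A :: 'a^2^2)) = mat (c * d) ** A"
  by (cases A rule: m2_cases) (simp add: mat_m2 mult.assoc)

lemma class_scalar:
  assumes d: "d \<noteq> 0"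
  shows "PGL2_class (mat d ** A) = PGL2_class (A :: 'a^2^2)"
  unfolding class_eq
proof (rule subset_antisym; rule subsetI)
  fix B assume "B \<in> {mat c ** (mat d ** A) | c. c \<noteq> 0}"
  then obtain c where c: "c \<noteq> 0" "B = mat c ** (mat d ** A)" by blast
  have "B = mat (c * d) ** A" "c * d \<noteq> 0" using c(1) d by (simp_all add: c(2) mat_mat_mult)
  then show "B \<in> {mat c ** A | c. c \<noteq> 0}" by blast
next
  fix B assume "B \<in> {mat c ** A | c. c \<noteq> 0}"
  then obtain c where c: "c \<noteq> 0" "B = mat c ** A" by blast
  have "B = mat (c / d) ** (mat d ** A)" "c / d \<noteq> 0" using c(1) d by (simp_all add: c(2) mat_mat_mult)
  then show "B \<in> {mat c ** (mat d ** A) | c. c \<noteq> 0}" by blast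
qed

lemma class_eqD:
  assumes e: "PGL2_class A = PGL2_class B"
  shows "\<exists>c. c \<noteq> 0 \<and> A = mat c ** (B :: 'a^2^2)"
proof -
  have "A \<in> PGL2_class A" unfolding class_eq mem_Collect_eq by (rule exI[of _ 1]) (simp add: mat_one)
  then have "A \<in> PGL2_class B" by (simp only: e)
  from this[unfolded class_eq mem_Collect_eq] show ?thesis by (elim exE conjE) (rule exI, rule conjI)
qed

lemma normal_scalars: "normal scalars (GL2 :: ('a^2^2) monoid)"
proof -
  interpret S: det_scalars v \<pi> "- {0}" "- {0}" by unfold_locales simp
  have g: "Group.group (GL2 :: ('a^2^2) monoid)" using S.group_M unfolding matM_GL2 .
  have comm: "A ** mat c = mat c ** A" for A :: "'a^2^2" and c
    by (cases A rule: m2_cases) (simp add: mat_m2 mult.commute)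
  have sub: "subgroup scalars (GL2 :: ('a^2^2) monoid)"
  proof (rule group.subgroupI[OF g])
    show "scalars \<subseteq> carrier (GL2 :: ('a^2^2) monoid)" by (auto simp: scalars_def GL2_def mat_m2)
    show "scalars \<noteq> ({} :: ('a^2^2) set)" unfolding scalars_def using one_neq_zero by blast
  next
    fix A :: "'a^2^2" assume "A \<in> scalars"
    then obtain c where c: "A = mat c" "c \<noteq> 0" unfolding scalars_def by blast
    have "inv\<^bsub>GL2\<^esub> A = mat (inverse c)"
      by (rule group.inv_equality[OF g]) (use c in \<open>simp_all add: GL2_def mat_m2\<close>)
    moreover have "inverse c \<noteq> 0" using c by simp
    ultimately show "inv\<^bsub>GL2\<^esub> A \<in> scalars" unfolding scalars_def by blast
  next
    fix A B :: "'a^2^2" assume "A \<in> scalars" "B \<in> scalars"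
    then obtain c d where c: "A = mat c" "c \<noteq> 0" "B = mat d" "d \<noteq> 0" unfolding scalars_def by blast
    have "A \<otimes>\<^bsub>GL2\<^esub> B = mat (c * d)" by (simp add: c GL2_def mat_m2)
    moreover have "c * d \<noteq> 0" using c by simp
    ultimately show "A \<otimes>\<^bsub>GL2\<^esub> B \<in> scalars" unfolding scalars_def by blast
  qed
  show ?thesis unfolding group.normal_inv_iff[OF g]
  proof (intro conjI sub ballI)
    fix A h :: "'a^2^2" assume A: "A \<in> carrier GL2" and h: "h \<in> scalars"
    then obtain c where c: "h = mat c" unfolding scalars_def by blast
    have "A \<otimes>\<^bsub>GL2\<^esub> h = h \<otimes>\<^bsub>GL2\<^esub> A" by (simp add: c GL2_def comm)
    then have "A \<otimes>\<^bsub>GL2\<^esub> h \<otimes>\<^bsub>GL2\<^esub> inv\<^bsub>GL2\<^esub> A = h"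
      using group.inv_mult_cancel(2)[OF g subgroup.mem_carrier[OF sub h] A] by simp
    then show "A \<otimes>\<^bsub>GL2\<^esub> h \<otimes>\<^bsub>GL2\<^esub> inv\<^bsub>GL2\<^esub> A \<in> scalars" using h by simp
  qed
qed

text \<open>The cover is GL2 with all scalars put into \<open>J\<close>, which makes
  \<open>J\<close> the full preimage of the pro-p-Iwahori subgroup.\<close>

lemma PGL2_splitting:
  assumes p: "CHAR('k::field) = residue_char v"
  shows "right_direct_factor (hecke PGL2 (PGL2_I v \<pi>)) (ind_module PGL2 (PGL2_I v \<pi>) :: (_, (('a^2^2) set, 'k) ind) module)
      (carrier (ind_fixed PGL2 (PGL2_I v \<pi>) (PGL2_I v \<pi>)))"
    and "rho PGL2 (PGL2_I v \<pi>) ` carrier (dual (hecke PGL2 (PGL2_I v \<pi>)) (ind_module PGL2 (PGL2_I v \<pi>))) =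
      carrier (hecke PGL2 (PGL2_I v \<pi>) :: (('a^2^2) set, 'k) hecke_elt ring)"
    and "\<forall>m\<ge>1. short_exact_left (hecke PGL2 (PGL2_I v \<pi>) :: (('a^2^2) set, 'k) hecke_elt ring)
      (Z_module PGL2 (PGL2_I v \<pi>) (PGL2_Km v \<pi> m)) (coinv_incl PGL2 (PGL2_I v \<pi>) (PGL2_Km v \<pi> m))
      (coinv_dual_fixed PGL2 (PGL2_I v \<pi>) (PGL2_Km v \<pi> m)) (coinv_to_hecke PGL2 (PGL2_I v \<pi>))
      (regular_left_module (hecke PGL2 (PGL2_I v \<pi>)))"
proof -
  interpret S: det_scalars v \<pi> "- {0}" "- {0}" by unfold_locales simp
  interpret N: normal scalars "GL2 :: ('a^2^2) monoid" by (rule normal_scalars)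
  have g: "Group.group (GL2 :: ('a^2^2) monoid)" using S.group_M unfolding matM_GL2 .
  have gP: "Group.group (PGL2 :: ('a^2^2) set monoid)" unfolding PGL2_def by (rule N.factorgroup_is_group)
  have clh: "PGL2_class \<in> hom GL2 (PGL2 :: ('a^2^2) set monoid)"
    unfolding PGL2_def PGL2_class_def[abs_def] by (rule N.r_coset_hom_Mod)
  have clc: "PGL2_class ` carrier GL2 = carrier (PGL2 :: ('a^2^2) set monoid)"
    unfolding PGL2_def PGL2_class_def FactGroup_def RCOSETS_def by auto
  let ?J = "matJ v (- {0}) (- {0})"
  \<comment> \<open>A congruence up to a unit scalar becomes an honest congruence after rescaling
    within the class.\<close>
  have u: "\<exists>B\<in>GL2_K v. mat_cong v a B C \<and> PGL2_class B = PGL2_class A"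
    if A: "A \<in> GL2_K v" and w: "v w = 1" and c: "mat_cong v a A (mat w ** C)" for A C :: "'a^2^2" and w a
  proof -
    have w0: "w \<noteq> 0" using w by auto
    let ?B = "mat (inverse w) ** A"
    obtain a1 a2 a3 a4 where Ae: "A = m2 a1 a2 a3 a4" by (rule m2_cases)
    have vi: "v (inverse w) = 1" using w by (simp add: v_inverse)
    have Be: "?B = m2 (inverse w * a1) (inverse w * a2) (inverse w * a3) (inverse w * a4)" by (simp add: Ae mat_m2)
    have Ai: "integral (m2 a1 a2 a3 a4)" using A unfolding Ae S.GL2_K_m2 .
    have "v (det A) = 1" using A by (simp add: GL2_K_def)
    then have "v (det ?B) = 1" by (simp only: det_scalar mult vi mult_1)
    moreover have "\<forall>i j. v (?B $ i $ j) \<le> 1"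
      unfolding Be S.entries_m2 using Ai vi by (simp add: integral_m2 mult)
    ultimately have BK: "?B \<in> GL2_K v" unfolding GL2_K_def by blast
    have ex: "\<exists>y. v y \<le> 1 \<and> inverse w * x - c = a * y" if h: "\<exists>y. v y \<le> 1 \<and> x - w * c = a * y" for x c
    proof -
      obtain y where y: "v y \<le> 1" "x - w * c = a * y" using h by blast
      have "inverse w * (x - w * c) = inverse w * x - c" using w0 by (simp add: right_diff_distrib)
      then have "inverse w * x - c = a * (inverse w * y)" by (simp add: y(2) mult.left_commute)
      moreover have "v (inverse w * y) \<le> 1" using y(1) by (simp add: mult vi)
      ultimately show ?thesis by blast
    qed
    have "mat_cong v a ?B C" unfolding mat_cong_def
    proof (intro allI)
      fix i j
      have "\<exists>y. v y \<le> 1 \<and> A $ i $ j - (mat w ** C) $ i $ j = a * y"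
        by (rule c[unfolded mat_cong_def, THEN spec, THEN spec])
      from ex[OF this[unfolded mat_entry]] show "\<exists>y. v y \<le> 1 \<and> ?B $ i $ j - C $ i $ j = a * y"
        unfolding mat_entry .
    qed
    moreover have "PGL2_class ?B = PGL2_class A" by (rule class_scalar) (use w0 in simp)
    ultimately show ?thesis using BK by (intro bexI[of _ ?B] conjI)
  qed
  have I: "PGL2_class ` ?J = PGL2_I v \<pi>"
  proof
    show "PGL2_class ` ?J \<subseteq> PGL2_I v \<pi>"
    proof (rule image_subsetI)
      fix A assume "A \<in> ?J"
      then obtain z B b where h: "z \<in> - {0}" "B \<in> GL2_K v" "v b \<le> 1" "mat_cong v \<pi> B (upper_unipotent b)" "A = mat z ** B"
        unfolding S.J_form by blast
      have e: "PGL2_class A = PGL2_class B" unfolding h(5) by (rule class_scalar) (use h(1) in simp)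
      have "mat_cong v \<pi> B (mat 1 ** upper_unipotent b)" using h(4) by (simp only: mat_one)
      then show "PGL2_class A \<in> PGL2_I v \<pi>" unfolding e PGL2_I_def using h(2,3) v_1 by blast
    qed
    show "PGL2_I v \<pi> \<subseteq> PGL2_class ` ?J" unfolding PGL2_I_def
    proof (rule image_subsetI, elim CollectE conjE exE)
      fix A w b assume A: "A \<in> GL2_K v" and w: "v w = 1" and b: "v b \<le> 1" and c: "mat_cong v \<pi> A (mat w ** upper_unipotent b)"
      from u[OF A w c] obtain B where B: "B \<in> GL2_K v" "mat_cong v \<pi> B (upper_unipotent b)" "PGL2_class B = PGL2_class A" by blast
      have "\<exists>b. v b \<le> 1 \<and> mat_cong v \<pi> B (upper_unipotent b)" using b B(2) by blast
      then have "\<exists>B'\<in>GL2_K v. (\<exists>b. v b \<le> 1 \<and> mat_cong v \<pi> B' (upper_unipotent b)) \<and> B = mat 1 ** B'"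
        using B(1) mat_one[of B, symmetric] by (intro bexI[of _ B] conjI)
      then have z: "\<exists>z\<in>- {0}. \<exists>B'\<in>GL2_K v. (\<exists>b. v b \<le> 1 \<and> mat_cong v \<pi> B' (upper_unipotent b)) \<and> B = mat z ** B'"
        by (rule bexI[of _ "1 :: 'a"]) simp
      have "det B \<in> - {0}" using GL2_K_det[OF B(1)] by simp
      then have "B \<in> ?J" unfolding S.J_form using z by (rule conjI)
      then show "PGL2_class A \<in> PGL2_class ` ?J" using B(3) by blast
    qed
  qed
  \<comment> \<open>As all scalars are absorbed in \<open>?J\<close>, membership does not depend on
    the representative of the class.\<close>
  have iff: "PGL2_class x \<in> PGL2_I v \<pi> \<longleftrightarrow> x \<in> ?J" for x
  proof
    assume "PGL2_class x \<in> PGL2_I v \<pi>"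
    then obtain A where A: "A \<in> ?J" "PGL2_class x = PGL2_class A" unfolding I[symmetric] by blast
    then obtain c where c: "c \<noteq> 0" "x = mat c ** A" using class_eqD by blast
    obtain z B where h: "det A \<in> - {0}" "z \<in> - {0}" "B \<in> GL2_K v" "\<exists>b. v b \<le> 1 \<and> mat_cong v \<pi> B (upper_unipotent b)" "A = mat z ** B"
      using A(1) unfolding S.J_form by blast
    have x: "x = mat (c * z) ** B" unfolding c(2) h(5) by (rule mat_mat_mult)
    have "det x \<in> - {0}" using h(1) c(1) by (simp add: c(2) det_scalar)
    moreover have "c * z \<in> - {0}" using c(1) h(2) by simp
    ultimately show "x \<in> ?J" unfolding S.J_form using h(3,4) x by blast
  next
    assume "x \<in> ?J" then show "PGL2_class x \<in> PGL2_I v \<pi>" unfolding I[symmetric] by (rule imageI)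
  qed
  have U: "PGL2_class ` S.Kg m = PGL2_Km v \<pi> m" if m: "m \<ge> 1" for m
  proof
    show "PGL2_class ` S.Kg m \<subseteq> PGL2_Km v \<pi> m"
      unfolding PGL2_Km_def using v_1 by (intro image_mono subsetI) (unfold S.Kg_form[OF m], blast)
    show "PGL2_Km v \<pi> m \<subseteq> PGL2_class ` S.Kg m" unfolding PGL2_Km_def
    proof (rule image_subsetI, elim CollectE conjE exE)
      fix A w assume A: "A \<in> GL2_K v" and w: "v w = 1" and c: "mat_cong v (\<pi> ^ m) A (mat w)"
      have "mat_cong v (\<pi> ^ m) A (mat w ** mat 1)" using c by (simp add: matrix_mul_rid)
      from u[OF A w this] obtain B where B: "B \<in> GL2_K v" "mat_cong v (\<pi> ^ m) B (mat 1)" "PGL2_class B = PGL2_class A" by blast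
      have "B \<in> S.Kg m" unfolding S.Kg_form[OF m] using B GL2_K_det[OF B(1)] by simp
      then show "PGL2_class A \<in> PGL2_class ` S.Kg m" using B(3) by blast
    qed
  qed
  have gh: "group_hom (GL2 :: ('a^2^2) monoid) PGL2 PGL2_class"
    by (rule group_hom.intro[OF g gP group_hom_axioms.intro[OF clh]])
  have sJ: "subgroup ?J (GL2 :: ('a^2^2) monoid)" using S.subgroup_J unfolding matM_GL2 .
  have sI: "subgroup (PGL2_I v \<pi>) PGL2"
    unfolding I[symmetric] by (rule group_hom.subgroup_img_is_subgroup[OF gh sJ])
  have cov: "hecke_cover (matM (- {0})) PGL2 (PGL2_I v \<pi>) PGL2_class ?J"
    unfolding matM_GL2
    by (rule hecke_cover.intro[OF g hecke_pair.intro[OF gP sI] hecke_cover_axioms.intro[OF clh clc sJ iff]])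
  note r = S.cover_splitting[OF cov p U]
  show "right_direct_factor (hecke PGL2 (PGL2_I v \<pi>)) (ind_module PGL2 (PGL2_I v \<pi>) :: (_, (('a^2^2) set, 'k) ind) module)
      (carrier (ind_fixed PGL2 (PGL2_I v \<pi>) (PGL2_I v \<pi>)))" by (rule r(1))
  show "rho PGL2 (PGL2_I v \<pi>) ` carrier (dual (hecke PGL2 (PGL2_I v \<pi>)) (ind_module PGL2 (PGL2_I v \<pi>))) =
      carrier (hecke PGL2 (PGL2_I v \<pi>) :: (('a^2^2) set, 'k) hecke_elt ring)" by (rule r(2))
  show "\<forall>m\<ge>1. short_exact_left (hecke PGL2 (PGL2_I v \<pi>) :: (('a^2^2) set, 'k) hecke_elt ring)
      (Z_module PGL2 (PGL2_I v \<pi>) (PGL2_Km v \<pi> m)) (coinv_incl PGL2 (PGL2_I v \<pi>) (PGL2_Km v \<pi> m))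
      (coinv_dual_fixed PGL2 (PGL2_I v \<pi>) (PGL2_Km v \<pi> m)) (coinv_to_hecke PGL2 (PGL2_I v \<pi>))
      (regular_left_module (hecke PGL2 (PGL2_I v \<pi>)))" by (rule r(3))
qed

end

theorem corollary2p7:
  fixes v :: "'a::field \<Rightarrow> real" and \<pi> :: 'a and p :: nat
  assumes "nonarch_local_field v"
    and "prime_element v \<pi>"
    and "residue_char v = p"
    and "CHAR('k::field) = p"
  shows
    "  (right_direct_factor (hecke SL2 (SL2_I v \<pi>))
          (ind_module SL2 (SL2_I v \<pi>) :: (_, ('a^2^2, 'k) ind) module)
          (carrier (ind_fixed SL2 (SL2_I v \<pi>) (SL2_I v \<pi>))))
     \<and> (rho SL2 (SL2_I v \<pi>) `
          carrier (dual (hecke SL2 (SL2_I v \<pi>)) (ind_module SL2 (SL2_I v \<pi>)))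
        = carrier (hecke SL2 (SL2_I v \<pi>) :: ('a^2^2, 'k) hecke_elt ring))
     \<and> (\<forall>m\<ge>1. short_exact_left (hecke SL2 (SL2_I v \<pi>) :: ('a^2^2, 'k) hecke_elt ring)
          (Z_module SL2 (SL2_I v \<pi>) (SL2_Km v \<pi> m))
          (coinv_incl SL2 (SL2_I v \<pi>) (SL2_Km v \<pi> m))
          (coinv_dual_fixed SL2 (SL2_I v \<pi>) (SL2_Km v \<pi> m))
          (coinv_to_hecke SL2 (SL2_I v \<pi>))
          (regular_left_module (hecke SL2 (SL2_I v \<pi>))))
     \<and> (right_direct_factor (hecke PGL2 (PGL2_I v \<pi>))
          (ind_module PGL2 (PGL2_I v \<pi>) :: (_, (('a^2^2) set, 'k) ind) module)
          (carrier (ind_fixed PGL2 (PGL2_I v \<pi>) (PGL2_I v \<pi>))))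
     \<and> (rho PGL2 (PGL2_I v \<pi>) `
          carrier (dual (hecke PGL2 (PGL2_I v \<pi>)) (ind_module PGL2 (PGL2_I v \<pi>)))
        = carrier (hecke PGL2 (PGL2_I v \<pi>) :: (('a^2^2) set, 'k) hecke_elt ring))
     \<and> (\<forall>m\<ge>1. short_exact_left (hecke PGL2 (PGL2_I v \<pi>) :: (('a^2^2) set, 'k) hecke_elt ring)
          (Z_module PGL2 (PGL2_I v \<pi>) (PGL2_Km v \<pi> m))
          (coinv_incl PGL2 (PGL2_I v \<pi>) (PGL2_Km v \<pi> m))
          (coinv_dual_fixed PGL2 (PGL2_I v \<pi>) (PGL2_Km v \<pi> m))
          (coinv_to_hecke PGL2 (PGL2_I v \<pi>))
          (regular_left_module (hecke PGL2 (PGL2_I v \<pi>))))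
     \<and> (right_direct_factor (hecke GL2 (GL2_I v \<pi>))
          (ind_module GL2 (GL2_I v \<pi>) :: (_, ('a^2^2, 'k) ind) module)
          (carrier (ind_fixed GL2 (GL2_I v \<pi>) (GL2_I v \<pi>))))
     \<and> (rho GL2 (GL2_I v \<pi>) `
          carrier (dual (hecke GL2 (GL2_I v \<pi>)) (ind_module GL2 (GL2_I v \<pi>)))
        = carrier (hecke GL2 (GL2_I v \<pi>) :: ('a^2^2, 'k) hecke_elt ring))
     \<and> (\<forall>m\<ge>1. short_exact_left (hecke GL2 (GL2_I v \<pi>) :: ('a^2^2, 'k) hecke_elt ring)
          (Z_module GL2 (GL2_I v \<pi>) (GL2_Km v \<pi> m))
          (coinv_incl GL2 (GL2_I v \<pi>) (GL2_Km v \<pi> m))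
          (coinv_dual_fixed GL2 (GL2_I v \<pi>) (GL2_Km v \<pi> m))
          (coinv_to_hecke GL2 (GL2_I v \<pi>))
          (regular_left_module (hecke GL2 (GL2_I v \<pi>))))"
proof -
  interpret local_field v \<pi> by (rule local_field.intro[OF assms(1) local_field_axioms.intro[OF assms(2)]])
  have p: "CHAR('k) = residue_char v" using assms(3,4) by simp
  show ?thesis
    by (intro conjI) (rule SL2_splitting[OF p] PGL2_splitting[OF p] GL2_splitting[OF p])+
qed


end
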